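(* Let $f\in\mathcal S(s,M_f)$ for some $s\in\mathbb R$, $M_f>0$. Let $\mathcal M:=\mathcal M(\bar C_1,\bar C_2,C_\varphi,c_\varphi,\beta,\rho,a,M_\mu)$ be the class of signed measures defined in the context, with $a>-s$. Assume that $\mathcal FK$ is supported on $[-\pi,\pi]$ and that either $\mathcal FK=\mathbf 1_{[-\pi,\pi]}$ (sinc kernel), or $K$ has order $a+s$ and $\mathcal FK\in\mathcal H_{\mathbb R}(a+s,L_K,R_K)$ for positive constants $L_K,R_K$. Then, for an optimal choice of bandwidths $h^*_{\Delta,n}>0$ (i.e. there is a deterministic choice $h^*_{\Delta,n}$ such that), with $T=\Delta n$ and $\Delta>0$ fixed, as $n\to\infty$, $$\sup_{\mu\in\mathcal M}\mathbb E_\mu\big[|\theta-\hat\theta_{\Delta,h^*_{\Delta,n},n}|^2\big]=O(r_{\Delta,n}),$$ where $r_{\Delta,n}$ is given as follows. If $\rho=0$ and $\bar C_1<\infty$: $r_{\Delta,n}=T^{-1}$ when $s\ge\Delta\beta$; $r_{\Delta,n}=T^{-\frac{2a+2s}{2a+2\Delta\beta}}$ when $s<\Delta\beta$. If $\rho=0$ and $\bar C_1=\infty$: $r_{\Delta,n}=T^{-1}$ when $s>\Delta\beta+\frac12$; $r_{\Delta,n}=(\log T)\,T^{-1}$ when $s=\Delta\beta+\frac12$; $r_{\Delta,n}=n^{-\frac{2a+2s}{2a+2\Delta\beta+1}}$ when $s<\Delta\beta+\frac12$. If $\rho>0$ (both for $\bar C_1<\infty$ and $\bar C_1=\infty$):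 $r_{\Delta,n}=\big(\frac{\log T}{\Delta}\big)^{-\frac{2a+2s}{\rho}}$.
   Context: Fourier transforms are $\mathcal Fg(u)=\int e^{iux}g(x)\,dx$, $\mathcal F\mu(u)=\int e^{iux}\mu(dx)$, extended to tempered distributions. Sobolev class: for $a\in\mathbb R$, $M>0$, $\mathcal S(a,M)$ is the set of tempered distributions $f$ with $\int|\mathcal Ff(-u)|^2(1+|u|^2)^a\,du\le M$. Hölder class: for $a>0$ let $\langle a\rangle:=\max\{k\in\{0,1,2,\dots\}:k<a\}$. For an open $D\subseteq\mathbb R$ and $a,L,R>0$, $\mathcal H_D(a,L,R)$ is the set of functions $f$ with $\sup_{x\in D}|f(x)|\le R$ such that $f|_D$ is $\langle a\rangle$ times continuously differentiable and $\sup_{x\ne y\in D}|f^{(\langle a\rangle)}(x)-f^{(\langle a\rangle)}(y)|/|x-y|^{a-\langle a\rangle}\le L$. Kernel: $K$ is a kernel function, normalised so that $\mathcal FK(0)=1$; $K_h(x)=h^{-1}K(x/h)$. $K$ has order $k$ if $\int x^mK(x)\,dx=0$ for all integers $1\le m<k$ and $\int|x|^k|K(x)|\,dx<\infty$. Class of measures: for constants $\bar C_1\in(0,\infty]$, $\bar C_2,C_\varphi,M_\mu>0$, $a\in\mathbb R$, $c_\varphi,\beta,\rho\ge0$, $\mathcal M(\bar C_1,\bar C_2,C_\varphi,c_\varphi,\beta,\rho,a,M_\mu)$ is the set of finite signed measures $\mu$ such that: (i) there is a real Lévy process $X$ with Lévy measure $\nu$, of pure jump type (no Gaussian part), with $\int_{\{|x|\le1\}}|x|\nu(dx)<\infty$,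 without drift, with $\int|x|^2\nu(dx)<\infty$, and $\mu(dx)=x\,\nu(dx)$; thus $\mathbb E[e^{iuX_t}]=e^{t\Psi(u)}$ with $\Psi(u)=\int(e^{iux}-1)\nu(dx)$; (ii) the characteristic function $\varphi$ of $X_1$ satisfies $|\varphi(u)|\ge C_\varphi(1+|u|^2)^{-\beta/2}e^{-c_\varphi|u|^\rho}$ for all $u\in\mathbb R$; (iii) $C_1\le\bar C_1$ and $C_2\le\bar C_2$, where $C_1=C(\int|\Psi''(x)|dx+2\int|\Psi'(x)|^2dx)\in[0,\infty]$, $C_2=C(\|\Psi''\|_\infty+2\|\Psi'\|_\infty^2)$ and $C>0$ is a fixed universal constant; (iv) $\mu\in\mathcal S(a,M_\mu)$. $\mathbb E_\mu$ is expectation when the underlying process is the $X$ associated with $\mu$. Functional: $\theta=\langle f,\mu\rangle$, where (standing assumption) either $f$ is a bounded function in $L^1(\mathbb R)$ (then $\theta=\int f\,d\mu$), or $f$ is a compactly supported distribution of some order $k$ and $\mu$ has, on an open interval containing $\mathrm{supp}(f)$, a $C^k$ density. Observations and estimator: $X$ is observed at times $\Delta,2\Delta,\dots,2n\Delta$, $Z_{\Delta,k}:=X_{k\Delta}-X_{(k-1)\Delta}$, $$\hat\varphi_{\Delta,n}(u):=\frac1n\sum_{k=1}^ne^{iuZ_{\Delta,k}},\quad \hat\varphi'_{\Delta,n}(u):=\frac1n\sum_{k=n+1}^{2n}iZ_{\Delta,k}e^{iuZ_{\Delta,k}},\quad \frac1{\tilde\varphi_{\Delta,n}(u)}:=\frac{\mathbf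 1(|\hat\varphi_{\Delta,n}(u)|\ge(\Delta n)^{-1/2})}{\hat\varphi_{\Delta,n}(u)},$$ $$\hat\theta_{\Delta,h,n}:=\frac1{2\pi}\int\mathcal Ff(-u)\,\mathcal FK_h(u)\,\frac{\frac1\Delta\hat\varphi'_{\Delta,n}(u)}{i\,\tilde\varphi_{\Delta,n}(u)}\,du .$$
   Formalization: When f is a bounded L^1 function, θ=∫f dμ is taken for a version of f that is |μ|-a.e. the limit of its local averages (sup over μ admitting one); for arbitrary pointwise f the claim fails, e.g. f=1_{{1}}, ν=δ_1, where the estimator is 0 but θ=1. *)

theory Defs
  imports "HOL-Probability.Probability"
begin

subsection \<open>Smooth functions and tempered distributions on the real line\<close>

definition vderiv :: "nat \<Rightarrow> (real \<Rightarrow> 'b::real_normed_vector) \<Rightarrow> real \<Rightarrow> 'b" where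
  "vderiv k f = ((\<lambda>g x. vector_derivative g (at x)) ^^ k) f"

text \<open>Only used for open \<open>D\<close>.\<close>
definition Ck_on :: "nat \<Rightarrow> real set \<Rightarrow> (real \<Rightarrow> 'b::real_normed_vector) \<Rightarrow> bool" where
  "Ck_on k D f \<longleftrightarrow>
     (\<forall>j<k. \<forall>x\<in>D. vderiv j f differentiable (at x)) \<and> continuous_on D (vderiv k f)"

definition smooth :: "(real \<Rightarrow> complex) \<Rightarrow> bool" where
  "smooth \<phi> \<longleftrightarrow> (\<forall>k. Ck_on k UNIV \<phi>)"

definition schwartz :: "(real \<Rightarrow> complex) set" where
  "schwartz = {\<phi>. smooth \<phi> \<and>
     (\<forall>m j. \<exists>B. \<forall>x. \<bar>x\<bar> ^ m * cmod (vderiv j \<phi> x) \<le> B)}"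

definition schwartz_norm :: "nat \<Rightarrow> (real \<Rightarrow> complex) \<Rightarrow> real" where
  "schwartz_norm N \<phi> = (\<Sum>m\<le>N. \<Sum>j\<le>N. SUP x. \<bar>x\<bar> ^ m * cmod (vderiv j \<phi> x))"

definition support :: "(real \<Rightarrow> complex) \<Rightarrow> real set" where
  "support \<phi> = closure {x. \<phi> x \<noteq> 0}"

definition test_functions :: "(real \<Rightarrow> complex) set" where
  "test_functions = {\<phi>. smooth \<phi> \<and> compact (support \<phi>)}"

text \<open>A distribution is a functional on all functions of which only the values on Schwartz
  functions matter.\<close>
type_synonym distribution = "(real \<Rightarrow> complex) \<Rightarrow> complex"

definition tempered_distribution :: "distribution \<Rightarrow> bool" where
  "tempered_distribution T \<longleftrightarrow>
     (\<forall>\<phi>\<in>schwartz. \<forall>\<psi>\<in>schwartz. T (\<lambda>x. \<phi> x + \<psi> x) = T \<phi> + T \<psi>) \<and>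
     (\<forall>c. \<forall>\<phi>\<in>schwartz. T (\<lambda>x. c * \<phi> x) = c * T \<phi>) \<and>
     (\<exists>B N. \<forall>\<phi>\<in>schwartz. cmod (T \<phi>) \<le> B * schwartz_norm N \<phi>)"

text \<open>Functions that define a tempered distribution by integration.\<close>
definition tempered_function :: "(real \<Rightarrow> complex) \<Rightarrow> bool" where
  "tempered_function g \<longleftrightarrow> g \<in> borel_measurable borel \<and>
     (\<exists>N::nat. integrable lborel (\<lambda>x. g x / of_real ((1 + x\<^sup>2) ^ N)))"

definition function_distribution :: "(real \<Rightarrow> complex) \<Rightarrow> distribution" where
  "function_distribution g \<phi> = (LINT x|lborel. g x * \<phi> x)"

definition fourier :: "(real \<Rightarrow> complex) \<Rightarrow> real \<Rightarrow> complex" where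
  "fourier \<phi> u = (LINT x|lborel. iexp (u * x) * \<phi> x)"

text \<open>The Fourier transform of \<open>T\<close>, namely \<open>\<phi> \<mapsto> T (fourier \<phi>)\<close>, is the function \<open>g\<close>.
  Such a \<open>g\<close> is unique up to Lebesgue null sets.\<close>
definition has_fourier_function :: "distribution \<Rightarrow> (real \<Rightarrow> complex) \<Rightarrow> bool" where
  "has_fourier_function T g \<longleftrightarrow> tempered_function g \<and>
     (\<forall>\<phi>\<in>schwartz. T (fourier \<phi>) = function_distribution g \<phi>)"

text \<open>Some version of the Fourier transform; it is only used under Lebesgue integrals.\<close>
definition fourier_function :: "distribution \<Rightarrow> real \<Rightarrow> complex" where
  "fourier_function T = (SOME g. has_fourier_function T g)"

definition sobolev_class :: "real \<Rightarrow> real \<Rightarrow> distribution set" where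
  "sobolev_class a M = {T. tempered_distribution T \<and>
     (\<exists>g. has_fourier_function T g \<and>
        (\<integral>\<^sup>+u. ennreal ((cmod (g (- u)))\<^sup>2 * (1 + \<bar>u\<bar>\<^sup>2) powr a) \<partial>lborel) \<le> ennreal M)}"

definition distribution_support :: "distribution \<Rightarrow> real set" where
  "distribution_support T =
     {x. \<forall>e>0. \<exists>\<phi>\<in>test_functions. support \<phi> \<subseteq> ball x e \<and> T \<phi> \<noteq> 0}"

text \<open>Order at most \<open>k\<close>.\<close>
definition distribution_order :: "nat \<Rightarrow> distribution \<Rightarrow> bool" where
  "distribution_order k T \<longleftrightarrow> (\<forall>A. compact A \<longrightarrow>
     (\<exists>B. \<forall>\<phi>\<in>test_functions. support \<phi> \<subseteq> A \<longrightarrow>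
        cmod (T \<phi>) \<le> B * (\<Sum>j\<le>k. SUP x. cmod (vderiv j \<phi> x))))"


subsection \<open>Hoelder classes and kernels\<close>

definition hoelder_index :: "real \<Rightarrow> nat" where
  "hoelder_index a = Max {k. real k < a}"

definition hoelder_class ::
  "real set \<Rightarrow> real \<Rightarrow> real \<Rightarrow> real \<Rightarrow> (real \<Rightarrow> 'b::real_normed_vector) set" where
  "hoelder_class D a L R = {f.
     (\<forall>x\<in>D. norm (f x) \<le> R) \<and> Ck_on (hoelder_index a) D f \<and>
     (\<forall>x\<in>D. \<forall>y\<in>D. x \<noteq> y \<longrightarrow>
        norm (vderiv (hoelder_index a) f x - vderiv (hoelder_index a) f y)
          / \<bar>x - y\<bar> powr (a - real (hoelder_index a)) \<le> L)}"

definition kernel_distribution :: "(real \<Rightarrow> real) \<Rightarrow> distribution" where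
  "kernel_distribution K = function_distribution (\<lambda>x. complex_of_real (K x))"

definition scaled_kernel :: "(real \<Rightarrow> real) \<Rightarrow> real \<Rightarrow> real \<Rightarrow> real" where
  "scaled_kernel K h x = K (x / h) / h"

text \<open>The order may be any positive real number.\<close>
definition kernel_order :: "real \<Rightarrow> (real \<Rightarrow> real) \<Rightarrow> bool" where
  "kernel_order k K \<longleftrightarrow>
     (\<forall>m::nat. 1 \<le> m \<and> real m < k \<longrightarrow> (LINT x|lborel. x ^ m * K x) = 0) \<and>
     integrable lborel (\<lambda>x. \<bar>x\<bar> powr k * \<bar>K x\<bar>)"


subsection \<open>Finite signed measures\<close>

text \<open>Finite signed Borel measures are set functions of which only the values on Borel sets
  matter.  Integrals are taken with respect to the Jordan decomposition.\<close>
type_synonym signed = "real set \<Rightarrow> real"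

definition signed_measure :: "signed \<Rightarrow> bool" where
  "signed_measure m \<longleftrightarrow> m {} = 0 \<and>
     (\<forall>A::nat \<Rightarrow> real set. range A \<subseteq> sets borel \<and> disjoint_family A \<longrightarrow>
        (\<lambda>i. m (A i)) sums m (\<Union>i. A i))"

definition upper_variation :: "signed \<Rightarrow> real measure" where
  "upper_variation m =
     measure_of UNIV (sets borel) (\<lambda>A. SUP B\<in>{B\<in>sets borel. B \<subseteq> A}. ennreal (m B))"

definition lower_variation :: "signed \<Rightarrow> real measure" where
  "lower_variation m = upper_variation (\<lambda>A. - m A)"

definition signed_integral :: "signed \<Rightarrow> (real \<Rightarrow> complex) \<Rightarrow> complex" where
  "signed_integral m g = (LINT x|upper_variation m. g x) - (LINT x|lower_variation m. g x)"

text \<open>As a distribution, \<open>m\<close> is \<open>signed_integral m\<close>, that is, \<open>\<phi> \<mapsto> \<integral> \<phi> dm\<close>.\<close>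

definition has_density_on :: "signed \<Rightarrow> real set \<Rightarrow> (real \<Rightarrow> real) \<Rightarrow> bool" where
  "has_density_on m I p \<longleftrightarrow> set_integrable lborel I p \<and>
     (\<forall>A\<in>sets borel. A \<subseteq> I \<longrightarrow> m A = (LINT x:A|lborel. p x))"


subsection \<open>The linear functional\<close>

text \<open>If the distribution \<open>f\<close> is a bounded integrable function, it determines this function only
  up to Lebesgue null sets, whereas \<open>m\<close> may charge such sets.  The integral is therefore taken for
  a version that is the limit of its own local averages almost everywhere with respect to the total
  variation of \<open>m\<close>.  Every version qualifies if \<open>m\<close> is absolutely continuous, and a continuous
  one always does.\<close>
definition function_pairing :: "distribution \<Rightarrow> signed \<Rightarrow> complex \<Rightarrow> bool" where
  "function_pairing f m \<theta> \<longleftrightarrow> (\<exists>g.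
     integrable lborel g \<and> (\<exists>B. \<forall>x. cmod (g x) \<le> B) \<and>
     (\<forall>\<phi>\<in>schwartz. f \<phi> = function_distribution g \<phi>) \<and>
     (\<forall>v\<in>{upper_variation m, lower_variation m}. AE x in v.
        ((\<lambda>r. (LINT y:{x - r..x + r}|lborel. g y) / of_real (2 * r)) \<longlongrightarrow> g x) (at_right 0)) \<and>
     \<theta> = signed_integral m g)"

text \<open>If \<open>f\<close> is a compactly supported distribution of order \<open>k\<close>, it is applied to the density
  \<open>p\<close> by continuous extension from test functions to functions that are \<open>k\<close> times continuously
  differentiable near the support of \<open>f\<close>.\<close>
definition distribution_pairing :: "distribution \<Rightarrow> signed \<Rightarrow> complex \<Rightarrow> bool" where
  "distribution_pairing f m \<theta> \<longleftrightarrow> (\<exists>k I p.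
     tempered_distribution f \<and> compact (distribution_support f) \<and> distribution_order k f \<and>
     open I \<and> is_interval I \<and> distribution_support f \<subseteq> I \<and>
     Ck_on k I p \<and> has_density_on m I p \<and>
     (\<forall>\<phi>. (\<forall>n. \<phi> n \<in> test_functions) \<and>
        (\<forall>j\<le>k. \<forall>A. compact A \<and> A \<subseteq> I \<longrightarrow>
           uniform_limit A (\<lambda>n. vderiv j (\<phi> n)) (vderiv j (\<lambda>x. complex_of_real (p x))) sequentially)
        \<longrightarrow> (\<lambda>n::nat. f (\<phi> n)) \<longlonglongrightarrow> \<theta>))"

definition has_pairing :: "distribution \<Rightarrow> signed \<Rightarrow> complex \<Rightarrow> bool" where
  "has_pairing f m \<theta> \<longleftrightarrow> function_pairing f m \<theta> \<or> distribution_pairing f m \<theta>"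

definition pairing :: "distribution \<Rightarrow> signed \<Rightarrow> complex" where
  "pairing f m = (THE \<theta>. has_pairing f m \<theta>)"


subsection \<open>Levy processes\<close>

text \<open>Time is the set of nonnegative reals; values of \<open>X\<close> at negative times are irrelevant.\<close>
definition levy_process :: "'w measure \<Rightarrow> (real \<Rightarrow> 'w \<Rightarrow> real) \<Rightarrow> bool" where
  "levy_process P X \<longleftrightarrow> prob_space P \<and>
     (\<forall>t\<ge>0. X t \<in> borel_measurable P) \<and>
     (AE w in P. X 0 w = 0) \<and>
     (\<forall>(t::nat \<Rightarrow> real) n. 0 \<le> t 0 \<and> mono t \<longrightarrow>
        prob_space.indep_vars P (\<lambda>_. borel) (\<lambda>i w. X (t (Suc i)) w - X (t i) w) {..<n}) \<and>
     (\<forall>s\<ge>0. \<forall>t\<ge>0. distr P borel (\<lambda>w. X (s + t) w - X s w) = distr P borel (X t)) \<and>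
     (\<forall>t\<ge>0. \<forall>e>0.
        ((\<lambda>s. measure P {w\<in>space P. \<bar>X s w - X t w\<bar> > e}) \<longlongrightarrow> 0) (at t within {0..})) \<and>
     (AE w in P. \<forall>t\<ge>0. continuous (at_right t) (\<lambda>s. X s w) \<and>
        (0 < t \<longrightarrow> (\<exists>l. ((\<lambda>s. X s w) \<longlongrightarrow> l) (at_left t))))"

definition levy_measure :: "real measure \<Rightarrow> bool" where
  "levy_measure \<nu> \<longleftrightarrow> sets \<nu> = sets borel \<and> emeasure \<nu> {0} = 0 \<and>
     (\<integral>\<^sup>+x. ennreal (min 1 (x\<^sup>2)) \<partial>\<nu>) < \<infinity>"

text \<open>Levy-Khintchine triplet with respect to the truncation function \<open>x 1(\<bar>x\<bar> \<le> 1)\<close>.\<close>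
definition levy_triplet ::
  "'w measure \<Rightarrow> (real \<Rightarrow> 'w \<Rightarrow> real) \<Rightarrow> real \<Rightarrow> real \<Rightarrow> real measure \<Rightarrow> bool" where
  "levy_triplet P X \<sigma>2 \<gamma> \<nu> \<longleftrightarrow> 0 \<le> \<sigma>2 \<and> levy_measure \<nu> \<and>
     (\<forall>t\<ge>0. \<forall>u. char (distr P borel (X t)) u =
        exp (of_real t * (\<i> * of_real (\<gamma> * u) - of_real (\<sigma>2 * u\<^sup>2 / 2) +
          (CLINT x|\<nu>. iexp (u * x) - 1 - (if \<bar>x\<bar> \<le> 1 then \<i> * of_real (u * x) else 0)))))"

text \<open>No Gaussian part, jumps of finite variation, and no drift: the truncated centering in the
  triplet exactly undoes the compensation.\<close>
definition pure_jump_levy :: "'w measure \<Rightarrow> (real \<Rightarrow> 'w \<Rightarrow> real) \<Rightarrow> real measure \<Rightarrow> bool" where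
  "pure_jump_levy P X \<nu> \<longleftrightarrow> levy_process P X \<and>
     (\<integral>\<^sup>+x\<in>{-1..1}. ennreal \<bar>x\<bar> \<partial>\<nu>) < \<infinity> \<and>
     (\<integral>\<^sup>+x. ennreal (\<bar>x\<bar>\<^sup>2) \<partial>\<nu>) < \<infinity> \<and>
     levy_triplet P X 0 (LINT x:{-1..1}|\<nu>. x) \<nu>"

definition levy_exponent :: "real measure \<Rightarrow> real \<Rightarrow> complex" where
  "levy_exponent \<nu> u = (CLINT x|\<nu>. iexp (u * x) - 1)"

definition is_jump_measure :: "signed \<Rightarrow> real measure \<Rightarrow> bool" where
  "is_jump_measure m \<nu> \<longleftrightarrow> (\<forall>A\<in>sets borel. m A = (LINT x:A|\<nu>. x))"

definition associated_process :: "signed \<Rightarrow> 'w measure \<Rightarrow> (real \<Rightarrow> 'w \<Rightarrow> real) \<Rightarrow> bool" where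
  "associated_process m P X \<longleftrightarrow> (\<exists>\<nu>. pure_jump_levy P X \<nu> \<and> is_jump_measure m \<nu>)"

text \<open>The constants \<open>C\<^sub>1\<close> and \<open>C\<^sub>2\<close>, with \<open>C\<close> the universal constant.\<close>
definition const1 :: "real \<Rightarrow> real measure \<Rightarrow> ennreal" where
  "const1 C \<nu> = ennreal C *
     ((\<integral>\<^sup>+u. ennreal (cmod (vderiv 2 (levy_exponent \<nu>) u)) \<partial>lborel) +
      2 * (\<integral>\<^sup>+u. ennreal ((cmod (vderiv 1 (levy_exponent \<nu>) u))\<^sup>2) \<partial>lborel))"

definition const2 :: "real \<Rightarrow> real measure \<Rightarrow> ennreal" where
  "const2 C \<nu> = ennreal C *
     ((SUP u. ennreal (cmod (vderiv 2 (levy_exponent \<nu>) u))) +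
      2 * (SUP u. ennreal (cmod (vderiv 1 (levy_exponent \<nu>) u)))\<^sup>2)"

text \<open>The case distinction on \<open>\<rho>\<close> implements \<open>\<bar>u\<bar>\<^sup>0 = 1\<close> also at \<open>u = 0\<close>, where \<open>0 powr 0 = 0\<close>.
  A process is sought on the type of real paths, which carries a copy of every real Levy
  process.\<close>
definition measure_class ::
  "real \<Rightarrow> ennreal \<Rightarrow> real \<Rightarrow> real \<Rightarrow> real \<Rightarrow> real \<Rightarrow> real \<Rightarrow> real \<Rightarrow> real \<Rightarrow> signed set" where
  "measure_class C C1bar C2bar C\<phi> c\<phi> \<beta> \<rho> a M\<mu> = {m. signed_measure m \<and>
     (\<exists>(P :: (real \<Rightarrow> real) measure) X \<nu>.
        pure_jump_levy P X \<nu> \<and> is_jump_measure m \<nu> \<and>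
        (\<forall>u. cmod (char (distr P borel (X 1)) u) \<ge>
           C\<phi> * (1 + \<bar>u\<bar>\<^sup>2) powr (- \<beta> / 2)
             * exp (- c\<phi> * (if \<rho> = 0 then 1 else \<bar>u\<bar> powr \<rho>))) \<and>
        const1 C \<nu> \<le> C1bar \<and> const2 C \<nu> \<le> ennreal C2bar) \<and>
     signed_integral m \<in> sobolev_class a M\<mu>}"


subsection \<open>The estimator\<close>

definition increment :: "(real \<Rightarrow> 'w \<Rightarrow> real) \<Rightarrow> real \<Rightarrow> nat \<Rightarrow> 'w \<Rightarrow> real" where
  "increment X \<Delta> k w = X (real k * \<Delta>) w - X ((real k - 1) * \<Delta>) w"

definition ecf :: "(real \<Rightarrow> 'w \<Rightarrow> real) \<Rightarrow> real \<Rightarrow> nat \<Rightarrow> 'w \<Rightarrow> real \<Rightarrow> complex" where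
  "ecf X \<Delta> n w u = (\<Sum>k=1..n. iexp (u * increment X \<Delta> k w)) / of_nat n"

definition ecf_deriv :: "(real \<Rightarrow> 'w \<Rightarrow> real) \<Rightarrow> real \<Rightarrow> nat \<Rightarrow> 'w \<Rightarrow> real \<Rightarrow> complex" where
  "ecf_deriv X \<Delta> n w u =
     (\<Sum>k=n+1..2*n. \<i> * of_real (increment X \<Delta> k w) * iexp (u * increment X \<Delta> k w)) / of_nat n"

definition inv_ecf :: "(real \<Rightarrow> 'w \<Rightarrow> real) \<Rightarrow> real \<Rightarrow> nat \<Rightarrow> 'w \<Rightarrow> real \<Rightarrow> complex" where
  "inv_ecf X \<Delta> n w u =
     (if cmod (ecf X \<Delta> n w u) \<ge> (\<Delta> * real n) powr (- 1 / 2) then 1 / ecf X \<Delta> n w u else 0)"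

definition estimator ::
  "distribution \<Rightarrow> (real \<Rightarrow> real) \<Rightarrow> (real \<Rightarrow> 'w \<Rightarrow> real) \<Rightarrow> real \<Rightarrow> real \<Rightarrow> nat \<Rightarrow> 'w \<Rightarrow> complex" where
  "estimator f K X \<Delta> h n w = 1 / (2 * of_real pi) *
     (LINT u|lborel. fourier_function f (- u)
        * fourier_function (kernel_distribution (scaled_kernel K h)) u
        * (ecf_deriv X \<Delta> n w u / of_real \<Delta> / \<i> * inv_ecf X \<Delta> n w u))"

text \<open>The supremum runs over those \<open>m\<close> in the class for which \<open>\<langle>f, m\<rangle>\<close> is defined, and over all
  realizations of the associated process.\<close>
definition worst_case_risk ::
  "'w itself \<Rightarrow> signed set \<Rightarrow> distribution \<Rightarrow> (real \<Rightarrow> real) \<Rightarrow> real \<Rightarrow> real \<Rightarrow> nat \<Rightarrow> ennreal" where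
  "worst_case_risk _ \<M> f K \<Delta> h n =
     (SUP (m, P, X) \<in> {(m, P :: 'w measure, X).
          m \<in> \<M> \<and> (\<exists>\<theta>. has_pairing f m \<theta>) \<and> associated_process m P X}.
        \<integral>\<^sup>+w. ennreal ((cmod (pairing f m - estimator f K X \<Delta> h n w))\<^sup>2) \<partial>P)"

definition rate :: "ennreal \<Rightarrow> real \<Rightarrow> real \<Rightarrow> real \<Rightarrow> real \<Rightarrow> real \<Rightarrow> nat \<Rightarrow> real" where
  "rate C1bar \<beta> \<rho> a s \<Delta> n = (let T = \<Delta> * real n in
     if \<rho> = 0 then
       if C1bar < \<infinity> then
         if s \<ge> \<Delta> * \<beta> then T powr (- 1)
         else T powr (- ((2 * a + 2 * s) / (2 * a + 2 * \<Delta> * \<beta>)))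
       else
         if s > \<Delta> * \<beta> + 1/2 then T powr (- 1)
         else if s = \<Delta> * \<beta> + 1/2 then ln T * T powr (- 1)
         else real n powr (- ((2 * a + 2 * s) / (2 * a + 2 * \<Delta> * \<beta> + 1)))
     else (ln T / \<Delta>) powr (- ((2 * a + 2 * s) / \<rho>)))"

end

theory Submission
  imports Defs "HOL-Real_Asymp.Real_Asymp"
begin

text \<open>
  Write \<open>F\<close> for the Fourier transform of the measure \<open>\<mu>\<close>, \<open>\<phi>\<close> for the characteristic function of an
  increment and \<open>FK\<close> for the Fourier transform of the kernel.  Since \<open>\<mu>(dx) = x \<nu>(dx)\<close>, the derivative
  of the exponent \<open>\<Psi>\<close> is \<open>\<i> F\<close>, so \<open>\<phi> = exp (\<Delta> \<Psi>)\<close> gives \<open>F = \<phi>' / (\<i> \<Delta> \<phi>)\<close>, and the estimator plugs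
  empirical versions of \<open>\<phi>'\<close> and \<open>1 / \<phi>\<close> into this identity.  The functional itself is
  \<open>\<theta> = 1 / (2 pi) \<integral> \<F>f(-u) F(u) du\<close> (\<open>pairing_eq\<close>).  This Parseval identity is immediate for nice
  functions; here it has to be derived from each of the two meanings of the pairing, by averaging over small
  intervals if \<open>f\<close> is a function (\<open>function_pairing_eq\<close>) and by mollifying the measure if \<open>f\<close> is a
  compactly supported distribution (\<open>distribution_pairing_eq\<close>).

  The error therefore splits into a deterministic bias and a stochastic part.  Only frequencies
  \<open>\<bar>u\<bar> \<le> pi / h\<close> enter the estimator, and \<open>\<bar>1 - FK(h u)\<bar>\<close> is at most a constant times
  \<open>\<bar>h u\<bar> powr (a + s)\<close> (\<open>kernel_transform_bounds\<close>).  By Cauchy-Schwarz and the two Sobolev conditions the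
  squared bias is of order \<open>h powr (2 (a + s))\<close> (\<open>bias_bound\<close>).

  For the stochastic part, \<open>\<phi>'\<close> and \<open>1 / \<phi>\<close> are estimated from the two independent halves of the
  sample.  The truncated inverse of the empirical characteristic function behaves in mean square like
  \<open>1 / \<phi>\<close>, with a relative error of squared size \<open>1 / (n \<bar>\<phi>\<bar>\<^sup>2)\<close>, because the empirical characteristic
  function has fourth central moments of order \<open>1 / n\<^sup>2\<close>.  The covariance of the empirical derivative at
  frequencies \<open>u\<close> and \<open>v\<close> is \<open>(- \<phi>''(u - v) - \<phi>'(u) cnj (\<phi>'(v))) / n\<close>.  Hence the second moment of the
  stochastic part is at most \<open>C / n\<close> times the double integral of \<open>b(u) b(v) k(u, v)\<close>, where
  \<open>b = \<bar>\<F>f(-u) FK(h u)\<bar> / \<bar>\<phi>(u)\<bar>\<close> and \<open>k\<close> is built from \<open>\<phi>''\<close>, \<open>\<phi>'\<close> and \<open>F\<close>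
  (\<open>stochastic_error\<close>).  As \<open>\<phi>'' = (\<Delta> \<Psi>'' + (\<Delta> \<Psi>')\<^sup>2) \<phi>\<close>, this kernel is controlled by \<open>\<Psi>'\<close> and
  \<open>\<Psi>''\<close>, hence by the constants of the class (\<open>sample_kernel_bounds\<close>).  If it is merely bounded, the
  double integral is at most a multiple of \<open>(\<integral> b)\<^sup>2\<close>; if \<open>\<Psi>''\<close> and \<open>\<bar>\<Psi>'\<bar>\<^sup>2\<close> are integrable, Young's
  inequality improves this to a multiple of \<open>\<integral> b\<^sup>2\<close>.  By the lower bound on \<open>\<bar>\<phi>\<bar>\<close> and the smoothness of
  \<open>f\<close>, the first is governed by the integral of \<open>(1 + u\<^sup>2) powr (\<Delta> \<beta> - s)\<close> over \<open>\<bar>u\<bar> \<le> pi / h\<close> and the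
  second by the supremum of this weight; this is the origin of the shift by \<open>1/2\<close> and of the logarithm in
  the case of an infinite first constant.

  All constants depend only on the parameters of the class (\<open>risk_bound\<close>), so it remains to choose \<open>h\<close>.
  A power of \<open>n\<close> balances the two terms if \<open>\<rho> = 0\<close>.  If \<open>\<rho> > 0\<close>, a small multiple of
  \<open>log n\<close> raised to the power \<open>-1 / \<rho>\<close> keeps the exponential factor in the noise below \<open>sqrt n\<close>, so that
  the bias alone determines the rate.
\<close>

section \<open>Iterated derivatives on the line\<close>

text \<open>The family \<open>F\<close> consists of a function and all its successive derivatives.  Exhibiting such a family
  is the way to prove smoothness and to compute all iterated derivatives at once.\<close>
definition derivatives :: "(nat \<Rightarrow> real \<Rightarrow> 'b::real_normed_vector) \<Rightarrow> bool" where
  "derivatives F \<longleftrightarrow> (\<forall>j x. (F j has_vector_derivative F (Suc j) x) (at x))"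

lemma derivativesD: "derivatives F \<Longrightarrow> (F j has_vector_derivative F (Suc j) x) (at x)"
  by (simp add: derivatives_def)

lemma vderiv_0 [simp]: "vderiv 0 f = f"
  by (simp add: vderiv_def)

lemma vderiv_Suc: "vderiv (Suc k) f x = vector_derivative (vderiv k f) (at x)"
  by (simp add: vderiv_def)

text \<open>Iterated derivatives are local: it is enough to know candidates for them on an open set.\<close>
lemma vderiv_eq_on_open:
  assumes U: "open U"
    and F: "\<And>j x. j < k \<Longrightarrow> x \<in> U \<Longrightarrow> (F j has_vector_derivative F (Suc j) x) (at x)"
    and f: "\<And>x. x \<in> U \<Longrightarrow> f x = F 0 x"
    and "j \<le> k" "x \<in> U"
  shows "vderiv j f x = F j x"
  using \<open>j \<le> k\<close> \<open>x \<in> U\<close>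
proof (induction j arbitrary: x)
  case 0
  then show ?case by (simp add: f)
next
  case (Suc j)
  have "(vderiv j f has_vector_derivative F (Suc j) x) (at x)"
    by (rule has_vector_derivative_transform_within_open[OF F U])
       (use Suc in auto)
  then show ?case
    by (simp add: vderiv_Suc vector_derivative_at)
qed

lemma derivatives_vderiv:
  assumes "derivatives F" shows "vderiv j (F 0) = F j"
proof
  show "vderiv j (F 0) x = F j x" for x
    by (rule vderiv_eq_on_open[where U=UNIV and k=j]) (use assms in \<open>auto simp: derivatives_def\<close>)
qed

lemma smooth_iff_derivatives: "smooth f \<longleftrightarrow> derivatives (\<lambda>j. vderiv j f)"
proof
  assume "smooth f"
  then have "vderiv j f differentiable (at x)" for j x
    unfolding smooth_def Ck_on_def by (metis UNIV_I lessI)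
  then show "derivatives (\<lambda>j. vderiv j f)"
    by (auto simp: derivatives_def vderiv_Suc vector_derivative_works)
next
  assume *: "derivatives (\<lambda>j. vderiv j f)"
  then have "vderiv j f differentiable (at x)" for j x
    by (auto simp: derivatives_def intro: differentiableI_vector)
  moreover have "continuous_on UNIV (vderiv k f)" for k
    using * by (auto simp: derivatives_def intro!: continuous_at_imp_continuous_on has_vector_derivative_continuous)
  ultimately show "smooth f" by (simp add: smooth_def Ck_on_def)
qed

lemma smoothI: "derivatives F \<Longrightarrow> smooth (F 0)"
  by (simp add: smooth_iff_derivatives derivatives_vderiv)

lemma smoothI': "derivatives F \<Longrightarrow> F 0 = f \<Longrightarrow> smooth f"
  using smoothI by blast

lemma smooth_derivatives: "smooth f \<Longrightarrow> derivatives (\<lambda>j. vderiv j f)"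
  by (simp add: smooth_iff_derivatives)

lemma derivatives_continuous: "derivatives F \<Longrightarrow> continuous_on A (F j)"
  by (auto simp: derivatives_def intro!: continuous_at_imp_continuous_on has_vector_derivative_continuous)

lemma derivatives_shift: "derivatives F \<Longrightarrow> derivatives (\<lambda>j. F (j + k))"
  by (simp add: derivatives_def)

lemma derivatives_affine:
  assumes "derivatives F"
  shows "derivatives (\<lambda>j x. c ^ j *\<^sub>R F j (c * x + d))"
  unfolding derivatives_def
proof safe
  fix j x
  have "((\<lambda>x. c * x + d) has_vector_derivative c) (at x)"
    by (auto intro!: derivative_eq_intros simp: has_real_derivative_iff_has_vector_derivative[symmetric])
  from vector_diff_chain_at[OF this derivativesD[OF assms]]
  have "((\<lambda>x. F j (c * x + d)) has_vector_derivative c *\<^sub>R F (Suc j) (c * x + d)) (at x)"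
    by (simp add: o_def)
  from bounded_linear.has_vector_derivative[OF bounded_linear_scaleR_right this, of "c ^ j"]
  show "((\<lambda>x. c ^ j *\<^sub>R F j (c * x + d)) has_vector_derivative c ^ Suc j *\<^sub>R F (Suc j) (c * x + d)) (at x)"
    by (simp add: mult.commute)
qed

lemma derivatives_linear:
  assumes "bounded_linear T" "derivatives F"
  shows "derivatives (\<lambda>j x. T (F j x))"
  using assms by (auto simp: derivatives_def intro: bounded_linear.has_vector_derivative)

lemma derivatives_add:
  assumes "derivatives F" "derivatives G"
  shows "derivatives (\<lambda>j x. F j x + G j x)"
  using assms by (auto simp: derivatives_def intro: has_vector_derivative_add)

text \<open>Pascal's rule in the form needed to differentiate the Leibniz formula once more.\<close>
lemma Leibniz_step:
  fixes f g :: "nat \<Rightarrow> 'b::comm_ring_1"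
  shows "(\<Sum>i\<le>j. of_nat (j choose i) * (f (Suc i) * g (j - i) + f i * g (Suc j - i)))
       = (\<Sum>i\<le>Suc j. of_nat (Suc j choose i) * (f i * g (Suc j - i)))"
proof -
  have "(\<Sum>i\<le>Suc j. of_nat (Suc j choose i) * (f i * g (Suc j - i)))
      = f 0 * g (Suc j) + (\<Sum>i\<le>j. of_nat (Suc j choose Suc i) * (f (Suc i) * g (j - i)))"
    by (subst sum.atMost_Suc_shift) simp
  also have "(\<Sum>i\<le>j. of_nat (Suc j choose Suc i) * (f (Suc i) * g (j - i)))
      = (\<Sum>i\<le>j. of_nat (j choose i) * (f (Suc i) * g (j - i)))
        + (\<Sum>i\<le>j. of_nat (j choose Suc i) * (f (Suc i) * g (j - i)))"
    by (simp add: sum.distrib algebra_simps)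
  also have "f 0 * g (Suc j) + (\<dots>) = (\<Sum>i\<le>j. of_nat (j choose i) * (f (Suc i) * g (j - i)))
     + (\<Sum>i\<le>Suc j. of_nat (j choose i) * (f i * g (Suc j - i)))"
    by (simp only: sum.atMost_Suc_shift[of "\<lambda>i. of_nat (j choose i) * (f i * g (Suc j - i))"])
      (simp add: algebra_simps del: sum.atMost_Suc)
  also have "(\<Sum>i\<le>Suc j. of_nat (j choose i) * (f i * g (Suc j - i)))
     = (\<Sum>i\<le>j. of_nat (j choose i) * (f i * g (Suc j - i)))"
    by (simp add: binomial_eq_0)
  finally show ?thesis by (simp add: sum.distrib algebra_simps)
qed

lemma derivatives_mult:
  fixes F G :: "nat \<Rightarrow> real \<Rightarrow> 'b::real_normed_field"
  assumes F: "derivatives F" and G: "derivatives G"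
  shows "derivatives (\<lambda>j x. \<Sum>i\<le>j. of_nat (j choose i) * (F i x * G (j - i) x))"
  unfolding derivatives_def
proof safe
  fix j x
  have "((\<lambda>x. \<Sum>i\<le>j. of_nat (j choose i) * (F i x * G (j - i) x)) has_vector_derivative
      (\<Sum>i\<le>j. of_nat (j choose i) * (F (Suc i) x * G (j - i) x + F i x * G (Suc j - i) x))) (at x)"
  proof (rule has_vector_derivative_sum)
    fix i assume "i \<in> {..j}"
    then have "(G (j - i) has_vector_derivative G (Suc j - i) x) (at x)"
      using derivativesD[OF G, of "j - i" x] by (simp add: Suc_diff_le)
    from has_vector_derivative_mult[OF derivativesD[OF F, of i x] this]
    have "((\<lambda>x. F i x * G (j - i) x) has_vector_derivative F i x * G (Suc j - i) x + F (Suc i) x * G (j - i) x) (at x)" .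
    from has_vector_derivative_mult_right[OF this, of "of_nat (j choose i)"]
    show "((\<lambda>x. of_nat (j choose i) * (F i x * G (j - i) x)) has_vector_derivative
        of_nat (j choose i) * (F (Suc i) x * G (j - i) x + F i x * G (Suc j - i) x)) (at x)"
      by (simp add: add.commute)
  qed
  then show "((\<lambda>x. \<Sum>i\<le>j. of_nat (j choose i) * (F i x * G (j - i) x)) has_vector_derivative
      (\<Sum>i\<le>Suc j. of_nat (Suc j choose i) * (F i x * G (Suc j - i) x))) (at x)"
    using Leibniz_step[of j "\<lambda>i. F i x" "\<lambda>i. G i x"] by simp
qed

lemma vderiv_mult:
  fixes f g :: "real \<Rightarrow> complex"
  assumes "smooth f" "smooth g"
  shows "vderiv j (\<lambda>x. f x * g x) = (\<lambda>x. \<Sum>i\<le>j. of_nat (j choose i) * (vderiv i f x * vderiv (j - i) g x))"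
  using derivatives_vderiv[OF derivatives_mult[OF assms[THEN smooth_derivatives]], of j] by simp

lemma smooth_mult: "smooth f \<Longrightarrow> smooth g \<Longrightarrow> smooth (\<lambda>x. f x * g x)"
  using smoothI'[OF derivatives_mult[OF smooth_derivatives smooth_derivatives], of f g "\<lambda>x. f x * g x"] by simp

lemma vderiv_affine:
  assumes "smooth f"
  shows "vderiv j (\<lambda>x. f (c * x + d)) x = c ^ j *\<^sub>R vderiv j f (c * x + d)"
  using derivatives_vderiv[OF derivatives_affine[OF smooth_derivatives[OF assms]], of j c d] by simp

lemma smooth_affine: "smooth f \<Longrightarrow> smooth (\<lambda>x. f (c * x + d))"
  by (rule smoothI'[OF derivatives_affine[OF smooth_derivatives]]) auto

lemma vderiv_cmult:
  assumes "smooth f"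
  shows "vderiv j (\<lambda>x. c * f x) x = c * vderiv j f x"
  using derivatives_vderiv[OF derivatives_linear[OF bounded_linear_mult_right smooth_derivatives[OF assms]], of j c]
  by simp

lemma smooth_cmult: "smooth f \<Longrightarrow> smooth (\<lambda>x. c * f x)"
  by (rule smoothI'[OF derivatives_linear[OF bounded_linear_mult_right smooth_derivatives]]) auto

lemma smooth_continuous: "smooth f \<Longrightarrow> continuous_on A (vderiv j f)"
  using derivatives_continuous[OF smooth_derivatives] by simp

lemma smooth_measurable: "smooth f \<Longrightarrow> vderiv j f \<in> borel_measurable borel"
  by (intro borel_measurable_continuous_onI smooth_continuous)

lemma smooth_measurable0: "smooth f \<Longrightarrow> f \<in> borel_measurable borel"
  using smooth_measurable[of f 0] by simp

lemma smooth_of_real: "smooth (\<lambda>x. of_real x)"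
proof (rule smoothI'[where F="\<lambda>j x. if j = 0 then of_real x else if j = 1 then 1 else 0"])
  show "derivatives (\<lambda>j x. if j = 0 then of_real x else if j = 1 then 1 else (0::complex))"
    unfolding derivatives_def
    by (auto intro!: derivative_eq_intros has_vector_derivative_of_real)
qed auto

lemma smooth_power_times: "smooth f \<Longrightarrow> smooth (\<lambda>x. (c * of_real x) ^ j * f x)"
proof (induction j)
  case (Suc j)
  have "(\<lambda>x. (c * of_real x) ^ Suc j * f x) = (\<lambda>x. (c * of_real x) * ((c * of_real x) ^ j * f x))"
    by (simp add: mult_ac)
  then show ?case using Suc by (simp add: smooth_mult smooth_cmult smooth_of_real)
qed simp


section \<open>Test functions\<close>

text \<open>The classical smooth function that vanishes to infinite order at \<open>0\<close>.\<close>
definition flat :: "real \<Rightarrow> real" where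
  "flat x = (if x > 0 then exp (- (1 / x)) else 0)"

text \<open>The \<open>j\<close>-th derivative of \<open>exp (- 1 / x)\<close> is a polynomial in \<open>1 / x\<close> times \<open>exp (- 1 / x)\<close>.\<close>
fun flat_poly :: "nat \<Rightarrow> real poly" where
  "flat_poly 0 = 1"
| "flat_poly (Suc j) = [:0, 0, 1:] * (flat_poly j - pderiv (flat_poly j))"

lemma poly_times_exp_minus_tendsto_0: "((\<lambda>y::real. poly p y * exp (- y)) \<longlongrightarrow> 0) at_top"
proof -
  have "((\<lambda>y. \<Sum>i\<le>degree p. coeff p i * (y ^ i / exp y)) \<longlongrightarrow> (\<Sum>i\<le>degree p. coeff p i * 0)) at_top"
    by (intro tendsto_intros tendsto_power_div_exp_0)
  then show ?thesis
    by (simp add: poly_altdef exp_minus sum_distrib_left divide_inverse mult_ac)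
qed

text \<open>At the origin the difference quotients from the right are a polynomial in \<open>y = 1 / x\<close> times
  \<open>exp (- y)\<close>, and the exponential wins.\<close>
lemma derivatives_flat:
  "derivatives (\<lambda>j x. if x > 0 then poly (flat_poly j) (1 / x) * exp (- (1 / x)) else 0)"
  (is "derivatives ?F")
  unfolding derivatives_def
proof safe
  fix j and x :: real
  consider "x > 0" | "x < 0" | "x = 0" by linarith
  then have "(?F j has_real_derivative ?F (Suc j) x) (at x)"
  proof cases
    case 1
    have "((\<lambda>x. poly (flat_poly j) (1 / x) * exp (- (1 / x))) has_real_derivative ?F (Suc j) x) (at x)"
      using 1 by (auto intro!: derivative_eq_intros poly_DERIV[THEN DERIV_chain2]
          simp: field_simps power2_eq_square)
    then show ?thesis
      by (rule has_field_derivative_transform_within_open[of _ _ _ "{0<..}"]) (use 1 in auto)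
  next
    case 2
    have "((\<lambda>x. 0) has_real_derivative ?F (Suc j) x) (at x)" using 2 by simp
    then show ?thesis
      by (rule has_field_derivative_transform_within_open[of _ _ _ "{..<0}"]) (use 2 in auto)
  next
    case 3
    have "((\<lambda>h. ?F j h / h) \<longlongrightarrow> 0) (at_left 0)"
      by (rule Lim_transform_eventually[OF tendsto_const])
         (rule eventually_mono[OF eventually_at_left_real[of "-1" 0]], auto)
    moreover have "((\<lambda>h. ?F j h / h) \<longlongrightarrow> 0) (at_right 0)"
      unfolding filterlim_at_right_to_top
    proof (rule Lim_transform_eventually[OF poly_times_exp_minus_tendsto_0[of "flat_poly j * [:0, 1:]"]])
      show "\<forall>\<^sub>F y in at_top. poly (flat_poly j * [:0, 1:]) y * exp (- y) = ?F j (inverse y) / inverse y"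
        using eventually_gt_at_top[of 0] by eventually_elim (simp add: field_simps)
    qed
    ultimately have "((\<lambda>h. ?F j h / h) \<longlongrightarrow> 0) (at 0)"
      by (rule filterlim_split_at)
    then show ?thesis using 3 by (simp add: DERIV_def cong: if_cong)
  qed
  then show "(?F j has_vector_derivative ?F (Suc j) x) (at x)"
    by (simp add: has_real_derivative_iff_has_vector_derivative)
qed

lemma smooth_flat: "smooth (\<lambda>x. complex_of_real (flat x))"
  by (rule smoothI'[OF derivatives_linear[OF bounded_linear_of_real derivatives_flat]])
     (auto simp: flat_def)

lemma flat_bounds: "0 \<le> flat x" "flat x \<le> 1"
  by (auto simp: flat_def)

lemma test_functionI:
  assumes "smooth \<phi>" "\<And>x. x \<notin> {a..b} \<Longrightarrow> \<phi> x = 0"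
  shows "\<phi> \<in> test_functions"
proof -
  have "{x. \<phi> x \<noteq> 0} \<subseteq> {a..b}" using assms(2) by blast
  then have "support \<phi> \<subseteq> {a..b}"
    unfolding support_def by (rule closure_minimal) simp
  then have "compact (support \<phi>)"
    by (metis closed_closure compact_Icc compact_Int_closed inf.absorb_iff2 support_def)
  then show ?thesis using assms by (simp add: test_functions_def)
qed

lemma test_function_bounded_support:
  assumes "\<phi> \<in> test_functions"
  obtains R where "R > 0" "\<And>x. \<bar>x\<bar> > R \<Longrightarrow> \<phi> x = 0"
proof -
  from assms have "bounded (support \<phi>)" by (auto simp: test_functions_def compact_imp_bounded)
  then obtain R where R: "\<And>x. x \<in> support \<phi> \<Longrightarrow> \<bar>x\<bar> \<le> R" and "R > 0"
    by (auto simp: bounded_pos)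
  have "\<phi> x = 0" if "\<bar>x\<bar> > R" for x
    using R[of x] that closure_subset[of "{x. \<phi> x \<noteq> 0}"] by (auto simp: support_def)
  with \<open>R > 0\<close> show ?thesis using that by blast
qed

lemma vderiv_zero_outside:
  assumes "\<And>x. \<bar>x\<bar> > R \<Longrightarrow> f x = (0 :: complex)" "\<bar>x\<bar> > R"
  shows "vderiv j f x = 0"
proof (rule vderiv_eq_on_open[where U="{x. \<bar>x\<bar> > R}" and k=j and F="\<lambda>j x. 0"])
  show "open {x. \<bar>x\<bar> > R}" by (intro open_Collect_less continuous_intros)
qed (use assms in auto)

text \<open>Stretching the factors makes the product saturate at \<open>1\<close> inside the interval, since
  \<open>flat\<close> tends to \<open>1\<close> at infinity.  This lets test functions detect integrals over intervals.\<close>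
lemma bump_exhausting_interval:
  fixes a b :: real
  assumes "a < b"
  defines "B \<equiv> \<lambda>n x. flat (real (Suc n) * (x - a)) * flat (real (Suc n) * (b - x))"
  shows "(\<lambda>x. complex_of_real (B n x)) \<in> test_functions"
    and "\<bar>B n x\<bar> \<le> indicator {a<..<b} x"
    and "(\<lambda>n. B n x) \<longlonglongrightarrow> indicator {a<..<b} x"
proof -
  have "smooth (\<lambda>x. complex_of_real (flat (real (Suc n) * x + (- real (Suc n) * a)))
      * complex_of_real (flat (- real (Suc n) * x + (real (Suc n) * b))))"
    by (intro smooth_mult smooth_affine[OF smooth_flat])
  then have "smooth (\<lambda>x. complex_of_real (B n x))"
    unfolding B_def by (simp add: algebra_simps)
  moreover have z: "B n x = 0" if "x \<notin> {a<..<b}" for n x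
    using that by (auto simp: B_def flat_def zero_less_mult_iff)
  ultimately show "(\<lambda>x. complex_of_real (B n x)) \<in> test_functions"
    by (intro test_functionI[of _ a b]) auto
  show "\<bar>B n x\<bar> \<le> indicator {a<..<b} x"
    using z[of x n] flat_bounds by (auto simp: B_def indicator_def abs_mult intro!: mult_le_one)
  have *: "(\<lambda>n. flat (real (Suc n) * c)) \<longlonglongrightarrow> 1" if "c > 0" for c :: real
  proof -
    have "(\<lambda>n. exp (- (1 / (real (Suc n) * c)))) \<longlonglongrightarrow> 1" using that by real_asymp
    then show ?thesis using that by (simp add: flat_def)
  qed
  show "(\<lambda>n. B n x) \<longlonglongrightarrow> indicator {a<..<b} x"
  proof (cases "x \<in> {a<..<b}")
    case True
    then have "(\<lambda>n. B n x) \<longlonglongrightarrow> 1 * 1"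
      unfolding B_def by (intro tendsto_mult *) auto
    then show ?thesis using True by simp
  next
    case False
    then show ?thesis using z by simp
  qed
qed

lemma mollifier_exists:
  obtains \<eta> :: "real \<Rightarrow> real" where "smooth (\<lambda>x. complex_of_real (\<eta> x))" "\<And>x. \<eta> x \<ge> 0"
    "\<And>x. \<bar>x\<bar> > 1 \<Longrightarrow> \<eta> x = 0" "(LINT x|lborel. \<eta> x) = 1"
proof -
  define B where "B x = flat (1 + x) * flat (1 - x)" for x
  have "smooth (\<lambda>x. complex_of_real (flat (1 * x + 1)) * complex_of_real (flat (- 1 * x + 1)))"
    by (intro smooth_mult smooth_affine[OF smooth_flat])
  then have sm: "smooth (\<lambda>x. complex_of_real (B x))"
    unfolding B_def by (simp add: algebra_simps)
  have z: "B x = 0" if "\<bar>x\<bar> \<ge> 1" for x using that by (auto simp: B_def flat_def)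
  have pos: "B x > 0" if "\<bar>x\<bar> < 1" for x using that by (auto simp: B_def flat_def)
  have nn: "B x \<ge> 0" for x by (simp add: B_def flat_bounds)
  have [measurable]: "B \<in> borel_measurable borel"
    using smooth_measurable0[OF sm] by (simp add: borel_measurable_complex_iff)
  have bd: "norm (B x) \<le> indicator {-1..1} x" for x
    using z[of x] flat_bounds by (auto simp: indicator_def abs_mult B_def intro!: mult_le_one)
  have int: "integrable lborel B"
    by (rule Bochner_Integration.integrable_bound[of _ "indicator {-1..1::real}"]) (use bd in auto)
  have "(LINT x|lborel. B x) \<noteq> 0"
  proof
    assume "(LINT x|lborel. B x) = 0"
    then have "AE x in lborel. B x = 0"
      using integral_nonneg_eq_0_iff_AE[OF int] nn by simp
    then have "AE x in lborel. x \<notin> {-1<..<1::real}"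
      by (rule AE_mp) (use pos in \<open>force intro!: AE_I2 simp: abs_less_iff\<close>)
    then have "emeasure lborel {-1<..<1::real} = 0"
      by (subst (asm) AE_iff_measurable[of "{-1<..<1}"]) auto
    then show False by simp
  qed
  moreover have "(LINT x|lborel. B x) \<ge> 0" using nn by simp
  ultimately have c: "(LINT x|lborel. B x) > 0" by simp
  show ?thesis
  proof
    have "smooth (\<lambda>x. complex_of_real (1 / (LINT x|lborel. B x)) * complex_of_real (B x))"
      by (rule smooth_cmult[OF sm])
    then show "smooth (\<lambda>x. complex_of_real (B x / (LINT x|lborel. B x)))"
      by (simp add: divide_inverse mult.commute)
    show "B x / (LINT x|lborel. B x) \<ge> 0" for x using c nn by simp
    show "B x / (LINT x|lborel. B x) = 0" if "\<bar>x\<bar> > 1" for x using z that by simp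
    show "(LINT x|lborel. B x / (LINT x|lborel. B x)) = 1" using c by simp
  qed
qed

lemma plateau_exists:
  obtains \<kappa> :: "real \<Rightarrow> complex" where "smooth \<kappa>"
    "\<And>x. \<bar>x\<bar> < 1 \<Longrightarrow> \<kappa> x = 1" "\<And>x. \<bar>x\<bar> > 3 \<Longrightarrow> \<kappa> x = 0"
proof -
  obtain \<eta> :: "real \<Rightarrow> real" where sm: "smooth (\<lambda>x. complex_of_real (\<eta> x))" and nn: "\<And>x. \<eta> x \<ge> 0"
    and z: "\<And>x. \<bar>x\<bar> > 1 \<Longrightarrow> \<eta> x = 0" and one: "(LINT x|lborel. \<eta> x) = 1"
    by (metis mollifier_exists)
  \<comment> \<open>A smooth step, which increases by \<open>1\<close> between \<open>-1\<close> and \<open>1\<close> and is constant outside; the plateau is the difference of two translates.\<close>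
  define H where "H x = (LBINT y=(0::real)..x. complex_of_real (\<eta> y))" for x :: real
  have H: "(H has_vector_derivative complex_of_real (\<eta> x)) (at x)" for x
  proof -
    have "(H has_vector_derivative complex_of_real (\<eta> x)) (at x within {- \<bar>x\<bar> - 1..\<bar>x\<bar> + 1})"
      unfolding H_def
      by (rule interval_integral_FTC2) (use smooth_continuous[OF sm, of _ 0] in auto)
    then show ?thesis
      by (subst (asm) at_within_interior) (auto simp: interior_atLeastAtMost_real)
  qed
  define T where "T j = (if j = 0 then H else vderiv (j - 1) (\<lambda>x. complex_of_real (\<eta> x)))" for j
  have T: "derivatives T"
    unfolding derivatives_def
  proof safe
    fix j x
    show "(T j has_vector_derivative T (Suc j) x) (at x)"
      using H[of x] derivativesD[OF smooth_derivatives[OF sm], of "j - 1" x]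
      by (cases j) (auto simp: T_def)
  qed
  have cont: "continuous_on A H" for A
    using derivatives_continuous[OF T, of A 0] by (simp add: T_def)
  have const: "H x = H y" if "x \<le> y" "\<And>t. x < t \<Longrightarrow> t < y \<Longrightarrow> \<bar>t\<bar> > 1" for x y
  proof (cases "x = y")
    case False
    have "\<exists>D. D = 0 \<and> (H has_vector_derivative D) (at t)" if "x < t" "t < y" for t
      using H[of t] z[of t] \<open>\<And>t. x < t \<Longrightarrow> t < y \<Longrightarrow> \<bar>t\<bar> > 1\<close>[OF that] by auto
    have "norm (H y - H x) \<le> 0 * norm (y - x)"
    proof -
      have "\<exists>t\<in>{x<..<y}. norm (H y - H x) \<le> norm ((\<lambda>h. h *\<^sub>R complex_of_real (\<eta> t)) (y - x))"
        by (rule mvt_general) (use False that(1) H cont in \<open>auto simp: has_vector_derivative_def\<close>)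
      then show ?thesis using z that(2) by auto
    qed
    then show ?thesis by simp
  qed simp
  have diff: "H 1 - H (- 1) = 1"
  proof -
    have "(LINT x|lborel. indicator {-1..1} x *\<^sub>R complex_of_real (\<eta> x)) = H 1 - H (- 1)"
      by (rule integral_FTC_Icc) (use smooth_continuous[OF sm, of _ 0] in \<open>auto intro!: has_vector_derivative_at_within[OF H]\<close>)
    also have "(LINT x|lborel. indicator {-1..1} x *\<^sub>R complex_of_real (\<eta> x))
        = (LINT x|lborel. complex_of_real (\<eta> x))"
    proof (rule Bochner_Integration.integral_cong)
      show "indicat_real {-1..1} x *\<^sub>R complex_of_real (\<eta> x) = complex_of_real (\<eta> x)" for x
        using z[of x] by (cases "\<bar>x\<bar> \<le> 1") (auto simp: indicator_def abs_le_iff)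
    qed simp
    finally show ?thesis using one by simp
  qed
  show ?thesis
  proof
    show "smooth (\<lambda>x. H (x + 2) - H (x - 2))"
      using smoothI[OF derivatives_add[OF derivatives_affine[OF T, of 1 2]
            derivatives_linear[OF bounded_linear_mult_right[of "- 1"] derivatives_affine[OF T, of 1 "- 2"]]]]
      by (simp add: T_def)
    show "H (x + 2) - H (x - 2) = 1" if "\<bar>x\<bar> < 1" for x
      using const[of 1 "x + 2"] const[of "x - 2" "- 1"] that diff by auto
    show "H (x + 2) - H (x - 2) = 0" if "\<bar>x\<bar> > 3" for x
      using const[of "x - 2" "x + 2"] that by auto
  qed
qed

section \<open>Integration tools\<close>

lemma has_vector_derivative_iff_quotient:
  "(f has_vector_derivative D) (at t) \<longleftrightarrow> ((\<lambda>h. (f (t + h) - f t) /\<^sub>R h) \<longlongrightarrow> D) (at 0)"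
proof -
  have "\<forall>\<^sub>F h in at 0. norm (f (t + h) - f t - h *\<^sub>R D) / norm h = norm ((f (t + h) - f t) /\<^sub>R h - D)"
    unfolding eventually_at_filter
  proof (intro always_eventually allI impI)
    fix h :: real assume "h \<noteq> 0"
    then have "(f (t + h) - f t) /\<^sub>R h - D = (f (t + h) - f t - h *\<^sub>R D) /\<^sub>R h"
      by (simp add: scaleR_diff_right)
    then show "norm (f (t + h) - f t - h *\<^sub>R D) / norm h = norm ((f (t + h) - f t) /\<^sub>R h - D)"
      by (simp add: divide_inverse mult.commute)
  qed
  then have "((\<lambda>h. norm (f (t + h) - f t - h *\<^sub>R D) / norm h) \<longlongrightarrow> 0) (at 0) \<longleftrightarrow>
      ((\<lambda>h. norm ((f (t + h) - f t) /\<^sub>R h - D)) \<longlongrightarrow> 0) (at 0)"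
    by (rule tendsto_cong)
  then show ?thesis
    unfolding has_vector_derivative_def has_derivative_at
    by (simp add: bounded_linear_scaleR_left tendsto_norm_zero_iff LIM_zero_iff)
qed

text \<open>Differentiation under the integral sign: the mean value theorem bounds the difference quotients by
  \<open>w\<close>, so dominated convergence applies.\<close>
lemma has_vector_derivative_integral:
  fixes f :: "real \<Rightarrow> 'a \<Rightarrow> 'b::{banach, second_countable_topology}"
  assumes der: "\<And>t x. x \<in> space M \<Longrightarrow> ((\<lambda>t. f t x) has_vector_derivative f' t x) (at t)"
    and int: "\<And>t. integrable M (f t)" and meas: "\<And>t. f' t \<in> borel_measurable M"
    and bd: "\<And>t x. x \<in> space M \<Longrightarrow> norm (f' t x) \<le> w x" and w: "integrable M w"
  shows "((\<lambda>t. \<integral>x. f t x \<partial>M) has_vector_derivative (\<integral>x. f' t x \<partial>M)) (at t)"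
  unfolding has_vector_derivative_iff_quotient tendsto_at_iff_sequentially comp_def
proof safe
  fix h :: "nat \<Rightarrow> real"
  assume h: "\<forall>i. h i \<in> UNIV - {0}" "h \<longlonglongrightarrow> 0"
  have eq: "(integral\<^sup>L M (f (t + h n)) - integral\<^sup>L M (f t)) /\<^sub>R h n
      = (\<integral>x. (f (t + h n) x - f t x) /\<^sub>R h n \<partial>M)" for n
    using int by simp
  have bound: "norm ((f (t + h n) x - f t x) /\<^sub>R h n) \<le> w x" if x: "x \<in> space M" for n x
  proof -
    have "norm (f (t + h n) x - f t x) \<le> w x * norm (t + h n - t)"
    proof (rule differentiable_bound[of UNIV "\<lambda>t. f t x" "\<lambda>t h. h *\<^sub>R f' t x"])
      fix s
      show "((\<lambda>t. f t x) has_derivative (\<lambda>h. h *\<^sub>R f' s x)) (at s)"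
        using der[OF x] by (simp add: has_vector_derivative_def)
      show "onorm (\<lambda>h. h *\<^sub>R f' s x) \<le> w x"
        by (rule onorm_le) (use bd[OF x, of s] in \<open>simp add: mult.commute mult_left_mono\<close>)
    qed auto
    moreover have "norm ((f (t + h n) x - f t x) /\<^sub>R h n) = norm (f (t + h n) x - f t x) / \<bar>h n\<bar>"
      by (simp add: divide_inverse mult.commute)
    ultimately show ?thesis using h(1) by (simp add: pos_divide_le_eq)
  qed
  show "(\<lambda>n. (integral\<^sup>L M (f (t + h n)) - integral\<^sup>L M (f t)) /\<^sub>R h n) \<longlonglongrightarrow> (\<integral>x. f' t x \<partial>M)"
    unfolding eq
  proof (rule integral_dominated_convergence[where w=w])
    show "AE x in M. (\<lambda>n. (f (t + h n) x - f t x) /\<^sub>R h n) \<longlonglongrightarrow> f' t x"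
    proof (rule AE_I2)
      fix x assume "x \<in> space M"
      from der[OF this, of t] h show "(\<lambda>n. (f (t + h n) x - f t x) /\<^sub>R h n) \<longlonglongrightarrow> f' t x"
        unfolding has_vector_derivative_iff_quotient tendsto_at_iff_sequentially comp_def by blast
    qed
    show "AE x in M. norm ((f (t + h n) x - f t x) /\<^sub>R h n) \<le> w x" for n
      using bound by (intro AE_I2) auto
  qed (use int meas w in auto)
qed

lemma nn_integral_parts_eq_of_integral_0:
  fixes h :: "'a \<Rightarrow> real"
  assumes "integrable M h" "integral\<^sup>L M h = 0"
  shows "(\<integral>\<^sup>+x. ennreal (h x) \<partial>M) = (\<integral>\<^sup>+x. ennreal (- h x) \<partial>M)"
proof -
  have fin: "(\<integral>\<^sup>+x. ennreal (h x) \<partial>M) < \<infinity>" "(\<integral>\<^sup>+x. ennreal (- h x) \<partial>M) < \<infinity>"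
    using assms(1) by (auto simp: real_integrable_def top.not_eq_extremum)
  have "enn2real (\<integral>\<^sup>+x. ennreal (h x) \<partial>M) = enn2real (\<integral>\<^sup>+x. ennreal (- h x) \<partial>M)"
    using real_lebesgue_integral_def[OF assms(1)] assms(2) by simp
  then show ?thesis
    using fin by (metis ennreal_enn2real infinity_ennreal_def)
qed

text \<open>On a bounded interval, the positive and the negative part of \<open>g\<close> are the densities of two finite
  measures that agree on half-lines and hence coincide.\<close>
lemma AE_zero_of_interval_integrals_real:
  fixes g :: "real \<Rightarrow> real"
  assumes [measurable]: "g \<in> borel_measurable borel"
    and int: "\<And>a b. a < b \<Longrightarrow> set_integrable lborel {a<..<b} g"
    and zero: "\<And>a b. a < b \<Longrightarrow> (LINT x:{a<..<b}|lborel. g x) = 0"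
  shows "AE x in lborel. g x = 0"
proof -
  have "AE x in lborel. x \<in> {- real (Suc n)<..<real (Suc n)} \<longrightarrow> g x = 0" for n :: nat
  proof -
    define r where "r = real (Suc n)"
    have r: "r > 0" by (simp add: r_def)
    \<comment> \<open>the two parts of \<open>g\<close> on \<open>(-r, r)\<close>, as measures\<close>
    define M1 where "M1 = density lborel (\<lambda>x. ennreal (indicator {-r<..<r} x * g x))"
    define M2 where "M2 = density lborel (\<lambda>x. ennreal (- (indicator {-r<..<r} x * g x)))"
    have ir: "integrable lborel (\<lambda>x. indicator {-r<..<r} x * g x)"
      using int[of "-r" r] r by (simp add: set_integrable_def)
    have tail: "emeasure M1 {c<..} = emeasure M2 {c<..} \<and> emeasure M1 {c<..} < \<infinity>" for c
    proof -
      define h where "h x = indicator {max c (-r)<..<r} x * g x" for x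
      have h: "integrable lborel h \<and> integral\<^sup>L lborel h = 0"
      proof (cases "max c (-r) < r")
        case True
        then show ?thesis using int[OF True] zero[OF True]
          by (simp add: set_integrable_def set_lebesgue_integral_def h_def[abs_def])
      next
        case False
        then have "h = (\<lambda>x. 0)" by (auto simp: h_def fun_eq_iff)
        then show ?thesis by simp
      qed
      have "emeasure M1 {c<..} = (\<integral>\<^sup>+x. ennreal (h x) \<partial>lborel)"
        unfolding M1_def by (subst emeasure_density) (auto intro!: nn_integral_cong simp: h_def indicator_def)
      moreover have "emeasure M2 {c<..} = (\<integral>\<^sup>+x. ennreal (- h x) \<partial>lborel)"
        unfolding M2_def by (subst emeasure_density) (auto intro!: nn_integral_cong simp: h_def indicator_def)
      moreover have "(\<integral>\<^sup>+x. ennreal (h x) \<partial>lborel) < \<infinity>"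
        using h by (auto simp: real_integrable_def top.not_eq_extremum)
      ultimately show ?thesis
        using nn_integral_parts_eq_of_integral_0[of lborel h] h by simp
    qed
    have "M1 = M2"
    proof (rule measure_eqI_lessThan)
      show "sets M1 = sets borel" "sets M2 = sets borel" by (simp_all add: M1_def M2_def)
      show "emeasure M1 {c<..} < \<infinity>" "emeasure M1 {c<..} = emeasure M2 {c<..}" for c
        using tail[of c] by blast+
    qed
    then have "AE x in lborel. ennreal (indicator {-r<..<r} x * g x) = ennreal (- (indicator {-r<..<r} x * g x))"
      unfolding M1_def M2_def
      by (subst (asm) finite_density_unique) (use ir in \<open>auto simp: real_integrable_def\<close>)
    then show ?thesis
      unfolding r_def[symmetric]
    proof eventually_elim
      case (elim x)
      then show ?case
        by (auto simp: indicator_def ennreal_eq_0_iff)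
           (metis ennreal_eq_0_iff linorder_le_cases neg_le_0_iff_le order_antisym_conv)
    qed
  qed
  then have "AE x in lborel. \<forall>n::nat. x \<in> {- real (Suc n)<..<real (Suc n)} \<longrightarrow> g x = 0"
    unfolding AE_all_countable by (rule allI)
  then show ?thesis
  proof eventually_elim
    case (elim x)
    obtain n where "\<bar>x\<bar> < real n" using reals_Archimedean2 by blast
    then have "x \<in> {- real (Suc n)<..<real (Suc n)}" by auto
    with elim show ?case by blast
  qed
qed

lemma AE_zero_of_interval_integrals:
  fixes g :: "real \<Rightarrow> complex"
  assumes [measurable]: "g \<in> borel_measurable borel"
    and int: "\<And>a b. a < b \<Longrightarrow> set_integrable lborel {a<..<b} g"
    and zero: "\<And>a b. a < b \<Longrightarrow> (LINT x:{a<..<b}|lborel. g x) = 0"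
  shows "AE x in lborel. g x = 0"
proof -
  have re: "set_integrable lborel {a<..<b} (\<lambda>x. Re (g x)) \<and> (LINT x:{a<..<b}|lborel. Re (g x)) = 0"
    and im: "set_integrable lborel {a<..<b} (\<lambda>x. Im (g x)) \<and> (LINT x:{a<..<b}|lborel. Im (g x)) = 0"
    if "a < b" for a b
    using integrable_Re[OF int[OF that, unfolded set_integrable_def]]
      integrable_Im[OF int[OF that, unfolded set_integrable_def]]
      integral_Re[OF int[OF that, unfolded set_integrable_def]]
      integral_Im[OF int[OF that, unfolded set_integrable_def]] zero[OF that]
    by (auto simp: set_integrable_def set_lebesgue_integral_def)
  have "AE x in lborel. Re (g x) = 0" "AE x in lborel. Im (g x) = 0"
    by (rule AE_zero_of_interval_integrals_real; use re im in simp)+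
  then show ?thesis by eventually_elim (simp add: complex_eq_iff)
qed

lemma AE_lborel_uminus:
  assumes "AE x in lborel. P (x::real)" shows "AE x in lborel. P (- x)"
proof -
  have "AE x in distr lborel borel uminus. P (x::real)"
    using assms by (subst lborel_distr_uminus)
  from AE_distrD[OF _ this] show ?thesis by simp
qed

lemma nn_integral_lborel_uminus:
  fixes f :: "real \<Rightarrow> ennreal"
  assumes "f \<in> borel_measurable borel"
  shows "(\<integral>\<^sup>+x. f (- x) \<partial>lborel) = (\<integral>\<^sup>+x. f x \<partial>lborel)"
  using nn_integral_real_affine[OF assms, of "-1" 0] by simp

lemma integral_lborel_uminus:
  fixes f :: "real \<Rightarrow> complex"
  shows "(LINT x|lborel. f (- x)) = (LINT x|lborel. f x)"
  using lborel_integral_real_affine[of "-1" f 0] by simp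

lemma integrable_lborel_uminus:
  fixes f :: "real \<Rightarrow> complex"
  shows "integrable lborel f \<Longrightarrow> integrable lborel (\<lambda>x. f (- x))"
  using lborel_integrable_real_affine[of f "-1" 0] by simp

text \<open>The exponent \<open>N\<close> depends on \<open>g\<close> alone, which makes it possible to dominate whole sequences of
  functions \<open>\<phi>\<close>.\<close>
lemma tempered_function_times_bounded:
  assumes g: "tempered_function g"
  obtains N where "\<And>\<phi> B. \<phi> \<in> borel_measurable borel \<Longrightarrow>
    (\<And>x. cmod (\<phi> x) * (1 + x\<^sup>2) ^ N \<le> B) \<Longrightarrow> integrable lborel (\<lambda>x. g x * \<phi> x)"
proof -
  from g obtain N where [measurable]: "g \<in> borel_measurable borel"
    and N: "integrable lborel (\<lambda>x. g x / of_real ((1 + x\<^sup>2) ^ N))"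
    by (auto simp: tempered_function_def)
  have "integrable lborel (\<lambda>x. g x * \<phi> x)"
    if [measurable]: "\<phi> \<in> borel_measurable borel" and B: "\<And>x. cmod (\<phi> x) * (1 + x\<^sup>2) ^ N \<le> B" for \<phi> B
  proof (rule Bochner_Integration.integrable_bound)
    show "integrable lborel (\<lambda>x. of_real B * (g x / of_real ((1 + x\<^sup>2) ^ N)))"
      using N by (rule integrable_mult_right)
    show "AE x in lborel. norm (g x * \<phi> x) \<le> norm (of_real B * (g x / of_real ((1 + x\<^sup>2) ^ N)))"
    proof (rule AE_I2)
      fix x :: real
      have p: "(1 + x\<^sup>2) ^ N > 0" by (simp add: add_pos_nonneg)
      have B0: "0 \<le> B"
        using B[of x] p by (meson mult_nonneg_nonneg less_imp_le norm_ge_zero order_trans)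
      have "cmod (\<phi> x) \<le> B / (1 + x\<^sup>2) ^ N" using B[of x] p by (simp add: field_simps)
      then have "cmod (g x) * cmod (\<phi> x) \<le> cmod (g x) * (B / (1 + x\<^sup>2) ^ N)"
        by (rule mult_left_mono) simp
      then show "norm (g x * \<phi> x) \<le> norm (of_real B * (g x / of_real ((1 + x\<^sup>2) ^ N)))"
        using B0 p by (simp add: norm_mult norm_divide norm_power mult_ac abs_mult
            del: of_real_power of_real_add)
    qed
  qed measurable
  then show ?thesis using that by blast
qed

lemma tempered_function_times_compact_support:
  assumes g: "tempered_function g" and [measurable]: "\<phi> \<in> borel_measurable borel"
    and B: "\<And>x. cmod (\<phi> x) \<le> B" and R: "\<And>x. \<bar>x\<bar> > R \<Longrightarrow> \<phi> x = 0"
  shows "integrable lborel (\<lambda>x. g x * \<phi> x)"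
proof -
  obtain N where N: "\<And>\<phi> B. \<phi> \<in> borel_measurable borel \<Longrightarrow>
    (\<And>x. cmod (\<phi> x) * (1 + x\<^sup>2) ^ N \<le> B) \<Longrightarrow> integrable lborel (\<lambda>x. g x * \<phi> x)"
    using tempered_function_times_bounded[OF g] by metis
  have "cmod (\<phi> x) * (1 + x\<^sup>2) ^ N \<le> B * (1 + R\<^sup>2) ^ N" for x
  proof (cases "\<bar>x\<bar> > R")
    case True
    have "0 \<le> B" using B norm_ge_zero order_trans by blast
    then show ?thesis using R[OF True] by simp
  next
    case False
    then have "x\<^sup>2 \<le> R\<^sup>2" by (simp add: abs_le_square_iff[symmetric])
    then show ?thesis using B[of x] by (intro mult_mono power_mono) (auto intro: order_trans[OF norm_ge_zero])
  qed
  then show ?thesis by (intro N) auto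
qed

lemma tempered_function_set_integrable:
  assumes g: "tempered_function g"
  shows "set_integrable lborel {a<..<b} g"
proof -
  have "integrable lborel (\<lambda>x. g x * indicator {a<..<b} x)"
    by (rule tempered_function_times_compact_support[OF g, of _ 1 "\<bar>a\<bar> + \<bar>b\<bar>"])
       (auto simp: indicator_def)
  moreover have "(\<lambda>x. indicat_real {a<..<b} x *\<^sub>R g x) = (\<lambda>x. g x * indicator {a<..<b} x)"
    by (auto simp: indicator_def fun_eq_iff)
  ultimately show ?thesis by (simp add: set_integrable_def)
qed

lemma tempered_function_measurable [measurable_dest]:
  "tempered_function g \<Longrightarrow> g \<in> borel_measurable borel"
  by (simp add: tempered_function_def)

lemma integrable_imp_tempered_function:
  assumes "integrable lborel g" shows "tempered_function g"
  unfolding tempered_function_def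
  using assms by (auto intro!: exI[of _ 0])

lemma tempered_function_diff:
  assumes "tempered_function g" "tempered_function h"
  shows "tempered_function (\<lambda>x. g x - h x)"
proof -
  obtain N where N: "\<And>\<phi> B. \<phi> \<in> borel_measurable borel \<Longrightarrow>
    (\<And>x. cmod (\<phi> x) * (1 + x\<^sup>2) ^ N \<le> B) \<Longrightarrow> integrable lborel (\<lambda>x. g x * \<phi> x)"
    using tempered_function_times_bounded[OF assms(1)] by metis
  obtain M where M: "\<And>\<phi> B. \<phi> \<in> borel_measurable borel \<Longrightarrow>
    (\<And>x. cmod (\<phi> x) * (1 + x\<^sup>2) ^ M \<le> B) \<Longrightarrow> integrable lborel (\<lambda>x. h x * \<phi> x)"
    using tempered_function_times_bounded[OF assms(2)] by metis
  define w where "w x = complex_of_real (1 / (1 + x\<^sup>2) ^ (max N M))" for x :: real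
  have w: "cmod (w x) * (1 + x\<^sup>2) ^ k \<le> 1" if "k \<le> max N M" for k x
  proof -
    have "(1 + x\<^sup>2) ^ k \<le> (1 + x\<^sup>2) ^ max N M" using that by (intro power_increasing) auto
    moreover have "(1 + x\<^sup>2) ^ max N M > 0" by (simp add: add_pos_nonneg)
    ultimately show ?thesis by (simp add: w_def norm_divide norm_power del: of_real_power of_real_add)
  qed
  have [measurable]: "w \<in> borel_measurable borel" by (simp add: w_def[abs_def])
  have "integrable lborel (\<lambda>x. g x * w x - h x * w x)"
    by (intro Bochner_Integration.integrable_diff N[of _ 1] M[of _ 1] w) auto
  moreover have "(\<lambda>x. g x * w x - h x * w x) = (\<lambda>x. (g x - h x) / of_real ((1 + x\<^sup>2) ^ max N M))"
    unfolding w_def by (rule ext) (simp only: of_real_divide of_real_1 diff_divide_distrib mult_1_right times_divide_eq_right)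
  ultimately have "integrable lborel (\<lambda>x. (g x - h x) / of_real ((1 + x\<^sup>2) ^ max N M))"
    by simp
  moreover have "(\<lambda>x. g x - h x) \<in> borel_measurable borel"
    using assms by (intro borel_measurable_diff tempered_function_measurable)
  ultimately show ?thesis unfolding tempered_function_def by (intro conjI exI[of _ "max N M"])
qed

lemma test_function_bounded:
  assumes "\<phi> \<in> test_functions"
  obtains B where "\<And>x. cmod (\<phi> x) \<le> B"
proof -
  obtain R where R: "R > 0" "\<And>x. \<bar>x\<bar> > R \<Longrightarrow> \<phi> x = 0"
    using test_function_bounded_support[OF assms] by metis
  have "continuous_on {-R..R} \<phi>"
    using assms smooth_continuous[of \<phi> _ 0] by (simp add: test_functions_def)
  then have "bounded (\<phi> ` {-R..R})"
    by (intro compact_imp_bounded compact_continuous_image) auto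
  then obtain B where "B > 0" and B: "\<And>x. \<bar>x\<bar> \<le> R \<Longrightarrow> cmod (\<phi> x) \<le> B"
    by (auto simp: bounded_pos abs_le_iff)
  have "cmod (\<phi> x) \<le> B" for x
    using B[of x] R(2)[of x] \<open>B > 0\<close> by (cases "\<bar>x\<bar> \<le> R") auto
  then show ?thesis using that by blast
qed

lemma test_function_smooth: "\<phi> \<in> test_functions \<Longrightarrow> smooth \<phi>"
  by (simp add: test_functions_def)

lemma test_function_measurable [measurable_dest]:
  "\<phi> \<in> test_functions \<Longrightarrow> \<phi> \<in> borel_measurable borel"
  by (simp add: test_functions_def smooth_measurable0)

lemma tempered_function_times_test_function:
  assumes "tempered_function g" "\<phi> \<in> test_functions"
  shows "integrable lborel (\<lambda>x. g x * \<phi> x)"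
proof -
  obtain B where B: "\<And>x. cmod (\<phi> x) \<le> B" using test_function_bounded[OF assms(2)] by metis
  obtain R where R: "\<And>x. \<bar>x\<bar> > R \<Longrightarrow> \<phi> x = 0" using test_function_bounded_support[OF assms(2)] by metis
  show ?thesis
    by (rule tempered_function_times_compact_support[OF assms(1) test_function_measurable[OF assms(2)] B R])
qed

lemma tempered_function_const: "tempered_function (\<lambda>x. c)"
proof -
  have "integrable lborel (\<lambda>x::real. inverse (1 + x\<^sup>2))"
    using integrable_inverse_1_plus_square by (simp add: set_integrable_def)
  then have "integrable lborel (\<lambda>x. c * complex_of_real (inverse (1 + x\<^sup>2)))"
    by (intro integrable_mult_right integrable_of_real)
  moreover have "(\<lambda>x. c * complex_of_real (inverse (1 + x\<^sup>2))) = (\<lambda>x. c / complex_of_real ((1 + x\<^sup>2) ^ 1))"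
    by (simp add: divide_inverse fun_eq_iff)
  ultimately show ?thesis
    unfolding tempered_function_def by (intro conjI exI[of _ 1]) auto
qed

lemma test_function_integrable:
  assumes "\<phi> \<in> test_functions" shows "integrable lborel \<phi>"
  using tempered_function_times_test_function[OF tempered_function_const[of 1] assms] by simp

text \<open>Dominated convergence along the bumps that exhaust an interval turns the integrals against test
  functions into integrals over that interval.\<close>
lemma AE_eq_of_test_function_integrals:
  assumes g: "tempered_function g" and h: "tempered_function h"
    and eq: "\<And>\<phi>. \<phi> \<in> test_functions \<Longrightarrow> function_distribution g \<phi> = function_distribution h \<phi>"
  shows "AE x in lborel. g x = h x"
proof -
  define d where "d x = g x - h x" for x
  have d: "tempered_function d" unfolding d_def by (rule tempered_function_diff[OF g h])
  note [measurable] = tempered_function_measurable[OF d]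
  have zero: "(LINT x|lborel. d x * \<phi> x) = 0" if "\<phi> \<in> test_functions" for \<phi>
    using eq[OF that] tempered_function_times_test_function[OF g that]
      tempered_function_times_test_function[OF h that]
    by (simp add: d_def function_distribution_def left_diff_distrib)
  have "AE x in lborel. d x = 0"
  proof (rule AE_zero_of_interval_integrals)
    fix a b :: real assume ab: "a < b"
    show int: "set_integrable lborel {a<..<b} d" by (rule tempered_function_set_integrable[OF d])
    define B where "B n x = flat (real (Suc n) * (x - a)) * flat (real (Suc n) * (b - x))" for n x
    note bump = bump_exhausting_interval[OF ab, folded B_def]
    have "(\<lambda>n. LINT x|lborel. d x * complex_of_real (B n x)) \<longlonglongrightarrow> (LINT x|lborel. indicator {a<..<b} x *\<^sub>R d x)"
    proof (rule integral_dominated_convergence[where w="\<lambda>x. norm (indicator {a<..<b} x *\<^sub>R d x)"])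
      have [measurable]: "(\<lambda>x. complex_of_real (B n x)) \<in> borel_measurable borel" for n
        using test_function_measurable[OF bump(1)] .
      show "(\<lambda>x. d x * complex_of_real (B n x)) \<in> borel_measurable lborel" for n by measurable
      show "AE x in lborel. (\<lambda>n. d x * complex_of_real (B n x)) \<longlonglongrightarrow> indicat_real {a<..<b} x *\<^sub>R d x"
      proof (rule AE_I2)
        fix x
        have "(\<lambda>n. d x * complex_of_real (B n x)) \<longlonglongrightarrow> d x * complex_of_real (indicator {a<..<b} x)"
          by (intro tendsto_intros bump(3))
        then show "(\<lambda>n. d x * complex_of_real (B n x)) \<longlonglongrightarrow> indicat_real {a<..<b} x *\<^sub>R d x"
          by (simp add: scaleR_conv_of_real mult.commute)
      qed
      show "AE x in lborel. norm (d x * complex_of_real (B n x)) \<le> norm (indicat_real {a<..<b} x *\<^sub>R d x)" for n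
        using bump(2)[of n] by (intro AE_I2) (simp add: norm_mult mult.commute[of _ "cmod _"] mult_left_mono)
    qed (use integrable_norm[OF int[unfolded set_integrable_def]] in auto)
    then show "(LINT x:{a<..<b}|lborel. d x) = 0"
      using zero[OF bump(1)] by (simp add: set_lebesgue_integral_def LIMSEQ_const_iff)
  qed measurable
  then show ?thesis by eventually_elim (simp add: d_def)
qed


section \<open>Fourier transforms\<close>

text \<open>Fubini.  The first factor is integrated against an arbitrary measure, because the identity is
  also applied to the total variation of a signed measure.\<close>
lemma fourier_duality:
  fixes q :: "real \<Rightarrow> complex" and w :: "real \<Rightarrow> complex"
  assumes M: "sigma_finite_measure M" "sets M = sets borel"
    and q: "integrable M q" and w: "integrable lborel w"
  shows "(LINT x|M. q x * fourier w x) = (LINT u|lborel. (LINT x|M. iexp (u * x) * q x) * w u)"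
proof -
  interpret M: sigma_finite_measure M by fact
  interpret pair_sigma_finite M lborel by unfold_locales
  note [measurable_cong] = M(2)
  note [measurable] = borel_measurable_integrable[OF q] borel_measurable_integrable[OF w]
  let ?f = "\<lambda>(x, u). q x * (iexp (u * x) * w u)"
  have "integrable (M \<Otimes>\<^sub>M lborel) ?f"
  proof (rule Fubini_integrable)
    show "?f \<in> borel_measurable (M \<Otimes>\<^sub>M lborel)" by measurable
    show "AE x in M. integrable lborel (\<lambda>y. ?f (x, y))"
      by (intro AE_I2) (auto intro!: integrable_mult_right Bochner_Integration.integrable_bound[OF w]
          simp: norm_mult)
    show "integrable M (\<lambda>x. LINT y|lborel. norm (?f (x, y)))"
      using q w by (simp add: norm_mult)
  qed
  from Fubini_integral[OF this]
  have "(LINT x|M. LINT u|lborel. q x * (iexp (u * x) * w u)) = (LINT u|lborel. LINT x|M. q x * (iexp (u * x) * w u))"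
    by simp
  moreover have "(LINT x|M. q x * (iexp (u * x) * w u)) = (LINT x|M. iexp (u * x) * q x) * w u" for u
    by (subst integral_mult_left_zero[symmetric]) (simp add: mult_ac)
  moreover have "q x * fourier w x = (LINT u|lborel. q x * (iexp (u * x) * w u))" for x
    by (simp add: fourier_def mult.commute)
  ultimately show ?thesis by (simp only:)
qed

lemma integrable_iexp_mult:
  assumes "integrable M w" "sets M = sets borel"
  shows "integrable M (\<lambda>x. iexp (u * x) * (w x :: complex))"
proof (rule Bochner_Integration.integrable_bound[OF assms(1)])
  note [measurable_cong] = assms(2)
  note [measurable] = borel_measurable_integrable[OF assms(1)]
  show "(\<lambda>x. iexp (u * x) * w x) \<in> borel_measurable M" by measurable
qed (simp add: norm_mult)

lemma fourier_of_integrable_bound: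
  "cmod (fourier w u) \<le> (LINT x|lborel. cmod (w x))"
proof -
  have "cmod (fourier w u) \<le> (LINT x|lborel. cmod (iexp (u * x) * w x))"
    unfolding fourier_def by (rule integral_norm_bound)
  then show ?thesis by (simp add: norm_mult)
qed

lemma continuous_signed_char:
  assumes q: "integrable M q" and M: "sets M = sets borel"
  shows "continuous_on A (\<lambda>u. LINT x|M. iexp (u * x) * (q x :: complex))"
proof (rule continuous_at_imp_continuous_on, safe)
  fix u
  note [measurable_cong] = M
  note [measurable] = borel_measurable_integrable[OF q]
  show "isCont (\<lambda>u. LINT x|M. iexp (u * x) * q x) u"
    unfolding isCont_def tendsto_at_iff_sequentially comp_def
  proof safe
    fix X assume "X \<longlonglongrightarrow> u"
    then show "(\<lambda>n. LINT x|M. iexp (X n * x) * q x) \<longlonglongrightarrow> (LINT x|M. iexp (u * x) * q x)"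
      by (intro integral_dominated_convergence[where w="\<lambda>x. cmod (q x)"])
         (auto simp: norm_mult q intro!: tendsto_intros)
  qed
qed

lemma fourier_continuous: "integrable lborel w \<Longrightarrow> continuous_on A (fourier w)"
  unfolding fourier_def[abs_def] by (rule continuous_signed_char) auto

lemma fourier_measurable: "integrable lborel w \<Longrightarrow> fourier w \<in> borel_measurable borel"
  by (intro borel_measurable_continuous_onI fourier_continuous)

lemma fourier_gaussian:
  assumes "\<epsilon> > 0"
  shows "fourier (\<lambda>u. iexp (- (u * y)) * of_real (exp (- (\<epsilon> * u)\<^sup>2 / 2))) x
       = of_real (sqrt (2 * pi) / \<epsilon> * exp (- ((x - y) / \<epsilon>)\<^sup>2 / 2))"
proof -
  have "of_real (exp (- ((x - y) / \<epsilon>)\<^sup>2 / 2)) = char std_normal_distribution ((x - y) / \<epsilon>)"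
    by (simp add: char_std_normal_distribution)
  also have "\<dots> = (LINT v|lborel. std_normal_density v *\<^sub>R iexp ((x - y) / \<epsilon> * v))"
    unfolding char_def by (subst integral_density) auto
  also have "\<dots> = \<bar>\<epsilon>\<bar> *\<^sub>R (LINT u|lborel. std_normal_density (0 + \<epsilon> * u) *\<^sub>R iexp ((x - y) / \<epsilon> * (0 + \<epsilon> * u)))"
    by (rule lborel_integral_real_affine) (use assms in simp)
  also have "(\<lambda>u. std_normal_density (0 + \<epsilon> * u) *\<^sub>R iexp ((x - y) / \<epsilon> * (0 + \<epsilon> * u)))
     = (\<lambda>u. of_real (1 / sqrt (2 * pi)) * (iexp (u * x) * (iexp (- (u * y)) * of_real (exp (- (\<epsilon> * u)\<^sup>2 / 2)))))"
  proof
    fix u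
    have "(x - y) / \<epsilon> * (0 + \<epsilon> * u) = u * x + - (u * y)" using assms by (simp add: field_simps)
    then have "iexp ((x - y) / \<epsilon> * (0 + \<epsilon> * u)) = iexp (u * x) * iexp (- (u * y))"
      by (simp only: of_real_add distrib_left exp_add)
    then show "std_normal_density (0 + \<epsilon> * u) *\<^sub>R iexp ((x - y) / \<epsilon> * (0 + \<epsilon> * u))
      = of_real (1 / sqrt (2 * pi)) * (iexp (u * x) * (iexp (- (u * y)) * of_real (exp (- (\<epsilon> * u)\<^sup>2 / 2))))"
      by (simp only: std_normal_density_def scaleR_conv_of_real of_real_mult) (simp add: mult_ac)
  qed
  also have "(LINT u|lborel. of_real (1 / sqrt (2 * pi)) * (iexp (u * x) * (iexp (- (u * y)) * of_real (exp (- (\<epsilon> * u)\<^sup>2 / 2)))))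
     = of_real (1 / sqrt (2 * pi)) * fourier (\<lambda>u. iexp (- (u * y)) * of_real (exp (- (\<epsilon> * u)\<^sup>2 / 2))) x"
    by (simp add: fourier_def mult.commute[of _ x] del: of_real_divide)
  finally show ?thesis using assms
    by (simp add: scaleR_conv_of_real field_simps)
qed

lemma integrable_gaussian_complex:
  assumes "\<epsilon> > 0"
  shows "integrable lborel (\<lambda>u. iexp (- (u * y)) * complex_of_real (exp (- (\<epsilon> * u)\<^sup>2 / 2)))"
proof -
  have "integrable lborel (\<lambda>x. sqrt (2 * pi) * std_normal_density (0 + \<epsilon> * x))"
    by (intro integrable_mult_right lborel_integrable_real_affine integrable_normal_density) (use assms in auto)
  then have "integrable lborel (\<lambda>x. exp (- (\<epsilon> * x)\<^sup>2 / 2))"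
    by (simp add: std_normal_density_def)
  then show ?thesis
    by (rule Bochner_Integration.integrable_bound) (auto simp: norm_mult)
qed

text \<open>Integrate the transform against a wide Gaussian.  By duality this is a Gaussian average of \<open>\<phi>\<close> around
  \<open>y\<close>, which concentrates at \<open>y\<close> as the Gaussian factor tends to \<open>1\<close>.\<close>
lemma fourier_inversion_continuous:
  assumes int: "integrable lborel \<phi>" and cont: "continuous_on UNIV \<phi>" and B: "\<And>x. cmod (\<phi> x) \<le> B"
    and intF: "integrable lborel (fourier \<phi>)"
  shows "fourier (fourier \<phi>) (- y) = 2 * of_real pi * \<phi> y"
proof -
  define e where "e n = 1 / real (Suc n)" for n
  have e: "e n > 0" for n by (simp add: e_def)
  have e0: "e \<longlonglongrightarrow> 0" unfolding e_def by real_asymp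
  have [measurable]: "\<phi> \<in> borel_measurable borel" using cont by (rule borel_measurable_continuous_onI)
  note [measurable] = fourier_measurable[OF int]
  define w where "w n u = iexp (- (u * y)) * complex_of_real (exp (- (e n * u)\<^sup>2 / 2))" for n u
  have A: "(LINT u|lborel. fourier \<phi> u * w n u)
      = (LINT z|lborel. of_real (2 * pi * std_normal_density z) * \<phi> (y + e n * z))" for n
  proof -
    have "(LINT u|lborel. fourier \<phi> u * w n u) = (LINT x|lborel. \<phi> x * fourier (w n) x)"
      using fourier_duality[OF sigma_finite_lborel _ int, of "w n"] integrable_gaussian_complex[OF e[of n], of y]
      unfolding w_def[abs_def] by (simp add: fourier_def[of \<phi>])
    also have "\<dots> = (LINT x|lborel. \<phi> x * of_real (sqrt (2 * pi) / e n * exp (- ((x - y) / e n)\<^sup>2 / 2)))"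
      unfolding w_def by (subst fourier_gaussian[OF e]) simp
    also have "\<dots> = \<bar>e n\<bar> *\<^sub>R (LINT z|lborel. \<phi> (y + e n * z) * of_real (sqrt (2 * pi) / e n * exp (- ((y + e n * z - y) / e n)\<^sup>2 / 2)))"
      by (rule lborel_integral_real_affine) (use e[of n] in simp)
    also have "\<dots> = (LINT z|lborel. \<bar>e n\<bar> *\<^sub>R (\<phi> (y + e n * z) * of_real (sqrt (2 * pi) / e n * exp (- ((y + e n * z - y) / e n)\<^sup>2 / 2))))"
      by simp
    also have "(\<lambda>z. \<bar>e n\<bar> *\<^sub>R (\<phi> (y + e n * z) * of_real (sqrt (2 * pi) / e n * exp (- ((y + e n * z - y) / e n)\<^sup>2 / 2))))
       = (\<lambda>z. of_real (2 * pi * std_normal_density z) * \<phi> (y + e n * z))"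
    proof
      fix z
      have "2 * pi * (1 / sqrt (2 * pi)) = sqrt (2 * pi)"
        by (simp add: field_simps flip: real_sqrt_mult power2_eq_square)
      then have "2 * pi * std_normal_density z = sqrt (2 * pi) * exp (- z\<^sup>2 / 2)"
        unfolding std_normal_density_def mult.assoc[symmetric] by simp
      also have "\<dots> = \<bar>e n\<bar> * (sqrt (2 * pi) / e n * exp (- ((y + e n * z - y) / e n)\<^sup>2 / 2))"
        using e[of n] by simp
      finally show "\<bar>e n\<bar> *\<^sub>R (\<phi> (y + e n * z) * of_real (sqrt (2 * pi) / e n * exp (- ((y + e n * z - y) / e n)\<^sup>2 / 2)))
        = of_real (2 * pi * std_normal_density z) * \<phi> (y + e n * z)"
        by (simp only: scaleR_conv_of_real of_real_mult mult_ac)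
    qed
    finally show ?thesis .
  qed
  have L1: "(\<lambda>n. LINT u|lborel. fourier \<phi> u * w n u) \<longlonglongrightarrow> (LINT u|lborel. fourier \<phi> u * iexp (- (u * y)))"
  proof (rule integral_dominated_convergence[where w="\<lambda>u. cmod (fourier \<phi> u)"])
    show "AE u in lborel. (\<lambda>n. fourier \<phi> u * w n u) \<longlonglongrightarrow> fourier \<phi> u * iexp (- (u * y))"
    proof (rule AE_I2)
      fix u
      have "(\<lambda>n. fourier \<phi> u * w n u) \<longlonglongrightarrow> fourier \<phi> u * (iexp (- (u * y)) * of_real (exp (- (0 * u)\<^sup>2 / 2)))"
        unfolding w_def by (intro tendsto_intros e0) simp
      then show "(\<lambda>n. fourier \<phi> u * w n u) \<longlonglongrightarrow> fourier \<phi> u * iexp (- (u * y))" by simp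
    qed
    show "AE u in lborel. cmod (fourier \<phi> u * w n u) \<le> cmod (fourier \<phi> u)" for n
      by (auto simp: norm_mult w_def intro!: mult_left_le)
    show "(\<lambda>u. fourier \<phi> u * w n u) \<in> borel_measurable lborel" for n
      unfolding w_def by measurable
  qed (use intF in auto)
  have L2: "(\<lambda>n. LINT z|lborel. of_real (2 * pi * std_normal_density z) * \<phi> (y + e n * z))
      \<longlonglongrightarrow> (LINT z|lborel. of_real (2 * pi * std_normal_density z) * \<phi> y)"
  proof (rule integral_dominated_convergence[where w="\<lambda>z. 2 * pi * std_normal_density z * B"])
    show "AE z in lborel. (\<lambda>n. of_real (2 * pi * std_normal_density z) * \<phi> (y + e n * z))
       \<longlonglongrightarrow> of_real (2 * pi * std_normal_density z) * \<phi> y"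
    proof (rule AE_I2)
      fix z
      have c: "isCont \<phi> y" using cont by (simp add: continuous_on_eq_continuous_at)
      have "(\<lambda>n. y + e n * z) \<longlonglongrightarrow> y + 0 * z" by (intro tendsto_intros e0)
      then have "(\<lambda>n. \<phi> (y + e n * z)) \<longlonglongrightarrow> \<phi> y"
        by (intro isCont_tendsto_compose[OF c]) simp
      then show "(\<lambda>n. of_real (2 * pi * std_normal_density z) * \<phi> (y + e n * z))
       \<longlonglongrightarrow> of_real (2 * pi * std_normal_density z) * \<phi> y"
        by (intro tendsto_intros)
    qed
    show "AE z in lborel. norm (of_real (2 * pi * std_normal_density z) * \<phi> (y + e n * z))
        \<le> 2 * pi * std_normal_density z * B" for n
      using B by (auto simp: norm_mult abs_mult intro!: mult_left_mono)
  qed (auto intro!: integrable_mult_right integrable_mult_left integrable_normal_density)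
  have L3: "(LINT z|lborel. complex_of_real (2 * pi * std_normal_density z) * \<phi> y) = 2 * of_real pi * \<phi> y"
  proof -
    have "(LINT z|lborel. complex_of_real (2 * pi * std_normal_density z) * \<phi> y)
       = (LINT z|lborel. complex_of_real (2 * pi * std_normal_density z)) * \<phi> y"
      by simp
    also have "(LINT z|lborel. complex_of_real (2 * pi * std_normal_density z))
       = complex_of_real (LINT z|lborel. 2 * pi * std_normal_density z)"
      by (rule integral_complex_of_real)
    also have "(LINT z|lborel. 2 * pi * std_normal_density z) = 2 * pi"
      using integral_normal_density[of 1 0] by simp
    finally show ?thesis by simp
  qed
  have "(LINT u|lborel. fourier \<phi> u * iexp (- (u * y))) = 2 * of_real pi * \<phi> y"
    using LIMSEQ_unique[OF L1[unfolded A] L2] L3 by (rule trans)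
  then show ?thesis by (simp add: fourier_def[of "fourier \<phi>"] mult.commute)
qed

lemma test_function_vderiv:
  assumes "\<phi> \<in> test_functions" shows "vderiv j \<phi> \<in> test_functions"
proof -
  obtain R where R: "\<And>x. \<bar>x\<bar> > R \<Longrightarrow> \<phi> x = 0" using test_function_bounded_support[OF assms] by metis
  have "smooth (vderiv j \<phi>)"
    using smoothI[OF derivatives_shift[OF smooth_derivatives[OF test_function_smooth[OF assms]], of j]] by simp
  then show ?thesis
    by (rule test_functionI[of _ "-R" R]) (use vderiv_zero_outside[OF R] in \<open>auto simp: abs_le_iff not_le\<close>)
qed

lemma vderiv_vderiv: "vderiv i (vderiv j \<phi>) = vderiv (i + j) \<phi>"
  by (simp add: vderiv_def funpow_add)

lemma test_function_cong_outside:
  assumes "\<phi> \<in> test_functions" "smooth \<psi>" "\<And>x. \<phi> x = 0 \<Longrightarrow> \<psi> x = 0"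
  shows "\<psi> \<in> test_functions"
proof -
  obtain R where R: "\<And>x. \<bar>x\<bar> > R \<Longrightarrow> \<phi> x = 0" using test_function_bounded_support[OF assms(1)] by metis
  show ?thesis by (rule test_functionI[OF assms(2), of "-R" R]) (use R assms(3) in force)
qed

lemma test_function_power_times:
  assumes "\<phi> \<in> test_functions" shows "(\<lambda>x. (c * of_real x) ^ j * \<phi> x) \<in> test_functions"
  by (rule test_function_cong_outside[OF assms smooth_power_times[OF test_function_smooth[OF assms]]]) simp

lemma integral_derivative_compact_support:
  fixes h :: "real \<Rightarrow> complex"
  assumes h: "\<And>x. (h has_vector_derivative h' x) (at x)" and c: "continuous_on UNIV h'"
    and R: "\<And>x. \<bar>x\<bar> > R \<Longrightarrow> h x = 0" "\<And>x. \<bar>x\<bar> > R \<Longrightarrow> h' x = 0"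
  shows "(LINT x|lborel. h' x) = 0"
proof -
  define r where "r = \<bar>R\<bar> + 1"
  have "(LINT x|lborel. indicator {-r..r} x *\<^sub>R h' x) = h r - h (-r)"
    by (rule integral_FTC_Icc)
       (auto simp: r_def intro!: has_vector_derivative_at_within[OF h] continuous_on_subset[OF c])
  moreover have "indicator {-r..r} x *\<^sub>R h' x = h' x" for x
    using R(2)[of x] by (cases "\<bar>x\<bar> > R") (auto simp: r_def indicator_def)
  ultimately show ?thesis using R(1)[of r] R(1)[of "-r"] by (simp add: r_def)
qed

lemma has_vector_derivative_iexp:
  "((\<lambda>t. iexp (t * x)) has_vector_derivative \<i> * of_real x * iexp (t * x)) (at t)"
proof -
  have "((\<lambda>t. \<i> * (of_real t * of_real x)) has_vector_derivative \<i> * of_real x) (at t)"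
    by (auto intro!: derivative_eq_intros has_vector_derivative_of_real simp: mult.commute)
  from field_vector_diff_chain_at[OF this DERIV_exp]
  show ?thesis by (simp add: o_def mult_ac)
qed

lemma fourier_vderiv_1:
  assumes "\<phi> \<in> test_functions"
  shows "fourier (vderiv 1 \<phi>) u = (- \<i> * of_real u) * fourier \<phi> u"
proof -
  obtain R where R: "\<And>x. \<bar>x\<bar> > R \<Longrightarrow> \<phi> x = 0" using test_function_bounded_support[OF assms] by metis
  have d: "(\<phi> has_vector_derivative vderiv 1 \<phi> x) (at x)" for x
    using derivativesD[OF smooth_derivatives[OF test_function_smooth[OF assms]], of 0 x] by simp
  define h' where "h' x = iexp (x * u) * vderiv 1 \<phi> x + (\<i> * of_real u * iexp (x * u)) * \<phi> x" for x
  have "(LINT x|lborel. h' x) = 0"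
  proof (rule integral_derivative_compact_support[where R=R])
    show "((\<lambda>x. iexp (x * u) * \<phi> x) has_vector_derivative h' x) (at x)" for x
      unfolding h'_def by (rule has_vector_derivative_mult[OF has_vector_derivative_iexp d])
    show "continuous_on UNIV h'"
      unfolding h'_def
      by (intro continuous_intros smooth_continuous[OF test_function_smooth[OF assms]]
          smooth_continuous[OF test_function_smooth[OF assms], of _ 0, simplified])
  qed (use R vderiv_zero_outside[OF R] in \<open>auto simp: h'_def\<close>)
  moreover have "integrable lborel (\<lambda>x. iexp (u * x) * vderiv 1 \<phi> x)" "integrable lborel (\<lambda>x. iexp (u * x) * \<phi> x)"
    by (intro integrable_iexp_mult test_function_integrable test_function_vderiv assms; simp)+
  ultimately have "fourier (vderiv 1 \<phi>) u + \<i> * of_real u * fourier \<phi> u = 0"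
    by (simp add: h'_def fourier_def mult_ac)
  then show ?thesis by (simp add: eq_neg_iff_add_eq_0)
qed

lemma fourier_vderiv:
  "\<phi> \<in> test_functions \<Longrightarrow> fourier (vderiv j \<phi>) u = (- \<i> * of_real u) ^ j * fourier \<phi> u"
proof (induction j)
  case (Suc j)
  have "vderiv (Suc j) \<phi> = vderiv 1 (vderiv j \<phi>)" by (simp add: vderiv_vderiv)
  then show ?case using Suc fourier_vderiv_1[OF test_function_vderiv[OF Suc.prems], of j u] by simp
qed simp

lemma fourier_derivatives:
  assumes "\<phi> \<in> test_functions"
  shows "derivatives (\<lambda>j. fourier (\<lambda>x. (\<i> * of_real x) ^ j * \<phi> x))"
  unfolding derivatives_def
proof safe
  fix j u
  let ?w = "\<lambda>j x. (\<i> * of_real x) ^ j * \<phi> x"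
  note t = test_function_power_times[OF assms, of \<i>]
  have int: "integrable lborel (?w j)" for j by (intro test_function_integrable t)
  have "((\<lambda>u. LINT x|lborel. iexp (u * x) * ?w j x) has_vector_derivative
      (LINT x|lborel. iexp (u * x) * ?w (Suc j) x)) (at u)"
  proof (rule has_vector_derivative_integral[where w="\<lambda>x. cmod (?w (Suc j) x)"])
    show "((\<lambda>u. iexp (u * x) * ?w j x) has_vector_derivative iexp (u * x) * ?w (Suc j) x) (at u)" for u x
      using has_vector_derivative_mult_left[OF has_vector_derivative_iexp[of x u], of "?w j x"]
      by (simp add: mult_ac)
    show "integrable lborel (\<lambda>x. iexp (u * x) * ?w j x)" for u
      by (intro integrable_iexp_mult int) simp
    show "(\<lambda>x. iexp (u * x) * ?w (Suc j) x) \<in> borel_measurable lborel" for u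
      using borel_measurable_integrable[OF integrable_iexp_mult[OF int[of "Suc j"], of u]] by simp
    show "integrable lborel (\<lambda>x. cmod (?w (Suc j) x))" by (intro integrable_norm int)
  qed (simp add: norm_mult)
  then show "(fourier (?w j) has_vector_derivative fourier (?w (Suc j)) u) (at u)"
    unfolding fourier_def[abs_def] .
qed

text \<open>Powers of \<open>u\<close> times derivatives of the transform are transforms of test functions up to constants,
  and these are bounded.  The reflection \<open>k = - 1\<close> is needed for the inversion formula.\<close>
lemma fourier_test_function_schwartz:
  assumes \<phi>: "\<phi> \<in> test_functions" and k: "\<bar>k\<bar> = 1"
  shows "(\<lambda>u. c * fourier \<phi> (k * u)) \<in> schwartz"
proof -
  have sm: "smooth (fourier \<phi>)"
    using smoothI[OF fourier_derivatives[OF \<phi>]] by simp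
  have vd: "vderiv j (fourier \<phi>) = fourier (\<lambda>x. (\<i> * of_real x) ^ j * \<phi> x)" for j
    using derivatives_vderiv[OF fourier_derivatives[OF \<phi>], of j] by simp
  have sm2: "smooth (\<lambda>u. fourier \<phi> (k * u))" using smooth_affine[OF sm, of k 0] by simp
  have "\<exists>B. \<forall>u. \<bar>u\<bar> ^ m * cmod (vderiv j (\<lambda>u. c * fourier \<phi> (k * u)) u) \<le> B" for m j
  proof -
    define \<psi> where "\<psi> = (\<lambda>x. (\<i> * of_real x) ^ j * \<phi> x)"
    have \<psi>: "\<psi> \<in> test_functions" unfolding \<psi>_def by (rule test_function_power_times[OF \<phi>])
    have "\<bar>u\<bar> ^ m * cmod (vderiv j (\<lambda>u. c * fourier \<phi> (k * u)) u)
        \<le> cmod c * (LINT x|lborel. cmod (vderiv m \<psi> x))" for u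
    proof -
      have "vderiv j (\<lambda>u. c * fourier \<phi> (k * u)) u = c * (k ^ j *\<^sub>R fourier \<psi> (k * u))"
        using vderiv_cmult[OF sm2, of j c u] vderiv_affine[OF sm, of j k 0 u] by (simp add: vd \<psi>_def)
      then have "\<bar>u\<bar> ^ m * cmod (vderiv j (\<lambda>u. c * fourier \<phi> (k * u)) u)
          = cmod c * (\<bar>k * u\<bar> ^ m * cmod (fourier \<psi> (k * u)))"
        using k by (simp add: norm_mult abs_mult power_abs mult_ac)
      also have "\<bar>k * u\<bar> ^ m * cmod (fourier \<psi> (k * u)) = cmod (fourier (vderiv m \<psi>) (k * u))"
        by (simp add: fourier_vderiv[OF \<psi>] norm_mult norm_power abs_mult)
      also have "\<dots> \<le> (LINT x|lborel. cmod (vderiv m \<psi> x))"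
        by (rule fourier_of_integrable_bound)
      finally show ?thesis by (simp add: mult_left_mono)
    qed
    then show ?thesis by blast
  qed
  then show ?thesis using smooth_cmult[OF sm2] by (simp add: schwartz_def)
qed

lemma test_function_schwartz: "\<phi> \<in> test_functions \<Longrightarrow> \<phi> \<in> schwartz"
proof -
  assume \<phi>: "\<phi> \<in> test_functions"
  obtain R where R: "R > 0" "\<And>x. \<bar>x\<bar> > R \<Longrightarrow> \<phi> x = 0" using test_function_bounded_support[OF \<phi>] by metis
  have "\<exists>B. \<forall>x. \<bar>x\<bar> ^ m * cmod (vderiv j \<phi> x) \<le> B" for m j
  proof -
    obtain B where B: "\<And>x. cmod (vderiv j \<phi> x) \<le> B"
      using test_function_bounded[OF test_function_vderiv[OF \<phi>]] by metis
    have "\<bar>x\<bar> ^ m * cmod (vderiv j \<phi> x) \<le> R ^ m * B" for x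
    proof (cases "\<bar>x\<bar> > R")
      case True
      have "0 \<le> B" using B[of x] norm_ge_zero order_trans by blast
      then show ?thesis using vderiv_zero_outside[OF R(2) True] R(1) by simp
    next
      case False
      then show ?thesis using B[of x] R(1) by (intro mult_mono power_mono) auto
    qed
    then show ?thesis by blast
  qed
  then show ?thesis using test_function_smooth[OF \<phi>] by (simp add: schwartz_def)
qed

lemma integrable_inverse_1_plus_square': "integrable lborel (\<lambda>x::real. inverse (1 + x\<^sup>2))"
  using integrable_inverse_1_plus_square by (simp add: set_integrable_def)

lemma schwartz_integrable:
  assumes "\<phi> \<in> schwartz" shows "integrable lborel \<phi>"
proof -
  have sm: "smooth \<phi>" and b: "\<And>m. \<exists>B. \<forall>x. \<bar>x\<bar> ^ m * cmod (\<phi> x) \<le> B"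
    using assms unfolding schwartz_def by (auto, metis vderiv_0)
  obtain B0 where B0: "\<And>x. cmod (\<phi> x) \<le> B0" using b[of 0] by auto
  obtain B2 where B2: "\<And>x. x\<^sup>2 * cmod (\<phi> x) \<le> B2" using b[of 2] by auto
  have *: "cmod (\<phi> x) \<le> (B0 + B2) * inverse (1 + x\<^sup>2)" for x
  proof -
    have "(1 + x\<^sup>2) * cmod (\<phi> x) \<le> B0 + B2" using B0[of x] B2[of x] by (simp add: distrib_right)
    moreover have "1 + x\<^sup>2 > 0" by (simp add: add_pos_nonneg)
    ultimately show ?thesis by (simp add: field_simps)
  qed
  have "integrable lborel (\<lambda>x. (B0 + B2) * inverse (1 + x\<^sup>2))"
    by (intro integrable_mult_right integrable_inverse_1_plus_square')
  then show ?thesis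
    by (rule Bochner_Integration.integrable_bound)
       (use smooth_measurable0[OF sm] * in \<open>auto intro: order_trans[OF _ abs_ge_self]\<close>)
qed

lemma fourier_test_function_integrable:
  assumes "\<phi> \<in> test_functions" shows "integrable lborel (fourier \<phi>)"
  using schwartz_integrable[OF fourier_test_function_schwartz[OF assms, of 1 1]] by simp

lemma fourier_uminus: "fourier (\<lambda>u. w (- u)) y = fourier w (- y)"
  unfolding fourier_def
  by (subst integral_lborel_uminus[symmetric]) simp

lemma fourier_cmult: "fourier (\<lambda>u. c * w u) y = c * fourier w y"
  unfolding fourier_def by (subst integral_mult_right_zero[symmetric]) (simp add: mult_ac)

lemma fourier_fourier_test_function:
  assumes "\<phi> \<in> test_functions"
  shows "fourier (fourier \<phi>) (- y) = 2 * of_real pi * \<phi> y"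
proof -
  obtain B where B: "\<And>x. cmod (\<phi> x) \<le> B" using test_function_bounded[OF assms] by metis
  show ?thesis
    by (rule fourier_inversion_continuous[OF test_function_integrable[OF assms] _ B
          fourier_test_function_integrable[OF assms]])
       (use smooth_continuous[OF test_function_smooth[OF assms], of _ 0] in simp)
qed

lemma bounded_imp_tempered_function:
  assumes [measurable]: "h \<in> borel_measurable borel" and B: "\<And>x. cmod (h x) \<le> B"
  shows "tempered_function h"
proof -
  obtain N where N: "integrable lborel (\<lambda>x. complex_of_real B / complex_of_real ((1 + x\<^sup>2) ^ N))"
    using tempered_function_const[of "complex_of_real B"] unfolding tempered_function_def by blast
  have "integrable lborel (\<lambda>x. h x / complex_of_real ((1 + x\<^sup>2) ^ N))"
    using N
  proof (rule Bochner_Integration.integrable_bound)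
    have "cmod (h x) \<le> cmod (complex_of_real B)" for x
      using B[of x] by simp
    then show "AE x in lborel. norm (h x / complex_of_real ((1 + x\<^sup>2) ^ N)) \<le> norm (complex_of_real B / complex_of_real ((1 + x\<^sup>2) ^ N))"
      by (intro AE_I2) (simp only: norm_divide, rule divide_right_mono, auto)
  qed measurable
  then show ?thesis using assms(1) unfolding tempered_function_def by blast
qed

text \<open>For an integrable function that need not be continuous, inversion follows by testing against test
  functions and moving both transforms onto the test function.\<close>
lemma fourier_inversion_L1:
  assumes G: "integrable lborel G" and F: "integrable lborel (fourier G)"
  shows "AE x in lborel. G x = fourier (fourier G) (- x) / (2 * of_real pi)"
proof (rule AE_eq_of_test_function_integrals)
  define H where "H x = fourier (fourier G) (- x) / (2 * of_real pi)" for x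
  have cH: "continuous_on UNIV H"
    unfolding H_def by (intro continuous_intros continuous_on_compose2[OF fourier_continuous[OF F, of UNIV]]) auto
  note [measurable] = borel_measurable_continuous_onI[OF cH]
  show "tempered_function G" by (rule integrable_imp_tempered_function[OF G])
  have "cmod (H x) \<le> (LINT u|lborel. cmod (fourier G u)) / (2 * pi)" for x
    unfolding H_def using fourier_of_integrable_bound[of "fourier G" "- x"]
    by (simp add: norm_divide norm_mult divide_right_mono)
  then have "tempered_function H"
    by (intro bounded_imp_tempered_function) auto
  then show "tempered_function (\<lambda>x. fourier (fourier G) (- x) / (2 * of_real pi))"
    by (simp add: H_def[abs_def])
  fix \<phi> assume \<phi>: "\<phi> \<in> test_functions"
  define \<psi> where "\<psi> x = \<phi> (- x)" for x
  have \<psi>: "\<psi> \<in> test_functions"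
  proof -
    obtain R where R: "\<And>x. \<bar>x\<bar> > R \<Longrightarrow> \<phi> x = 0" using test_function_bounded_support[OF \<phi>] by metis
    show ?thesis
      by (rule test_functionI[of _ "-R" R])
         (use smooth_affine[OF test_function_smooth[OF \<phi>], of "-1" 0] R in \<open>auto simp: \<psi>_def[abs_def] abs_le_iff not_le\<close>)
  qed
  have "(LINT x|lborel. fourier (fourier G) (- x) * \<phi> x) = (LINT x|lborel. \<psi> x * fourier (fourier G) x)"
    by (subst integral_lborel_uminus[symmetric]) (simp add: \<psi>_def mult.commute)
  also have "\<dots> = (LINT u|lborel. fourier \<psi> u * fourier G u)"
    using fourier_duality[OF sigma_finite_lborel _ test_function_integrable[OF \<psi>] F] by (simp add: fourier_def[of \<psi>])
  also have "\<dots> = (LINT x|lborel. G x * fourier (fourier \<psi>) x)"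
    using fourier_duality[OF sigma_finite_lborel _ G fourier_test_function_integrable[OF \<psi>]]
    by (simp add: fourier_def[of G] mult.commute)
  also have "\<dots> = (LINT x|lborel. 2 * of_real pi * (G x * \<phi> x))"
    using fourier_fourier_test_function[OF \<psi>, of "- x" for x] by (simp add: \<psi>_def mult_ac)
  also have "\<dots> = 2 * of_real pi * (LINT x|lborel. G x * \<phi> x)" by simp
  finally have eq: "(LINT x|lborel. fourier (fourier G) (- x) * \<phi> x) = 2 * of_real pi * (LINT x|lborel. G x * \<phi> x)" .
  show "function_distribution G \<phi> = function_distribution (\<lambda>x. fourier (fourier G) (- x) / (2 * of_real pi)) \<phi>"
    unfolding function_distribution_def using eq
    by (simp add: times_divide_eq_left)
qed

text \<open>To identify the Fourier transform of a distribution, test functions suffice.\<close>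
lemma fourier_function_AE_unique:
  assumes g: "has_fourier_function T g" and h: "tempered_function h"
    and eq: "\<And>\<phi>. \<phi> \<in> test_functions \<Longrightarrow> T (fourier \<phi>) = function_distribution h \<phi>"
  shows "AE u in lborel. g u = h u"
  by (rule AE_eq_of_test_function_integrals)
     (use assms test_function_schwartz in \<open>auto simp: has_fourier_function_def\<close>)

lemma fourier_function_works:
  assumes "has_fourier_function T g"
  shows "has_fourier_function T (fourier_function T)"
  unfolding fourier_function_def using someI_ex[of "has_fourier_function T"] assms by blast

lemma fourier_function_AE_eq:
  assumes "has_fourier_function T g"
  shows "AE u in lborel. fourier_function T u = g u"
  by (rule fourier_function_AE_unique[OF fourier_function_works[OF assms]])
     (use assms test_function_schwartz in \<open>auto simp: has_fourier_function_def\<close>)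

text \<open>Every test function is the transform of the Schwartz function obtained by inversion, so the
  value of \<open>T\<close> on it can be read off from the Fourier transform of \<open>T\<close>.\<close>
lemma distribution_of_test_function_via_fourier:
  assumes g: "has_fourier_function T g" and \<phi>: "\<phi> \<in> test_functions"
  shows "T \<phi> = 1 / (2 * of_real pi) * (LINT u|lborel. g (- u) * fourier \<phi> u)"
proof -
  define \<psi> where "\<psi> u = 1 / (2 * of_real pi) * fourier \<phi> (- 1 * u)" for u
  have \<psi>: "\<psi> \<in> schwartz" unfolding \<psi>_def by (rule fourier_test_function_schwartz[OF \<phi>]) simp
  have "fourier \<psi> y = \<phi> y" for y
  proof -
    have "fourier \<psi> y = 1 / (2 * of_real pi) * fourier (\<lambda>u. fourier \<phi> (- u)) y"
      unfolding \<psi>_def by (subst fourier_cmult) simp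
    also have "\<dots> = \<phi> y"
      by (subst fourier_uminus) (simp add: fourier_fourier_test_function[OF \<phi>])
    finally show ?thesis .
  qed
  then have "T \<phi> = function_distribution g \<psi>"
    using g \<psi> by (metis ext has_fourier_function_def)
  also have "\<dots> = (LINT u|lborel. 1 / (2 * of_real pi) * (g (- u) * fourier \<phi> u))"
    unfolding function_distribution_def by (subst integral_lborel_uminus[symmetric]) (simp add: \<psi>_def)
  also have "\<dots> = 1 / (2 * of_real pi) * (LINT u|lborel. g (- u) * fourier \<phi> u)"
    by (rule integral_mult_right_zero)
  finally show ?thesis .
qed

section \<open>Signed measures with a density\<close>

text \<open>The supremum that defines the upper variation is attained on the part of the set where the density
  is positive (Hahn decomposition).\<close>
lemma upper_variation_density:
  assumes \<nu>: "sets \<nu> = sets borel" and q: "integrable \<nu> q"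
    and m: "\<And>A. A \<in> sets borel \<Longrightarrow> m A = (LINT x:A|\<nu>. q x)"
  shows "upper_variation m = density \<nu> (\<lambda>x. ennreal (q x))"
proof -
  note [measurable_cong] = \<nu>
  note [measurable] = borel_measurable_integrable[OF q]
  define N where "N = density \<nu> (\<lambda>x. ennreal (q x))"
  have space: "space \<nu> = UNIV" using sets_eq_imp_space_eq[OF \<nu>] by simp
  have N_sets: "sets N = sets borel" "space N = UNIV" by (simp_all add: N_def \<nu> space)
  have N: "emeasure N A = (\<integral>\<^sup>+x. ennreal (indicator A x * q x) \<partial>\<nu>)" if "A \<in> sets borel" for A
    unfolding N_def using that
    by (subst emeasure_density) (auto simp: \<nu> indicator_def intro!: nn_integral_cong)
  have int: "integrable \<nu> (\<lambda>x. indicator A x * q x)" if "A \<in> sets borel" for A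
    using integrable_mult_indicator[OF _ q, of A] that by (simp add: \<nu>)
  have mA: "m A = (\<integral>x. indicator A x * q x \<partial>\<nu>)" if "A \<in> sets borel" for A
    using m[OF that] by (simp add: set_lebesgue_integral_def)
  have le: "ennreal (m B) \<le> emeasure N A" if "A \<in> sets borel" "B \<in> sets borel" "B \<subseteq> A" for A B
  proof -
    have "m B \<le> (\<integral>x. max 0 (indicator A x * q x) \<partial>\<nu>)"
      unfolding mA[OF that(2)]
      by (rule integral_mono) (use int that in \<open>auto simp: indicator_def\<close>)
    then have "ennreal (m B) \<le> ennreal (\<integral>x. max 0 (indicator A x * q x) \<partial>\<nu>)"
      by (rule ennreal_leI)
    also have "\<dots> = (\<integral>\<^sup>+x. ennreal (max 0 (indicator A x * q x)) \<partial>\<nu>)"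
      by (rule nn_integral_eq_integral[symmetric]) (use int that in auto)
    also have "\<dots> = emeasure N A"
      unfolding N[OF that(1)] by (intro nn_integral_cong) (simp add: max_def ennreal_neg)
    finally show ?thesis .
  qed
  have eq: "(SUP B\<in>{B\<in>sets borel. B \<subseteq> A}. ennreal (m B)) = emeasure N A" if A: "A \<in> sets borel" for A
  proof (rule antisym)
    show "(SUP B\<in>{B\<in>sets borel. B \<subseteq> A}. ennreal (m B)) \<le> emeasure N A"
      using le[OF A] by (intro SUP_least) auto
    define B where "B = A \<inter> {x. q x > 0}"
    have "{x \<in> space \<nu>. q x > 0} \<in> sets \<nu>" by measurable
    then have B: "B \<in> sets borel" "B \<subseteq> A" using A by (auto simp: B_def \<nu> space)
    have "emeasure N A = (\<integral>\<^sup>+x. ennreal (indicator B x * q x) \<partial>\<nu>)"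
      unfolding N[OF A] by (intro nn_integral_cong) (auto simp: B_def indicator_def ennreal_neg)
    also have "\<dots> = ennreal (m B)"
      unfolding mA[OF B(1)] by (rule nn_integral_eq_integral) (use int[OF B(1)] in \<open>auto simp: B_def indicator_def\<close>)
    also have "\<dots> \<le> (SUP B\<in>{B\<in>sets borel. B \<subseteq> A}. ennreal (m B))"
      using B by (intro SUP_upper) auto
    finally show "emeasure N A \<le> (SUP B\<in>{B\<in>sets borel. B \<subseteq> A}. ennreal (m B))" .
  qed
  have "upper_variation m = measure_of UNIV (sets borel) (emeasure N)"
    unfolding upper_variation_def
    by (rule measure_of_eq) (use eq sets.sigma_sets_eq[of "borel :: real measure"] in auto)
  also have "\<dots> = N"
    using measure_of_of_measure[of N] by (simp add: N_sets)
  finally show ?thesis by (simp add: N_def)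
qed

lemma lower_variation_density:
  assumes \<nu>: "sets \<nu> = sets borel" and q: "integrable \<nu> q"
    and m: "\<And>A. A \<in> sets borel \<Longrightarrow> m A = (LINT x:A|\<nu>. q x)"
  shows "lower_variation m = density \<nu> (\<lambda>x. ennreal (- q x))"
  unfolding lower_variation_def
  by (rule upper_variation_density) (use assms in \<open>auto simp: set_lebesgue_integral_def\<close>)

lemma integrable_bounded_times:
  assumes \<nu>: "sets \<nu> = sets borel" and q: "integrable \<nu> (q :: real \<Rightarrow> real)"
    and [measurable]: "g \<in> borel_measurable borel" and B: "\<And>x. cmod (g x) \<le> B"
  shows "integrable \<nu> (\<lambda>x. of_real (q x) * g x)"
proof (rule Bochner_Integration.integrable_bound)
  note [measurable_cong] = \<nu>
  note [measurable] = borel_measurable_integrable[OF q]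
  show "integrable \<nu> (\<lambda>x. q x * B)" using q by simp
  show "(\<lambda>x. of_real (q x) * g x) \<in> borel_measurable \<nu>" by measurable
  show "AE x in \<nu>. norm (of_real (q x) * g x) \<le> norm (q x * B)"
    using order_trans[OF B abs_ge_self] by (auto simp: norm_mult abs_mult intro!: mult_left_mono)
qed

lemma signed_integral_density:
  assumes \<nu>: "sets \<nu> = sets borel" and q: "integrable \<nu> q"
    and m: "\<And>A. A \<in> sets borel \<Longrightarrow> m A = (LINT x:A|\<nu>. q x)"
    and g: "g \<in> borel_measurable borel" and B: "\<And>x. cmod (g x) \<le> B"
  shows "signed_integral m g = (LINT x|\<nu>. of_real (q x) * g x)"
proof -
  note [measurable_cong] = \<nu>
  note [measurable] = borel_measurable_integrable[OF q] g
  have d: "(LINT x|density \<nu> (\<lambda>x. ennreal (p x)). g x) = (LINT x|\<nu>. of_real (max 0 (p x)) * g x)"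
    if [measurable]: "p \<in> borel_measurable \<nu>" for p
  proof -
    have "density \<nu> (\<lambda>x. ennreal (p x)) = density \<nu> (\<lambda>x. ennreal (max 0 (p x)))"
      by (intro density_cong) (auto simp: max_def ennreal_neg)
    moreover have "(LINT x|density \<nu> (\<lambda>x. ennreal (max 0 (p x))). g x) = (LINT x|\<nu>. max 0 (p x) *\<^sub>R g x)"
      by (rule integral_density) auto
    ultimately show ?thesis by (simp only: scaleR_conv_of_real)
  qed
  have up: "upper_variation m = density \<nu> (\<lambda>x. ennreal (q x))"
    and lo: "lower_variation m = density \<nu> (\<lambda>x. ennreal (- q x))"
    by (rule upper_variation_density lower_variation_density; use assms in simp)+
  have "signed_integral m g = (LINT x|\<nu>. of_real (max 0 (q x)) * g x) - (LINT x|\<nu>. of_real (max 0 (- q x)) * g x)"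
    unfolding signed_integral_def up lo by (subst (1 2) d) auto
  also have "\<dots> = (LINT x|\<nu>. of_real (max 0 (q x)) * g x - of_real (max 0 (- q x)) * g x)"
    by (intro Bochner_Integration.integral_diff[symmetric] integrable_bounded_times[OF \<nu> _ g B])
       (use q in auto)
  also have "(\<lambda>x. complex_of_real (max 0 (q x)) * g x - of_real (max 0 (- q x)) * g x) = (\<lambda>x. of_real (q x) * g x)"
    by (auto simp: max_def)
  finally show ?thesis .
qed

text \<open>The signed measure \<open>m\<close> has the integrable density \<open>q\<close> with respect to \<open>\<nu>\<close>.  The example to
  have in mind is the total variation \<open>\<nu>\<close> of \<open>m\<close> and a sign \<open>q\<close>.\<close>
locale signed_density = sigma_finite_measure \<nu> for \<nu> :: "real measure" +
  fixes q :: "real \<Rightarrow> real" and m :: signed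
  assumes sets_\<nu>: "sets \<nu> = sets borel" and q: "integrable \<nu> q"
    and m: "A \<in> sets borel \<Longrightarrow> m A = (LINT x:A|\<nu>. q x)"
begin

declare sets_\<nu> [measurable_cong]
declare borel_measurable_integrable[OF q, measurable]

lemma upper_variation_eq: "upper_variation m = density \<nu> (\<lambda>x. ennreal (q x))"
  and lower_variation_eq: "lower_variation m = density \<nu> (\<lambda>x. ennreal (- q x))"
  by (rule upper_variation_density lower_variation_density; use sets_\<nu> q m in simp)+

definition transform :: "real \<Rightarrow> complex" where
  "transform u = (LINT x|\<nu>. iexp (u * x) * of_real (q x))"

lemma transform_continuous: "continuous_on A transform"
  unfolding transform_def[abs_def]
  by (rule continuous_signed_char) (use q sets_\<nu> in auto)

lemma transform_measurable [measurable]: "transform \<in> borel_measurable borel"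
  by (intro borel_measurable_continuous_onI transform_continuous)

lemma transform_bound: "cmod (transform u) \<le> (LINT x|\<nu>. \<bar>q x\<bar>)"
proof -
  have "cmod (transform u) \<le> (LINT x|\<nu>. cmod (iexp (u * x) * of_real (q x)))"
    unfolding transform_def by (rule integral_norm_bound)
  then show ?thesis by (simp add: norm_mult)
qed

lemma signed_integral_fourier:
  assumes "integrable lborel \<phi>"
  shows "signed_integral m (fourier \<phi>) = function_distribution transform \<phi>"
proof -
  have "signed_integral m (fourier \<phi>) = (LINT x|\<nu>. of_real (q x) * fourier \<phi> x)"
    by (rule signed_integral_density[OF sets_\<nu> q m fourier_measurable[OF assms] fourier_of_integrable_bound])
  also have "\<dots> = (LINT u|lborel. transform u * \<phi> u)"
    unfolding transform_def
    by (rule fourier_duality) (use sets_\<nu> q assms sigma_finite_measure_axioms in auto)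
  finally show ?thesis by (simp add: function_distribution_def)
qed

lemma transform_tempered: "tempered_function transform"
  by (rule bounded_imp_tempered_function[OF transform_measurable transform_bound])

lemma signed_integral_fourier_AE:
  assumes "has_fourier_function (signed_integral m) g"
  shows "AE u in lborel. g u = transform u"
  by (rule fourier_function_AE_unique[OF assms transform_tempered])
     (use signed_integral_fourier test_function_integrable in blast)

text \<open>Integrating \<open>g\<close> against the measure gives the value of this function at \<open>0\<close>, and its Fourier
  transform is a product; this converts the pairing into a pointwise Fourier inversion.\<close>
definition correlation :: "(real \<Rightarrow> complex) \<Rightarrow> real \<Rightarrow> complex" where
  "correlation g t = (LINT x|\<nu>. of_real (q x) * g (x + t))"

lemma
  assumes g: "integrable lborel g"
  shows correlation_integrable: "integrable lborel (correlation g)"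
    and correlation_times: "\<And>k B. k \<in> borel_measurable borel \<Longrightarrow> (\<And>t. cmod (k t) \<le> B) \<Longrightarrow>
      (LINT t|lborel. k t * correlation g t) = (LINT x|\<nu>. of_real (q x) * (LINT t|lborel. k t * g (x + t)))"
proof -
  interpret pair_sigma_finite \<nu> lborel by unfold_locales
  note [measurable] = borel_measurable_integrable[OF g]
  have tr: "integrable lborel (\<lambda>t. g (x + t))" "(LINT t|lborel. cmod (g (x + t))) = (LINT t|lborel. cmod (g t))" for x
    using lborel_integrable_real_affine[OF g, of 1 x] lborel_integral_real_affine[of 1 "\<lambda>t. cmod (g t)" x]
    by simp_all
  have int: "integrable (\<nu> \<Otimes>\<^sub>M lborel) (\<lambda>(x, t). of_real (q x) * (k t * g (x + t)))"
    if [measurable]: "k \<in> borel_measurable borel" and B: "\<And>t. cmod (k t) \<le> B" for k B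
  proof (rule Bochner_Integration.integrable_bound)
    show "integrable (\<nu> \<Otimes>\<^sub>M lborel) (\<lambda>(x, t). B * (\<bar>q x\<bar> * cmod (g (x + t))))"
    proof (rule Fubini_integrable)
      show "(\<lambda>(x, t). B * (\<bar>q x\<bar> * cmod (g (x + t)))) \<in> borel_measurable (\<nu> \<Otimes>\<^sub>M lborel)" by measurable
      show "AE x in \<nu>. integrable lborel (\<lambda>y. case (x, y) of (x, t) \<Rightarrow> B * (\<bar>q x\<bar> * cmod (g (x + t))))"
        using tr(1) by auto
      show "integrable \<nu> (\<lambda>x. LINT y|lborel. norm (case (x, y) of (x, t) \<Rightarrow> B * (\<bar>q x\<bar> * cmod (g (x + t)))))"
        using q by (simp add: abs_mult tr(2))
    qed
    show "(\<lambda>(x, t). of_real (q x) * (k t * g (x + t))) \<in> borel_measurable (\<nu> \<Otimes>\<^sub>M lborel)" by measurable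
    have "0 \<le> B" using B[of 0] norm_ge_zero order_trans by blast
    then show "AE x in \<nu> \<Otimes>\<^sub>M lborel. norm (case x of (x, t) \<Rightarrow> complex_of_real (q x) * (k t * g (x + t)))
        \<le> norm (case x of (x, t) \<Rightarrow> B * (\<bar>q x\<bar> * cmod (g (x + t))))"
      using B by (intro AE_I2)
        (auto simp: norm_mult abs_mult mult.left_commute[of B] intro!: mult_left_mono mult_right_mono)
  qed
  have "integrable lborel (\<lambda>t. LINT x|\<nu>. of_real (q x) * (1 * g (x + t)))"
    using integrable_snd[OF int[of "\<lambda>_. 1" 1]] by simp
  then show "integrable lborel (correlation g)"
    by (simp add: correlation_def[abs_def])
  show "(LINT t|lborel. k t * correlation g t) = (LINT x|\<nu>. of_real (q x) * (LINT t|lborel. k t * g (x + t)))"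
    if "k \<in> borel_measurable borel" "\<And>t. cmod (k t) \<le> B" for k B
  proof -
    have "(LINT t|lborel. k t * correlation g t) = (LINT t|lborel. LINT x|\<nu>. of_real (q x) * (k t * g (x + t)))"
      unfolding correlation_def by (subst integral_mult_right_zero[symmetric]) (simp add: mult_ac)
    also have "\<dots> = (LINT x|\<nu>. LINT t|lborel. of_real (q x) * (k t * g (x + t)))"
      using Fubini_integral[OF int[OF that]] by simp
    finally show ?thesis by simp
  qed
qed

lemma fourier_correlation:
  assumes g: "integrable lborel g"
  shows "fourier (correlation g) u = fourier g u * transform (- u)"
proof -
  have shift: "(LINT t|lborel. iexp (u * t) * g (x + t)) = iexp (- u * x) * fourier g u" for x
  proof -
    have "fourier g u = (LINT t|lborel. iexp (u * (x + t)) * g (x + t))"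
      unfolding fourier_def using lborel_integral_real_affine[of 1 "\<lambda>t. iexp (u * t) * g t" x] by simp
    also have "\<dots> = (LINT t|lborel. iexp (u * x) * (iexp (u * t) * g (x + t)))"
      by (simp add: distrib_left exp_add mult.assoc)
    also have "\<dots> = iexp (u * x) * (LINT t|lborel. iexp (u * t) * g (x + t))"
      by (rule integral_mult_right_zero)
    finally show ?thesis
      by (simp add: exp_minus)
  qed
  have "fourier (correlation g) u = (LINT x|\<nu>. of_real (q x) * (LINT t|lborel. iexp (u * t) * g (x + t)))"
    unfolding fourier_def by (rule correlation_times[OF g, of _ 1]) auto
  also have "\<dots> = (LINT x|\<nu>. of_real (q x) * (iexp (- u * x) * fourier g u))"
    by (simp only: shift)
  also have "\<dots> = (LINT x|\<nu>. fourier g u * (iexp (- u * x) * of_real (q x)))"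
    by (simp add: mult_ac)
  also have "\<dots> = fourier g u * transform (- u)"
    unfolding transform_def by (rule integral_mult_right_zero)
  finally show ?thesis .
qed

end

section \<open>Parseval identity for bounded integrable functions\<close>

definition local_average :: "real \<Rightarrow> (real \<Rightarrow> complex) \<Rightarrow> real \<Rightarrow> complex" where
  "local_average r g x = (LINT y:{x - r..x + r}|lborel. g y) / of_real (2 * r)"

lemma local_average_eq:
  assumes "r > 0"
  shows "local_average r g x = (LINT z:{-1..1}|lborel. g (x + r * z)) / 2"
proof -
  have "(LINT y:{x - r..x + r}|lborel. g y)
      = \<bar>r\<bar> *\<^sub>R (LINT z|lborel. indicator {x - r..x + r} (x + r * z) *\<^sub>R g (x + r * z))"
    unfolding set_lebesgue_integral_def by (rule lborel_integral_real_affine) (use assms in simp)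
  moreover have "indicator {x - r..x + r} (x + r * z) = indicat_real {-1..1} z" for z
    using assms mult_le_cancel_left_pos[OF assms, of z 1] mult_le_cancel_left_pos[OF assms, of "-1" z]
    by (auto simp: indicator_def)
  ultimately show ?thesis using assms
    by (simp add: local_average_def set_lebesgue_integral_def scaleR_conv_of_real)
qed

lemma local_average_shift:
  "local_average r g x = (LINT t|lborel. (indicator {-r..r} t / of_real (2 * r)) * g (x + t))"
proof -
  have "(LINT y:{x - r..x + r}|lborel. g y) = (LINT t|lborel. indicator {x - r..x + r} (x + t) *\<^sub>R g (x + t))"
    unfolding set_lebesgue_integral_def
    using lborel_integral_real_affine[of 1 "\<lambda>y. indicat_real {x - r..x + r} y *\<^sub>R g y" x] by simp
  also have "\<dots> = (LINT t|lborel. indicator {-r..r} t * g (x + t))"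
    by (rule Bochner_Integration.integral_cong) (auto simp: indicator_def)
  finally show ?thesis by (simp add: local_average_def)
qed

lemma local_average_bound:
  assumes "r > 0" and B: "\<And>x. cmod (g x) \<le> B"
  shows "cmod (local_average r g x) \<le> B"
proof -
  have "0 \<le> B" using B[of 0] norm_ge_zero order_trans by blast
  have "cmod (LINT z:{-1..1}|lborel. g (x + r * z)) \<le> (LINT z|lborel. B * indicator {-1..1::real} z)"
    unfolding set_lebesgue_integral_def
  proof (rule order_trans[OF integral_norm_bound integral_mono'])
    show "integrable lborel (\<lambda>z. B * indicator {-1..1::real} z)" by simp
  qed (use B \<open>0 \<le> B\<close> in \<open>auto simp: indicator_def\<close>)
  then show ?thesis using assms by (simp add: local_average_eq norm_divide)
qed

text \<open>After rescaling to a fixed interval this is dominated convergence.\<close>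
lemma local_average_tendsto:
  assumes cont: "continuous_on UNIV g" and B: "\<And>x. cmod (g x) \<le> B" and r: "r \<longlonglongrightarrow> 0" "\<And>n. r n > 0"
  shows "(\<lambda>n. local_average (r n) g x) \<longlonglongrightarrow> g x"
proof -
  have [measurable]: "g \<in> borel_measurable borel" using cont by (rule borel_measurable_continuous_onI)
  have "(\<lambda>n. LINT z:{-1..1}|lborel. g (x + r n * z)) \<longlonglongrightarrow> (LINT z:{-1..1::real}|lborel. g x)"
    unfolding set_lebesgue_integral_def
  proof (rule integral_dominated_convergence[where w="\<lambda>z. B * indicator {-1..1} z"])
    show "AE z in lborel. (\<lambda>n. indicat_real {-1..1} z *\<^sub>R g (x + r n * z)) \<longlonglongrightarrow> indicat_real {-1..1} z *\<^sub>R g x"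
    proof (rule AE_I2)
      fix z
      have "(\<lambda>n. x + r n * z) \<longlonglongrightarrow> x + 0 * z" by (intro tendsto_intros r)
      then have "(\<lambda>n. g (x + r n * z)) \<longlonglongrightarrow> g x"
        by (intro isCont_tendsto_compose[of x g]) (use cont in \<open>auto simp: continuous_on_eq_continuous_at\<close>)
      then show "(\<lambda>n. indicat_real {-1..1} z *\<^sub>R g (x + r n * z)) \<longlonglongrightarrow> indicat_real {-1..1} z *\<^sub>R g x"
        by (intro tendsto_intros)
    qed
    show "AE z in lborel. norm (indicat_real {-1..1} z *\<^sub>R g (x + r n * z)) \<le> B * indicator {-1..1} z" for n
      using B by (auto simp: indicator_def)
  qed auto
  then have "(\<lambda>n. (LINT z:{-1..1}|lborel. g (x + r n * z)) / 2) \<longlonglongrightarrow> (LINT z:{-1..1::real}|lborel. g x) / 2"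
    by (intro tendsto_intros) auto
  then show ?thesis using r(2)
    by (simp add: local_average_eq set_lebesgue_integral_def scaleR_conv_of_real)
qed

context signed_density
begin

text \<open>The correlation \<open>G\<close> of \<open>g\<close> with the measure has an integrable transform, so it agrees almost
  everywhere with a continuous function \<open>H\<close>, its inverse transform, and the claim is that \<open>\<theta> = H 0\<close>.
  The averages of \<open>G\<close> and \<open>H\<close> over small intervals around \<open>0\<close> are equal.  Those of \<open>H\<close> tend to
  \<open>H 0\<close> by continuity.  Those of \<open>G\<close> are integrals of local averages of \<open>g\<close> against the measure and tend
  to \<open>\<theta>\<close>, because the version \<open>g\<close> is the limit of its own local averages almost everywhere for both
  variations.\<close>
lemma function_pairing_eq:
  assumes p: "function_pairing f m \<theta>" and F: "has_fourier_function f F"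
    and int: "integrable lborel (\<lambda>u. F (- u) * transform u)"
  shows "\<theta> = 1 / (2 * of_real pi) * (LINT u|lborel. F (- u) * transform u)"
proof -
  from p obtain g B where g: "integrable lborel g" and B: "\<And>x. cmod (g x) \<le> B"
    and fg: "\<And>\<phi>. \<phi> \<in> schwartz \<Longrightarrow> f \<phi> = function_distribution g \<phi>"
    and avg: "\<And>v. v \<in> {upper_variation m, lower_variation m} \<Longrightarrow>
        AE x in v. ((\<lambda>r. local_average r g x) \<longlongrightarrow> g x) (at_right 0)"
    and \<theta>: "\<theta> = signed_integral m g"
    unfolding function_pairing_def local_average_def by blast
  have [measurable]: "g \<in> borel_measurable borel" using borel_measurable_integrable[OF g] by simp
  have \<theta>': "\<theta> = (LINT x|\<nu>. of_real (q x) * g x)"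
    unfolding \<theta> by (rule signed_integral_density[OF sets_\<nu> q m _ B]) auto
  have F_AE: "AE u in lborel. F u = fourier g u"
  proof (rule fourier_function_AE_unique[OF F])
    show "tempered_function (fourier g)"
      by (rule bounded_imp_tempered_function[OF fourier_measurable[OF g] fourier_of_integrable_bound])
    fix \<phi> assume \<phi>: "\<phi> \<in> test_functions"
    have "f (fourier \<phi>) = function_distribution g (fourier \<phi>)"
      using fg[OF fourier_test_function_schwartz[OF \<phi>, of 1 1]] by simp
    also have "\<dots> = (LINT u|lborel. fourier g u * \<phi> u)"
      unfolding function_distribution_def
      using fourier_duality[OF sigma_finite_lborel _ g test_function_integrable[OF \<phi>]]
      by (simp add: fourier_def[of g])
    finally show "f (fourier \<phi>) = function_distribution (fourier g) \<phi>"
      by (simp add: function_distribution_def)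
  qed
  let ?G = "correlation g"
  have G: "integrable lborel ?G" by (rule correlation_integrable[OF g])
  have FG: "AE u in lborel. F u * transform (- u) = fourier ?G u"
    using F_AE by eventually_elim (simp add: fourier_correlation[OF g])
  have [measurable]: "F \<in> borel_measurable borel"
    using F tempered_function_measurable by (auto simp: has_fourier_function_def)
  note [measurable] = fourier_measurable[OF G]
  have "integrable lborel (\<lambda>u. F u * transform (- u))"
    using integrable_lborel_uminus[OF int] by simp
  then have intFG: "integrable lborel (fourier ?G)"
    by (subst (asm) integrable_cong_AE[OF _ _ FG]) auto
  define H where "H x = fourier (fourier ?G) (- x) / (2 * of_real pi)" for x
  have H_AE: "AE x in lborel. ?G x = H x"
    unfolding H_def by (rule fourier_inversion_L1[OF G intFG])
  have cH: "continuous_on UNIV H"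
    unfolding H_def by (intro continuous_intros continuous_on_compose2[OF fourier_continuous[OF intFG, of UNIV]]) auto
  have bH: "cmod (H x) \<le> (LINT u|lborel. cmod (fourier ?G u)) / (2 * pi)" for x
    unfolding H_def using fourier_of_integrable_bound[of "fourier ?G" "- x"]
    by (simp add: norm_divide norm_mult divide_right_mono)
  note [measurable] = borel_measurable_continuous_onI[OF cH] borel_measurable_integrable[OF G]
  define r where "r n = 1 / real (Suc n)" for n
  have r: "r n > 0" for n by (simp add: r_def)
  have r_neq: "r n \<noteq> 0" for n using r[of n] by simp
  have r0: "r \<longlonglongrightarrow> 0" unfolding r_def by real_asymp
  have r1: "filterlim r (at_right 0) sequentially"
    using r0 r r_neq by (auto simp: filterlim_at intro!: always_eventually)
  have avg_eq: "local_average (r n) H 0 = (LINT x|\<nu>. of_real (q x) * local_average (r n) g x)" for n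
  proof -
    have "local_average (r n) H 0 = (LINT t|lborel. (indicator {-r n..r n} t / of_real (2 * r n)) * H t)"
      by (simp add: local_average_shift)
    also have "\<dots> = (LINT t|lborel. (indicator {-r n..r n} t / of_real (2 * r n)) * ?G t)"
    proof (rule integral_cong_AE)
      show "AE t in lborel. indicator {-r n..r n} t / of_real (2 * r n) * H t
          = indicator {-r n..r n} t / of_real (2 * r n) * ?G t"
        using H_AE by eventually_elim simp
    qed auto
    also have "\<dots> = (LINT x|\<nu>. of_real (q x) * (LINT t|lborel. (indicator {-r n..r n} t / of_real (2 * r n)) * g (x + t)))"
      by (rule correlation_times[OF g, of _ "1 / (2 * r n)"]) (use r[of n] in \<open>auto simp: norm_divide indicator_def\<close>)
    finally show ?thesis by (simp add: local_average_shift)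
  qed
  \<comment> \<open>Where \<open>q\<close> vanishes, the local averages of \<open>g\<close> need not converge, but there the integrand is zero.\<close>
  have up: "AE x in \<nu>. 0 < q x \<longrightarrow> ((\<lambda>r. local_average r g x) \<longlongrightarrow> g x) (at_right 0)"
    using avg[of "upper_variation m", simplified] unfolding upper_variation_eq
    by (subst (asm) AE_density) auto
  have lo: "AE x in \<nu>. q x < 0 \<longrightarrow> ((\<lambda>r. local_average r g x) \<longlongrightarrow> g x) (at_right 0)"
    using avg[of "lower_variation m", simplified] unfolding lower_variation_eq
    by (subst (asm) AE_density) auto
  have "(\<lambda>n. LINT x|\<nu>. of_real (q x) * local_average (r n) g x) \<longlonglongrightarrow> (LINT x|\<nu>. of_real (q x) * g x)"
  proof (rule integral_dominated_convergence[where w="\<lambda>x. \<bar>q x\<bar> * B"])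
    show "AE x in \<nu>. (\<lambda>n. of_real (q x) * local_average (r n) g x) \<longlonglongrightarrow> of_real (q x) * g x"
      using up lo
    proof eventually_elim
      case (elim x)
      show ?case
      proof (cases "q x = 0")
        case False
        then have "((\<lambda>r. local_average r g x) \<longlongrightarrow> g x) (at_right 0)" using elim by linarith
        from filterlim_compose[OF this r1] show ?thesis by (intro tendsto_intros)
      qed simp
    qed
    show "AE x in \<nu>. norm (of_real (q x) * local_average (r n) g x) \<le> \<bar>q x\<bar> * B" for n
      using local_average_bound[OF r B] by (auto simp: norm_mult intro!: mult_left_mono)
    show "(\<lambda>x. of_real (q x) * local_average (r n) g x) \<in> borel_measurable \<nu>" for n
      unfolding local_average_shift by measurable
  qed (use q in auto)
  then have "(\<lambda>n. local_average (r n) H 0) \<longlonglongrightarrow> \<theta>"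
    by (simp add: avg_eq \<theta>')
  with local_average_tendsto[OF cH bH r0 r] have "\<theta> = H 0"
    using LIMSEQ_unique by blast
  also have "H 0 = 1 / (2 * of_real pi) * (LINT u|lborel. fourier ?G u)"
    by (simp add: H_def fourier_def[of "fourier ?G"])
  also have "(LINT u|lborel. fourier ?G u) = (LINT u|lborel. F u * transform (- u))"
    by (rule integral_cong_AE) (use FG in auto)
  also have "\<dots> = (LINT u|lborel. F (- u) * transform u)"
    by (subst integral_lborel_uminus[symmetric]) simp
  finally show ?thesis .
qed

end

section \<open>Parseval identity for compactly supported distributions\<close>

lemma Ck_on_has_vderiv:
  assumes "Ck_on k I p" "j < k" "x \<in> I"
  shows "(vderiv j p has_vector_derivative vderiv (Suc j) p x) (at x)"
  using assms by (auto simp: Ck_on_def vderiv_Suc vector_derivative_works)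

lemma Ck_on_continuous:
  assumes "Ck_on k I p" "j \<le> k" shows "continuous_on I (vderiv j p)"
proof (cases "j = k")
  case False
  then show ?thesis
    using assms by (intro continuous_at_imp_continuous_on ballI has_vector_derivative_continuous[OF Ck_on_has_vderiv[OF assms(1)]]) auto
qed (use assms in \<open>simp add: Ck_on_def\<close>)

lemma vderiv_of_real:
  assumes "Ck_on k I p" "open I" "j \<le> k" "x \<in> I"
  shows "vderiv j (\<lambda>x. complex_of_real (p x)) x = complex_of_real (vderiv j p x)"
  by (rule vderiv_eq_on_open[where U=I and k=k])
     (use assms Ck_on_has_vderiv[OF assms(1)] in \<open>auto intro: bounded_linear.has_vector_derivative[OF bounded_linear_of_real]\<close>)

text \<open>The boundary terms vanish because \<open>w\<close> vanishes to all orders at distance \<open>d\<close>.\<close>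
lemma integral_by_parts_reflected:
  assumes p: "Ck_on k I p" and I: "{x - d..x + d} \<subseteq> I" and d: "d > 0" and w: "smooth w"
    and w0: "\<And>z. \<bar>z\<bar> \<ge> d \<Longrightarrow> vderiv l w z = 0" and i: "i < k"
  shows "(LINT y:{x - d..x + d}|lborel. of_real (vderiv i p y) * vderiv (Suc l) w (x - y))
       = (LINT y:{x - d..x + d}|lborel. of_real (vderiv (Suc i) p y) * vderiv l w (x - y))"
proof -
  let ?J = "{x - d..x + d}"
  have cont: "continuous_on ?J (\<lambda>y. complex_of_real (vderiv j p y) * vderiv l' w (x - y))" if "j \<le> k" for j l'
  proof (rule continuous_on_mult)
    show "continuous_on ?J (\<lambda>y. complex_of_real (vderiv j p y))"
      by (rule continuous_on_of_real[OF continuous_on_subset[OF Ck_on_continuous[OF p that] I]])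
    show "continuous_on ?J (\<lambda>y. vderiv l' w (x - y))"
      by (rule continuous_on_compose2[OF smooth_continuous[OF w, of UNIV l']]) (auto intro!: continuous_intros)
  qed
  have int: "set_integrable lborel ?J (\<lambda>y. complex_of_real (vderiv j p y) * vderiv l' w (x - y))" if "j \<le> k" for j l'
    by (rule borel_integrable_atLeastAtMost') (rule cont[OF that])
  have "(LINT y|lborel. indicator ?J y *\<^sub>R (of_real (vderiv (Suc i) p y) * vderiv l w (x - y)
        - of_real (vderiv i p y) * vderiv (Suc l) w (x - y)))
    = of_real (vderiv i p (x + d)) * vderiv l w (x - (x + d)) - of_real (vderiv i p (x - d)) * vderiv l w (x - (x - d))"
  proof (rule integral_FTC_Icc)
    fix y assume "x - d \<le> y" "y \<le> x + d"
    then have y: "y \<in> I" using I by auto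
    have 1: "((\<lambda>y. complex_of_real (vderiv i p y)) has_vector_derivative of_real (vderiv (Suc i) p y)) (at y)"
      by (intro bounded_linear.has_vector_derivative[OF bounded_linear_of_real] Ck_on_has_vderiv[OF p i y])
    have 2: "((\<lambda>y. vderiv l w (x - y)) has_vector_derivative - vderiv (Suc l) w (x - y)) (at y)"
    proof -
      have "((\<lambda>y. x - y) has_vector_derivative - 1) (at y)"
        by (auto intro!: derivative_eq_intros simp: has_real_derivative_iff_has_vector_derivative[symmetric])
      from vector_diff_chain_at[OF this derivativesD[OF smooth_derivatives[OF w], of l "x - y"]]
      show ?thesis by (simp add: o_def)
    qed
    from has_vector_derivative_at_within[OF has_vector_derivative_mult[OF 1 2], of ?J]
    show "((\<lambda>y. of_real (vderiv i p y) * vderiv l w (x - y)) has_vector_derivative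
       of_real (vderiv (Suc i) p y) * vderiv l w (x - y) - of_real (vderiv i p y) * vderiv (Suc l) w (x - y))
       (at y within ?J)"
      by (simp add: algebra_simps)
  next
    show "continuous_on ?J (\<lambda>y. of_real (vderiv (Suc i) p y) * vderiv l w (x - y)
        - of_real (vderiv i p y) * vderiv (Suc l) w (x - y))"
      using i by (intro continuous_on_diff cont) auto
  qed (use d in auto)
  also have "\<dots> = 0" using w0[of d] w0[of "-d"] d by simp
  finally have zero: "(LINT y:?J|lborel. of_real (vderiv (Suc i) p y) * vderiv l w (x - y)
      - of_real (vderiv i p y) * vderiv (Suc l) w (x - y)) = 0"
    unfolding set_lebesgue_integral_def .
  have "(LINT y:?J|lborel. of_real (vderiv (Suc i) p y) * vderiv l w (x - y)
      - of_real (vderiv i p y) * vderiv (Suc l) w (x - y))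
    = (LINT y:?J|lborel. of_real (vderiv (Suc i) p y) * vderiv l w (x - y))
      - (LINT y:?J|lborel. of_real (vderiv i p y) * vderiv (Suc l) w (x - y))"
    by (rule set_integral_diff(2)[OF int int]) (use i in auto)
  with zero show ?thesis by simp
qed

lemma tempered_function_times_bounded_ex:
  assumes "tempered_function g"
  shows "\<exists>N. \<forall>\<phi> B. \<phi> \<in> borel_measurable borel \<longrightarrow>
    (\<forall>x. cmod (\<phi> x) * (1 + x\<^sup>2) ^ N \<le> B) \<longrightarrow> integrable lborel (\<lambda>x. g x * \<phi> x)"
  by (rule tempered_function_times_bounded[OF assms]) blast
lemma outside_interval_abs: fixes x y d :: real assumes "y \<notin> {x-d..x+d}" shows "d \<le> \<bar>x - y\<bar>"
  using assms unfolding atLeastAtMost_iff de_Morgan_conj not_le by linarith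

lemma tempered_function_uminus:
  assumes "tempered_function g" shows "tempered_function (\<lambda>u. g (- u))"
proof -
  obtain N where N: "integrable lborel (\<lambda>x. g x / of_real ((1 + x\<^sup>2) ^ N))"
    and [measurable]: "g \<in> borel_measurable borel"
    using assms by (auto simp: tempered_function_def)
  have "integrable lborel (\<lambda>x. g (- x) / of_real ((1 + x\<^sup>2) ^ N))"
    using integrable_lborel_uminus[OF N] by simp
  moreover have "(\<lambda>u. g (- u)) \<in> borel_measurable borel" by measurable
  ultimately show ?thesis unfolding tempered_function_def by blast
qed

text \<open>The power \<open>(1 + u\<^sup>2) ^ N\<close> is at most \<open>2 ^ N * (1 + u ^ (2 * N))\<close>, and the second summand is absorbed by
  \<open>2 * N\<close> derivatives.\<close>
lemma fourier_decay:
  assumes \<phi>: "\<phi> \<in> test_functions"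
  shows "cmod (fourier \<phi> u) * (1 + u\<^sup>2) ^ N
    \<le> 2 ^ N * ((LINT x|lborel. cmod (\<phi> x)) + (LINT x|lborel. cmod (vderiv (2 * N) \<phi> x)))"
proof -
  have "(1 + u\<^sup>2) ^ N \<le> (2 * max 1 (u\<^sup>2)) ^ N" by (intro power_mono) auto
  also have "\<dots> = 2 ^ N * (max 1 (u\<^sup>2)) ^ N" by (rule power_mult_distrib)
  also have "(max 1 (u\<^sup>2)) ^ N \<le> 1 + u ^ (2 * N)"
    by (cases "u\<^sup>2 \<le> 1") (auto simp: max_def power_mult)
  finally have "(1 + u\<^sup>2) ^ N \<le> 2 ^ N * (1 + u ^ (2 * N))" by simp
  then have "cmod (fourier \<phi> u) * (1 + u\<^sup>2) ^ N \<le> cmod (fourier \<phi> u) * (2 ^ N * (1 + u ^ (2 * N)))"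
    by (rule mult_left_mono) simp
  also have "\<dots> = 2 ^ N * (cmod (fourier \<phi> u) + u ^ (2 * N) * cmod (fourier \<phi> u))"
    by (simp add: algebra_simps)
  also have "u ^ (2 * N) * cmod (fourier \<phi> u) = cmod (fourier (vderiv (2 * N) \<phi>) u)"
    by (simp add: fourier_vderiv[OF \<phi>] norm_mult norm_power power_even_abs)
  also have "2 ^ N * (cmod (fourier \<phi> u) + cmod (fourier (vderiv (2 * N) \<phi>) u))
     \<le> 2 ^ N * ((LINT x|lborel. cmod (\<phi> x)) + (LINT x|lborel. cmod (vderiv (2 * N) \<phi> x)))"
    by (intro mult_left_mono add_mono fourier_of_integrable_bound) auto
  finally show ?thesis .
qed

text \<open>The function \<open>g\<close> is smooth but may decay too slowly to be a Schwartz function, so that \<open>T\<close> can only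
  be applied after a cutoff.  The first \<open>2 * N\<close> derivatives of the cut off functions are bounded in
  \<open>L\<^sup>1\<close> uniformly in the cutoff.  Hence their transforms are dominated by a multiple of
  \<open>1 / (1 + u\<^sup>2) ^ N\<close>, where \<open>N\<close> is chosen according to the growth of \<open>F\<close>.\<close>
lemma distribution_of_cutoff_tendsto:
  assumes \<kappa>: "\<kappa> \<in> test_functions" "\<kappa> 0 = 1"
    and g: "smooth g" "\<And>j. integrable lborel (vderiv j g)"
    and F: "has_fourier_function T F"
  shows "(\<lambda>n. T (\<lambda>x. \<kappa> (x / real (Suc n)) * g x)) \<longlonglongrightarrow> 1 / (2 * of_real pi) * (LINT u|lborel. F (- u) * fourier g u)"
proof -
  define c where "c n = 1 / real (Suc n)" for n
  have c: "0 < c n" "c n \<le> 1" for n by (auto simp: c_def)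
  have c0: "c \<longlonglongrightarrow> 0" unfolding c_def by real_asymp
  define \<kappa>n where "\<kappa>n n x = \<kappa> (c n * x + 0)" for n x
  define \<phi> where "\<phi> n x = \<kappa>n n x * g x" for n x
  have sm: "smooth (\<kappa>n n)" for n
    unfolding \<kappa>n_def by (rule smooth_affine[OF test_function_smooth[OF \<kappa>(1)]])
  obtain R where R: "R > 0" "\<And>x. \<bar>x\<bar> > R \<Longrightarrow> \<kappa> x = 0" using test_function_bounded_support[OF \<kappa>(1)] by metis
  have \<phi>_test: "\<phi> n \<in> test_functions" for n
  proof (rule test_functionI[of _ "- (R / c n)" "R / c n"])
    show "smooth (\<phi> n)" unfolding \<phi>_def[abs_def] by (intro smooth_mult sm g)
    fix x assume "x \<notin> {- (R / c n)..R / c n}"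
    then have "\<not> \<bar>x\<bar> \<le> R / c n" unfolding atLeastAtMost_iff abs_le_iff by linarith
    then have "R < \<bar>x\<bar> * c n" using c(1)[of n] by (simp only: not_le pos_divide_less_eq)
    then have "\<bar>c n * x\<bar> > R" using c(1)[of n] by (simp only: abs_mult abs_of_pos mult.commute)
    then show "\<phi> n x = 0" using R(2) by (simp add: \<phi>_def \<kappa>n_def)
  qed
  define B where "B j = (SUP x. cmod (vderiv j \<kappa> x))" for j
  have B: "cmod (vderiv j \<kappa> x) \<le> B j" for j x
  proof -
    obtain b where "\<And>x. cmod (vderiv j \<kappa> x) \<le> b"
      using test_function_bounded[OF test_function_vderiv[OF \<kappa>(1)]] by metis
    then show ?thesis unfolding B_def by (intro cSUP_upper bdd_aboveI2[where M=b]) auto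
  qed
  have B0: "0 \<le> B j" for j using B[of j 0] norm_ge_zero order_trans by blast
  have \<kappa>n_bound: "cmod (vderiv j (\<kappa>n n) x) \<le> B j" for j n x
  proof -
    have "cmod (vderiv j (\<kappa>n n) x) = c n ^ j * cmod (vderiv j \<kappa> (c n * x + 0))"
      unfolding \<kappa>n_def using c[of n] by (subst vderiv_affine[OF test_function_smooth[OF \<kappa>(1)]]) simp
    also have "\<dots> \<le> 1 * B j" using c[of n] B0[of j] by (intro mult_mono B power_le_one) auto
    finally show ?thesis by simp
  qed
  have g0: "integrable lborel g" using g(2)[of 0] by simp
  have [measurable]: "g \<in> borel_measurable borel" using borel_measurable_integrable[OF g0] by simp
  define D where "D j = (\<Sum>i\<le>j. real (j choose i) * (B i * (LINT x|lborel. cmod (vderiv (j - i) g x))))" for j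
  have D: "(LINT x|lborel. cmod (vderiv j (\<phi> n) x)) \<le> D j" for j n
  proof -
    have i: "integrable lborel (\<lambda>x. real (j choose i) * (B i * cmod (vderiv (j - i) g x)))" for i
      by (intro integrable_mult_right integrable_norm g)
    have le: "cmod (vderiv j (\<phi> n) x) \<le> (\<Sum>i\<le>j. real (j choose i) * (B i * cmod (vderiv (j - i) g x)))" for x
      unfolding \<phi>_def[abs_def] vderiv_mult[OF sm g(1)]
      by (rule order_trans[OF norm_sum sum_mono]) (auto simp: norm_mult intro!: mult_left_mono mult_right_mono \<kappa>n_bound)
    have "(LINT x|lborel. cmod (vderiv j (\<phi> n) x))
      \<le> (LINT x|lborel. (\<Sum>i\<le>j. real (j choose i) * (B i * cmod (vderiv (j - i) g x))))"
      by (rule integral_mono)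
         (use le i integrable_norm[OF test_function_integrable[OF test_function_vderiv[OF \<phi>_test]]] in auto)
    also have "\<dots> = (\<Sum>i\<le>j. LINT x|lborel. real (j choose i) * (B i * cmod (vderiv (j - i) g x)))"
      by (rule Bochner_Integration.integral_sum) (rule i)
    also have "\<dots> = D j" by (simp add: D_def)
    finally show ?thesis .
  qed
  define F' where "F' u = F (- u)" for u
  have tF: "tempered_function F'"
    unfolding F'_def by (rule tempered_function_uminus) (use F in \<open>simp add: has_fourier_function_def\<close>)
  note [measurable] = tempered_function_measurable[OF tF]
  obtain N where N: "\<forall>\<phi> B. \<phi> \<in> borel_measurable borel \<longrightarrow>
    (\<forall>x. cmod (\<phi> x) * (1 + x\<^sup>2) ^ N \<le> B) \<longrightarrow> integrable lborel (\<lambda>x. F' x * \<phi> x)"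
    using tempered_function_times_bounded_ex[OF tF] by (elim exE)
  define W where "W = 2 ^ N * (D 0 + D (2 * N))"
  have W: "cmod (fourier (\<phi> n) u) * (1 + u\<^sup>2) ^ N \<le> W" for n u
  proof -
    have "cmod (fourier (\<phi> n) u) * (1 + u\<^sup>2) ^ N
      \<le> 2 ^ N * ((LINT x|lborel. cmod (\<phi> n x)) + (LINT x|lborel. cmod (vderiv (2 * N) (\<phi> n) x)))"
      by (rule fourier_decay[OF \<phi>_test])
    also have "\<dots> \<le> W"
      unfolding W_def using D[of 0 n] D[of "2 * N" n] by (intro mult_left_mono add_mono) auto
    finally show ?thesis .
  qed
  have pos: "(1 + u\<^sup>2) ^ N > 0" for u :: real by (simp add: add_pos_nonneg)
  have "0 \<le> W" using W[of 0 0] pos[of 0] by (auto intro: order_trans[rotated])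
  define w where "w u = complex_of_real (W / (1 + u\<^sup>2) ^ N)" for u :: real
  have w: "cmod (w u) = W / (1 + u\<^sup>2) ^ N" for u
    unfolding w_def using \<open>0 \<le> W\<close> pos[of u] by (simp only: norm_of_real) simp
  have le: "cmod (fourier (\<phi> n) u) \<le> cmod (w u)" for n u
    unfolding w using W[of n u] pos[of u] by (simp add: pos_le_divide_eq)
  have intw: "integrable lborel (\<lambda>u. F' u * w u)"
    by (rule N[rule_format, of _ W]) (use pos[THEN less_imp_neq] in \<open>auto simp: w\<close>, simp add: w_def[abs_def])
  note [measurable] = fourier_measurable[OF test_function_integrable[OF \<phi>_test]]
    test_function_measurable[OF \<phi>_test] fourier_measurable[OF g0]
  have lim: "(\<lambda>n. fourier (\<phi> n) u) \<longlonglongrightarrow> fourier g u" for u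
    unfolding fourier_def
  proof (rule integral_dominated_convergence[where w="\<lambda>x. B 0 * cmod (g x)"])
    show "AE x in lborel. (\<lambda>n. iexp (u * x) * \<phi> n x) \<longlonglongrightarrow> iexp (u * x) * g x"
    proof (rule AE_I2)
      fix x
      have "(\<lambda>n. c n * x + 0) \<longlonglongrightarrow> 0 * x + 0" by (intro tendsto_intros c0)
      then have "(\<lambda>n. \<kappa> (c n * x + 0)) \<longlonglongrightarrow> \<kappa> 0"
        using smooth_continuous[OF test_function_smooth[OF \<kappa>(1)], of UNIV 0]
        by (intro isCont_tendsto_compose[of 0 \<kappa>]) (auto simp: continuous_on_eq_continuous_at)
      then have "(\<lambda>n. iexp (u * x) * (\<kappa> (c n * x + 0) * g x)) \<longlonglongrightarrow> iexp (u * x) * (\<kappa> 0 * g x)"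
        by (intro tendsto_intros)
      then show "(\<lambda>n. iexp (u * x) * \<phi> n x) \<longlonglongrightarrow> iexp (u * x) * g x"
        by (simp add: \<phi>_def \<kappa>n_def \<kappa>(2))
    qed
    show "AE x in lborel. norm (iexp (u * x) * \<phi> n x) \<le> B 0 * cmod (g x)" for n
      using \<kappa>n_bound[of 0 n] by (intro AE_I2) (auto simp: norm_mult \<phi>_def intro!: mult_right_mono)
    show "(\<lambda>x. iexp (u * x) * \<phi> n x) \<in> borel_measurable lborel" for n
      by measurable
  qed (use g0 in auto)
  have "(\<lambda>n. LINT u|lborel. F' u * fourier (\<phi> n) u) \<longlonglongrightarrow> (LINT u|lborel. F' u * fourier g u)"
  proof (rule integral_dominated_convergence[where w="\<lambda>u. cmod (F' u * w u)"])
    show "AE u in lborel. (\<lambda>n. F' u * fourier (\<phi> n) u) \<longlonglongrightarrow> F' u * fourier g u"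
      by (intro AE_I2 tendsto_intros lim)
    show "AE u in lborel. norm (F' u * fourier (\<phi> n) u) \<le> cmod (F' u * w u)" for n
      unfolding norm_mult by (intro AE_I2 mult_left_mono le) simp
    show "(\<lambda>u. F' u * fourier (\<phi> n) u) \<in> borel_measurable lborel" for n
      by measurable
    show "(\<lambda>u. F' u * fourier g u) \<in> borel_measurable lborel"
      by measurable
    show "integrable lborel (\<lambda>u. cmod (F' u * w u))" by (rule integrable_norm[OF intw])
  qed
  then have "(\<lambda>n. 1 / (2 * of_real pi) * (LINT u|lborel. F' u * fourier (\<phi> n) u))
      \<longlonglongrightarrow> 1 / (2 * of_real pi) * (LINT u|lborel. F' u * fourier g u)"
    by (intro tendsto_intros)
  moreover have "T (\<lambda>x. \<kappa> (x / real (Suc n)) * g x) = 1 / (2 * of_real pi) * (LINT u|lborel. F' u * fourier (\<phi> n) u)" for n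
  proof -
    have "(\<lambda>x. \<kappa> (x / real (Suc n)) * g x) = \<phi> n"
      by (simp add: \<phi>_def \<kappa>n_def c_def fun_eq_iff)
    then show ?thesis using distribution_of_test_function_via_fourier[OF F \<phi>_test[of n]] by (simp add: F'_def)
  qed
  ultimately show ?thesis by (simp add: F'_def)
qed

context signed_density
begin

definition convolution :: "(real \<Rightarrow> complex) \<Rightarrow> real \<Rightarrow> complex" where
  "convolution w x = (LINT y|\<nu>. of_real (q y) * w (x - y))"

lemma convolution_derivatives:
  assumes w: "w \<in> test_functions"
  shows "derivatives (\<lambda>j. convolution (vderiv j w))"
  unfolding derivatives_def convolution_def[abs_def]
proof safe
  fix j x
  obtain B where B: "\<And>x. cmod (vderiv (Suc j) w x) \<le> B"
    using test_function_bounded[OF test_function_vderiv[OF w]] by metis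
  obtain B' where B': "\<And>x. cmod (vderiv j w x) \<le> B'"
    using test_function_bounded[OF test_function_vderiv[OF w]] by metis
  note [measurable] = smooth_measurable[OF test_function_smooth[OF w]]
  show "((\<lambda>x. LINT y|\<nu>. of_real (q y) * vderiv j w (x - y)) has_vector_derivative
      (LINT y|\<nu>. of_real (q y) * vderiv (Suc j) w (x - y))) (at x)"
  proof (rule has_vector_derivative_integral[where w="\<lambda>y. \<bar>q y\<bar> * B"])
    show "((\<lambda>x. of_real (q y) * vderiv j w (x - y)) has_vector_derivative of_real (q y) * vderiv (Suc j) w (x - y)) (at x)" for x y
    proof (rule has_vector_derivative_mult_right)
      show "((\<lambda>x. vderiv j w (x - y)) has_vector_derivative vderiv (Suc j) w (x - y)) (at x)"
        using derivativesD[OF derivatives_affine[OF smooth_derivatives[OF test_function_smooth[OF w]], of 1 "-y"], of j x]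
        by simp
    qed
    show "integrable \<nu> (\<lambda>y. of_real (q y) * vderiv j w (x - y))" for x
      by (rule integrable_bounded_times[OF sets_\<nu> q _ B']) measurable
  qed (use q B in \<open>auto simp: norm_mult intro!: mult_left_mono\<close>)
qed

lemma convolution_smooth: "w \<in> test_functions \<Longrightarrow> smooth (convolution w)"
  using smoothI[OF convolution_derivatives] by simp

lemma vderiv_convolution: "w \<in> test_functions \<Longrightarrow> vderiv j (convolution w) = convolution (vderiv j w)"
  using derivatives_vderiv[OF convolution_derivatives] by simp

lemma convolution_eq_correlation: "convolution w x = correlation (\<lambda>t. w (- t)) (- x)"
  by (simp add: convolution_def correlation_def)

lemma convolution_integrable:
  "integrable lborel w \<Longrightarrow> integrable lborel (convolution w)"
  unfolding convolution_eq_correlation[abs_def]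
  by (intro integrable_lborel_uminus correlation_integrable)

lemma fourier_convolution:
  "integrable lborel w \<Longrightarrow> fourier (convolution w) u = fourier w u * transform u"
  unfolding convolution_eq_correlation[abs_def]
  by (simp add: fourier_uminus fourier_correlation integrable_lborel_uminus)

text \<open>The restriction of the measure to \<open>I\<close> has two densities, and both compute integrals.\<close>
lemma integral_eq_density_integral:
  assumes p: "has_density_on m I p" and I: "open I"
    and [measurable]: "g \<in> borel_measurable borel" and B: "\<And>x. cmod (g x) \<le> B" and g0: "\<And>x. x \<notin> I \<Longrightarrow> g x = 0"
  shows "(LINT y|\<nu>. of_real (q y) * g y) = (LINT y:I|lborel. of_real (p y) * g y)"
proof -
  have Ib: "I \<in> sets borel" using I by simp
  note [measurable] = Ib
  have pI: "integrable lborel (\<lambda>x. indicator I x * p x)"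
    using p by (simp add: has_density_on_def set_integrable_def)
  have qI: "integrable \<nu> (\<lambda>x. indicator I x * q x)"
    using integrable_mult_indicator[OF _ q, of I] by (simp add: sets_\<nu>)
  have mA: "m (A \<inter> I) = (LINT x:A|\<nu>. indicator I x * q x)" "m (A \<inter> I) = (LINT x:A|lborel. indicator I x * p x)"
    if [measurable]: "A \<in> sets borel" for A
  proof -
    have ind: "indicator (A \<inter> I) x *\<^sub>R z = indicator A x *\<^sub>R (indicator I x * z)" for x and z :: real
      by (simp add: indicator_def)
    show "m (A \<inter> I) = (LINT x:A|\<nu>. indicator I x * q x)"
      using m[of "A \<inter> I"] by (simp add: set_lebesgue_integral_def ind del: real_scaleR_def)
    show "m (A \<inter> I) = (LINT x:A|lborel. indicator I x * p x)"
      using p unfolding has_density_on_def by (simp add: set_lebesgue_integral_def ind del: real_scaleR_def)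
  qed
  have "(LINT y|\<nu>. of_real (q y) * g y) = (LINT y|\<nu>. of_real (indicator I y * q y) * g y)"
    by (rule Bochner_Integration.integral_cong) (use g0 in \<open>auto simp: indicator_def\<close>)
  also have "\<dots> = signed_integral (\<lambda>A. m (A \<inter> I)) g"
    by (rule signed_integral_density[symmetric, OF sets_\<nu> qI _ _ B]) (use mA in auto)
  also have "\<dots> = (LINT y|lborel. of_real (indicator I y * p y) * g y)"
    by (rule signed_integral_density[OF _ pI _ _ B]) (use mA in auto)
  also have "\<dots> = (LINT y:I|lborel. of_real (p y) * g y)"
    unfolding set_lebesgue_integral_def
    by (rule Bochner_Integration.integral_cong) (auto simp: indicator_def)
  finally show ?thesis .
qed

text \<open>Near \<open>x\<close> only the density matters, and integration by parts moves the derivatives from \<open>w\<close> to the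
  density; globally the measure need not have a density.\<close>
lemma convolution_vderiv_local:
  assumes p: "has_density_on m I p" "Ck_on k I p" and I: "open I" "{x - d..x + d} \<subseteq> I" and d: "d > 0"
    and w: "w \<in> test_functions" and w0: "\<And>z. \<bar>z\<bar> > r \<Longrightarrow> w z = 0" and r: "r < d" and j: "j \<le> k"
  shows "convolution (vderiv j w) x = (LINT y:{x - d..x + d}|lborel. of_real (vderiv j p y) * w (x - y))"
proof -
  have z: "vderiv l w z = 0" if "\<bar>z\<bar> \<ge> d" for l z
    by (rule vderiv_zero_outside[OF w0]) (use that r in auto)
  obtain B where B: "\<And>x. cmod (vderiv j w x) \<le> B"
    using test_function_bounded[OF test_function_vderiv[OF w]] by metis
  note [measurable] = smooth_measurable[OF test_function_smooth[OF w]]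
  have "convolution (vderiv j w) x = (LINT y:I|lborel. of_real (p y) * vderiv j w (x - y))"
    unfolding convolution_def
  proof (rule integral_eq_density_integral[OF p(1) I(1) _ B])
    show "vderiv j w (x - y) = 0" if "y \<notin> I" for y
      by (rule z, rule outside_interval_abs) (use that I(2) in blast)
  qed measurable
  also have "\<dots> = (LINT y:{x - d..x + d}|lborel. of_real (p y) * vderiv j w (x - y))"
    unfolding set_lebesgue_integral_def
  proof (rule Bochner_Integration.integral_cong)
    fix y
    show "indicat_real I y *\<^sub>R (of_real (p y) * vderiv j w (x - y))
        = indicat_real {x - d..x + d} y *\<^sub>R (of_real (p y) * vderiv j w (x - y))"
    proof (cases "y \<in> {x - d..x + d}")
      case True then show ?thesis using I(2) by (auto simp: indicator_def)
    next
      case False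
      then have "\<bar>x - y\<bar> \<ge> d" by (rule outside_interval_abs)
      then show ?thesis using z by simp
    qed
  qed simp
  also have "\<dots> = (LINT y:{x - d..x + d}|lborel. of_real (vderiv i p y) * vderiv (j - i) w (x - y))" if "i \<le> j" for i
    using that
  proof (induction i)
    case (Suc i)
    have "Suc (j - Suc i) = j - i" using Suc.prems by simp
    then show ?case
      using integral_by_parts_reflected[OF p(2) I(2) d test_function_smooth[OF w] z, where l="j - Suc i" and i=i] Suc j by simp
  qed simp
  from this[of j] show ?thesis using calculation by simp
qed

end

locale mollifier =
  fixes \<eta> :: "real \<Rightarrow> real"
  assumes smooth_eta: "smooth (\<lambda>x. complex_of_real (\<eta> x))" and eta_nonneg: "\<And>x. \<eta> x \<ge> 0"
    and eta_support: "\<And>x. \<bar>x\<bar> > 1 \<Longrightarrow> \<eta> x = 0" and eta_integral: "(LINT x|lborel. \<eta> x) = 1"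
begin

definition scaled :: "nat \<Rightarrow> real \<Rightarrow> real" where
  "scaled n x = real (Suc n) * \<eta> (real (Suc n) * x)"

lemma eta_test: "(\<lambda>x. complex_of_real (\<eta> x)) \<in> test_functions"
  by (rule test_functionI[OF smooth_eta, of "-1" 1]) (use eta_support outside_interval_abs in force)

lemma eta_measurable [measurable]: "\<eta> \<in> borel_measurable borel"
  using smooth_measurable0[OF smooth_eta] by (simp add: borel_measurable_complex_iff)

lemma eta_integrable: "integrable lborel \<eta>"
  using test_function_integrable[OF eta_test] by (simp add: complex_of_real_integrable_eq)

lemma scaled_nonneg: "scaled n x \<ge> 0"
  by (simp add: scaled_def eta_nonneg)

lemma scaled_support: "\<bar>x\<bar> > 1 / real (Suc n) \<Longrightarrow> scaled n x = 0"
proof -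
  assume "\<bar>x\<bar> > 1 / real (Suc n)"
  then have "1 < \<bar>real (Suc n) * x\<bar>" by (simp add: abs_mult field_simps)
  then show ?thesis by (simp add: scaled_def eta_support)
qed

lemma scaled_measurable [measurable]: "scaled n \<in> borel_measurable borel"
  unfolding scaled_def by measurable

lemma scaled_integrable: "integrable lborel (scaled n)"
  using lborel_integrable_real_affine[OF eta_integrable, of "real (Suc n)" 0]
  unfolding scaled_def by (intro integrable_mult_right) simp

lemma scaled_integral: "(LINT x|lborel. scaled n x) = 1"
  using lborel_integral_real_affine[of "real (Suc n)" \<eta> 0] eta_integral
  by (simp add: scaled_def)

lemma scaled_reflected:
  "integrable lborel (\<lambda>y. scaled n (x - y))" "(LINT y|lborel. scaled n (x - y)) = 1"
  using lborel_integrable_real_affine[OF scaled_integrable, of "-1" n x]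
    lborel_integral_real_affine[of "-1" "scaled n" x] scaled_integral[of n] by simp_all

lemma scaled_test: "(\<lambda>x. complex_of_real (scaled n x)) \<in> test_functions"
proof (rule test_functionI[of _ "- (1 / real (Suc n))" "1 / real (Suc n)"])
  have "smooth (\<lambda>x. complex_of_real (real (Suc n)) * complex_of_real (\<eta> (real (Suc n) * x + 0)))"
    by (intro smooth_cmult smooth_affine[OF smooth_eta])
  then show "smooth (\<lambda>x. complex_of_real (scaled n x))"
    by (simp add: scaled_def del: of_nat_Suc)
  fix x assume "x \<notin> {- (1 / real (Suc n))..1 / real (Suc n)}"
  then have "\<bar>x\<bar> > 1 / real (Suc n)"
    unfolding atLeastAtMost_iff de_Morgan_conj not_le by linarith
  then show "complex_of_real (scaled n x) = 0" by (simp add: scaled_support)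
qed

lemma fourier_scaled: "fourier (\<lambda>x. complex_of_real (scaled n x)) u = fourier (\<lambda>x. complex_of_real (\<eta> x)) (u / real (Suc n))"
proof -
  have "fourier (\<lambda>x. complex_of_real (\<eta> x)) (u / real (Suc n))
     = \<bar>real (Suc n)\<bar> *\<^sub>R (LINT x|lborel. iexp (u / real (Suc n) * (0 + real (Suc n) * x)) * complex_of_real (\<eta> (0 + real (Suc n) * x)))"
    unfolding fourier_def by (rule lborel_integral_real_affine) simp
  also have "\<dots> = (LINT x|lborel. real (Suc n) *\<^sub>R (iexp (u * x) * complex_of_real (\<eta> (real (Suc n) * x))))"
    by (simp del: of_nat_Suc)
  also have "\<dots> = fourier (\<lambda>x. complex_of_real (scaled n x)) u"
    unfolding fourier_def scaled_def
    by (simp add: scaleR_conv_of_real mult.left_commute del: of_nat_Suc)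
  finally show ?thesis by simp
qed

lemma fourier_scaled_tendsto_1:
  "(\<lambda>n. fourier (\<lambda>x. complex_of_real (scaled n x)) u) \<longlonglongrightarrow> 1"
proof -
  have c: "isCont (fourier (\<lambda>x. complex_of_real (\<eta> x))) 0"
    using fourier_continuous[OF test_function_integrable[OF eta_test], of UNIV]
    by (simp add: continuous_on_eq_continuous_at)
  have "(\<lambda>n. u / real (Suc n)) \<longlonglongrightarrow> 0" by real_asymp
  from isCont_tendsto_compose[OF c this] show ?thesis
    unfolding fourier_scaled using eta_integral by (simp add: fourier_def integral_complex_of_real)
qed

lemma fourier_scaled_bound: "cmod (fourier (\<lambda>x. complex_of_real (scaled n x)) u) \<le> 1"
  using fourier_of_integrable_bound[of "\<lambda>x. complex_of_real (scaled n x)" u]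
  by (simp add: scaled_nonneg scaled_integral)

text \<open>Mollified values differ from the value at \<open>x\<close> by at most the oscillation near \<open>x\<close>.\<close>
lemma average_approximates:
  assumes cont: "continuous_on {x - d..x + d} (P :: real \<Rightarrow> real)" and n: "1 / real (Suc n) \<le> d" and e: "e \<ge> 0"
    and osc: "\<And>y. \<bar>y - x\<bar> \<le> 1 / real (Suc n) \<Longrightarrow> \<bar>P y - P x\<bar> \<le> e"
  shows "cmod ((LINT y:{x - d..x + d}|lborel. of_real (P y) * complex_of_real (scaled n (x - y))) - of_real (P x)) \<le> e"
proof -
  let ?J = "{x - d..x + d}"
  have supp: "scaled n (x - y) = 0" if "y \<notin> ?J" for y
  proof (rule scaled_support)
    have "d < \<bar>x - y\<bar>" using that unfolding atLeastAtMost_iff de_Morgan_conj not_le by linarith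
    with n show "1 / real (Suc n) < \<bar>x - y\<bar>" by (rule le_less_trans)
  qed
  have "set_integrable lborel ?J (\<lambda>y. complex_of_real (P y) * complex_of_real (scaled n (x - y)))"
  proof (rule borel_integrable_atLeastAtMost', rule continuous_on_mult)
    show "continuous_on ?J (\<lambda>y. complex_of_real (P y))" by (rule continuous_on_of_real[OF cont])
    have "continuous_on UNIV (\<lambda>z. complex_of_real (scaled n z))"
      using smooth_continuous[OF test_function_smooth[OF scaled_test], of UNIV 0 n] unfolding vderiv_0 .
    then show "continuous_on ?J (\<lambda>y. complex_of_real (scaled n (x - y)))"
      by (rule continuous_on_compose2[where f="\<lambda>y. x - y"]) (auto intro!: continuous_on_op_minus)
  qed
  then have int1: "integrable lborel (\<lambda>y. indicator ?J y *\<^sub>R (complex_of_real (P y) * complex_of_real (scaled n (x - y))))"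
    by (simp add: set_integrable_def)
  have int2: "integrable lborel (\<lambda>y. complex_of_real (P x) * complex_of_real (scaled n (x - y)))"
    using scaled_reflected(1)[of n x] by (intro integrable_mult_right integrable_of_real)
  have "complex_of_real (P x) = (LINT y|lborel. complex_of_real (P x) * complex_of_real (scaled n (x - y)))"
    using scaled_reflected(2)[of n x] by (simp add: integral_complex_of_real)
  then have diff: "(LINT y:?J|lborel. of_real (P y) * complex_of_real (scaled n (x - y))) - of_real (P x)
     = (LINT y|lborel. indicator ?J y *\<^sub>R (complex_of_real (P y) * complex_of_real (scaled n (x - y)))
          - complex_of_real (P x) * complex_of_real (scaled n (x - y)))"
    unfolding set_lebesgue_integral_def by (subst Bochner_Integration.integral_diff[OF int1 int2]) simp
  have "cmod (LINT y|lborel. indicator ?J y *\<^sub>R (complex_of_real (P y) * complex_of_real (scaled n (x - y)))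
          - complex_of_real (P x) * complex_of_real (scaled n (x - y))) \<le> (LINT y|lborel. e * scaled n (x - y))"
  proof (rule Bochner_Integration.integral_norm_bound_integral)
    fix y
    show "norm (indicator ?J y *\<^sub>R (complex_of_real (P y) * complex_of_real (scaled n (x - y)))
          - complex_of_real (P x) * complex_of_real (scaled n (x - y))) \<le> e * scaled n (x - y)"
    proof (cases "scaled n (x - y) = 0")
      case False
      then have y: "y \<in> ?J" "\<bar>y - x\<bar> \<le> 1 / real (Suc n)"
        using supp scaled_support[of n "x - y"] by (auto simp: abs_minus_commute not_less[symmetric])
      have "norm (complex_of_real (P y) * complex_of_real (scaled n (x - y))
          - complex_of_real (P x) * complex_of_real (scaled n (x - y))) = \<bar>P y - P x\<bar> * scaled n (x - y)"
        by (simp only: left_diff_distrib[symmetric] of_real_diff[symmetric] norm_mult norm_of_real abs_of_nonneg[OF scaled_nonneg])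
      also have "\<dots> \<le> e * scaled n (x - y)"
        by (intro mult_right_mono osc y scaled_nonneg)
      finally show ?thesis using y(1) by simp
    qed simp
  qed (rule Bochner_Integration.integrable_diff[OF int1 int2], rule integrable_mult_right[OF scaled_reflected(1)])
  also have "\<dots> = e" by (simp only: integral_mult_right_zero scaled_reflected(2) mult_1_right)
  finally show ?thesis unfolding diff .
qed

end

context signed_density
begin

text \<open>Convolving the measure with a narrow mollifier and cutting it off far out yields test functions
  whose derivatives up to order \<open>k\<close> converge locally uniformly on \<open>I\<close> to those of the density, so the
  values of \<open>f\<close> tend to \<open>\<theta>\<close>.  On the Fourier side convolution is multiplication by the transform of
  the mollifier, which is bounded by \<open>1\<close> and tends to \<open>1\<close>, so dominated convergence identifies the limit.\<close>
lemma distribution_pairing_eq: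
  assumes dp: "distribution_pairing f m \<theta>" and F: "has_fourier_function f F"
    and int: "integrable lborel (\<lambda>u. F (- u) * transform u)"
  shows "\<theta> = 1 / (2 * of_real pi) * (LINT u|lborel. F (- u) * transform u)"
proof -
  from dp obtain k I p where I: "open I" and p: "Ck_on k I p" "has_density_on m I p"
    and lim: "\<And>\<phi>. (\<forall>n. \<phi> n \<in> test_functions) \<Longrightarrow>
        (\<forall>j\<le>k. \<forall>A. compact A \<and> A \<subseteq> I \<longrightarrow>
           uniform_limit A (\<lambda>n. vderiv j (\<phi> n)) (vderiv j (\<lambda>x. complex_of_real (p x))) sequentially)
        \<Longrightarrow> (\<lambda>n::nat. f (\<phi> n)) \<longlonglongrightarrow> \<theta>"
    unfolding distribution_pairing_def by blast
  obtain \<eta> where "smooth (\<lambda>x. complex_of_real (\<eta> x))" "\<And>x. \<eta> x \<ge> 0"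
    "\<And>x. \<bar>x\<bar> > 1 \<Longrightarrow> \<eta> x = 0" "(LINT x|lborel. \<eta> x) = 1"
    by (metis mollifier_exists)
  then interpret mollifier \<eta> by unfold_locales
  obtain \<kappa> where \<kappa>: "smooth \<kappa>" "\<And>x. \<bar>x\<bar> < 1 \<Longrightarrow> \<kappa> x = 1" "\<And>x. \<bar>x\<bar> > 3 \<Longrightarrow> \<kappa> x = 0"
    by (metis plateau_exists)
  have \<kappa>_test: "\<kappa> \<in> test_functions"
  proof (rule test_functionI[OF \<kappa>(1), of "-3" 3])
    fix x :: real assume "x \<notin> {-3..3}"
    then have "\<bar>x\<bar> > 3" unfolding atLeastAtMost_iff de_Morgan_conj not_le by linarith
    then show "\<kappa> x = 0" by (rule \<kappa>(3))
  qed
  define E where "E n x = complex_of_real (scaled n x)" for n x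
  have E: "E n \<in> test_functions" for n unfolding E_def by (rule scaled_test)
  define L where "L n = 1 / (2 * of_real pi) * (LINT u|lborel. F (- u) * (fourier (E n) u * transform u))" for n
  have cut: "(\<lambda>k. f (\<lambda>x. \<kappa> (x / real (Suc k)) * convolution (E n) x)) \<longlonglongrightarrow> L n" for n
  proof -
    have "(\<lambda>k. f (\<lambda>x. \<kappa> (x / real (Suc k)) * convolution (E n) x))
       \<longlonglongrightarrow> 1 / (2 * of_real pi) * (LINT u|lborel. F (- u) * fourier (convolution (E n)) u)"
    proof (rule distribution_of_cutoff_tendsto[OF \<kappa>_test _ convolution_smooth[OF E] _ F])
      show "\<kappa> 0 = 1" by (simp add: \<kappa>(2))
      show "integrable lborel (vderiv j (convolution (E n)))" for j
        unfolding vderiv_convolution[OF E]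
        by (intro convolution_integrable test_function_integrable test_function_vderiv E)
    qed
    then show ?thesis
      by (simp add: L_def fourier_convolution[OF test_function_integrable[OF E]])
  qed
  \<comment> \<open>For each mollifier, cut off so far out that the value of \<open>f\<close> is close to its limit; \<open>K n \<ge> n\<close> keeps the cutoff away from compact sets.\<close>
  have ex: "\<forall>n. \<exists>K. K \<ge> n \<and> cmod (f (\<lambda>x. \<kappa> (x / real (Suc K)) * convolution (E n) x) - L n) < 1 / real (Suc n)"
  proof
    fix n
    have "\<forall>\<^sub>F K in sequentially. dist (f (\<lambda>x. \<kappa> (x / real (Suc K)) * convolution (E n) x)) (L n) < 1 / real (Suc n)"
      by (rule tendstoD[OF cut]) simp
    then obtain K0 where "\<And>K. K \<ge> K0 \<Longrightarrow> dist (f (\<lambda>x. \<kappa> (x / real (Suc K)) * convolution (E n) x)) (L n) < 1 / real (Suc n)"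
      unfolding eventually_sequentially by blast
    from this[of "max n K0"] show "\<exists>K. K \<ge> n \<and> cmod (f (\<lambda>x. \<kappa> (x / real (Suc K)) * convolution (E n) x) - L n) < 1 / real (Suc n)"
      by (intro exI[of _ "max n K0"]) (auto simp: dist_norm)
  qed
  from choice[OF ex] obtain K where
    "\<forall>n. K n \<ge> n \<and> cmod (f (\<lambda>x. \<kappa> (x / real (Suc (K n))) * convolution (E n) x) - L n) < 1 / real (Suc n)"
    by (elim exE)
  then have K: "\<And>n. K n \<ge> n"
    "\<And>n. cmod (f (\<lambda>x. \<kappa> (x / real (Suc (K n))) * convolution (E n) x) - L n) < 1 / real (Suc n)"
    by (rule allE, blast)+
  define \<phi> where "\<phi> n x = \<kappa> (x / real (Suc (K n))) * convolution (E n) x" for n x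
  have L: "L \<longlonglongrightarrow> 1 / (2 * of_real pi) * (LINT u|lborel. F (- u) * transform u)"
    unfolding L_def
  proof (intro tendsto_intros integral_dominated_convergence[where w="\<lambda>u. cmod (F (- u) * transform u)"])
    have [measurable]: "F \<in> borel_measurable borel"
      using F tempered_function_measurable by (auto simp: has_fourier_function_def)
    note [measurable] = fourier_measurable[OF test_function_integrable[OF E]]
    show "(\<lambda>u. F (- u) * transform u) \<in> borel_measurable lborel" by measurable
    show "(\<lambda>u. F (- u) * (fourier (E n) u * transform u)) \<in> borel_measurable lborel" for n by measurable
    show "AE u in lborel. (\<lambda>n. F (- u) * (fourier (E n) u * transform u)) \<longlonglongrightarrow> F (- u) * transform u"
    proof (rule AE_I2)
      fix u
      have "(\<lambda>n. F (- u) * (fourier (E n) u * transform u)) \<longlonglongrightarrow> F (- u) * (1 * transform u)"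
        unfolding E_def by (intro tendsto_intros fourier_scaled_tendsto_1)
      then show "(\<lambda>n. F (- u) * (fourier (E n) u * transform u)) \<longlonglongrightarrow> F (- u) * transform u" by simp
    qed
    show "AE u in lborel. norm (F (- u) * (fourier (E n) u * transform u)) \<le> cmod (F (- u) * transform u)" for n
      using fourier_scaled_bound[of n] unfolding E_def norm_mult
      by (intro AE_I2 mult_left_mono mult_left_le_one_le) auto
    show "integrable lborel (\<lambda>u. cmod (F (- u) * transform u))" by (rule integrable_norm[OF int])
  qed
  have f_lim: "(\<lambda>n. f (\<phi> n)) \<longlonglongrightarrow> 1 / (2 * of_real pi) * (LINT u|lborel. F (- u) * transform u)"
  proof -
    have "(\<lambda>n. f (\<phi> n) - L n) \<longlonglongrightarrow> 0"
    proof (rule Lim_null_comparison)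
      show "\<forall>\<^sub>F n in sequentially. norm (f (\<phi> n) - L n) \<le> 1 / real (Suc n)"
        using K(2) by (intro always_eventually allI less_imp_le) (simp add: \<phi>_def[abs_def])
      show "(\<lambda>n. 1 / real (Suc n)) \<longlonglongrightarrow> 0" by real_asymp
    qed
    from tendsto_add[OF this L] show ?thesis by simp
  qed
  have \<phi>_test: "\<phi> n \<in> test_functions" for n
  proof (rule test_functionI[of _ "- (3 * real (Suc (K n)))" "3 * real (Suc (K n))"])
    have "smooth (\<lambda>x. \<kappa> ((1 / real (Suc (K n))) * x + 0) * convolution (E n) x)"
      by (intro smooth_mult smooth_affine[OF \<kappa>(1)] convolution_smooth E)
    then show "smooth (\<phi> n)" by (simp add: \<phi>_def[abs_def])
    fix x assume "x \<notin> {- (3 * real (Suc (K n)))..3 * real (Suc (K n))}"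
    then have "\<bar>x\<bar> > 3 * real (Suc (K n))" unfolding atLeastAtMost_iff de_Morgan_conj not_le by linarith
    then have "\<bar>x / real (Suc (K n))\<bar> > 3" by (simp add: field_simps)
    then show "\<phi> n x = 0" by (simp add: \<phi>_def \<kappa>(3))
  qed
  have "(\<lambda>n. f (\<phi> n)) \<longlonglongrightarrow> \<theta>"
  proof (rule lim; intro allI impI)
    show "\<phi> n \<in> test_functions" for n by (rule \<phi>_test)
    fix j A assume j: "j \<le> k" and A: "compact A \<and> A \<subseteq> I"
    obtain d where d: "d > 0" "(\<Union>x\<in>A. cball x d) \<subseteq> I"
      using compact_subset_open_imp_cball_epsilon_subset[of A I] A I by blast
    obtain \<rho> where \<rho>: "\<And>x. x \<in> A \<Longrightarrow> \<bar>x\<bar> \<le> \<rho>"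
      using A compact_imp_bounded[of A] unfolding bounded_iff by auto
    \<comment> \<open>A compact neighbourhood of \<open>A\<close> inside \<open>I\<close>, on which the derivatives of the density are uniformly continuous.\<close>
    define A' where "A' = {x + y | x y. x \<in> A \<and> y \<in> cball 0 d}"
    have A'_compact: "compact A'" unfolding A'_def by (rule compact_sums) (use A in auto)
    have A'_eq: "x + y \<in> A'" if "x \<in> A" "\<bar>y\<bar> \<le> d" for x y
      unfolding A'_def using that by auto
    have A'I: "A' \<subseteq> I"
    proof
      fix z assume "z \<in> A'"
      then obtain x y where "z = x + y" "x \<in> A" "\<bar>y\<bar> \<le> d" unfolding A'_def by auto
      then have "z \<in> cball x d" by (simp add: dist_real_def)
      then show "z \<in> I" using d(2) \<open>x \<in> A\<close> by blast
    qed
    have uc: "uniformly_continuous_on A' (vderiv j p)"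
      by (rule compact_uniformly_continuous[OF continuous_on_subset[OF Ck_on_continuous[OF p(1) j] A'I] A'_compact])
    show "uniform_limit A (\<lambda>n. vderiv j (\<phi> n)) (vderiv j (\<lambda>x. complex_of_real (p x))) sequentially"
      unfolding uniform_limit_iff
    proof (intro allI impI)
      fix e :: real assume e: "e > 0"
      then obtain r where r: "r > 0" and osc: "\<And>x y. x \<in> A' \<Longrightarrow> y \<in> A' \<Longrightarrow> dist y x < r \<Longrightarrow> dist (vderiv j p y) (vderiv j p x) < e / 2"
        using uc unfolding uniformly_continuous_on_def by (metis half_gt_zero)
      have "\<forall>\<^sub>F n in sequentially. 1 / real (Suc n) < min r d"
        using r d by (intro order_tendstoD(2)[where y=0]) (real_asymp, simp)
      moreover have "\<forall>\<^sub>F n in sequentially. real n \<ge> \<rho> + 1" by real_asymp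
      ultimately show "\<forall>\<^sub>F n in sequentially. \<forall>x\<in>A. dist (vderiv j (\<phi> n) x) (vderiv j (\<lambda>x. complex_of_real (p x)) x) < e"
      proof eventually_elim
        case (elim n)
        show ?case
        proof
          fix x assume x: "x \<in> A"
          have xI: "x \<in> I" using A x by blast
          have J: "{x - d..x + d} \<subseteq> I"
          proof
            fix y assume "y \<in> {x - d..x + d}"
            then have "y \<in> cball x d" by (auto simp: dist_real_def)
            then show "y \<in> I" using d(2) x by blast
          qed
          have "vderiv j (\<phi> n) x = vderiv j (convolution (E n)) x"
          proof (rule vderiv_eq_on_open[where U="ball x 1" and k=j and F="\<lambda>j. vderiv j (convolution (E n))"])
            show "\<phi> n y = vderiv 0 (convolution (E n)) y" if "y \<in> ball x 1" for y
            proof -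
              have "\<bar>y\<bar> < \<rho> + 1" using that \<rho>[OF x] by (auto simp: dist_real_def)
              also have "\<rho> + 1 \<le> real (Suc (K n))" using elim(2) K(1)[of n] by simp
              finally have "\<bar>y / real (Suc (K n))\<bar> < 1" by (simp add: abs_divide)
              then show ?thesis by (simp add: \<phi>_def \<kappa>(2))
            qed
          qed (use smooth_derivatives[OF convolution_smooth[OF E], of n] in \<open>auto simp: derivatives_def\<close>)
          also have "\<dots> = convolution (vderiv j (E n)) x"
            by (simp add: vderiv_convolution[OF E])
          also have "\<dots> = (LINT y:{x - d..x + d}|lborel. of_real (vderiv j p y) * E n (x - y))"
          proof (rule convolution_vderiv_local[OF p(2,1) I J d(1) E _ _ j])
            show "E n z = 0" if "1 / real (Suc n) < \<bar>z\<bar>" for z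
              using scaled_support[OF that] by (simp add: E_def)
            show "1 / real (Suc n) < d" using elim(1) by simp
          qed
          finally have eq: "vderiv j (\<phi> n) x = (LINT y:{x - d..x + d}|lborel. of_real (vderiv j p y) * complex_of_real (scaled n (x - y)))"
            by (simp add: E_def)
          have "cmod ((LINT y:{x - d..x + d}|lborel. of_real (vderiv j p y) * complex_of_real (scaled n (x - y))) - of_real (vderiv j p x)) \<le> e / 2"
          proof (rule average_approximates)
            show "continuous_on {x - d..x + d} (vderiv j p)"
              by (rule continuous_on_subset[OF Ck_on_continuous[OF p(1) j] J])
            fix y assume y: "\<bar>y - x\<bar> \<le> 1 / real (Suc n)"
            have "x \<in> A'" using A'_eq[OF x, of 0] d by simp
            moreover have "y \<in> A'" using A'_eq[OF x, of "y - x"] y elim(1) by simp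
            ultimately show "\<bar>vderiv j p y - vderiv j p x\<bar> \<le> e / 2"
              using osc[of x y] y elim(1) by (simp add: dist_real_def)
          qed (use elim(1) e in auto)
          then show "dist (vderiv j (\<phi> n) x) (vderiv j (\<lambda>x. complex_of_real (p x)) x) < e"
            using e by (simp add: eq dist_norm vderiv_of_real[OF p(1) I j xI])
        qed
      qed
    qed
  qed
  then show ?thesis using f_lim LIMSEQ_unique by blast
qed

lemma pairing_eq:
  assumes ex: "\<exists>\<theta>. has_pairing f m \<theta>" and F: "has_fourier_function f F"
    and int: "integrable lborel (\<lambda>u. F (- u) * transform u)"
  shows "pairing f m = 1 / (2 * of_real pi) * (LINT u|lborel. F (- u) * transform u)"
proof -
  have "\<theta> = 1 / (2 * of_real pi) * (LINT u|lborel. F (- u) * transform u)" if "has_pairing f m \<theta>" for \<theta>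
    using that function_pairing_eq[OF _ F int] distribution_pairing_eq[OF _ F int]
    by (auto simp: has_pairing_def)
  with ex show ?thesis unfolding pairing_def by (metis the_equality)
qed

end

section \<open>Kernels\<close>

lemma schwartz_rescale:
  assumes \<phi>: "\<phi> \<in> schwartz" and h: "h > 0"
  shows "(\<lambda>x. \<phi> (x / h) / of_real h) \<in> schwartz"
proof -
  have sm: "smooth \<phi>" and b: "\<And>m j. \<exists>B. \<forall>x. \<bar>x\<bar> ^ m * cmod (vderiv j \<phi> x) \<le> B"
    using \<phi> by (auto simp: schwartz_def)
  have eq: "(\<lambda>x. \<phi> (x / h) / of_real h) = (\<lambda>x. of_real (1 / h) * \<phi> ((1 / h) * x + 0))"
    by (simp add: fun_eq_iff)
  have sm': "smooth (\<lambda>x. \<phi> ((1 / h) * x + 0))" by (rule smooth_affine[OF sm])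
  have bnd: "\<exists>B. \<forall>x. \<bar>x\<bar> ^ m * cmod (vderiv j (\<lambda>x. of_real (1 / h) * \<phi> ((1 / h) * x + 0)) x) \<le> B" for m j
  proof -
    obtain B where B: "\<And>x. \<bar>x\<bar> ^ m * cmod (vderiv j \<phi> x) \<le> B" using b by blast
    have "\<bar>x\<bar> ^ m * cmod (vderiv j (\<lambda>x. of_real (1 / h) * \<phi> ((1 / h) * x + 0)) x) \<le> h ^ m * ((1 / h) * (1 / h) ^ j) * B" for x
    proof -
      have "vderiv j (\<lambda>x. of_real (1 / h) * \<phi> ((1 / h) * x + 0)) x = of_real (1 / h) * ((1 / h) ^ j *\<^sub>R vderiv j \<phi> ((1 / h) * x + 0))"
        unfolding vderiv_cmult[OF sm'] vderiv_affine[OF sm] ..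
      then have "\<bar>x\<bar> ^ m * cmod (vderiv j (\<lambda>x. of_real (1 / h) * \<phi> ((1 / h) * x + 0)) x)
          = (h ^ m * ((1 / h) * (1 / h) ^ j)) * (\<bar>x / h\<bar> ^ m * cmod (vderiv j \<phi> (x / h)))"
        using h by (simp add: norm_mult norm_power norm_divide power_divide abs_divide field_simps)
      also have "\<dots> \<le> h ^ m * ((1 / h) * (1 / h) ^ j) * B"
        using h by (intro mult_left_mono B) auto
      finally show ?thesis .
    qed
    then show ?thesis by blast
  qed
  show ?thesis unfolding eq schwartz_def mem_Collect_eq
    by (intro conjI allI smooth_cmult[OF sm'] bnd)
qed

lemma fourier_rescale:
  assumes h: "h > 0"
  shows "fourier (\<lambda>x. \<phi> (x / h) / of_real h) y = fourier \<phi> (h * y)"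
proof -
  have "fourier (\<lambda>x. \<phi> (x / h) / of_real h) y
     = \<bar>h\<bar> *\<^sub>R (LINT x|lborel. iexp (y * (0 + h * x)) * (\<phi> ((0 + h * x) / h) / of_real h))"
    unfolding fourier_def by (rule lborel_integral_real_affine) (use h in simp)
  also have "\<dots> = (LINT x|lborel. h *\<^sub>R (iexp (y * (0 + h * x)) * (\<phi> ((0 + h * x) / h) / of_real h)))"
    using h by simp
  also have "\<dots> = fourier \<phi> (h * y)"
    unfolding fourier_def by (rule Bochner_Integration.integral_cong) (use h in \<open>auto simp: scaleR_conv_of_real mult_ac\<close>)
  finally show ?thesis .
qed

text \<open>Scaling the kernel is dual to scaling the Schwartz function under the Fourier transform.\<close>
lemma scaled_kernel_fourier_function:
  assumes K: "has_fourier_function (kernel_distribution K) FK" and h: "h > 0"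
    and [measurable]: "FK \<in> borel_measurable borel" and B: "\<And>u. cmod (FK u) \<le> B"
  shows "has_fourier_function (kernel_distribution (scaled_kernel K h)) (\<lambda>u. FK (h * u))"
  unfolding has_fourier_function_def
proof safe
  show "tempered_function (\<lambda>u. FK (h * u))"
    by (rule bounded_imp_tempered_function[OF _ B]) measurable
  fix \<phi> assume \<phi>: "\<phi> \<in> schwartz"
  define \<phi>h where "\<phi>h x = \<phi> (x / h) / of_real h" for x
  have \<phi>h: "\<phi>h \<in> schwartz" unfolding \<phi>h_def by (rule schwartz_rescale[OF \<phi> h])
  have "kernel_distribution (scaled_kernel K h) (fourier \<phi>)
     = \<bar>h\<bar> *\<^sub>R (LINT x|lborel. of_real (scaled_kernel K h (0 + h * x)) * fourier \<phi> (0 + h * x))"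
    unfolding kernel_distribution_def function_distribution_def
    by (rule lborel_integral_real_affine) (use h in simp)
  also have "\<dots> = (LINT x|lborel. h *\<^sub>R (of_real (scaled_kernel K h (0 + h * x)) * fourier \<phi> (0 + h * x)))"
    using h by simp
  also have "\<dots> = (LINT x|lborel. of_real (K x) * fourier \<phi>h x)"
    using h by (intro Bochner_Integration.integral_cong)
      (auto simp: scaled_kernel_def \<phi>h_def[abs_def] fourier_rescale scaleR_conv_of_real)
  also have "\<dots> = (LINT x|lborel. FK x * \<phi>h x)"
    using K \<phi>h by (simp add: has_fourier_function_def kernel_distribution_def function_distribution_def)
  also have "\<dots> = \<bar>h\<bar> *\<^sub>R (LINT x|lborel. FK (0 + h * x) * \<phi>h (0 + h * x))"
    by (rule lborel_integral_real_affine) (use h in simp)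
  also have "\<dots> = (LINT x|lborel. h *\<^sub>R (FK (0 + h * x) * \<phi>h (0 + h * x)))"
    using h by simp
  also have "\<dots> = (LINT x|lborel. FK (h * x) * \<phi> x)"
    using h by (intro Bochner_Integration.integral_cong) (auto simp: \<phi>h_def scaleR_conv_of_real)
  finally show "kernel_distribution (scaled_kernel K h) (fourier \<phi>) = function_distribution (\<lambda>u. FK (h * u)) \<phi>"
    by (simp add: function_distribution_def)
qed

lemma continuous_AE_eq:
  fixes f g :: "real \<Rightarrow> complex"
  assumes f: "continuous_on UNIV f" and g: "continuous_on UNIV g" and eq: "AE x in lborel. f x = g x"
  shows "f x = g x"
proof (rule ccontr)
  assume ne: "f x \<noteq> g x"
  have op: "open {x. f x \<noteq> g x}" by (rule open_Collect_neq[OF f g])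
  then obtain e where e: "e > 0" "ball x e \<subseteq> {x. f x \<noteq> g x}" using ne by (auto elim: openE)
  have "emeasure lborel {x. f x \<noteq> g x} = 0"
    using eq op by (subst (asm) AE_iff_measurable[of "{x. f x \<noteq> g x}"]) auto
  moreover have "{x - e / 2..x + e / 2} \<subseteq> {x. f x \<noteq> g x}"
    using e by (force simp: dist_real_def subset_iff abs_if)
  then have "emeasure lborel {x - e / 2..x + e / 2} \<le> emeasure lborel {x. f x \<noteq> g x}"
    using op by (intro emeasure_mono) auto
  ultimately show False using e(1) by simp
qed

lemma hoelder_index_bounds:
  assumes "k > 0" shows "real (hoelder_index k) < k" "k \<le> real (Suc (hoelder_index k))"
proof -
  have sub: "{n::nat. real n < k} \<subseteq> {..nat \<lceil>k\<rceil>}" by (auto, linarith)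
  then have fin: "finite {n::nat. real n < k}" by (rule finite_subset) simp
  have "hoelder_index k \<in> {n. real n < k}"
    unfolding hoelder_index_def by (rule Max_in[OF fin]) (use assms in \<open>auto intro: exI[of _ 0]\<close>)
  then show "real (hoelder_index k) < k" by simp
  show "k \<le> real (Suc (hoelder_index k))"
  proof (rule ccontr)
    assume "\<not> k \<le> real (Suc (hoelder_index k))"
    then have "Suc (hoelder_index k) \<le> hoelder_index k"
      unfolding hoelder_index_def by (intro Max_ge[OF fin]) (simp add: hoelder_index_def)
    then show False by simp
  qed
qed

text \<open>The Taylor remainder has order \<open>Suc l\<close> for small \<open>y\<close> and order \<open>l\<close> for large \<open>y\<close>; the exponent \<open>k\<close>
  lies in between.\<close>
lemma iexp_taylor_powr:
  assumes l: "real l < k" "k \<le> real (Suc l)"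
  shows "cmod (iexp y - (\<Sum>j\<le>l. (\<i> * y) ^ j / fact j)) \<le> 2 * \<bar>y\<bar> powr k"
proof (cases "\<bar>y\<bar> \<le> 1")
  case True
  have "cmod (iexp y - (\<Sum>j\<le>l. (\<i> * y) ^ j / fact j)) \<le> \<bar>y\<bar> ^ Suc l / fact (Suc l)" by (rule iexp_approx1)
  also have "\<dots> \<le> \<bar>y\<bar> ^ Suc l / 1"
    by (intro divide_left_mono) (auto simp: fact_ge_1 simp del: fact_Suc)
  also have "\<bar>y\<bar> ^ Suc l / 1 \<le> \<bar>y\<bar> powr k"
  proof (cases "y = 0")
    case False
    then have "\<bar>y\<bar> ^ Suc l = \<bar>y\<bar> powr real (Suc l)" by (subst powr_realpow) auto
    also have "\<dots> \<le> \<bar>y\<bar> powr k" using True False l by (intro powr_mono') auto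
    finally show ?thesis by simp
  qed simp
  also have "\<dots> \<le> 2 * \<bar>y\<bar> powr k" by simp
  finally show ?thesis .
next
  case False
  have "cmod (iexp y - (\<Sum>j\<le>l. (\<i> * y) ^ j / fact j)) \<le> 2 * \<bar>y\<bar> ^ l / fact l" by (rule iexp_approx2)
  also have "\<dots> \<le> 2 * \<bar>y\<bar> ^ l / 1" by (intro divide_left_mono) (auto simp: fact_ge_1)
  also have "\<bar>y\<bar> ^ l = \<bar>y\<bar> powr real l" using False by (subst powr_realpow) auto
  also have "2 * \<bar>y\<bar> powr real l / 1 \<le> 2 * \<bar>y\<bar> powr k"
    using False l by (auto intro!: powr_mono)
  finally show ?thesis .
qed

text \<open>Temperedness controls the kernel near the origin, and the moment of order \<open>k\<close> away from it.\<close>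
lemma kernel_order_imp_integrable:
  assumes K: "tempered_function (\<lambda>x. complex_of_real (K x))" and int: "integrable lborel (\<lambda>x. \<bar>x\<bar> powr k * \<bar>K x\<bar>)"
    and k: "k > 0"
  shows "integrable lborel K"
proof -
  obtain N where N: "integrable lborel (\<lambda>x. complex_of_real (K x) / of_real ((1 + x\<^sup>2) ^ N))"
    and "(\<lambda>x. complex_of_real (K x)) \<in> borel_measurable borel"
    using K by (auto simp: tempered_function_def)
  then have [measurable]: "K \<in> borel_measurable borel" by (simp add: borel_measurable_complex_iff)
  have "integrable lborel (\<lambda>x. 2 ^ N * cmod (complex_of_real (K x) / of_real ((1 + x\<^sup>2) ^ N)) + \<bar>x\<bar> powr k * \<bar>K x\<bar>)"
    by (intro Bochner_Integration.integrable_add integrable_mult_right integrable_norm N int)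
  then show ?thesis
  proof (rule Bochner_Integration.integrable_bound)
    show "AE x in lborel. norm (K x) \<le> norm (2 ^ N * cmod (complex_of_real (K x) / of_real ((1 + x\<^sup>2) ^ N)) + \<bar>x\<bar> powr k * \<bar>K x\<bar>)"
    proof (rule AE_I2)
      fix x :: real
      have p: "(1 + x\<^sup>2) ^ N > 0" by (simp add: add_pos_nonneg)
      have "\<bar>K x\<bar> \<le> 2 ^ N * (\<bar>K x\<bar> / (1 + x\<^sup>2) ^ N) + \<bar>x\<bar> powr k * \<bar>K x\<bar>"
      proof (cases "\<bar>x\<bar> \<le> 1")
        case True
        then have "x\<^sup>2 \<le> 1" by (simp add: abs_square_le_1)
        then have "(1 + x\<^sup>2) ^ N \<le> 2 ^ N" by (intro power_mono) auto
        then have "\<bar>K x\<bar> * (1 + x\<^sup>2) ^ N \<le> 2 ^ N * \<bar>K x\<bar>" by (simp add: mult.commute mult_left_mono)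
        then have "\<bar>K x\<bar> \<le> 2 ^ N * (\<bar>K x\<bar> / (1 + x\<^sup>2) ^ N)" using p by (simp add: pos_le_divide_eq)
        then show ?thesis by (simp add: add_increasing2)
      next
        case False
        then have "1 \<le> \<bar>x\<bar> powr k" using k by (intro ge_one_powr_ge_zero) auto
        then have "1 * \<bar>K x\<bar> \<le> \<bar>x\<bar> powr k * \<bar>K x\<bar>" by (intro mult_right_mono) auto
        then show ?thesis using p by (simp add: add_increasing)
      qed
      also have "\<dots> = 2 ^ N * cmod (complex_of_real (K x) / of_real ((1 + x\<^sup>2) ^ N)) + \<bar>x\<bar> powr k * \<bar>K x\<bar>"
        using p by (simp only: norm_divide norm_of_real abs_of_pos)
      finally show "norm (K x) \<le> norm (2 ^ N * cmod (complex_of_real (K x) / of_real ((1 + x\<^sup>2) ^ N)) + \<bar>x\<bar> powr k * \<bar>K x\<bar>)"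
        unfolding real_norm_def by (rule order_trans[OF _ abs_ge_self])
    qed
  qed measurable
qed

text \<open>All Taylor terms but the constant one integrate to zero against \<open>K\<close>.\<close>
lemma kernel_transform_near_0:
  assumes k: "k > 0" and K: "integrable lborel K" and ord: "kernel_order k K"
  shows "cmod (fourier (\<lambda>x. complex_of_real (K x)) u - fourier (\<lambda>x. complex_of_real (K x)) 0)
     \<le> 2 * (LINT x|lborel. \<bar>x\<bar> powr k * \<bar>K x\<bar>) * \<bar>u\<bar> powr k"
proof -
  define l where "l = hoelder_index k"
  note l = hoelder_index_bounds[OF k, folded l_def]
  have Kk: "integrable lborel (\<lambda>x. \<bar>x\<bar> powr k * \<bar>K x\<bar>)"
    and mom0: "\<And>j::nat. 1 \<le> j \<Longrightarrow> real j < k \<Longrightarrow> (LINT x|lborel. x ^ j * K x) = 0"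
    using ord by (auto simp: kernel_order_def)
  have [measurable]: "K \<in> borel_measurable borel" using borel_measurable_integrable[OF K] by simp
  have mom: "integrable lborel (\<lambda>x. x ^ j * K x)" if "j \<le> l" for j
  proof (rule Bochner_Integration.integrable_bound)
    show "integrable lborel (\<lambda>x. \<bar>K x\<bar> + \<bar>x\<bar> powr k * \<bar>K x\<bar>)"
      by (intro Bochner_Integration.integrable_add Kk) (use K in auto)
    show "AE x in lborel. norm (x ^ j * K x) \<le> norm (\<bar>K x\<bar> + \<bar>x\<bar> powr k * \<bar>K x\<bar>)"
    proof (rule AE_I2)
      fix x :: real
      have "\<bar>x\<bar> ^ j \<le> 1 + \<bar>x\<bar> powr k"
      proof (cases "\<bar>x\<bar> \<le> 1")
        case True then show ?thesis by (intro add_increasing2 power_le_one) auto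
      next
        case False
        then have "\<bar>x\<bar> ^ j = \<bar>x\<bar> powr real j" by (subst powr_realpow) auto
        also have "\<dots> \<le> \<bar>x\<bar> powr k" using False that l(1) by (intro powr_mono) auto
        finally show ?thesis by simp
      qed
      then have "\<bar>x\<bar> ^ j * \<bar>K x\<bar> \<le> (1 + \<bar>x\<bar> powr k) * \<bar>K x\<bar>" by (rule mult_right_mono) simp
      then show "norm (x ^ j * K x) \<le> norm (\<bar>K x\<bar> + \<bar>x\<bar> powr k * \<bar>K x\<bar>)"
        by (simp add: abs_mult power_abs distrib_right)
    qed
  qed measurable
  define S where "S x = (\<Sum>j\<le>l. (\<i> * complex_of_real (u * x)) ^ j / fact j)" for x
  have int_term: "integrable lborel (\<lambda>x. (\<i> * complex_of_real (u * x)) ^ j / fact j * complex_of_real (K x))"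
    and val_term: "(LINT x|lborel. (\<i> * complex_of_real (u * x)) ^ j / fact j * complex_of_real (K x))
        = (if j = 0 then fourier (\<lambda>x. complex_of_real (K x)) 0 else 0)" if "j \<le> l" for j
  proof -
    have eq: "(\<i> * complex_of_real (u * x)) ^ j / fact j * complex_of_real (K x)
      = ((\<i> * of_real u) ^ j / fact j) * complex_of_real (x ^ j * K x)" for x
      by (simp add: power_mult_distrib mult_ac)
    show "integrable lborel (\<lambda>x. (\<i> * complex_of_real (u * x)) ^ j / fact j * complex_of_real (K x))"
      unfolding eq by (intro integrable_mult_right integrable_of_real mom that)
    have "(LINT x|lborel. ((\<i> * of_real u) ^ j / fact j) * complex_of_real (x ^ j * K x))
       = ((\<i> * of_real u) ^ j / fact j) * complex_of_real (LINT x|lborel. x ^ j * K x)"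
      by (simp only: integral_mult_right_zero integral_complex_of_real)
    also have "\<dots> = (if j = 0 then fourier (\<lambda>x. complex_of_real (K x)) 0 else 0)"
      using mom0[of j] that l(1) by (cases "j = 0") (auto simp: fourier_def integral_complex_of_real)
    finally show "(LINT x|lborel. (\<i> * complex_of_real (u * x)) ^ j / fact j * complex_of_real (K x))
        = (if j = 0 then fourier (\<lambda>x. complex_of_real (K x)) 0 else 0)" unfolding eq .
  qed
  have intS: "integrable lborel (\<lambda>x. S x * complex_of_real (K x))"
    unfolding S_def sum_distrib_right by (intro Bochner_Integration.integrable_sum int_term) auto
  have "(LINT x|lborel. S x * complex_of_real (K x))
     = (\<Sum>j\<le>l. LINT x|lborel. (\<i> * complex_of_real (u * x)) ^ j / fact j * complex_of_real (K x))"
    unfolding S_def sum_distrib_right by (intro Bochner_Integration.integral_sum int_term) auto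
  also have "\<dots> = (\<Sum>j\<le>l. if j = 0 then fourier (\<lambda>x. complex_of_real (K x)) 0 else 0)"
    by (intro sum.cong val_term) auto
  also have "\<dots> = fourier (\<lambda>x. complex_of_real (K x)) 0" by simp
  finally have valS: "(LINT x|lborel. S x * complex_of_real (K x)) = fourier (\<lambda>x. complex_of_real (K x)) 0" .
  have intE: "integrable lborel (\<lambda>x. iexp (u * x) * complex_of_real (K x))"
    by (intro integrable_iexp_mult integrable_of_real K) simp
  have diff: "fourier (\<lambda>x. complex_of_real (K x)) u - fourier (\<lambda>x. complex_of_real (K x)) 0
     = (LINT x|lborel. iexp (u * x) * complex_of_real (K x) - S x * complex_of_real (K x))"
    using valS by (subst Bochner_Integration.integral_diff[OF intE intS]) (simp add: fourier_def)
  have "cmod (LINT x|lborel. iexp (u * x) * complex_of_real (K x) - S x * complex_of_real (K x)) \<le> (LINT x|lborel. (2 * \<bar>u\<bar> powr k) * (\<bar>x\<bar> powr k * \<bar>K x\<bar>))"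
  proof (rule Bochner_Integration.integral_norm_bound_integral)
    show "integrable lborel (\<lambda>x. iexp (u * x) * complex_of_real (K x) - S x * complex_of_real (K x))"
      by (intro Bochner_Integration.integrable_diff intE intS)
    show "integrable lborel (\<lambda>x. (2 * \<bar>u\<bar> powr k) * (\<bar>x\<bar> powr k * \<bar>K x\<bar>))"
      by (intro integrable_mult_right Kk)
    fix x
    have "cmod (iexp (u * x) * complex_of_real (K x) - S x * complex_of_real (K x)) = cmod (iexp (u * x) - S x) * \<bar>K x\<bar>"
      by (simp only: left_diff_distrib[symmetric] norm_mult norm_of_real)
    also have "\<dots> \<le> (2 * \<bar>u * x\<bar> powr k) * \<bar>K x\<bar>"
      unfolding S_def by (intro mult_right_mono iexp_taylor_powr l) auto
    also have "\<dots> = (2 * \<bar>u\<bar> powr k) * (\<bar>x\<bar> powr k * \<bar>K x\<bar>)"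
      by (simp add: abs_mult powr_mult mult_ac)
    finally show "cmod (iexp (u * x) * complex_of_real (K x) - S x * complex_of_real (K x)) \<le> (2 * \<bar>u\<bar> powr k) * (\<bar>x\<bar> powr k * \<bar>K x\<bar>)" .
  qed
  also have "\<dots> = 2 * (LINT x|lborel. \<bar>x\<bar> powr k * \<bar>K x\<bar>) * \<bar>u\<bar> powr k" by simp
  finally show ?thesis unfolding diff .
qed

text \<open>The sinc kernel is included for every \<open>k\<close>: its transform is \<open>1\<close> near the origin, and where it is not,
  \<open>\<bar>u\<bar> \<ge> 1\<close>.  For a kernel of order \<open>k\<close>, the transform \<open>FK\<close> is only determined almost everywhere; it
  equals the Fourier integral everywhere because both are continuous.\<close>
lemma kernel_transform_bounds:
  fixes FK :: "real \<Rightarrow> complex"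
  assumes k: "k > 0"
    and K: "tempered_function (\<lambda>x. complex_of_real (K x))"
    and F: "has_fourier_function (kernel_distribution K) FK"
    and FK0: "FK 0 = 1" and supp: "support FK \<subseteq> {- pi..pi}"
    and alt: "FK = indicator {- pi..pi} \<or> (kernel_order k K \<and> FK \<in> hoelder_class UNIV k LK RK)"
  obtains R B where "R > 0" "B > 0" "FK \<in> borel_measurable borel" "\<And>u. cmod (FK u) \<le> R"
    "\<And>u. cmod (1 - FK u) \<le> B * \<bar>u\<bar> powr k" "\<And>u. \<bar>u\<bar> > pi \<Longrightarrow> FK u = 0"
proof -
  have z: "FK u = 0" if "\<bar>u\<bar> > pi" for u
  proof (rule ccontr)
    assume "FK u \<noteq> 0"
    then have "u \<in> support FK" unfolding support_def by (intro closure_subset[THEN subsetD]) simp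
    with supp have "u \<in> {- pi..pi}" by (rule subsetD)
    with that show False unfolding atLeastAtMost_iff by linarith
  qed
  from alt show ?thesis
  proof
    assume FK: "FK = indicator {- pi..pi}"
    show ?thesis
    proof (rule that[of 1 1])
      show "FK \<in> borel_measurable borel" unfolding FK by measurable
      show "cmod (FK u) \<le> 1" for u unfolding FK by (simp add: indicator_def)
      show "cmod (1 - FK u) \<le> 1 * \<bar>u\<bar> powr k" for u
      proof (cases "u \<in> {- pi..pi}")
        case False
        then have "\<bar>u\<bar> \<ge> 1" using pi_gt3 by (auto simp: abs_if)
        then have "1 \<le> \<bar>u\<bar> powr k" using k by (intro ge_one_powr_ge_zero) auto
        then show ?thesis using False by (simp add: FK)
      qed (simp add: FK)
    qed (use z in auto)
  next
    assume *: "kernel_order k K \<and> FK \<in> hoelder_class UNIV k LK RK"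
    have contF: "continuous_on UNIV FK"
      using * Ck_on_continuous[of "hoelder_index k" UNIV FK 0] by (simp add: hoelder_class_def)
    have bF: "cmod (FK u) \<le> RK" for u using * by (simp add: hoelder_class_def)
    have intK: "integrable lborel K"
      using * by (intro kernel_order_imp_integrable[OF K _ k]) (auto simp: kernel_order_def)
    let ?K = "\<lambda>x. complex_of_real (K x)"
    have intK': "integrable lborel ?K" using intK by (rule integrable_of_real)
    have "AE u in lborel. FK u = fourier ?K u"
    proof (rule fourier_function_AE_unique[OF F])
      show "tempered_function (fourier ?K)"
        by (rule bounded_imp_tempered_function[OF fourier_measurable[OF intK'] fourier_of_integrable_bound])
      show "kernel_distribution K (fourier \<phi>) = function_distribution (fourier ?K) \<phi>" if "\<phi> \<in> test_functions" for \<phi>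
        unfolding kernel_distribution_def function_distribution_def
        using fourier_duality[OF sigma_finite_lborel _ intK' test_function_integrable[OF that]]
        by (simp add: fourier_def[of ?K])
    qed
    then have eq: "FK u = fourier ?K u" for u
      by (rule continuous_AE_eq[OF contF fourier_continuous[OF intK']])
    define B where "B = 2 * (LINT x|lborel. \<bar>x\<bar> powr k * \<bar>K x\<bar>) + 1"
    have "(LINT x|lborel. \<bar>x\<bar> powr k * \<bar>K x\<bar>) \<ge> 0" by (intro integral_nonneg_AE) auto
    then have B: "B > 0" unfolding B_def by linarith
    show ?thesis
    proof (rule that[of "\<bar>RK\<bar> + 1" B])
      show "FK \<in> borel_measurable borel" by (rule borel_measurable_continuous_onI[OF contF])
      show "cmod (FK u) \<le> \<bar>RK\<bar> + 1" for u using bF[of u] by linarith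
      show "cmod (1 - FK u) \<le> B * \<bar>u\<bar> powr k" for u
      proof -
        have "cmod (1 - FK u) = cmod (fourier ?K u - fourier ?K 0)"
          using FK0 eq by (metis norm_minus_commute)
        also have "\<dots> \<le> 2 * (LINT x|lborel. \<bar>x\<bar> powr k * \<bar>K x\<bar>) * \<bar>u\<bar> powr k"
          using * by (intro kernel_transform_near_0 k intK) auto
        also have "\<dots> \<le> B * \<bar>u\<bar> powr k" unfolding B_def by (intro mult_right_mono) auto
        finally show ?thesis .
      qed
    qed (use B z in auto)
  qed
qed

section \<open>Levy processes of the model\<close>

text \<open>The analytic content of the model assumptions: \<open>m\<close> is \<open>x \<nu>(dx)\<close> for the Levy measure \<open>\<nu>\<close> of a process of
  finite variation with finite second moment.\<close>
locale jump_measure =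
  fixes \<nu> :: "real measure" and m :: signed
  assumes levy: "levy_measure \<nu>"
    and small: "(\<integral>\<^sup>+x\<in>{-1..1}. ennreal \<bar>x\<bar> \<partial>\<nu>) < \<infinity>"
    and square: "(\<integral>\<^sup>+x. ennreal (\<bar>x\<bar>\<^sup>2) \<partial>\<nu>) < \<infinity>"
    and jump: "is_jump_measure m \<nu>"
begin

lemma sets_nu [measurable_cong]: "sets \<nu> = sets borel"
  using levy by (simp add: levy_measure_def)

lemma integrable_sq: "integrable \<nu> (\<lambda>x. x\<^sup>2)"
  using square by (intro integrableI_bounded) (auto simp: abs_mult power2_eq_square)

lemma integrable_id: "integrable \<nu> (\<lambda>x. x)"
proof (rule integrableI_bounded)
  have "(\<integral>\<^sup>+x. ennreal (norm x) \<partial>\<nu>) \<le> (\<integral>\<^sup>+x. ennreal \<bar>x\<bar> * indicator {-1..1} x + ennreal (\<bar>x\<bar>\<^sup>2) \<partial>\<nu>)"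
  proof (rule nn_integral_mono)
    fix x :: real
    show "ennreal (norm x) \<le> ennreal \<bar>x\<bar> * indicator {-1..1} x + ennreal (\<bar>x\<bar>\<^sup>2)"
    proof (cases "x \<in> {-1..1}")
      case False
      then have "1 \<le> \<bar>x\<bar>" by auto
      then have "\<bar>x\<bar> * 1 \<le> \<bar>x\<bar> * \<bar>x\<bar>" by (intro mult_left_mono) auto
      then show ?thesis using False by (auto simp: power2_eq_square abs_mult[symmetric] intro!: ennreal_leI)
    qed simp
  qed
  also have "\<dots> = (\<integral>\<^sup>+x\<in>{-1..1}. ennreal \<bar>x\<bar> \<partial>\<nu>) + (\<integral>\<^sup>+x. ennreal (\<bar>x\<bar>\<^sup>2) \<partial>\<nu>)"
    by (rule nn_integral_add) auto
  also have "\<dots> < \<infinity>" using small square by simp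
  finally show "(\<integral>\<^sup>+x. ennreal (norm x) \<partial>\<nu>) < \<infinity>" .
qed measurable

abbreviation \<Psi> :: "real \<Rightarrow> complex" where "\<Psi> \<equiv> levy_exponent \<nu>"

definition \<Psi>1 :: "real \<Rightarrow> complex" where "\<Psi>1 u = (LINT x|\<nu>. \<i> * of_real x * iexp (u * x))"
definition \<Psi>2 :: "real \<Rightarrow> complex" where "\<Psi>2 u = (LINT x|\<nu>. - of_real (x\<^sup>2) * iexp (u * x))"

lemma integrable_iexp_minus_1: "integrable \<nu> (\<lambda>x. iexp (u * x) - 1)"
proof (rule Bochner_Integration.integrable_bound)
  show "integrable \<nu> (\<lambda>x. u * x)" using integrable_id by simp
  have "cmod (iexp y - 1) \<le> \<bar>y\<bar>" for y using iexp_approx1[of y 0] by simp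
  then show "AE x in \<nu>. norm (iexp (u * x) - 1) \<le> norm (u * x)"
    by (simp only: real_norm_def) simp
qed measurable

lemma integrable_x_iexp: "integrable \<nu> (\<lambda>x. \<i> * of_real x * iexp (u * x))"
  by (rule Bochner_Integration.integrable_bound[OF integrable_id]) (auto simp: norm_mult)

lemma levy_exponent_deriv: "(\<Psi> has_vector_derivative \<Psi>1 u) (at u)"
  unfolding levy_exponent_def[abs_def] \<Psi>1_def
proof (rule has_vector_derivative_integral[where w="\<lambda>x. \<bar>x\<bar>"])
  show "((\<lambda>t. iexp (t * x) - 1) has_vector_derivative \<i> * of_real x * iexp (t * x)) (at t)" for t x
    using has_vector_derivative_diff[OF has_vector_derivative_iexp[of x t] has_vector_derivative_const[of 1]] by simp
  show "integrable \<nu> (\<lambda>x. iexp (t * x) - 1)" for t by (rule integrable_iexp_minus_1)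
  show "integrable \<nu> (\<lambda>x. \<bar>x\<bar>)" using integrable_id by (rule integrable_abs)
qed (auto simp: norm_mult)

lemma levy_exponent_deriv2: "(\<Psi>1 has_vector_derivative \<Psi>2 u) (at u)"
  unfolding \<Psi>1_def[abs_def] \<Psi>2_def
proof (rule has_vector_derivative_integral[where w="\<lambda>x. x\<^sup>2"])
  show "((\<lambda>t. \<i> * of_real x * iexp (t * x)) has_vector_derivative - of_real (x\<^sup>2) * iexp (t * x)) (at t)" for t x
    using has_vector_derivative_mult_right[OF has_vector_derivative_iexp[of x t], of "\<i> * of_real x"]
    by (simp add: power2_eq_square mult_ac)
  show "integrable \<nu> (\<lambda>x. \<i> * of_real x * iexp (t * x))" for t by (rule integrable_x_iexp)
  show "integrable \<nu> (\<lambda>x. x\<^sup>2)" by (rule integrable_sq)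
qed (auto simp: norm_mult norm_power)

lemma vderiv_levy_exponent: "vderiv 1 \<Psi> = \<Psi>1" "vderiv 2 \<Psi> = \<Psi>2"
proof -
  show 1: "vderiv 1 \<Psi> = \<Psi>1"
    using vderiv_Suc[of 0 \<Psi>] vector_derivative_at[OF levy_exponent_deriv] by (simp add: fun_eq_iff)
  show "vderiv 2 \<Psi> = \<Psi>2"
  proof
    have one: "vderiv (Suc 0) \<Psi> = \<Psi>1" using 1 by simp
    show "vderiv 2 \<Psi> x = \<Psi>2 x" for x
      by (simp only: numeral_2_eq_2 vderiv_Suc[of "Suc 0"] one vector_derivative_at[OF levy_exponent_deriv2])
  qed
qed

lemma levy_exponent_0: "\<Psi> 0 = 0" by (simp add: levy_exponent_def)

lemma Psi2_continuous: "continuous_on A \<Psi>2"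
proof -
  have "continuous_on A (\<lambda>u. LINT x|\<nu>. iexp (u * x) * (- complex_of_real (x\<^sup>2)))"
    by (rule continuous_signed_char[OF _ sets_nu])
       (intro Bochner_Integration.integrable_minus integrable_of_real integrable_sq)
  then show ?thesis unfolding \<Psi>2_def[abs_def] by (simp only: mult.commute)
qed

text \<open>The total variation of \<open>m\<close>.  Unlike \<open>\<nu>\<close> it is finite, and \<open>m\<close> has the density \<open>sgn\<close> with respect to it.\<close>
definition weighted :: "real measure" where "weighted = density \<nu> (\<lambda>x. ennreal \<bar>x\<bar>)"

sublocale signed_density weighted sgn m
proof -
  have sp: "space \<nu> = UNIV" using sets_eq_imp_space_eq[OF sets_nu] by simp
  have "emeasure weighted (space weighted) = (\<integral>\<^sup>+x. ennreal \<bar>x\<bar> \<partial>\<nu>)"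
    unfolding weighted_def by (subst emeasure_density) (auto simp: sp)
  also have "\<dots> < \<infinity>" using integrable_id by (simp add: integrable_iff_bounded)
  finally have fin: "emeasure weighted (space weighted) \<noteq> \<infinity>" by simp
  interpret finite_measure weighted by (rule finite_measureI[OF fin])
  show "signed_density weighted sgn m"
  proof unfold_locales
    show s: "sets weighted = sets borel" by (simp add: weighted_def sets_nu)
    show "integrable weighted sgn"
      by (rule integrable_const_bound[of _ 1]) (auto simp: abs_sgn_eq measurable_cong_sets[OF s refl])
    fix A :: "real set" assume A: "A \<in> sets borel"
    have "(LINT x:A|weighted. sgn x) = (LINT x|\<nu>. \<bar>x\<bar> *\<^sub>R (indicator A x *\<^sub>R sgn x))"
      unfolding set_lebesgue_integral_def weighted_def
      by (rule integral_density) (use A in \<open>auto simp: measurable_cong_sets[OF sets_nu refl]\<close>)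
    also have "\<dots> = (LINT x:A|\<nu>. x)"
      unfolding set_lebesgue_integral_def
      by (rule Bochner_Integration.integral_cong) (auto simp: abs_mult_sgn mult_ac)
    finally show "m A = (LINT x:A|weighted. sgn x)"
      using jump A by (simp add: is_jump_measure_def)
  qed
qed

lemma transform_eq: "transform u = (LINT x|\<nu>. iexp (u * x) * of_real x)"
proof -
  have "transform u = (LINT x|\<nu>. \<bar>x\<bar> *\<^sub>R (iexp (u * x) * of_real (sgn x)))"
    unfolding transform_def by (subst weighted_def, rule integral_density) auto
  also have "\<dots> = (LINT x|\<nu>. iexp (u * x) * of_real x)"
  proof (rule Bochner_Integration.integral_cong)
    fix x :: real
    have "\<bar>x\<bar> *\<^sub>R (iexp (u * x) * of_real (sgn x)) = iexp (u * x) * of_real (\<bar>x\<bar> * sgn x)"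
      by (simp add: scaleR_conv_of_real mult_ac)
    then show "\<bar>x\<bar> *\<^sub>R (iexp (u * x) * of_real (sgn x)) = iexp (u * x) * of_real x"
      by (simp add: abs_mult_sgn)
  qed simp
  finally show ?thesis .
qed

text \<open>This is the identity on which the estimator rests.\<close>
lemma Psi1_eq: "\<Psi>1 u = \<i> * transform u"
proof -
  have "\<Psi>1 u = (LINT x|\<nu>. \<i> * (iexp (u * x) * of_real x))"
    unfolding \<Psi>1_def by (simp add: mult_ac)
  then show ?thesis by (simp only: transform_eq integral_mult_right_zero)
qed

lemma Psi1_continuous: "continuous_on A \<Psi>1"
  using transform_continuous[of A] unfolding Psi1_eq[abs_def] by (intro continuous_intros)

lemma transform_signed_integral: "transform u = signed_integral m (\<lambda>x. iexp (u * x))"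
proof -
  have "signed_integral m (\<lambda>x. iexp (u * x)) = (LINT x|weighted. of_real (sgn x) * iexp (u * x))"
    by (rule signed_integral_density[OF _ q m, of _ 1]) (auto simp: weighted_def sets_nu)
  then show ?thesis by (simp add: transform_def mult.commute)
qed

end

text \<open>The measure \<open>m\<close> determines \<open>\<Psi>'\<close>, hence \<open>\<Psi>\<close>.  The bounds of the class are stated for one process
  associated with \<open>m\<close>, and the risk is taken over all of them; this lemma transfers the bounds.\<close>
lemma levy_exponent_unique:
  assumes "jump_measure \<nu> m" "jump_measure \<nu>' m"
  shows "levy_exponent \<nu> = levy_exponent \<nu>'"
proof -
  interpret A: jump_measure \<nu> m by fact
  interpret B: jump_measure \<nu>' m by fact
  have eq: "A.\<Psi>1 u = B.\<Psi>1 u" for u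
    by (simp add: A.Psi1_eq B.Psi1_eq A.transform_signed_integral B.transform_signed_integral)
  have d: "((\<lambda>u. levy_exponent \<nu> u - levy_exponent \<nu>' u) has_vector_derivative 0) (at u within UNIV)" for u
    using has_vector_derivative_diff[OF A.levy_exponent_deriv B.levy_exponent_deriv, of u] eq by simp
  obtain c where c: "\<And>u. levy_exponent \<nu> u - levy_exponent \<nu>' u = c"
    using has_vector_derivative_zero_constant[of UNIV, OF convex_UNIV d] by auto
  have "c = 0" using c[of 0] A.levy_exponent_0 B.levy_exponent_0 by simp
  with c show ?thesis by (auto simp: fun_eq_iff)
qed

text \<open>The compensator in the triplet cancels against the centering, since the small jumps are summable.\<close>
lemma pure_jump_levy_char:
  assumes pj: "pure_jump_levy P X \<nu>" and jm: "is_jump_measure m \<nu>"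
  shows "jump_measure \<nu> m"
    and "t \<ge> 0 \<Longrightarrow> char (distr P borel (X t)) u = exp (of_real t * levy_exponent \<nu> u)"
proof -
  show J: "jump_measure \<nu> m"
    using pj jm unfolding pure_jump_levy_def levy_triplet_def by unfold_locales auto
  interpret jump_measure \<nu> m by (rule J)
  show "char (distr P borel (X t)) u = exp (of_real t * levy_exponent \<nu> u)" if t: "t \<ge> 0"
  proof -
    define \<gamma> where "\<gamma> = (LINT x:{-1..1}|\<nu>. x)"
    have ind: "integrable \<nu> (\<lambda>x. indicator {-1..1} x *\<^sub>R x)"
      using integrable_mult_indicator[OF _ integrable_id, of "{-1..1}"] by (simp add: sets_nu)
    have i2: "integrable \<nu> (\<lambda>x. (\<i> * of_real u) * complex_of_real (indicator {-1..1} x *\<^sub>R x))"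
      using ind by (intro integrable_mult_right integrable_of_real)
    have "(CLINT x|\<nu>. iexp (u * x) - 1 - (if \<bar>x\<bar> \<le> 1 then \<i> * of_real (u * x) else 0))
       = (CLINT x|\<nu>. (iexp (u * x) - 1) - (\<i> * of_real u) * complex_of_real (indicator {-1..1} x *\<^sub>R x))"
      by (rule Bochner_Integration.integral_cong) (auto simp: indicator_def abs_le_iff)
    also have "\<dots> = (CLINT x|\<nu>. iexp (u * x) - 1) - (CLINT x|\<nu>. (\<i> * of_real u) * complex_of_real (indicator {-1..1} x *\<^sub>R x))"
      by (rule Bochner_Integration.integral_diff[OF integrable_iexp_minus_1 i2])
    also have "(CLINT x|\<nu>. (\<i> * of_real u) * complex_of_real (indicator {-1..1} x *\<^sub>R x)) = \<i> * of_real (\<gamma> * u)"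
      unfolding \<gamma>_def set_lebesgue_integral_def by (simp only: integral_mult_right_zero integral_complex_of_real) simp
    finally have "(CLINT x|\<nu>. iexp (u * x) - 1 - (if \<bar>x\<bar> \<le> 1 then \<i> * of_real (u * x) else 0))
      = levy_exponent \<nu> u - \<i> * of_real (\<gamma> * u)" unfolding levy_exponent_def .
    moreover have "char (distr P borel (X t)) u =
        exp (of_real t * (\<i> * of_real (\<gamma> * u) - of_real (0 * u\<^sup>2 / 2) +
          (CLINT x|\<nu>. iexp (u * x) - 1 - (if \<bar>x\<bar> \<le> 1 then \<i> * of_real (u * x) else 0))))"
      using pj t unfolding pure_jump_levy_def levy_triplet_def \<gamma>_def by blast
    ultimately show ?thesis by simp
  qed
qed

text \<open>The second difference quotients of the real part of the characteristic function at \<open>0\<close> are integrals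
  of nonnegative functions that tend to \<open>x\<^sup>2\<close>; Fatou's lemma bounds the second moment by a bound for these quotients.\<close>
lemma second_moment_of_char:
  assumes M: "real_distribution M"
    and d1: "\<And>u. (char M has_vector_derivative c1 u) (at u)"
    and d2: "\<And>u. (c1 has_vector_derivative c2 u) (at u)"
    and c: "continuous_on UNIV c2"
  shows "integrable M (\<lambda>x. x\<^sup>2)"
proof -
  interpret M: real_distribution M by fact
  define g where "g u = Re (char M u)" for u
  have g_deriv: "(g has_real_derivative Re (c1 u)) (at u)" for u
    unfolding g_def has_real_derivative_iff_has_vector_derivative
    by (rule bounded_linear.has_vector_derivative[OF bounded_linear_Re d1])
  have g_int: "g u = (LINT x|M. cos (u * x))" and int_cos: "integrable M (\<lambda>x. cos (u * x))" for u
  proof -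
    show "integrable M (\<lambda>x. cos (u * x))" by (rule M.integrable_const_bound[of _ 1]) auto
    have "integrable M (\<lambda>x. iexp (u * x))" by (rule M.integrable_iexp) auto
    from integral_Re[OF this] show "g u = (LINT x|M. cos (u * x))"
      unfolding g_def char_def by (simp add: Re_exp)
  qed
  have g_even: "g (- u) = g u" for u by (simp add: g_int)
  have g0: "g 0 = 1" using M.prob_space by (simp add: g_int)
  have c1_0: "Re (c1 0) = 0"
  proof -
    have "((\<lambda>u. g (- u)) has_real_derivative Re (c1 (- 0)) * (- 1)) (at 0)"
      by (rule DERIV_chain2[OF g_deriv]) (auto intro!: derivative_eq_intros)
    then have "(g has_real_derivative - Re (c1 0)) (at 0)" by (simp add: g_even)
    from DERIV_unique[OF this g_deriv] show ?thesis by simp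
  qed
  obtain B where B: "B > 0" "\<And>u. u \<in> {0..1} \<Longrightarrow> cmod (c2 u) \<le> B"
  proof -
    have "bounded (c2 ` {0..1})"
      by (intro compact_imp_bounded compact_continuous_image continuous_on_subset[OF c]) auto
    then show ?thesis using that unfolding bounded_pos by auto
  qed
  have c1_bound: "\<bar>Re (c1 t)\<bar> \<le> B" if t: "t \<in> {0..1}" for t
  proof -
    have "norm (c1 t - c1 0) \<le> B * norm (t - 0)"
    proof (rule differentiable_bound[of "{0..1}" c1 "\<lambda>t h. h *\<^sub>R c2 t"])
      fix s :: real assume s: "s \<in> {0..1}"
      show "(c1 has_derivative (\<lambda>h. h *\<^sub>R c2 s)) (at s within {0..1})"
        using d2[of s] unfolding has_vector_derivative_def by (rule has_derivative_at_withinI)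
      show "onorm (\<lambda>h. h *\<^sub>R c2 s) \<le> B"
        by (rule onorm_le) (use mult_right_mono[OF B(2)[OF s] abs_ge_zero] in \<open>simp add: mult.commute\<close>)
    qed (use t in auto)
    also have "\<dots> \<le> B * 1" using t B by (intro mult_left_mono) auto
    finally have "\<bar>Re (c1 t - c1 0)\<bar> \<le> B" using abs_Re_le_cmod order_trans by fastforce
    then show ?thesis using c1_0 by simp
  qed
  have g_bound: "\<bar>g h - 1\<bar> \<le> B * h\<^sup>2" if h: "h \<in> {0..1}" for h
  proof -
    have "norm (g h - g 0) \<le> (B * h) * norm (h - 0)"
    proof (rule differentiable_bound[of "{0..h}" g "\<lambda>t x. Re (c1 t) * x"])
      fix s :: real assume s: "s \<in> {0..h}"
      show "(g has_derivative (*) (Re (c1 s))) (at s within {0..h})"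
        using g_deriv[of s] unfolding has_field_derivative_def by (rule has_derivative_at_withinI)
      have "norm (c1 s - c1 0) \<le> B * norm (s - 0)"
      proof (rule differentiable_bound[of "{0..1}" c1 "\<lambda>t h. h *\<^sub>R c2 t"])
        fix s :: real assume s: "s \<in> {0..1}"
        show "(c1 has_derivative (\<lambda>h. h *\<^sub>R c2 s)) (at s within {0..1})"
          using d2[of s] unfolding has_vector_derivative_def by (rule has_derivative_at_withinI)
        show "onorm (\<lambda>h. h *\<^sub>R c2 s) \<le> B"
          by (rule onorm_le) (use mult_right_mono[OF B(2)[OF s] abs_ge_zero] in \<open>simp add: mult.commute\<close>)
      qed (use s h in auto)
      then have "\<bar>Re (c1 s)\<bar> \<le> B * \<bar>s\<bar>"
        using abs_Re_le_cmod[of "c1 s - c1 0"] c1_0 by simp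
      also have "\<dots> \<le> B * h" using s B by (intro mult_left_mono) auto
      finally show "onorm ((*) (Re (c1 s))) \<le> B * h"
        by (intro onorm_le) (simp add: abs_mult mult_right_mono)
    qed (use h in auto)
    then show ?thesis using h g0 by (simp add: power2_eq_square mult_ac)
  qed
  \<comment> \<open>second difference quotients with step \<open>1 / (n + 1)\<close>\<close>
  define f where "f n x = 2 * (real (Suc n))\<^sup>2 * (1 - cos (1 / real (Suc n) * x))" for n :: nat and x :: real
  have f_nonneg: "f n x \<ge> 0" for n x by (simp add: f_def)
  have f_int: "(\<integral>\<^sup>+x. ennreal (f n x) \<partial>M) \<le> ennreal (2 * B)" for n
  proof -
    let ?h = "1 / real (Suc n)"
    have i: "integrable M (f n)"
      unfolding f_def by (intro integrable_mult_right Bochner_Integration.integrable_diff int_cos) auto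
    have "(\<integral>\<^sup>+x. ennreal (f n x) \<partial>M) = ennreal (LINT x|M. f n x)"
      by (rule nn_integral_eq_integral[OF i]) (simp add: f_nonneg)
    also have "(LINT x|M. f n x) = 2 * (real (Suc n))\<^sup>2 * (1 - g ?h)"
      unfolding f_def integral_mult_right_zero
      using M.prob_space int_cos[of ?h]
      by (subst Bochner_Integration.integral_diff) (auto simp: g_int)
    also have "\<dots> \<le> 2 * (real (Suc n))\<^sup>2 * (B * ?h\<^sup>2)"
      using g_bound[of ?h] by (intro mult_left_mono) auto
    also have "\<dots> = 2 * B" by (simp add: power_divide)
    finally show ?thesis by (simp add: ennreal_leI)
  qed
  have f_lim: "(\<lambda>n. f n x) \<longlonglongrightarrow> x\<^sup>2" for x
  proof -
    have "(\<lambda>n. 2 * (real (Suc n))\<^sup>2 * (1 - cos (1 / real (Suc n) * x))) \<longlonglongrightarrow> x\<^sup>2"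
    proof (cases "x = 0")
      case False then show ?thesis by (real_asymp simp: power2_eq_square)
    qed simp
    then show ?thesis unfolding f_def .
  qed
  have "(\<integral>\<^sup>+x. ennreal (x\<^sup>2) \<partial>M) = (\<integral>\<^sup>+x. liminf (\<lambda>n. ennreal (f n x)) \<partial>M)"
    by (intro nn_integral_cong lim_imp_Liminf[symmetric] tendsto_ennrealI f_lim) simp
  also have "\<dots> \<le> liminf (\<lambda>n. \<integral>\<^sup>+x. ennreal (f n x) \<partial>M)"
    by (rule nn_integral_liminf) (simp add: f_def)
  also have "\<dots> \<le> ennreal (2 * B)"
    by (rule Liminf_le) (use f_int in auto)
  finally have "(\<integral>\<^sup>+x. ennreal (norm (x\<^sup>2)) \<partial>M) < \<infinity>" by (simp add: le_less_trans)
  then show ?thesis by (intro integrableI_bounded) auto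
qed

lemma char_derivatives:
  assumes M: "real_distribution M" and sq: "integrable M (\<lambda>x. x\<^sup>2)"
  shows "(char M has_vector_derivative (LINT x|M. \<i> * of_real x * iexp (u * x))) (at u)"
    and "((\<lambda>u. LINT x|M. \<i> * of_real x * iexp (u * x)) has_vector_derivative (LINT x|M. - of_real (x\<^sup>2) * iexp (u * x))) (at u)"
proof -
  interpret M: real_distribution M by fact
  have abs: "integrable M (\<lambda>x. \<bar>x\<bar>)"
    using M.square_integrable_imp_integrable[of "\<lambda>x. x"] sq by simp
  have i1: "integrable M (\<lambda>x. \<i> * of_real x * iexp (u * x))" for u
    by (rule Bochner_Integration.integrable_bound[OF abs]) (auto simp: norm_mult)
  show "(char M has_vector_derivative (LINT x|M. \<i> * of_real x * iexp (u * x))) (at u)"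
    unfolding char_def[abs_def]
  proof (rule has_vector_derivative_integral[where w="\<lambda>x. \<bar>x\<bar>"])
    show "integrable M (\<lambda>x. iexp (t * x))" for t by (rule M.integrable_iexp) auto
    show "((\<lambda>t. iexp (t * x)) has_vector_derivative \<i> * of_real x * iexp (t * x)) (at t)" for t x
      by (rule has_vector_derivative_iexp)
  qed (auto intro: abs simp: norm_mult)
  show "((\<lambda>u. LINT x|M. \<i> * of_real x * iexp (u * x)) has_vector_derivative (LINT x|M. - of_real (x\<^sup>2) * iexp (u * x))) (at u)"
  proof (rule has_vector_derivative_integral[where w="\<lambda>x. x\<^sup>2"])
    show "((\<lambda>t. \<i> * of_real x * iexp (t * x)) has_vector_derivative - of_real (x\<^sup>2) * iexp (t * x)) (at t)" for t x
      using has_vector_derivative_mult_right[OF has_vector_derivative_iexp[of x t], of "\<i> * of_real x"]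
      by (simp add: power2_eq_square mult_ac)
    show "integrable M (\<lambda>x. \<i> * of_real x * iexp (t * x))" for t by (rule i1)
  qed (auto intro: sq simp: norm_mult norm_power)
qed

lemma (in jump_measure) increment_moments:
  assumes M: "real_distribution M" and ch: "\<And>u. char M u = exp (of_real t * \<Psi> u)"
  shows "integrable M (\<lambda>x. x\<^sup>2)"
    and "(LINT x|M. \<i> * of_real x * iexp (u * x)) = of_real t * \<Psi>1 u * exp (of_real t * \<Psi> u)"
    and "(LINT x|M. - of_real (x\<^sup>2) * iexp (u * x)) = (of_real t * \<Psi>2 u + (of_real t * \<Psi>1 u)\<^sup>2) * exp (of_real t * \<Psi> u)"
proof -
  have d1: "((\<lambda>u. exp (of_real t * \<Psi> u)) has_vector_derivative of_real t * \<Psi>1 u * exp (of_real t * \<Psi> u)) (at u)" for u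
    using field_vector_diff_chain_at[OF has_vector_derivative_mult_right[OF levy_exponent_deriv, of "of_real t"] DERIV_exp, of u]
    by (simp add: o_def)
  have d2: "((\<lambda>u. of_real t * \<Psi>1 u * exp (of_real t * \<Psi> u)) has_vector_derivative
      (of_real t * \<Psi>2 u + (of_real t * \<Psi>1 u)\<^sup>2) * exp (of_real t * \<Psi> u)) (at u)" for u
    using has_vector_derivative_mult[OF has_vector_derivative_mult_right[OF levy_exponent_deriv2, of "of_real t"] d1, of u]
    by (simp add: algebra_simps power2_eq_square)
  have ch': "char M = (\<lambda>u. exp (of_real t * \<Psi> u))" using ch by (simp add: fun_eq_iff)
  have cont: "continuous_on UNIV \<Psi>"
    using levy_exponent_deriv by (intro continuous_at_imp_continuous_on ballI) (auto intro: has_vector_derivative_continuous)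
  show sq: "integrable M (\<lambda>x. x\<^sup>2)"
    by (rule second_moment_of_char[OF M, unfolded ch', OF d1 d2])
       (intro continuous_intros Psi1_continuous Psi2_continuous cont)
  note c = char_derivatives[OF M sq]
  show 1: "(LINT x|M. \<i> * of_real x * iexp (u * x)) = of_real t * \<Psi>1 u * exp (of_real t * \<Psi> u)" for u
    using vector_derivative_unique_at[OF c(1)[unfolded ch'] d1] .
  show "(LINT x|M. - of_real (x\<^sup>2) * iexp (u * x)) = (of_real t * \<Psi>2 u + (of_real t * \<Psi>1 u)\<^sup>2) * exp (of_real t * \<Psi> u)"
    using vector_derivative_unique_at[OF c(2)[unfolded 1] d2] .
qed

section \<open>Moments of the empirical characteristic function\<close>

lemma (in prob_space) integrable_bounded:
  fixes f :: "'a \<Rightarrow> 'b::{banach, second_countable_topology}"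
  assumes "f \<in> borel_measurable M" "\<And>w. w \<in> space M \<Longrightarrow> norm (f w) \<le> B"
  shows "integrable M f"
  by (rule integrable_const_bound[of _ B]) (use assms in \<open>auto intro!: AE_I2\<close>)

text \<open>Expand the powers of \<open>y + S\<close>: the terms with a single factor \<open>y\<close> or \<open>S\<close> have mean zero.  The
  induction for the fourth moment needs the second one, so both are proved together.\<close>
lemma (in prob_space) fourth_moment_of_sum:
  fixes Y :: "'i \<Rightarrow> 'a \<Rightarrow> real"
  assumes "finite I" "indep_vars (\<lambda>_. borel) Y I"
    and "\<And>i w. i \<in> I \<Longrightarrow> w \<in> space M \<Longrightarrow> \<bar>Y i w\<bar> \<le> 2"
    and "\<And>i. i \<in> I \<Longrightarrow> expectation (Y i) = 0"
  shows "expectation (\<lambda>w. \<Sum>i\<in>I. Y i w) = 0 \<and> expectation (\<lambda>w. (\<Sum>i\<in>I. Y i w)\<^sup>2) \<le> 4 * real (card I)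
    \<and> expectation (\<lambda>w. (\<Sum>i\<in>I. Y i w) ^ 4) \<le> 48 * (real (card I))\<^sup>2"
  using assms
proof (induction I rule: finite_induct)
  case (insert i I)
  define y where "y = Y i"
  define S where "S w = (\<Sum>i\<in>I. Y i w)" for w
  have ind: "indep_var borel y borel S"
    using indep_vars_sum[OF insert(1,2,4)] by (simp add: y_def S_def[abs_def])
  have IH: "expectation S = 0" "expectation (\<lambda>w. (S w)\<^sup>2) \<le> 4 * real (card I)" "expectation (\<lambda>w. S w ^ 4) \<le> 48 * (real (card I))\<^sup>2"
    using insert.IH[OF indep_vars_subset[OF insert(4)]] insert(5,6) by (auto simp: S_def[abs_def])
  have meas [measurable]: "y \<in> borel_measurable M" "S \<in> borel_measurable M"
    using ind by (auto dest: indep_var_rv1 indep_var_rv2)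
  have y2: "\<bar>y w\<bar> \<le> 2" if "w \<in> space M" for w using insert(5) that by (simp add: y_def)
  have Sb: "\<bar>S w\<bar> \<le> 2 * real (card I)" if "w \<in> space M" for w
  proof -
    have "\<bar>S w\<bar> \<le> (\<Sum>i\<in>I. \<bar>Y i w\<bar>)" unfolding S_def by (rule sum_abs)
    also have "\<dots> \<le> (\<Sum>i\<in>I. 2)" using insert(5) that by (intro sum_mono) auto
    finally show ?thesis by simp
  qed
  have iy: "integrable M (\<lambda>w. y w ^ a)" for a
    by (rule integrable_bounded[of _ "2 ^ a"]) (use y2 in \<open>auto simp: power_abs intro!: power_mono\<close>)
  have iS: "integrable M (\<lambda>w. S w ^ a)" for a
  proof (rule integrable_bounded[of _ "(2 * real (card I)) ^ a"])
    show "norm (S w ^ a) \<le> (2 * real (card I)) ^ a" if "w \<in> space M" for w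
      unfolding real_norm_def power_abs by (intro power_mono Sb[OF that]) simp
  qed measurable
  have indp: "indep_var borel (\<lambda>w. y w ^ a) borel (\<lambda>w. S w ^ b)" for a b
    using indep_var_compose[OF ind, of "\<lambda>x. x ^ a" borel "\<lambda>x. x ^ b" borel] by (simp add: o_def)
  have iyS: "integrable M (\<lambda>w. y w ^ a * S w ^ b)" for a b
    by (rule indep_var_integrable[OF indp iy iS])
  have EyS: "expectation (\<lambda>w. y w ^ a * S w ^ b) = expectation (\<lambda>w. y w ^ a) * expectation (\<lambda>w. S w ^ b)" for a b
    by (rule indep_var_lebesgue_integral[OF indp iy iS])
  have Ey: "expectation y = 0" using insert(6) by (simp add: y_def)
  have Eyp: "expectation (\<lambda>w. y w ^ a) \<le> 2 ^ a" for a
  proof -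
    have "expectation (\<lambda>w. y w ^ a) \<le> expectation (\<lambda>w. 2 ^ a)"
    proof (rule integral_mono[OF iy])
      fix w assume "w \<in> space M"
      then have "\<bar>y w ^ a\<bar> \<le> 2 ^ a" using y2[of w] by (auto simp: power_abs intro!: power_mono)
      then show "y w ^ a \<le> 2 ^ a" by simp
    qed simp
    then show ?thesis by (simp add: prob_space)
  qed
  have sum_eq: "(\<Sum>i\<in>insert i I. Y i w) = y w + S w" for w
    using insert(1,2) by (simp add: y_def S_def)
  have iS1: "integrable M S" and iy1: "integrable M y" using iS[of 1] iy[of 1] by simp_all
  have E1: "expectation (\<lambda>w. y w + S w) = 0"
    using IH(1) Ey by (simp add: iS1 iy1)
  have "expectation (\<lambda>w. (y w + S w)\<^sup>2) = expectation (\<lambda>w. y w ^ 2 + 2 * (y w ^ 1 * S w ^ 1) + S w ^ 2)"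
    by (intro Bochner_Integration.integral_cong) (auto simp: power2_eq_square algebra_simps)
  also have "\<dots> = expectation (\<lambda>w. y w ^ 2) + 2 * (expectation (\<lambda>w. y w ^ 1) * expectation (\<lambda>w. S w ^ 1)) + expectation (\<lambda>w. S w ^ 2)"
    using iy[of 2] iS[of 2] iyS[of 1 1] EyS[of 1 1] by simp
  also have "\<dots> \<le> 4 * real (card (insert i I))"
    using IH Ey Eyp[of 2] insert(1,2) by simp
  finally have E2: "expectation (\<lambda>w. (y w + S w)\<^sup>2) \<le> 4 * real (card (insert i I))" .
  have "expectation (\<lambda>w. (y w + S w) ^ 4) = expectation (\<lambda>w. y w ^ 4 + 4 * (y w ^ 3 * S w ^ 1) + 6 * (y w ^ 2 * S w ^ 2)
      + 4 * (y w ^ 1 * S w ^ 3) + S w ^ 4)"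
    by (intro Bochner_Integration.integral_cong) (auto simp: eval_nat_numeral algebra_simps)
  also have "\<dots> = expectation (\<lambda>w. y w ^ 4) + 4 * (expectation (\<lambda>w. y w ^ 3) * expectation (\<lambda>w. S w ^ 1))
     + 6 * (expectation (\<lambda>w. y w ^ 2) * expectation (\<lambda>w. S w ^ 2))
     + 4 * (expectation (\<lambda>w. y w ^ 1) * expectation (\<lambda>w. S w ^ 3)) + expectation (\<lambda>w. S w ^ 4)"
    unfolding EyS[symmetric]
    by (simp only: Bochner_Integration.integral_add Bochner_Integration.integrable_add integrable_mult_right iy iS iyS integral_mult_right_zero)
  also have "\<dots> = expectation (\<lambda>w. y w ^ 4) + 6 * (expectation (\<lambda>w. y w ^ 2) * expectation (\<lambda>w. S w ^ 2)) + expectation (\<lambda>w. S w ^ 4)"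
    using IH(1) Ey by simp
  also have "\<dots> \<le> 16 + 6 * (4 * (4 * real (card I))) + 48 * (real (card I))\<^sup>2"
  proof -
    have "expectation (\<lambda>w. y w ^ 2) * expectation (\<lambda>w. S w ^ 2) \<le> 4 * (4 * real (card I))"
      using Eyp[of 2] IH(2) by (intro mult_mono) auto
    then show ?thesis using Eyp[of 4] IH(3) by simp
  qed
  also have "\<dots> \<le> 48 * (real (card (insert i I)))\<^sup>2"
    using insert(1,2) by (simp add: power2_eq_square algebra_simps)
  finally have E4: "expectation (\<lambda>w. (y w + S w) ^ 4) \<le> 48 * (real (card (insert i I)))\<^sup>2" .
  show ?case using E1 E2 E4 by (simp only: sum_eq) 
qed simp

text \<open>Let \<open>\<tau> = T powr (- 1 / 2)\<close> be the truncation level.  If \<open>\<bar>\<phi>\<bar> \<ge> 2 \<tau>\<close>, then truncation, or an \<open>x\<close> of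
  less than half the size of \<open>\<phi>\<close>, forces the deviation \<open>d\<close> to be at least \<open>\<bar>\<phi>\<bar> / 2\<close>, and this loss is paid
  for by higher powers of \<open>d\<close>.  If \<open>\<bar>\<phi>\<bar> < 2 \<tau>\<close>, the trivial bound \<open>\<bar>A\<bar> \<le> 1 / \<tau>\<close> is already of the right
  size.\<close>
lemma truncated_inverse_bounds:
  fixes x \<phi> :: complex and T :: real
  assumes T: "T > 0" and \<phi>: "\<phi> \<noteq> 0"
  defines "A \<equiv> if cmod x \<ge> T powr (- 1 / 2) then 1 / x else 0" and "d \<equiv> cmod (x - \<phi>)"
  shows "cmod A \<le> T powr (1 / 2)"
    and "(cmod (A - 1 / \<phi>))\<^sup>2 \<le> (4 * d\<^sup>2 + 4 * T * d ^ 4 + 40 / T) / cmod \<phi> ^ 4"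
    and "(cmod A)\<^sup>2 \<le> (4 + 2 * T * d\<^sup>2 + 2 * T\<^sup>2 * d ^ 4) / (cmod \<phi>)\<^sup>2"
proof -
  define \<tau> where "\<tau> = T powr (- 1 / 2)"
  define p where "p = cmod \<phi>"
  define r where "r = cmod x"
  have \<tau>: "\<tau> > 0" using T by (simp add: \<tau>_def)
  have \<tau>2: "\<tau>\<^sup>2 = 1 / T" unfolding \<tau>_def power2_eq_square powr_add[symmetric] using T by (simp add: powr_minus_divide)
  have \<tau>inv: "T powr (1 / 2) = 1 / \<tau>" by (simp add: \<tau>_def powr_minus_divide)
  have p: "p > 0" using \<phi> by (simp add: p_def)
  have d: "d \<ge> 0" by (simp add: d_def)
  have pd: "p \<le> r + d" "r \<le> p + d"
    unfolding p_def r_def d_def using norm_triangle_ineq[of "x" "\<phi> - x"] norm_triangle_ineq[of "x - \<phi>" "\<phi>"]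
    by (simp_all add: norm_minus_commute)
  have A_eq: "A = (if \<tau> \<le> r then 1 / x else 0)" by (simp only: A_def \<tau>_def r_def)
  have A0: "A = 0" if "r < \<tau>" using that by (simp add: A_def r_def \<tau>_def)
  have A1: "A = 1 / x" "r > 0" if "r \<ge> \<tau>"
    using that \<tau> A_eq by simp_all
  have A_le: "cmod A \<le> 1 / \<tau>"
  proof (cases "r \<ge> \<tau>")
    case True
    have "cmod A = 1 / r" using A1(1)[OF True] by (simp add: norm_divide r_def)
    also have "\<dots> \<le> 1 / \<tau>" using True \<tau> by (intro divide_left_mono) auto
    finally show ?thesis .
  qed (use A0 \<tau> in simp)
  show "cmod A \<le> T powr (1 / 2)" using A_le by (simp add: \<tau>inv)
  have A_sq: "(cmod A)\<^sup>2 \<le> T"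
    using power_mono[OF A_le, of 2] \<tau>2 T by (simp add: power_divide)
  have big: "(cmod (A - 1 / \<phi>))\<^sup>2 \<le> (4 * d\<^sup>2 + 4 * T * d ^ 4) / p ^ 4" if "p \<ge> 2 * \<tau>"
  proof (cases "r \<ge> \<tau>")
    case False
    then have "p / 2 \<le> d" using pd that by simp
    then have "p\<^sup>2 \<le> 4 * d\<^sup>2" using p power_mono[of "p / 2" d 2] by (simp add: power_divide)
    have "(cmod (A - 1 / \<phi>))\<^sup>2 = p\<^sup>2 / p ^ 4"
      using A0 False p by (simp add: norm_divide p_def power_divide) (simp add: eval_nat_numeral)
    also have "\<dots> \<le> (4 * d\<^sup>2 + 4 * T * d ^ 4) / p ^ 4"
      using \<open>p\<^sup>2 \<le> 4 * d\<^sup>2\<close> T p by (intro divide_right_mono) (auto intro: add_increasing2)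
    finally show ?thesis .
  next
    case True
    have r: "r > 0" using A1(2)[OF True] .
    have "x \<noteq> 0" using r by (auto simp: r_def)
    then have "A - 1 / \<phi> = (\<phi> - x) / (x * \<phi>)" using A1(1)[OF True] \<phi> by (simp add: field_simps)
    then have eq: "(cmod (A - 1 / \<phi>))\<^sup>2 = d\<^sup>2 / (r\<^sup>2 * p\<^sup>2)"
      by (simp add: norm_divide norm_mult d_def r_def p_def norm_minus_commute power_divide power_mult_distrib)
    have p4: "p ^ 4 = p\<^sup>2 * p\<^sup>2" by (simp add: eval_nat_numeral)
    show ?thesis
    proof (cases "r \<ge> p / 2")
      case True
      then have "p\<^sup>2 / 4 \<le> r\<^sup>2" using p power_mono[of "p / 2" r 2] by (simp add: power_divide)
      then have "d\<^sup>2 / (r\<^sup>2 * p\<^sup>2) \<le> d\<^sup>2 / (p\<^sup>2 / 4 * p\<^sup>2)"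
        using p r by (intro divide_left_mono mult_right_mono) auto
      also have "\<dots> = 4 * d\<^sup>2 / p ^ 4" unfolding p4 by simp
      also have "\<dots> \<le> (4 * d\<^sup>2 + 4 * T * d ^ 4) / p ^ 4"
        using T p by (intro divide_right_mono) auto
      finally show ?thesis using eq by simp
    next
      case False
      then have "p / 2 \<le> d" using pd by simp
      then have pd2: "p\<^sup>2 \<le> 4 * d\<^sup>2" using p power_mono[of "p / 2" d 2] by (simp add: power_divide)
      have "1 / T \<le> r\<^sup>2" using power_mono[OF \<open>r \<ge> \<tau>\<close>, of 2] \<tau> \<tau>2 by simp
      then have "d\<^sup>2 / (r\<^sup>2 * p\<^sup>2) \<le> d\<^sup>2 / (1 / T * p\<^sup>2)"
        using p r T by (intro divide_left_mono mult_right_mono) auto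
      also have "\<dots> = T * d\<^sup>2 * p\<^sup>2 / p ^ 4" using p by (simp add: field_simps eval_nat_numeral)
      also have "\<dots> \<le> T * d\<^sup>2 * (4 * d\<^sup>2) / p ^ 4"
        using T p pd2 by (intro divide_right_mono mult_left_mono) auto
      also have "\<dots> \<le> (4 * d\<^sup>2 + 4 * T * d ^ 4) / p ^ 4"
        using T p by (intro divide_right_mono) (auto simp: eval_nat_numeral)
      finally show ?thesis using eq by simp
    qed
  qed
  have small: "T * p\<^sup>2 \<le> 4" if "p < 2 * \<tau>"
  proof -
    have "p\<^sup>2 \<le> (2 * \<tau>)\<^sup>2" using that p by (intro power_mono) auto
    also have "\<dots> = 4 / T" using \<tau>2 by (simp add: power_mult_distrib)
    finally show ?thesis using T by (simp add: field_simps)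
  qed
  show "(cmod (A - 1 / \<phi>))\<^sup>2 \<le> (4 * d\<^sup>2 + 4 * T * d ^ 4 + 40 / T) / cmod \<phi> ^ 4"
  proof (cases "p \<ge> 2 * \<tau>")
    case True
    have "(4 * d\<^sup>2 + 4 * T * d ^ 4) / p ^ 4 \<le> (4 * d\<^sup>2 + 4 * T * d ^ 4 + 40 / T) / p ^ 4"
      using T p by (intro divide_right_mono) auto
    then show ?thesis using big[OF True] by (simp add: p_def)
  next
    case False
    then have s: "T * p\<^sup>2 \<le> 4" using small by simp
    have "cmod (A - 1 / \<phi>) \<le> cmod A + 1 / p"
      using norm_triangle_ineq4[of A "1 / \<phi>"] by (simp add: norm_divide p_def)
    then have "(cmod (A - 1 / \<phi>))\<^sup>2 \<le> (cmod A + 1 / p)\<^sup>2" by (intro power_mono) auto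
    also have "\<dots> \<le> 2 * (cmod A)\<^sup>2 + 2 * (1 / p)\<^sup>2"
      using sum_squares_bound[of "cmod A" "1 / p"] by (simp add: power2_sum)
    also have "\<dots> \<le> 2 * T + 2 * (1 / p)\<^sup>2" using A_sq by simp
    also have "\<dots> = (2 * (T * p\<^sup>2) * (T * p\<^sup>2) + 2 * (T * p\<^sup>2)) / (T * p ^ 4)"
      using T p by (simp add: field_simps eval_nat_numeral)
    also have "\<dots> \<le> (2 * 4 * 4 + 2 * 4) / (T * p ^ 4)"
      using s T p by (intro divide_right_mono add_mono mult_mono) auto
    also have "\<dots> = (40 / T) / p ^ 4" by simp
    also have "\<dots> \<le> (4 * d\<^sup>2 + 4 * T * d ^ 4 + 40 / T) / p ^ 4"
      using T p d by (intro divide_right_mono) auto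
    finally show ?thesis by (simp add: p_def)
  qed
  show "(cmod A)\<^sup>2 \<le> (4 + 2 * T * d\<^sup>2 + 2 * T\<^sup>2 * d ^ 4) / (cmod \<phi>)\<^sup>2"
  proof (cases "p \<ge> 2 * \<tau>")
    case True
    have "(2 * \<tau>)\<^sup>2 \<le> p\<^sup>2" using True \<tau> by (intro power_mono) auto
    then have Tp: "4 \<le> T * p\<^sup>2" using \<tau>2 T by (simp add: power_mult_distrib field_simps)
    have "cmod A \<le> cmod (A - 1 / \<phi>) + 1 / p"
      using norm_triangle_ineq[of "A - 1 / \<phi>" "1 / \<phi>"] by (simp add: norm_divide p_def)
    then have "(cmod A)\<^sup>2 \<le> (cmod (A - 1 / \<phi>) + 1 / p)\<^sup>2" by (intro power_mono) auto
    also have "\<dots> \<le> 2 * (cmod (A - 1 / \<phi>))\<^sup>2 + 2 * (1 / p)\<^sup>2"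
      using sum_squares_bound[of "cmod (A - 1 / \<phi>)" "1 / p"] by (simp add: power2_sum)
    also have "\<dots> \<le> 2 * ((4 * d\<^sup>2 + 4 * T * d ^ 4) / p ^ 4) + 2 * (1 / p)\<^sup>2"
      by (intro add_right_mono mult_left_mono big[OF True]) auto
    also have "(4 * d\<^sup>2 + 4 * T * d ^ 4) / p ^ 4 = (d\<^sup>2 + T * d ^ 4) / p\<^sup>2 * (4 / p\<^sup>2)"
      by (simp add: eval_nat_numeral field_simps)
    also have "\<dots> \<le> (d\<^sup>2 + T * d ^ 4) / p\<^sup>2 * T"
      using Tp T p by (intro mult_left_mono) (auto simp: field_simps)
    finally have "(cmod A)\<^sup>2 \<le> 2 * ((d\<^sup>2 + T * d ^ 4) / p\<^sup>2 * T) + 2 * (1 / p)\<^sup>2" by simp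
    also have "\<dots> = (2 + 2 * T * d\<^sup>2 + 2 * T\<^sup>2 * d ^ 4) / p\<^sup>2"
      using p by (simp add: field_simps eval_nat_numeral)
    also have "\<dots> \<le> (4 + 2 * T * d\<^sup>2 + 2 * T\<^sup>2 * d ^ 4) / p\<^sup>2"
      using p by (intro divide_right_mono) auto
    finally show ?thesis by (simp add: p_def)
  next
    case False
    have "(cmod A)\<^sup>2 \<le> T" by (rule A_sq)
    also have "T = (T * p\<^sup>2) / p\<^sup>2" using p by simp
    also have "\<dots> \<le> (4 + 2 * T * d\<^sup>2 + 2 * T\<^sup>2 * d ^ 4) / p\<^sup>2"
      using small False T p by (intro divide_right_mono) (auto intro!: add_increasing2)
    finally show ?thesis by (simp add: p_def)
  qed
qed

lemma borel_measurable_cnj [measurable]: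
  assumes "f \<in> borel_measurable M" shows "(\<lambda>x. cnj (f x)) \<in> borel_measurable M"
  by (rule measurable_compose[OF assms borel_measurable_continuous_onI]) (intro continuous_intros)

lemma ennreal_norm_integral_le:
  fixes f :: "'a \<Rightarrow> 'b::{banach, second_countable_topology}"
  shows "ennreal (norm (integral\<^sup>L M f)) \<le> (\<integral>\<^sup>+x. ennreal (norm (f x)) \<partial>M)"
  using integral_norm_bound_ennreal[of M f] by (cases "integrable M f") (auto simp: not_integrable_integral_eq)

text \<open>The square of the integral is a double integral, and Fubini moves the expectation inside.  The
  envelope \<open>W u * d x\<close> is what makes Fubini applicable.\<close>
lemma (in prob_space) second_moment_of_integral:
  fixes g :: "'a \<Rightarrow> real \<Rightarrow> complex"
  assumes g: "(\<lambda>(x, u). g x u) \<in> borel_measurable (M \<Otimes>\<^sub>M lborel)"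
    and bound: "\<And>x u. x \<in> space M \<Longrightarrow> cmod (g x u) \<le> W u * d x"
    and W: "integrable lborel W" "\<And>u. 0 \<le> W u" and d: "d \<in> borel_measurable M" "integrable M (\<lambda>x. (d x)\<^sup>2)"
    and d0: "\<And>x. 0 \<le> d x"
    and b: "\<And>u v. ennreal (cmod (LINT x|M. g x u * cnj (g x v))) \<le> b u v"
  shows "(\<integral>\<^sup>+x. ennreal ((cmod (LINT u|lborel. g x u))\<^sup>2) \<partial>M) \<le> (\<integral>\<^sup>+u. \<integral>\<^sup>+v. b u v \<partial>lborel \<partial>lborel)"
proof -
  interpret PL: pair_sigma_finite M lborel by unfold_locales
  note [measurable] = g borel_measurable_integrable[OF W(1)] d(1)
  have gu [measurable]: "(\<lambda>x. g x u) \<in> borel_measurable M" for u by measurable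
  have gx: "g x \<in> borel_measurable lborel" if "x \<in> space M" for x using that by measurable
  define I where "I x = (LINT u|lborel. g x u)" for x
  have I_meas [measurable]: "I \<in> borel_measurable M" unfolding I_def by measurable
  have int_gx: "integrable lborel (g x)" if "x \<in> space M" for x
  proof (rule Bochner_Integration.integrable_bound)
    show "integrable lborel (\<lambda>u. W u * d x)" using W(1) by simp
    show "AE u in lborel. norm (g x u) \<le> norm (W u * d x)"
      using bound[OF that] W(2) d0 by (intro AE_I2) simp
  qed (rule gx[OF that])
  have I_bound: "cmod (I x) \<le> (LINT u|lborel. W u) * d x" if "x \<in> space M" for x
  proof -
    have "cmod (I x) \<le> (LINT u|lborel. W u * d x)"
      unfolding I_def
      by (rule Bochner_Integration.integral_norm_bound_integral) (use int_gx bound that W in auto)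
    then show ?thesis by simp
  qed
  have prod_int: "integrable (M \<Otimes>\<^sub>M lborel) (\<lambda>(x, u). f x u)"
    if [measurable]: "(\<lambda>(x, u). f x u) \<in> borel_measurable (M \<Otimes>\<^sub>M lborel)"
      and f: "\<And>x u. x \<in> space M \<Longrightarrow> cmod (f x u) \<le> V u * (d x)\<^sup>2" and V: "integrable lborel V" "\<And>u. V u \<ge> 0"
    for f :: "'a \<Rightarrow> real \<Rightarrow> complex" and V
  proof (rule Bochner_Integration.integrable_bound)
    note [measurable] = borel_measurable_integrable[OF V(1)]
    show "integrable (M \<Otimes>\<^sub>M lborel) (\<lambda>(x, u). (d x)\<^sup>2 * V u)"
    proof (rule PL.Fubini_integrable)
      show "integrable M (\<lambda>x. LINT y|lborel. norm (case (x, y) of (x, u) \<Rightarrow> (d x)\<^sup>2 * V u))"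
        using d(2) by (simp add: abs_mult)
      show "AE x in M. integrable lborel (\<lambda>y. case (x, y) of (x, u) \<Rightarrow> (d x)\<^sup>2 * V u)"
        using V by simp
    qed measurable
    show "AE x in M \<Otimes>\<^sub>M lborel. norm (case x of (x, u) \<Rightarrow> f x u) \<le> norm (case x of (x, u) \<Rightarrow> (d x)\<^sup>2 * V u)"
      using f V(2) by (intro AE_I2) (auto simp: space_pair_measure abs_mult mult.commute)
  qed measurable
  have e1: "(LINT x|M. I x * cnj (I x)) = (LINT u|lborel. LINT x|M. g x u * cnj (I x))"
  proof -
    have "integrable (M \<Otimes>\<^sub>M lborel) (\<lambda>(x, u). g x u * cnj (I x))"
    proof (rule prod_int[of _ "\<lambda>u. W u * (LINT u|lborel. W u)"])
      fix x u assume x: "x \<in> space M"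
      have "cmod (g x u * cnj (I x)) \<le> (W u * d x) * ((LINT u|lborel. W u) * d x)"
        unfolding norm_mult complex_mod_cnj using bound[OF x] I_bound[OF x] W(2) d0 by (intro mult_mono) auto
      then show "cmod (g x u * cnj (I x)) \<le> W u * (LINT u|lborel. W u) * (d x)\<^sup>2"
        by (simp add: power2_eq_square mult_ac)
    next
      show "(\<lambda>(x, u). g x u * cnj (I x)) \<in> borel_measurable (M \<Otimes>\<^sub>M lborel)"
        by measurable
    qed (use W in auto)
    from PL.Fubini_integral[OF this]
    have "(LINT x|M. LINT u|lborel. g x u * cnj (I x)) = (LINT u|lborel. LINT x|M. g x u * cnj (I x))" by simp
    then show ?thesis by (simp add: I_def)
  qed
  have e2: "(LINT x|M. g x u * cnj (I x)) = (LINT v|lborel. LINT x|M. g x u * cnj (g x v))" for u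
  proof -
    have "integrable (M \<Otimes>\<^sub>M lborel) (\<lambda>(x, v). g x u * cnj (g x v))"
    proof (rule prod_int[of _ "\<lambda>v. W u * W v"])
      fix x v assume x: "x \<in> space M"
      have "cmod (g x u * cnj (g x v)) \<le> (W u * d x) * (W v * d x)"
        unfolding norm_mult complex_mod_cnj using bound[OF x] W(2) d0 by (intro mult_mono) auto
      then show "cmod (g x u * cnj (g x v)) \<le> W u * W v * (d x)\<^sup>2"
        by (simp add: power2_eq_square mult_ac)
    qed (use W in auto)
    from PL.Fubini_integral[OF this]
    have "(LINT x|M. LINT v|lborel. g x u * cnj (g x v)) = (LINT v|lborel. LINT x|M. g x u * cnj (g x v))" by simp
    moreover have "g x u * cnj (I x) = (LINT v|lborel. g x u * cnj (g x v))" for x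
      by (simp add: I_def)
    ultimately show ?thesis by (simp only:)
  qed
  have int_I: "integrable M (\<lambda>x. (cmod (I x))\<^sup>2)"
  proof (rule Bochner_Integration.integrable_bound)
    show "integrable M (\<lambda>x. (LINT u|lborel. W u)\<^sup>2 * (d x)\<^sup>2)" using d(2) by simp
    show "AE x in M. norm ((cmod (I x))\<^sup>2) \<le> norm ((LINT u|lborel. W u)\<^sup>2 * (d x)\<^sup>2)"
      using I_bound by (intro AE_I2) (auto simp: abs_mult simp flip: power_mult_distrib intro!: power_mono)
  qed measurable
  have "(\<integral>\<^sup>+x. ennreal ((cmod (I x))\<^sup>2) \<partial>M) = ennreal (LINT x|M. (cmod (I x))\<^sup>2)"
    by (rule nn_integral_eq_integral[OF int_I]) simp
  also have "(LINT x|M. (cmod (I x))\<^sup>2) = cmod (complex_of_real (LINT x|M. (cmod (I x))\<^sup>2))"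
    by simp
  also have "complex_of_real (LINT x|M. (cmod (I x))\<^sup>2) = (LINT x|M. I x * cnj (I x))"
    unfolding integral_complex_of_real[symmetric] by (simp add: complex_mult_cnj cmod_power2)
  also have "\<dots> = (LINT u|lborel. LINT v|lborel. LINT x|M. g x u * cnj (g x v))"
    unfolding e1 e2 ..
  finally have "(\<integral>\<^sup>+x. ennreal ((cmod (I x))\<^sup>2) \<partial>M)
     = ennreal (cmod (LINT u|lborel. LINT v|lborel. LINT x|M. g x u * cnj (g x v)))" .
  also have "\<dots> \<le> (\<integral>\<^sup>+u. ennreal (cmod (LINT v|lborel. LINT x|M. g x u * cnj (g x v))) \<partial>lborel)"
    by (rule ennreal_norm_integral_le)
  also have "\<dots> \<le> (\<integral>\<^sup>+u. \<integral>\<^sup>+v. ennreal (cmod (LINT x|M. g x u * cnj (g x v))) \<partial>lborel \<partial>lborel)"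
    by (intro nn_integral_mono ennreal_norm_integral_le)
  also have "\<dots> \<le> (\<integral>\<^sup>+u. \<integral>\<^sup>+v. b u v \<partial>lborel \<partial>lborel)"
    by (intro nn_integral_mono b)
  finally show ?thesis by (simp add: I_def)
qed

lemma (in prob_space) expectation_product_le:
  fixes a b :: "'a \<Rightarrow> real"
  assumes [measurable]: "a \<in> borel_measurable M" "b \<in> borel_measurable M"
    and i: "integrable M (\<lambda>x. (a x)\<^sup>2)" "integrable M (\<lambda>x. (b x)\<^sup>2)"
    and E: "expectation (\<lambda>x. (a x)\<^sup>2) \<le> \<alpha>\<^sup>2" "expectation (\<lambda>x. (b x)\<^sup>2) \<le> \<beta>\<^sup>2" and pos: "\<alpha> > 0" "\<beta> > 0"
  shows "expectation (\<lambda>x. \<bar>a x * b x\<bar>) \<le> \<alpha> * \<beta>"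
proof -
  have "expectation (\<lambda>x. \<bar>a x * b x\<bar>) \<le> expectation (\<lambda>x. \<beta> / (2 * \<alpha>) * (a x)\<^sup>2 + \<alpha> / (2 * \<beta>) * (b x)\<^sup>2)"
  proof (rule integral_mono')
    fix x
    have "0 \<le> (\<beta> * \<bar>a x\<bar> - \<alpha> * \<bar>b x\<bar>)\<^sup>2 / (2 * \<alpha> * \<beta>)" using pos by simp
    also have "\<dots> = (\<beta> / (2 * \<alpha>) * (a x)\<^sup>2 + \<alpha> / (2 * \<beta>) * (b x)\<^sup>2) - \<bar>a x * b x\<bar>"
      using pos by (simp add: power2_diff power_mult_distrib abs_mult field_simps power2_eq_square)
    finally show "\<bar>a x * b x\<bar> \<le> \<beta> / (2 * \<alpha>) * (a x)\<^sup>2 + \<alpha> / (2 * \<beta>) * (b x)\<^sup>2" by simp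
  qed (use i pos in auto)
  also have "\<dots> = \<beta> / (2 * \<alpha>) * expectation (\<lambda>x. (a x)\<^sup>2) + \<alpha> / (2 * \<beta>) * expectation (\<lambda>x. (b x)\<^sup>2)"
    using i by simp
  also have "\<dots> \<le> \<beta> / (2 * \<alpha>) * \<alpha>\<^sup>2 + \<alpha> / (2 * \<beta>) * \<beta>\<^sup>2"
    using E pos by (intro add_mono mult_left_mono) auto
  also have "\<dots> = \<alpha> * \<beta>" using pos by (simp add: power2_eq_square)
  finally show ?thesis .
qed

section \<open>The stochastic error\<close>

text \<open>The statistical experiment: increments \<open>1, \<dots>, n\<close> serve to estimate \<open>\<phi>\<close> and increments
  \<open>n + 1, \<dots>, 2 n\<close> to estimate its derivative.\<close>
locale increment_sample = prob_space P for P :: "'w measure" +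
  fixes X :: "real \<Rightarrow> 'w \<Rightarrow> real" and \<Delta> :: real and n :: nat and D :: "real measure"
  assumes \<Delta>: "\<Delta> > 0" and n: "n > 0"
    and indep: "indep_vars (\<lambda>_. borel) (increment X \<Delta>) {1..2 * n}"
    and ident: "\<And>k. k \<in> {1..2 * n} \<Longrightarrow> distr P borel (increment X \<Delta> k) = D"
    and square: "integrable D (\<lambda>x. x\<^sup>2)"
    and char_nonzero: "\<And>u. char D u \<noteq> 0"
begin

abbreviation "Z \<equiv> increment X \<Delta>"
abbreviation "T \<equiv> \<Delta> * real n"
abbreviation "\<phi> \<equiv> char D"

definition \<phi>' :: "real \<Rightarrow> complex" where "\<phi>' u = (LINT x|D. \<i> * of_real x * iexp (u * x))"
definition A :: "'w \<Rightarrow> real \<Rightarrow> complex" where "A w u = inv_ecf X \<Delta> n w u"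
definition dev :: "'w \<Rightarrow> real \<Rightarrow> complex" where "dev w u = ecf_deriv X \<Delta> n w u - \<phi>' u"

lemma Z_measurable: "k \<in> {1..2 * n} \<Longrightarrow> Z k \<in> borel_measurable P"
  using indep by (auto simp: indep_vars_def)

lemma D: "real_distribution D"
proof -
  have 1: "(1::nat) \<in> {1..2 * n}" using n by simp
  have "prob_space D" using prob_space_distr[OF Z_measurable[OF 1]] ident[OF 1] by simp
  moreover have "sets D = sets borel" "space D = UNIV" using ident[OF 1] by auto
  ultimately show ?thesis by (simp add: real_distribution_def real_distribution_axioms_def)
qed

sublocale D: real_distribution D by (rule D)

lemma integral_Z:
  fixes f :: "real \<Rightarrow> 'b::{banach, second_countable_topology}"
  assumes k: "k \<in> {1..2 * n}" and f: "f \<in> borel_measurable borel"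
  shows "(LINT w|P. f (Z k w)) = (LINT x|D. f x)" "integrable P (\<lambda>w. f (Z k w)) \<longleftrightarrow> integrable D f"
  using integral_distr[OF Z_measurable[OF k] f] integrable_distr_eq[OF Z_measurable[OF k] f] ident[OF k] by simp_all

lemma integrable_abs_D: "integrable D (\<lambda>x. \<bar>x\<bar>)"
  using D.square_integrable_imp_integrable[of "\<lambda>x. x"] square by simp

lemma T_pos: "T > 0" using \<Delta> n by simp

lemma phi_measurable [measurable]: "\<phi> \<in> borel_measurable borel"
  by (rule D.char_measurable)

lemma phi'_measurable [measurable]: "\<phi>' \<in> borel_measurable borel"
proof -
  have "integrable D (\<lambda>x. \<i> * complex_of_real x)"
    by (rule Bochner_Integration.integrable_bound[OF integrable_abs_D]) (auto simp: norm_mult)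
  from continuous_signed_char[OF this, of UNIV] show ?thesis
    unfolding \<phi>'_def[abs_def] by (intro borel_measurable_continuous_onI) (simp add: mult.commute)
qed

lemma phi'_bound: "cmod (\<phi>' u) \<le> (LINT x|D. \<bar>x\<bar>)"
proof -
  have "cmod (\<phi>' u) \<le> (LINT x|D. cmod (\<i> * of_real x * iexp (u * x)))"
    unfolding \<phi>'_def by (rule integral_norm_bound)
  then show ?thesis by (simp add: norm_mult)
qed

lemma ecf_measurable [measurable]:
  "(\<lambda>(w, u). ecf X \<Delta> n w u) \<in> borel_measurable (P \<Otimes>\<^sub>M lborel)"
proof -
  have "(\<lambda>x. \<Sum>k=1..n. iexp (snd x * Z k (fst x))) \<in> borel_measurable (P \<Otimes>\<^sub>M lborel)"
  proof (rule borel_measurable_sum)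
    fix k assume "k \<in> {1..n}"
    then have [measurable]: "Z k \<in> borel_measurable P" by (intro Z_measurable) auto
    show "(\<lambda>x. iexp (snd x * Z k (fst x))) \<in> borel_measurable (P \<Otimes>\<^sub>M lborel)" by measurable
  qed
  then show ?thesis unfolding ecf_def by (simp add: split_beta')
qed

lemma ecf_deriv_measurable [measurable]:
  "(\<lambda>(w, u). ecf_deriv X \<Delta> n w u) \<in> borel_measurable (P \<Otimes>\<^sub>M lborel)"
proof -
  have "(\<lambda>x. \<Sum>k=n+1..2*n. \<i> * of_real (Z k (fst x)) * iexp (snd x * Z k (fst x))) \<in> borel_measurable (P \<Otimes>\<^sub>M lborel)"
  proof (rule borel_measurable_sum)
    fix k assume "k \<in> {n+1..2*n}"
    then have [measurable]: "Z k \<in> borel_measurable P" by (intro Z_measurable) auto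
    show "(\<lambda>x. \<i> * of_real (Z k (fst x)) * iexp (snd x * Z k (fst x))) \<in> borel_measurable (P \<Otimes>\<^sub>M lborel)" by measurable
  qed
  then show ?thesis unfolding ecf_deriv_def by (simp add: split_beta')
qed

lemma A_measurable [measurable]: "(\<lambda>(w, u). A w u) \<in> borel_measurable (P \<Otimes>\<^sub>M lborel)"
  unfolding A_def inv_ecf_def by measurable

lemma dev_measurable [measurable]: "(\<lambda>(w, u). dev w u) \<in> borel_measurable (P \<Otimes>\<^sub>M lborel)"
  unfolding dev_def by measurable

lemma A_bounds:
  fixes w u
  defines "d \<equiv> cmod (ecf X \<Delta> n w u - \<phi> u)"
  shows "cmod (A w u) \<le> T powr (1 / 2)"
    and "(cmod (A w u - 1 / \<phi> u))\<^sup>2 \<le> (4 * d\<^sup>2 + 4 * T * d ^ 4 + 40 / T) / cmod (\<phi> u) ^ 4"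
    and "(cmod (A w u))\<^sup>2 \<le> (4 + 2 * T * d\<^sup>2 + 2 * T\<^sup>2 * d ^ 4) / (cmod (\<phi> u))\<^sup>2"
  using truncated_inverse_bounds[OF T_pos char_nonzero[of u], of "ecf X \<Delta> n w u"]
  unfolding A_def inv_ecf_def d_def by simp_all

lemma ecf_error_bound: "cmod (ecf X \<Delta> n w u - \<phi> u) \<le> 2"
proof -
  have "cmod (ecf X \<Delta> n w u) \<le> (\<Sum>k=1..n. cmod (iexp (u * Z k w))) / real n"
    unfolding ecf_def norm_divide norm_of_nat by (intro divide_right_mono norm_sum) auto
  also have "\<dots> = 1" using n by simp
  finally show ?thesis
    using norm_triangle_ineq4[of "ecf X \<Delta> n w u" "\<phi> u"] D.cmod_char_le_1[of u] by simp
qed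

lemma ecf_error_measurable [measurable]: "(\<lambda>w. cmod (ecf X \<Delta> n w u - \<phi> u)) \<in> borel_measurable P"
  by measurable

lemma ecf_error_integrable: "integrable P (\<lambda>w. cmod (ecf X \<Delta> n w u - \<phi> u) ^ j)"
  by (rule integrable_bounded[of _ "2 ^ j"]) (use ecf_error_bound in \<open>auto intro!: power_mono\<close>)

text \<open>Applied to the real and to the imaginary part of the exponential.\<close>
lemma ecf_part_fourth_moment:
  assumes f: "f \<in> borel_measurable borel" "\<And>x. \<bar>f x\<bar> \<le> (1::real)"
  shows "integrable P (\<lambda>w. ((\<Sum>k=1..n. f (Z k w)) / real n - (LINT x|D. f x)) ^ 4)"
    and "expectation (\<lambda>w. ((\<Sum>k=1..n. f (Z k w)) / real n - (LINT x|D. f x)) ^ 4) \<le> 48 / (real n)\<^sup>2"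
proof -
  define c where "c = (LINT x|D. f x)"
  note [measurable] = f(1)
  have intf: "integrable D f" by (rule D.integrable_bounded[of _ 1]) (use f in auto)
  have c1: "\<bar>c\<bar> \<le> 1"
  proof -
    have "\<bar>c\<bar> \<le> (LINT x|D. 1)"
      unfolding c_def real_norm_def[symmetric]
      by (rule order_trans[OF integral_norm_bound integral_mono']) (use f in auto)
    then show ?thesis using D.prob_space by simp
  qed
  define Y where "Y k w = f (Z k w) - c" for k w
  have Yb: "\<bar>Y k w\<bar> \<le> 2" for k w
    using f(2)[of "Z k w"] c1 unfolding Y_def by linarith
  have indY: "indep_vars (\<lambda>_. borel) Y {1..n}"
  proof -
    have "indep_vars (\<lambda>_. borel) (\<lambda>k. (\<lambda>x. f x - c) \<circ> Z k) {1..n}"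
      by (rule indep_vars_compose[OF indep_vars_subset[OF indep]]) auto
    then show ?thesis by (simp add: Y_def[abs_def] o_def)
  qed
  have EY: "expectation (Y k) = 0" if "k \<in> {1..n}" for k
  proof -
    have k: "k \<in> {1..2 * n}" using that by auto
    have "integrable P (\<lambda>w. f (Z k w))" using integral_Z(2)[OF k f(1)] intf by simp
    then show ?thesis using integral_Z(1)[OF k f(1)] by (simp add: Y_def[abs_def] c_def prob_space)
  qed
  have eq: "(\<Sum>k=1..n. f (Z k w)) / real n - c = (\<Sum>k=1..n. Y k w) / real n" for w
    using n by (simp add: Y_def sum_subtractf field_simps)
  have Zm: "Y k \<in> borel_measurable P" if "k \<in> {1..n}" for k
    using indY that by (auto simp: indep_vars_def)
  have m: "(\<lambda>w. \<Sum>k=1..n. Y k w) \<in> borel_measurable P" by (rule borel_measurable_sum[OF Zm])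
  have b: "\<bar>\<Sum>k=1..n. Y k w\<bar> \<le> 2 * real n" for w
  proof -
    have "\<bar>\<Sum>k=1..n. Y k w\<bar> \<le> (\<Sum>k=1..n. 2)" by (rule order_trans[OF sum_abs sum_mono]) (use Yb in auto)
    then show ?thesis by simp
  qed
  have "integrable P (\<lambda>w. (\<Sum>k=1..n. Y k w) ^ 4)"
  proof (rule integrable_bounded[of _ "(2 * real n) ^ 4"])
    show "norm ((\<Sum>k=1..n. Y k w) ^ 4) \<le> (2 * real n) ^ 4" for w
      unfolding real_norm_def power_abs by (intro power_mono b) simp
  qed (use m in measurable)
  then show "integrable P (\<lambda>w. ((\<Sum>k=1..n. f (Z k w)) / real n - (LINT x|D. f x)) ^ 4)"
    unfolding c_def[symmetric] eq power_divide by simp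
  have "expectation (\<lambda>w. (\<Sum>k=1..n. Y k w) ^ 4) \<le> 48 * (real (card {1..n}))\<^sup>2"
    using fourth_moment_of_sum[OF _ indY] Yb EY by blast
  then have "expectation (\<lambda>w. (\<Sum>k=1..n. Y k w) ^ 4) / real n ^ 4 \<le> 48 * (real n)\<^sup>2 / real n ^ 4"
    using n by (intro divide_right_mono) auto
  also have "48 * (real n)\<^sup>2 / real n ^ 4 = 48 / (real n)\<^sup>2" using n by (simp add: field_simps eval_nat_numeral)
  finally show "expectation (\<lambda>w. ((\<Sum>k=1..n. f (Z k w)) / real n - (LINT x|D. f x)) ^ 4) \<le> 48 / (real n)\<^sup>2"
    unfolding c_def[symmetric] eq power_divide by simp
qed

lemma ecf_error_fourth_moment:
  "expectation (\<lambda>w. cmod (ecf X \<Delta> n w u - \<phi> u) ^ 4) \<le> 192 / (real n)\<^sup>2"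
proof -
  define a where "a w = (\<Sum>k=1..n. cos (u * Z k w)) / real n - (LINT x|D. cos (u * x))" for w
  define b where "b w = (\<Sum>k=1..n. sin (u * Z k w)) / real n - (LINT x|D. sin (u * x))" for w
  have int: "integrable D (\<lambda>x. iexp (u * x))" by (rule D.integrable_iexp) auto
  have Re: "Re (ecf X \<Delta> n w u - \<phi> u) = a w" and Im: "Im (ecf X \<Delta> n w u - \<phi> u) = b w" for w
    using integral_Re[OF int] integral_Im[OF int]
    by (simp_all add: a_def b_def ecf_def char_def Re_exp Im_exp Re_divide_of_nat Im_divide_of_nat)
  have le: "cmod (ecf X \<Delta> n w u - \<phi> u) ^ 4 \<le> 2 * a w ^ 4 + 2 * b w ^ 4" for w
  proof -
    have "cmod (ecf X \<Delta> n w u - \<phi> u) ^ 4 = ((cmod (ecf X \<Delta> n w u - \<phi> u))\<^sup>2)\<^sup>2" by (simp flip: power_mult)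
    also have "\<dots> = ((a w)\<^sup>2 + (b w)\<^sup>2)\<^sup>2" by (simp only: cmod_power2 Re Im)
    also have "\<dots> \<le> 2 * ((a w)\<^sup>2)\<^sup>2 + 2 * ((b w)\<^sup>2)\<^sup>2"
      using sum_squares_bound[of "(a w)\<^sup>2" "(b w)\<^sup>2"] by (simp add: power2_sum)
    finally show ?thesis by (simp flip: power_mult)
  qed
  have ma: "integrable P (\<lambda>w. a w ^ 4)" "expectation (\<lambda>w. a w ^ 4) \<le> 48 / (real n)\<^sup>2"
    unfolding a_def by (rule ecf_part_fourth_moment; simp)+
  have mb: "integrable P (\<lambda>w. b w ^ 4)" "expectation (\<lambda>w. b w ^ 4) \<le> 48 / (real n)\<^sup>2"
    unfolding b_def by (rule ecf_part_fourth_moment; simp)+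
  have "expectation (\<lambda>w. cmod (ecf X \<Delta> n w u - \<phi> u) ^ 4) \<le> expectation (\<lambda>w. 2 * a w ^ 4 + 2 * b w ^ 4)"
    by (rule integral_mono[OF ecf_error_integrable]) (use ma(1) mb(1) le in auto)
  also have "\<dots> = 2 * expectation (\<lambda>w. a w ^ 4) + 2 * expectation (\<lambda>w. b w ^ 4)"
    using ma(1) mb(1) by simp
  also have "\<dots> \<le> 192 / (real n)\<^sup>2" using ma(2) mb(2) by simp
  finally show ?thesis .
qed

text \<open>Deduced from the fourth moment by \<open>2 e \<le> 1 / n + n e\<^sup>2\<close>, at the price of a larger constant.\<close>
lemma ecf_error_second_moment:
  "expectation (\<lambda>w. (cmod (ecf X \<Delta> n w u - \<phi> u))\<^sup>2) \<le> 97 / real n"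
proof -
  have n1: "real n > 0" using n by simp
  have "expectation (\<lambda>w. (cmod (ecf X \<Delta> n w u - \<phi> u))\<^sup>2)
     \<le> expectation (\<lambda>w. 1 / (2 * real n) + real n / 2 * cmod (ecf X \<Delta> n w u - \<phi> u) ^ 4)"
  proof (rule integral_mono[OF ecf_error_integrable])
    fix w
    define e where "e = (cmod (ecf X \<Delta> n w u - \<phi> u))\<^sup>2"
    have "0 \<le> (1 - real n * e)\<^sup>2 / (2 * real n)" using n1 by simp
    also have "\<dots> = 1 / (2 * real n) + real n / 2 * e\<^sup>2 - e"
      using n1 by (simp add: power2_diff power_mult_distrib field_simps power2_eq_square)
    finally show "(cmod (ecf X \<Delta> n w u - \<phi> u))\<^sup>2 \<le> 1 / (2 * real n) + real n / 2 * cmod (ecf X \<Delta> n w u - \<phi> u) ^ 4"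
      by (simp add: e_def flip: power_mult)
  qed (use ecf_error_integrable in simp)
  also have "\<dots> = 1 / (2 * real n) + real n / 2 * expectation (\<lambda>w. cmod (ecf X \<Delta> n w u - \<phi> u) ^ 4)"
    using ecf_error_integrable[of u 4] by (simp add: prob_space)
  also have "\<dots> \<le> 1 / (2 * real n) + real n / 2 * (192 / (real n)\<^sup>2)"
    using ecf_error_fourth_moment[of u] n1 by (intro add_left_mono mult_left_mono) auto
  also have "\<dots> \<le> 97 / real n" using n1 by (simp add: field_simps power2_eq_square)
  finally show ?thesis .
qed

text \<open>The constants are those of \<open>truncated_inverse_bounds\<close> after taking expectations with the moment bounds
  \<open>97 / n\<close> and \<open>192 / n\<^sup>2\<close> for the error of the empirical characteristic function.\<close>
definition CN :: real where "CN = 388 + 768 * \<Delta> + 40 / \<Delta>"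
definition CA :: real where "CA = 4 + 194 * \<Delta> + 384 * \<Delta>\<^sup>2"

lemma CN_pos: "CN > 0" and CA_pos: "CA > 0"
  using \<Delta> by (auto simp: CN_def CA_def intro!: add_pos_nonneg)

lemma A_section_measurable [measurable]: "(\<lambda>w. A w u) \<in> borel_measurable P"
  by measurable

lemma A_second_moment:
  "integrable P (\<lambda>w. (cmod (A w u))\<^sup>2)"
  "expectation (\<lambda>w. (cmod (A w u))\<^sup>2) \<le> (sqrt CA / cmod (\<phi> u))\<^sup>2"
proof -
  show int: "integrable P (\<lambda>w. (cmod (A w u))\<^sup>2)"
    by (rule integrable_bounded[of _ "(T powr (1 / 2))\<^sup>2"])
       (use A_bounds(1) in \<open>auto intro!: power_mono\<close>)
  note e = ecf_error_integrable[of u 2] ecf_error_integrable[of u 4]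
  have "expectation (\<lambda>w. (cmod (A w u))\<^sup>2) \<le> expectation (\<lambda>w. (4 + 2 * T * (cmod (ecf X \<Delta> n w u - \<phi> u))\<^sup>2
      + 2 * T\<^sup>2 * cmod (ecf X \<Delta> n w u - \<phi> u) ^ 4) / (cmod (\<phi> u))\<^sup>2)"
    by (rule integral_mono[OF int]) (use e A_bounds(3) in auto)
  also have "\<dots> = (4 + 2 * T * expectation (\<lambda>w. (cmod (ecf X \<Delta> n w u - \<phi> u))\<^sup>2)
      + 2 * T\<^sup>2 * expectation (\<lambda>w. cmod (ecf X \<Delta> n w u - \<phi> u) ^ 4)) / (cmod (\<phi> u))\<^sup>2"
    using e by (simp add: prob_space)
  also have "\<dots> \<le> (4 + 2 * T * (97 / real n) + 2 * T\<^sup>2 * (192 / (real n)\<^sup>2)) / (cmod (\<phi> u))\<^sup>2"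
    using T_pos ecf_error_second_moment[of u] ecf_error_fourth_moment[of u]
    by (intro divide_right_mono add_mono mult_left_mono) auto
  also have "4 + 2 * T * (97 / real n) + 2 * T\<^sup>2 * (192 / (real n)\<^sup>2) = CA"
    using n by (simp add: CA_def power_mult_distrib)
  also have "CA / (cmod (\<phi> u))\<^sup>2 = (sqrt CA / cmod (\<phi> u))\<^sup>2"
    using CA_pos by (simp add: power_divide)
  finally show "expectation (\<lambda>w. (cmod (A w u))\<^sup>2) \<le> (sqrt CA / cmod (\<phi> u))\<^sup>2" .
qed

lemma relative_error_second_moment:
  "integrable P (\<lambda>w. (cmod (\<phi> u * A w u - 1))\<^sup>2)"
  "expectation (\<lambda>w. (cmod (\<phi> u * A w u - 1))\<^sup>2) \<le> (sqrt (CN / real n) / cmod (\<phi> u))\<^sup>2"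
proof -
  have p: "cmod (\<phi> u) > 0" using char_nonzero by simp
  have le: "(cmod (\<phi> u * A w u - 1))\<^sup>2 \<le> (4 * (cmod (ecf X \<Delta> n w u - \<phi> u))\<^sup>2
      + 4 * T * cmod (ecf X \<Delta> n w u - \<phi> u) ^ 4 + 40 / T) / (cmod (\<phi> u))\<^sup>2" for w
  proof -
    have "\<phi> u * A w u - 1 = \<phi> u * (A w u - 1 / \<phi> u)" using char_nonzero[of u] by (simp add: right_diff_distrib)
    then have "(cmod (\<phi> u * A w u - 1))\<^sup>2 = (cmod (\<phi> u))\<^sup>2 * (cmod (A w u - 1 / \<phi> u))\<^sup>2"
      by (simp add: norm_mult power_mult_distrib)
    also have "\<dots> \<le> (cmod (\<phi> u))\<^sup>2 * ((4 * (cmod (ecf X \<Delta> n w u - \<phi> u))\<^sup>2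
      + 4 * T * cmod (ecf X \<Delta> n w u - \<phi> u) ^ 4 + 40 / T) / cmod (\<phi> u) ^ 4)"
      by (intro mult_left_mono A_bounds(2)) auto
    also have "\<dots> = (4 * (cmod (ecf X \<Delta> n w u - \<phi> u))\<^sup>2
      + 4 * T * cmod (ecf X \<Delta> n w u - \<phi> u) ^ 4 + 40 / T) / (cmod (\<phi> u))\<^sup>2"
    proof -
      have "p\<^sup>2 * (z / p ^ 4) = z / p\<^sup>2" if "p > 0" for p z :: real
        using that by (simp add: field_simps eval_nat_numeral)
      from this[OF p] show ?thesis .
    qed
    finally show ?thesis .
  qed
  show int: "integrable P (\<lambda>w. (cmod (\<phi> u * A w u - 1))\<^sup>2)"
  proof (rule integrable_bounded[of _ "(cmod (\<phi> u) * T powr (1 / 2) + 1)\<^sup>2"])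
    fix w
    have "cmod (\<phi> u * A w u - 1) \<le> cmod (\<phi> u) * cmod (A w u) + 1"
      using norm_triangle_ineq4[of "\<phi> u * A w u" 1] by (simp add: norm_mult)
    also have "\<dots> \<le> cmod (\<phi> u) * T powr (1 / 2) + 1"
      by (intro add_right_mono mult_left_mono A_bounds(1)) auto
    finally show "norm ((cmod (\<phi> u * A w u - 1))\<^sup>2) \<le> (cmod (\<phi> u) * T powr (1 / 2) + 1)\<^sup>2"
      by (simp add: power_mono)
  qed measurable
  note e = ecf_error_integrable[of u 2] ecf_error_integrable[of u 4]
  have "expectation (\<lambda>w. (cmod (\<phi> u * A w u - 1))\<^sup>2) \<le> expectation (\<lambda>w. (4 * (cmod (ecf X \<Delta> n w u - \<phi> u))\<^sup>2
      + 4 * T * cmod (ecf X \<Delta> n w u - \<phi> u) ^ 4 + 40 / T) / (cmod (\<phi> u))\<^sup>2)"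
    by (rule integral_mono[OF int]) (use e le in auto)
  also have "\<dots> = (4 * expectation (\<lambda>w. (cmod (ecf X \<Delta> n w u - \<phi> u))\<^sup>2)
      + 4 * T * expectation (\<lambda>w. cmod (ecf X \<Delta> n w u - \<phi> u) ^ 4) + 40 / T) / (cmod (\<phi> u))\<^sup>2"
    using e by (simp add: prob_space)
  also have "\<dots> \<le> (4 * (97 / real n) + 4 * T * (192 / (real n)\<^sup>2) + 40 / T) / (cmod (\<phi> u))\<^sup>2"
    using T_pos ecf_error_second_moment[of u] ecf_error_fourth_moment[of u]
    by (intro divide_right_mono add_mono mult_left_mono) auto
  also have "4 * (97 / real n) + 4 * T * (192 / (real n)\<^sup>2) + 40 / T = CN / real n"
    using n \<Delta> by (simp add: CN_def field_simps power2_eq_square)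
  also have "CN / real n / (cmod (\<phi> u))\<^sup>2 = (sqrt (CN / real n) / cmod (\<phi> u))\<^sup>2"
    using CN_pos by (simp add: power_divide)
  finally show "expectation (\<lambda>w. (cmod (\<phi> u * A w u - 1))\<^sup>2) \<le> (sqrt (CN / real n) / cmod (\<phi> u))\<^sup>2" .
qed

text \<open>Up to sign, the second derivative of \<open>\<phi>\<close>.\<close>
definition R :: "real \<Rightarrow> complex" where "R t = (LINT x|D. of_real (x\<^sup>2) * iexp (t * x))"
definition c :: real where "c = (LINT x|D. \<bar>x\<bar>)"
text \<open>One centered summand of the empirical derivative.\<close>
definition dk :: "real \<Rightarrow> real \<Rightarrow> complex" where "dk u x = \<i> * of_real x * iexp (u * x) - \<phi>' u"

lemma c_nonneg: "c \<ge> 0" by (simp add: c_def)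

lemma R_measurable [measurable]: "R \<in> borel_measurable borel"
proof -
  have "integrable D (\<lambda>x. complex_of_real (x\<^sup>2))" using square by (rule integrable_of_real)
  from continuous_signed_char[OF this, of UNIV] show ?thesis
    unfolding R_def[abs_def] by (intro borel_measurable_continuous_onI) (simp add: mult.commute)
qed

lemma dk_measurable [measurable]: "dk u \<in> borel_measurable borel"
  unfolding dk_def by measurable

lemma dk_bound: "cmod (dk u x) \<le> \<bar>x\<bar> + c"
proof -
  have "cmod (dk u x) \<le> cmod (\<i> * of_real x * iexp (u * x)) + cmod (\<phi>' u)"
    unfolding dk_def by (rule norm_triangle_ineq4)
  also have "cmod (\<i> * of_real x * iexp (u * x)) = \<bar>x\<bar>" by (simp add: norm_mult)
  finally show ?thesis using phi'_bound[of u] by (simp add: c_def)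
qed

lemma integrable_shifted_square: "integrable D (\<lambda>x. (\<bar>x\<bar> + c)\<^sup>2)"
proof -
  have "integrable D (\<lambda>x. x\<^sup>2 + 2 * c * \<bar>x\<bar> + c\<^sup>2)"
    using square integrable_abs_D by simp
  then show ?thesis by (simp add: power2_sum ac_simps)
qed

lemma integrable_dk: "integrable D (dk u)"
proof (rule Bochner_Integration.integrable_bound)
  show "integrable D (\<lambda>x. \<bar>x\<bar> + c)" using integrable_abs_D by simp
  show "AE x in D. norm (dk u x) \<le> norm (\<bar>x\<bar> + c)"
    using dk_bound by (intro AE_I2) (auto intro: order_trans[OF _ abs_ge_self])
qed measurable

lemma integrable_x_iexp_D: "integrable D (\<lambda>x. \<i> * of_real x * iexp (u * x))"
  by (rule Bochner_Integration.integrable_bound[OF integrable_abs_D]) (auto simp: norm_mult)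

lemma integral_dk: "(LINT x|D. dk u x) = 0"
  using integrable_x_iexp_D[of u] D.prob_space by (simp add: dk_def \<phi>'_def)

text \<open>Multiplying out, \<open>x\<^sup>2 exp (\<i> (u - v) x)\<close> is the only term that does not factorize; it depends on
  \<open>u - v\<close> alone, which is what later allows Young's inequality.\<close>
lemma dk_covariance:
  "(LINT x|D. dk u x * cnj (dk v x)) = R (u - v) - \<phi>' u * cnj (\<phi>' v)"
proof -
  define f1 where "f1 x = of_real (x\<^sup>2) * iexp ((u - v) * x)" for x
  have i1: "integrable D f1"
    unfolding f1_def by (rule Bochner_Integration.integrable_bound[OF square]) (auto simp: norm_mult norm_power)
  note i2 = integrable_x_iexp_D[of u] and i3 = integrable_x_iexp_D[of "- v"]
  have cn: "cnj (iexp (v * x)) = iexp (- v * x)" for x by (simp add: exp_cnj)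
  have ee: "iexp (u * x) * iexp (- v * x) = iexp ((u - v) * x)" for x
    by (simp add: exp_add[symmetric] algebra_simps)
  have eq: "dk u x * cnj (dk v x) = f1 x - cnj (\<phi>' v) * (\<i> * of_real x * iexp (u * x))
      + \<phi>' u * (\<i> * of_real x * iexp (- v * x)) + \<phi>' u * cnj (\<phi>' v)" for x
  proof -
    have "cnj (dk v x) = - (\<i> * of_real x * iexp (- v * x)) - cnj (\<phi>' v)"
      unfolding dk_def by (simp only: complex_cnj_diff complex_cnj_mult complex_cnj_i complex_cnj_complex_of_real cn) simp
    then have "dk u x * cnj (dk v x) = (\<i> * of_real x * iexp (u * x) - \<phi>' u) * (- (\<i> * of_real x * iexp (- v * x)) - cnj (\<phi>' v))"
      by (simp only: dk_def)
    also have "\<dots> = of_real x * of_real x * (iexp (u * x) * iexp (- v * x)) - cnj (\<phi>' v) * (\<i> * of_real x * iexp (u * x))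
      + \<phi>' u * (\<i> * of_real x * iexp (- v * x)) + \<phi>' u * cnj (\<phi>' v)"
      by (simp only: ring_distribs) (simp add: algebra_simps)
    finally show ?thesis unfolding ee f1_def by (simp add: power2_eq_square)
  qed
  have conj: "(LINT x|D. \<i> * of_real x * iexp (- v * x)) = - cnj (\<phi>' v)"
  proof -
    have "cnj (\<phi>' v) = (LINT x|D. cnj (\<i> * of_real x * iexp (v * x)))"
      unfolding \<phi>'_def by (rule Bochner_Integration.integral_cnj[symmetric])
    also have "(\<lambda>x. cnj (\<i> * of_real x * iexp (v * x))) = (\<lambda>x. - (\<i> * of_real x * iexp (- v * x)))"
      by (rule ext) (simp only: complex_cnj_mult complex_cnj_i complex_cnj_complex_of_real cn, simp)
    also have "(LINT x|D. - (\<i> * of_real x * iexp (- v * x))) = - (LINT x|D. \<i> * of_real x * iexp (- v * x))"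
      by (rule Bochner_Integration.integral_minus)
    finally show ?thesis by simp
  qed
  have "(LINT x|D. dk u x * cnj (dk v x)) = (LINT x|D. f1 x) - cnj (\<phi>' v) * (LINT x|D. \<i> * of_real x * iexp (u * x))
      + \<phi>' u * (LINT x|D. \<i> * of_real x * iexp (- v * x)) + \<phi>' u * cnj (\<phi>' v) * (LINT x|D. 1)"
    unfolding eq
    by (subst Bochner_Integration.integral_add Bochner_Integration.integral_diff integral_mult_right_zero |
        (intro Bochner_Integration.integrable_add Bochner_Integration.integrable_diff integrable_mult_right i1 i2 i3 D.integrable_const))+
       (simp add: D.prob_space[simplified])
  also have "\<dots> = R (u - v) - \<phi>' u * cnj (\<phi>' v)"
    unfolding conj R_def f1_def \<phi>'_def[symmetric] using D.prob_space by simp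
  finally show ?thesis .
qed

lemma dev_eq: "dev w u = (\<Sum>k=n+1..2*n. dk u (Z k w)) / of_nat n"
  using n by (simp add: dev_def ecf_deriv_def dk_def sum_subtractf diff_divide_distrib)

lemma integrable_dk_product:
  assumes "k \<in> {1..2 * n}" "l \<in> {1..2 * n}"
  shows "integrable P (\<lambda>w. dk u (Z k w) * cnj (dk v (Z l w)))"
proof (rule Bochner_Integration.integrable_bound)
  have [measurable]: "Z k \<in> borel_measurable P" by (rule Z_measurable[OF assms(1)])
  have [measurable]: "Z l \<in> borel_measurable P" by (rule Z_measurable[OF assms(2)])
  show "(\<lambda>w. dk u (Z k w) * cnj (dk v (Z l w))) \<in> borel_measurable P" by measurable
  have f: "(\<lambda>x. (\<bar>x\<bar> + c)\<^sup>2) \<in> borel_measurable borel" by measurable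
  show "integrable P (\<lambda>w. (\<bar>Z k w\<bar> + c)\<^sup>2 + (\<bar>Z l w\<bar> + c)\<^sup>2)"
    using integral_Z(2)[OF assms(1) f] integral_Z(2)[OF assms(2) f] integrable_shifted_square by simp
  show "AE w in P. norm (dk u (Z k w) * cnj (dk v (Z l w))) \<le> norm ((\<bar>Z k w\<bar> + c)\<^sup>2 + (\<bar>Z l w\<bar> + c)\<^sup>2)"
  proof (rule AE_I2)
    fix w
    have "norm (dk u (Z k w) * cnj (dk v (Z l w))) \<le> (\<bar>Z k w\<bar> + c) * (\<bar>Z l w\<bar> + c)"
      unfolding norm_mult complex_mod_cnj using dk_bound c_nonneg by (intro mult_mono) auto
    also have "\<dots> \<le> (\<bar>Z k w\<bar> + c)\<^sup>2 + (\<bar>Z l w\<bar> + c)\<^sup>2"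
    proof -
      have "x * y \<le> x\<^sup>2 + y\<^sup>2" if "0 \<le> x" "0 \<le> y" for x y :: real
        using sum_squares_bound[of x y] mult_nonneg_nonneg[OF that] by linarith
      then show ?thesis using c_nonneg by simp
    qed
    finally show "norm (dk u (Z k w) * cnj (dk v (Z l w))) \<le> norm ((\<bar>Z k w\<bar> + c)\<^sup>2 + (\<bar>Z l w\<bar> + c)\<^sup>2)"
      by simp
  qed
qed

lemma expectation_dk_product:
  assumes k: "k \<in> {1..2 * n}" and l: "l \<in> {1..2 * n}"
  shows "(LINT w|P. dk u (Z k w) * cnj (dk v (Z l w))) = (if k = l then R (u - v) - \<phi>' u * cnj (\<phi>' v) else 0)"
proof (cases "k = l")
  case True
  have "(\<lambda>x. dk u x * cnj (dk v x)) \<in> borel_measurable borel" by measurable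
  from integral_Z(1)[OF k this] True show ?thesis by (simp add: dk_covariance)
next
  case False
  have "indep_var borel ((\<lambda>z. dk u (z k)) \<circ> (\<lambda>w. restrict (\<lambda>k. Z k w) {k})) borel ((\<lambda>z. cnj (dk v (z l))) \<circ> (\<lambda>w. restrict (\<lambda>k. Z k w) {l}))"
    by (rule indep_var_compose[OF indep_var_restrict[OF indep]]) (use False k l in \<open>auto, measurable\<close>)
  then have ind: "indep_var borel (\<lambda>w. dk u (Z k w)) borel (\<lambda>w. cnj (dk v (Z l w)))"
    by (simp add: o_def)
  have i: "integrable P (\<lambda>w. dk u (Z k w))" "integrable P (\<lambda>w. cnj (dk v (Z l w)))"
    using integral_Z(2)[OF k dk_measurable, of u] integral_Z(2)[OF l dk_measurable, of v] integrable_dk by simp_all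
  from indep_var_lebesgue_integral[OF ind i] False show ?thesis
    using integral_Z(1)[OF k dk_measurable, of u] by (simp add: integral_dk)
qed

lemma dev_product_eq:
  "dev w u * cnj (dev w v) = (\<Sum>k=n+1..2*n. \<Sum>l=n+1..2*n. dk u (Z k w) * cnj (dk v (Z l w))) / (of_nat n)\<^sup>2"
  unfolding dev_eq by (simp add: sum_product power2_eq_square)

lemma integrable_dev_product: "integrable P (\<lambda>w. dev w u * cnj (dev w v))"
  unfolding dev_product_eq divide_inverse
  by (intro integrable_mult_left Bochner_Integration.integrable_sum integrable_dk_product) auto

lemma dev_covariance:
  "cmod (LINT w|P. dev w u * cnj (dev w v)) \<le> (cmod (R (u - v)) + cmod (\<phi>' u) * cmod (\<phi>' v)) / real n"
proof -
  have "(LINT w|P. dev w u * cnj (dev w v))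
      = (LINT w|P. (\<Sum>k=n+1..2*n. \<Sum>l=n+1..2*n. dk u (Z k w) * cnj (dk v (Z l w)))) / (of_nat n)\<^sup>2"
    unfolding dev_product_eq by simp
  also have "(LINT w|P. (\<Sum>k=n+1..2*n. \<Sum>l=n+1..2*n. dk u (Z k w) * cnj (dk v (Z l w))))
     = (\<Sum>k=n+1..2*n. LINT w|P. (\<Sum>l=n+1..2*n. dk u (Z k w) * cnj (dk v (Z l w))))"
    by (intro Bochner_Integration.integral_sum Bochner_Integration.integrable_sum integrable_dk_product) auto
  also have "\<dots> = (\<Sum>k=n+1..2*n. \<Sum>l=n+1..2*n. LINT w|P. dk u (Z k w) * cnj (dk v (Z l w)))"
    by (intro sum.cong refl Bochner_Integration.integral_sum integrable_dk_product) auto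
  also have "\<dots> = (\<Sum>k=n+1..2*n. \<Sum>l=n+1..2*n. if k = l then R (u - v) - \<phi>' u * cnj (\<phi>' v) else 0)"
    by (intro sum.cong refl expectation_dk_product) auto
  also have "\<dots> = of_nat n * (R (u - v) - \<phi>' u * cnj (\<phi>' v))"
    by (simp add: sum.delta')
  finally have "cmod (LINT w|P. dev w u * cnj (dev w v)) = cmod (R (u - v) - \<phi>' u * cnj (\<phi>' v)) / real n"
    using n by (simp add: norm_mult norm_divide norm_power power2_eq_square)
  also have "\<dots> \<le> (cmod (R (u - v)) + cmod (\<phi>' u) * cmod (\<phi>' v)) / real n"
    using norm_triangle_ineq4[of "R (u - v)" "\<phi>' u * cnj (\<phi>' v)"]
    by (intro divide_right_mono) (auto simp: norm_mult)
  finally show ?thesis .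
qed

text \<open>A bound for the error of the empirical derivative that is uniform in the frequency, as required for
  Fubini.\<close>
definition envelope :: "'w \<Rightarrow> real" where
  "envelope w = (\<Sum>k=n+1..2*n. \<bar>Z k w\<bar> + c) / real n"

lemma envelope_nonneg: "envelope w \<ge> 0"
  unfolding envelope_def using c_nonneg by (intro divide_nonneg_nonneg sum_nonneg) auto

lemma dev_le_envelope: "cmod (dev w u) \<le> envelope w"
  unfolding dev_eq envelope_def norm_divide norm_of_nat
  by (intro divide_right_mono order_trans[OF norm_sum sum_mono] dk_bound) auto

lemma envelope_measurable [measurable]: "envelope \<in> borel_measurable P"
proof -
  have "(\<lambda>w. \<Sum>k=n+1..2*n. \<bar>Z k w\<bar> + c) \<in> borel_measurable P"
  proof (rule borel_measurable_sum)
    fix k assume "k \<in> {n+1..2*n}"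
    then have [measurable]: "Z k \<in> borel_measurable P" by (intro Z_measurable) auto
    show "(\<lambda>w. \<bar>Z k w\<bar> + c) \<in> borel_measurable P" by measurable
  qed
  then show ?thesis unfolding envelope_def by measurable
qed

lemma envelope_square_integrable: "integrable P (\<lambda>w. (envelope w)\<^sup>2)"
proof (rule Bochner_Integration.integrable_bound)
  have f: "(\<lambda>x. (\<bar>x\<bar> + c)\<^sup>2) \<in> borel_measurable borel" by measurable
  have i: "integrable P (\<lambda>w. (\<bar>Z k w\<bar> + c)\<^sup>2)" if "k \<in> {n+1..2*n}" for k
    using integral_Z(2)[OF _ f, of k] integrable_shifted_square that by auto
  show "integrable P (\<lambda>w. (\<Sum>k=n+1..2*n. (\<bar>Z k w\<bar> + c)\<^sup>2) / real n)"
    unfolding divide_inverse by (intro integrable_mult_left Bochner_Integration.integrable_sum i)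
  show "AE w in P. norm ((envelope w)\<^sup>2) \<le> norm ((\<Sum>k=n+1..2*n. (\<bar>Z k w\<bar> + c)\<^sup>2) / real n)"
  proof (rule AE_I2)
    fix w
    have "(\<Sum>k=n+1..2*n. \<bar>Z k w\<bar> + c)\<^sup>2 \<le> real n * (\<Sum>k=n+1..2*n. (\<bar>Z k w\<bar> + c)\<^sup>2)"
      using Cauchy_Schwarz_ineq_sum[of "\<lambda>_. 1" "\<lambda>k. \<bar>Z k w\<bar> + c" "{n+1..2*n}"] by simp
    then have "(envelope w)\<^sup>2 \<le> (real n * (\<Sum>k=n+1..2*n. (\<bar>Z k w\<bar> + c)\<^sup>2)) / (real n)\<^sup>2"
      unfolding envelope_def power_divide by (rule divide_right_mono) simp
    also have "\<dots> = (\<Sum>k=n+1..2*n. (\<bar>Z k w\<bar> + c)\<^sup>2) / real n" using n by (simp add: power2_eq_square)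
    finally have "(envelope w)\<^sup>2 \<le> (\<Sum>k=n+1..2*n. (\<bar>Z k w\<bar> + c)\<^sup>2) / real n" .
    then show "norm ((envelope w)\<^sup>2) \<le> norm ((\<Sum>k=n+1..2*n. (\<bar>Z k w\<bar> + c)\<^sup>2) / real n)"
      unfolding real_norm_def abs_of_nonneg[OF zero_le_power2] by (rule order_trans[OF _ abs_ge_self])
  qed
qed measurable

text \<open>The two factors are computed from disjoint blocks of increments.\<close>
lemma A_dev_product:
  "(LINT w|P. (A w u * cnj (A w v)) * (dev w u * cnj (dev w v)))
     = (LINT w|P. A w u * cnj (A w v)) * (LINT w|P. dev w u * cnj (dev w v))"
proof (rule indep_var_lebesgue_integral)
  define e where "e z t = (\<Sum>k=1..n. iexp (t * z k)) / of_nat n" for z :: "nat \<Rightarrow> real" and t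
  define a where "a z t = (if cmod (e z t) \<ge> T powr (- 1 / 2) then 1 / e z t else 0)" for z t
  define s where "s z t = (\<Sum>k=n+1..2*n. dk t (z k)) / of_nat n" for z :: "nat \<Rightarrow> real" and t
  have em [measurable]: "(\<lambda>z. e z t) \<in> borel_measurable (\<Pi>\<^sub>M k\<in>{1..n}. borel)" for t
    unfolding e_def by measurable
  have sm [measurable]: "(\<lambda>z. s z t) \<in> borel_measurable (\<Pi>\<^sub>M k\<in>{n+1..2*n}. borel)" for t
    unfolding s_def by measurable
  have am [measurable]: "(\<lambda>z. a z t) \<in> borel_measurable (\<Pi>\<^sub>M k\<in>{1..n}. borel)" for t
    unfolding a_def by measurable
  have A_eq: "A w t = a (restrict (\<lambda>k. Z k w) {1..n}) t" for w t
    by (simp add: A_def inv_ecf_def ecf_def a_def e_def)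
  have dev_eq': "dev w t = s (restrict (\<lambda>k. Z k w) {n+1..2*n}) t" for w t
    by (simp add: dev_eq s_def)
  have "indep_var borel ((\<lambda>z. a z u * cnj (a z v)) \<circ> (\<lambda>w. restrict (\<lambda>k. Z k w) {1..n}))
      borel ((\<lambda>z. s z u * cnj (s z v)) \<circ> (\<lambda>w. restrict (\<lambda>k. Z k w) {n+1..2*n}))"
  proof (rule indep_var_compose[OF indep_var_restrict[OF indep]])
    show "(\<lambda>z. a z u * cnj (a z v)) \<in> (\<Pi>\<^sub>M k\<in>{1..n}. borel) \<rightarrow>\<^sub>M borel" by measurable
    show "(\<lambda>z. s z u * cnj (s z v)) \<in> (\<Pi>\<^sub>M k\<in>{n+1..2*n}. borel) \<rightarrow>\<^sub>M borel" by measurable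
  qed auto
  then show "indep_var borel (\<lambda>w. A w u * cnj (A w v)) borel (\<lambda>w. dev w u * cnj (dev w v))"
    by (simp add: o_def A_eq dev_eq')
  show "integrable P (\<lambda>w. A w u * cnj (A w v))"
  proof (rule integrable_bounded[of _ "T powr (1 / 2) * T powr (1 / 2)"])
    show "norm (A w u * cnj (A w v)) \<le> T powr (1 / 2) * T powr (1 / 2)" for w
      unfolding norm_mult complex_mod_cnj by (intro mult_mono A_bounds(1)) auto
  qed measurable
  show "integrable P (\<lambda>w. dev w u * cnj (dev w v))" by (rule integrable_dev_product)
qed

lemma A_covariance: "cmod (LINT w|P. A w u * cnj (A w v)) \<le> CA / (cmod (\<phi> u) * cmod (\<phi> v))"
proof -
  have "cmod (LINT w|P. A w u * cnj (A w v)) \<le> (LINT w|P. cmod (A w u * cnj (A w v)))"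
    by (rule integral_norm_bound)
  also have "\<dots> = expectation (\<lambda>w. \<bar>cmod (A w u) * cmod (A w v)\<bar>)"
    by (simp add: norm_mult)
  also have "\<dots> \<le> (sqrt CA / cmod (\<phi> u)) * (sqrt CA / cmod (\<phi> v))"
    using char_nonzero CA_pos by (intro expectation_product_le A_second_moment) auto
  also have "\<dots> = CA / (cmod (\<phi> u) * cmod (\<phi> v))" using CA_pos by simp
  finally show ?thesis .
qed

lemma relative_error_covariance:
  "cmod (LINT w|P. (\<phi> u * A w u - 1) * cnj (\<phi> v * A w v - 1)) \<le> CN / real n / (cmod (\<phi> u) * cmod (\<phi> v))"
proof -
  have "cmod (LINT w|P. (\<phi> u * A w u - 1) * cnj (\<phi> v * A w v - 1))
     \<le> (LINT w|P. cmod ((\<phi> u * A w u - 1) * cnj (\<phi> v * A w v - 1)))"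
    by (rule integral_norm_bound)
  also have "\<dots> = expectation (\<lambda>w. \<bar>cmod (\<phi> u * A w u - 1) * cmod (\<phi> v * A w v - 1)\<bar>)"
    unfolding norm_mult complex_mod_cnj by simp
  also have "\<dots> \<le> (sqrt (CN / real n) / cmod (\<phi> u)) * (sqrt (CN / real n) / cmod (\<phi> v))"
    using char_nonzero CN_pos n by (intro expectation_product_le relative_error_second_moment) auto
  also have "\<dots> = CN / real n / (cmod (\<phi> u) * cmod (\<phi> v))"
  proof -
    have "sqrt (CN / real n) * sqrt (CN / real n) = CN / real n"
      using CN_pos by (intro real_sqrt_mult_self[THEN trans]) simp
    then show ?thesis by (simp only: times_divide_times_eq)
  qed
  finally show ?thesis .
qed

text \<open>Since \<open>\<phi>' = \<i> \<Delta> F \<phi>\<close>, the estimated transform minus \<open>F\<close> is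
  \<open>A dev / (\<i> \<Delta>) + F (\<phi> A - 1)\<close>.  In the first summand the factors are independent and contribute
  \<open>1 / (\<bar>\<phi>(u)\<bar> \<bar>\<phi>(v)\<bar>)\<close> and the covariance of the empirical derivative, in the second the covariance of the
  relative error enters.\<close>
theorem stochastic_error:
  fixes w F :: "real \<Rightarrow> complex"
  assumes w: "integrable lborel w" and F [measurable]: "F \<in> borel_measurable borel" and B: "\<And>u. cmod (F u) \<le> B"
    and \<phi>'F: "\<And>u. \<phi>' u = of_real \<Delta> * \<i> * F u * \<phi> u"
  defines "S \<equiv> \<lambda>\<omega>. LINT u|lborel. w u * (ecf_deriv X \<Delta> n \<omega> u / of_real \<Delta> / \<i> * inv_ecf X \<Delta> n \<omega> u - F u)"
    and "b \<equiv> \<lambda>u. cmod (w u) / cmod (\<phi> u)"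
  shows "\<And>\<omega>. \<omega> \<in> space P \<Longrightarrow> integrable lborel (\<lambda>u. w u * (ecf_deriv X \<Delta> n \<omega> u / of_real \<Delta> / \<i> * inv_ecf X \<Delta> n \<omega> u - F u))"
    and "(\<integral>\<^sup>+\<omega>. ennreal ((cmod (S \<omega>))\<^sup>2) \<partial>P) \<le> ennreal ((2 * CA / \<Delta>\<^sup>2 + 2 * CN) / real n) *
     (\<integral>\<^sup>+u. \<integral>\<^sup>+v. ennreal (b u * b v * (cmod (R (u - v)) + cmod (\<phi>' u) * cmod (\<phi>' v) + cmod (F u) * cmod (F v))) \<partial>lborel \<partial>lborel)"
proof -
  note [measurable] = borel_measurable_integrable[OF w]
  have B0: "0 \<le> B" using B[of 0] norm_ge_zero order_trans by blast
  define g1 where "g1 \<omega> u = w u * (A \<omega> u * dev \<omega> u)" for \<omega> u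
  define g2 where "g2 \<omega> u = (w u * F u) * (\<phi> u * A \<omega> u - 1)" for \<omega> u
  define K where "K u v = cmod (R (u - v)) + cmod (\<phi>' u) * cmod (\<phi>' v) + cmod (F u) * cmod (F v)" for u v
  have K0: "K u v \<ge> 0" for u v by (simp add: K_def)
  have b0: "b u \<ge> 0" for u by (simp add: b_def)
  have Km [measurable]: "(\<lambda>(u, v). K u v) \<in> borel_measurable (borel \<Otimes>\<^sub>M borel)" unfolding K_def by measurable
  have bm [measurable]: "b \<in> borel_measurable borel" unfolding b_def by measurable
  define Q where "Q = (\<integral>\<^sup>+u. \<integral>\<^sup>+v. ennreal (b u * b v * K u v) \<partial>lborel \<partial>lborel)"
  have scale: "(\<integral>\<^sup>+u. \<integral>\<^sup>+v. ennreal a * ennreal (b u * b v * K u v) \<partial>lborel \<partial>lborel) = ennreal a * Q" for a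
    unfolding Q_def by (simp add: nn_integral_cmult)
  have g1m [measurable]: "(\<lambda>(\<omega>, u). g1 \<omega> u) \<in> borel_measurable (P \<Otimes>\<^sub>M lborel)" unfolding g1_def by measurable
  have g2m [measurable]: "(\<lambda>(\<omega>, u). g2 \<omega> u) \<in> borel_measurable (P \<Otimes>\<^sub>M lborel)" unfolding g2_def by measurable
  have g1_bound: "cmod (g1 \<omega> u) \<le> (cmod (w u) * T powr (1 / 2)) * envelope \<omega>" for \<omega> u
    unfolding g1_def norm_mult mult.assoc
    by (intro mult_left_mono mult_mono A_bounds(1) dev_le_envelope envelope_nonneg) auto
  have g2_bound: "cmod (g2 \<omega> u) \<le> (cmod (w u) * B * (T powr (1 / 2) + 1)) * 1" for \<omega> u
  proof -
    have "cmod (\<phi> u * A \<omega> u - 1) \<le> cmod (\<phi> u) * cmod (A \<omega> u) + 1"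
      using norm_triangle_ineq4[of "\<phi> u * A \<omega> u" 1] by (simp add: norm_mult)
    also have "\<dots> \<le> 1 * T powr (1 / 2) + 1"
      by (intro add_right_mono mult_mono A_bounds(1) D.cmod_char_le_1) auto
    finally have "cmod (\<phi> u * A \<omega> u - 1) \<le> T powr (1 / 2) + 1" by simp
    then have "cmod (w u) * cmod (F u) * cmod (\<phi> u * A \<omega> u - 1) \<le> cmod (w u) * B * (T powr (1 / 2) + 1)"
      using B B0 by (intro mult_mono) auto
    then show ?thesis by (simp add: g2_def norm_mult)
  qed
  have E1: "(\<integral>\<^sup>+\<omega>. ennreal ((cmod (LINT u|lborel. g1 \<omega> u))\<^sup>2) \<partial>P) \<le> ennreal (CA / real n) * Q"
    unfolding scale[symmetric]
  proof (rule second_moment_of_integral[OF g1m g1_bound])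
    show "integrable lborel (\<lambda>u. cmod (w u) * T powr (1 / 2))" using w by simp
    show "integrable P (\<lambda>x. (envelope x)\<^sup>2)" by (rule envelope_square_integrable)
    fix u v
    have "(LINT x|P. g1 x u * cnj (g1 x v)) = (LINT x|P. (w u * cnj (w v)) * ((A x u * cnj (A x v)) * (dev x u * cnj (dev x v))))"
      by (simp add: g1_def mult_ac)
    also have "\<dots> = (w u * cnj (w v)) * ((LINT x|P. A x u * cnj (A x v)) * (LINT x|P. dev x u * cnj (dev x v)))"
      by (simp only: integral_mult_right_zero A_dev_product)
    finally have "cmod (LINT x|P. g1 x u * cnj (g1 x v)) = cmod (w u) * cmod (w v) *
        (cmod (LINT x|P. A x u * cnj (A x v)) * cmod (LINT x|P. dev x u * cnj (dev x v)))"
      by (simp add: norm_mult)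
    also have "\<dots> \<le> cmod (w u) * cmod (w v) * (CA / (cmod (\<phi> u) * cmod (\<phi> v)) * (K u v / real n))"
    proof (intro mult_left_mono mult_mono A_covariance)
      have "cmod (LINT x|P. dev x u * cnj (dev x v)) \<le> (cmod (R (u - v)) + cmod (\<phi>' u) * cmod (\<phi>' v)) / real n"
        by (rule dev_covariance)
      also have "\<dots> \<le> K u v / real n" unfolding K_def by (intro divide_right_mono) auto
      finally show "cmod (LINT x|P. dev x u * cnj (dev x v)) \<le> K u v / real n" .
    qed (use CA_pos in auto)
    also have "\<dots> = CA / real n * (b u * b v * K u v)" by (simp add: b_def mult_ac)
    finally show "ennreal (cmod (LINT x|P. g1 x u * cnj (g1 x v))) \<le> ennreal (CA / real n) * ennreal (b u * b v * K u v)"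
      using CA_pos K0 b0 by (subst ennreal_mult'[symmetric]) (auto intro!: ennreal_leI)
  qed (auto simp: envelope_nonneg)
  have E2: "(\<integral>\<^sup>+\<omega>. ennreal ((cmod (LINT u|lborel. g2 \<omega> u))\<^sup>2) \<partial>P) \<le> ennreal (CN / real n) * Q"
    unfolding scale[symmetric]
  proof (rule second_moment_of_integral[OF g2m g2_bound])
    show "integrable lborel (\<lambda>u. cmod (w u) * B * (T powr (1 / 2) + 1))" using w by simp
    fix u v
    have "(LINT x|P. g2 x u * cnj (g2 x v)) = (LINT x|P. (w u * F u * cnj (w v * F v)) * ((\<phi> u * A x u - 1) * cnj (\<phi> v * A x v - 1)))"
      unfolding g2_def complex_cnj_mult by (simp only: mult_ac)
    also have "\<dots> = (w u * F u * cnj (w v * F v)) * (LINT x|P. (\<phi> u * A x u - 1) * cnj (\<phi> v * A x v - 1))"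
      by (rule integral_mult_right_zero)
    finally have "cmod (LINT x|P. g2 x u * cnj (g2 x v)) = cmod (w u) * cmod (w v) * (cmod (F u) * cmod (F v)) *
        cmod (LINT x|P. (\<phi> u * A x u - 1) * cnj (\<phi> v * A x v - 1))"
      by (simp only: norm_mult complex_mod_cnj mult_ac)
    also have "\<dots> \<le> cmod (w u) * cmod (w v) * K u v * (CN / real n / (cmod (\<phi> u) * cmod (\<phi> v)))"
      by (intro mult_mono mult_left_mono relative_error_covariance) (auto simp: K_def)
    also have "\<dots> = CN / real n * (b u * b v * K u v)" by (simp add: b_def mult_ac)
    finally show "ennreal (cmod (LINT x|P. g2 x u * cnj (g2 x v))) \<le> ennreal (CN / real n) * ennreal (b u * b v * K u v)"
      using CN_pos K0 b0 by (subst ennreal_mult'[symmetric]) (auto intro!: ennreal_leI)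
  qed (use B0 in auto)
  have S_int: "integrable lborel (\<lambda>u. w u * (ecf_deriv X \<Delta> n \<omega> u / of_real \<Delta> / \<i> * inv_ecf X \<Delta> n \<omega> u - F u))"
    and S_eq: "S \<omega> = (LINT u|lborel. g1 \<omega> u) / (of_real \<Delta> * \<i>) + (LINT u|lborel. g2 \<omega> u)" if \<omega>: "\<omega> \<in> space P" for \<omega>
  proof -
    have m: "g1 \<omega> \<in> borel_measurable lborel" "g2 \<omega> \<in> borel_measurable lborel" using \<omega> by measurable
    have i1: "integrable lborel (\<lambda>u. g1 \<omega> u / (of_real \<Delta> * \<i>))"
    proof (rule integrable_divide, rule Bochner_Integration.integrable_bound[OF _ m(1)])
      show "integrable lborel (\<lambda>u. (cmod (w u) * T powr (1 / 2)) * envelope \<omega>)" using w by simp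
      show "AE u in lborel. norm (g1 \<omega> u) \<le> norm (cmod (w u) * T powr (1 / 2) * envelope \<omega>)"
        using g1_bound by (intro AE_I2) (auto intro: order_trans[OF _ abs_ge_self])
    qed
    have i2: "integrable lborel (g2 \<omega>)"
    proof (rule Bochner_Integration.integrable_bound[OF _ m(2)])
      show "integrable lborel (\<lambda>u. (cmod (w u) * B * (T powr (1 / 2) + 1)) * 1)" using w by simp
      show "AE u in lborel. norm (g2 \<omega> u) \<le> norm (cmod (w u) * B * (T powr (1 / 2) + 1) * 1)"
        using g2_bound by (intro AE_I2) (auto intro: order_trans[OF _ abs_ge_self])
    qed
    have eq: "w u * (ecf_deriv X \<Delta> n \<omega> u / of_real \<Delta> / \<i> * inv_ecf X \<Delta> n \<omega> u - F u) = g1 \<omega> u / (of_real \<Delta> * \<i>) + g2 \<omega> u" for u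
    proof -
      have d0: "complex_of_real \<Delta> * \<i> \<noteq> 0" using \<Delta> by simp
      have "ecf_deriv X \<Delta> n \<omega> u = dev \<omega> u + of_real \<Delta> * \<i> * F u * \<phi> u" by (simp add: dev_def \<phi>'F)
      then have "ecf_deriv X \<Delta> n \<omega> u / of_real \<Delta> / \<i> = (dev \<omega> u + (of_real \<Delta> * \<i>) * (F u * \<phi> u)) / (of_real \<Delta> * \<i>)"
        by (simp only: divide_divide_eq_left mult.assoc)
      also have "\<dots> = dev \<omega> u / (of_real \<Delta> * \<i>) + F u * \<phi> u"
        by (simp only: add_divide_distrib nonzero_mult_div_cancel_left[OF d0])
      finally have "ecf_deriv X \<Delta> n \<omega> u / of_real \<Delta> / \<i> = dev \<omega> u / (of_real \<Delta> * \<i>) + F u * \<phi> u" .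
      then show ?thesis
        unfolding A_def[symmetric] g1_def g2_def by (simp add: algebra_simps)
    qed
    show "integrable lborel (\<lambda>u. w u * (ecf_deriv X \<Delta> n \<omega> u / of_real \<Delta> / \<i> * inv_ecf X \<Delta> n \<omega> u - F u))"
      unfolding eq by (rule Bochner_Integration.integrable_add[OF i1 i2])
    have "S \<omega> = (LINT u|lborel. g1 \<omega> u / (of_real \<Delta> * \<i>) + g2 \<omega> u)" unfolding S_def eq ..
    also have "\<dots> = (LINT u|lborel. g1 \<omega> u / (of_real \<Delta> * \<i>)) + (LINT u|lborel. g2 \<omega> u)"
      by (rule Bochner_Integration.integral_add[OF i1 i2])
    finally show "S \<omega> = (LINT u|lborel. g1 \<omega> u) / (of_real \<Delta> * \<i>) + (LINT u|lborel. g2 \<omega> u)" by simp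
  qed
  have S_le: "ennreal ((cmod (S \<omega>))\<^sup>2) \<le> ennreal (2 / \<Delta>\<^sup>2) * ennreal ((cmod (LINT u|lborel. g1 \<omega> u))\<^sup>2)
      + ennreal 2 * ennreal ((cmod (LINT u|lborel. g2 \<omega> u))\<^sup>2)" if \<omega>: "\<omega> \<in> space P" for \<omega>
  proof -
    define x where "x = cmod (LINT u|lborel. g1 \<omega> u)"
    define y where "y = cmod (LINT u|lborel. g2 \<omega> u)"
    have "cmod (S \<omega>) \<le> x / \<Delta> + y"
      unfolding S_eq[OF \<omega>] x_def y_def
      by (rule order_trans[OF norm_triangle_ineq]) (use \<Delta> in \<open>simp add: norm_divide norm_mult\<close>)
    then have "(cmod (S \<omega>))\<^sup>2 \<le> (x / \<Delta> + y)\<^sup>2" by (intro power_mono) auto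
    also have "\<dots> \<le> 2 * (x / \<Delta>)\<^sup>2 + 2 * y\<^sup>2"
      using sum_squares_bound[of "x / \<Delta>" y] by (simp add: power2_sum)
    also have "\<dots> = 2 / \<Delta>\<^sup>2 * x\<^sup>2 + 2 * y\<^sup>2" by (simp add: power_divide)
    finally have "ennreal ((cmod (S \<omega>))\<^sup>2) \<le> ennreal (2 / \<Delta>\<^sup>2 * x\<^sup>2 + 2 * y\<^sup>2)" by (rule ennreal_leI)
    also have "\<dots> = ennreal (2 / \<Delta>\<^sup>2) * ennreal (x\<^sup>2) + ennreal 2 * ennreal (y\<^sup>2)"
    proof -
      have "ennreal (2 / \<Delta>\<^sup>2 * x\<^sup>2) = ennreal (2 / \<Delta>\<^sup>2) * ennreal (x\<^sup>2)" by (rule ennreal_mult') simp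
      moreover have "ennreal (2 * y\<^sup>2) = ennreal 2 * ennreal (y\<^sup>2)" by (rule ennreal_mult') simp
      ultimately show ?thesis by (subst ennreal_plus) simp_all
    qed
    finally show ?thesis unfolding x_def y_def .
  qed
  have "(\<integral>\<^sup>+\<omega>. ennreal ((cmod (S \<omega>))\<^sup>2) \<partial>P) \<le> (\<integral>\<^sup>+\<omega>. ennreal (2 / \<Delta>\<^sup>2) * ennreal ((cmod (LINT u|lborel. g1 \<omega> u))\<^sup>2)
      + ennreal 2 * ennreal ((cmod (LINT u|lborel. g2 \<omega> u))\<^sup>2) \<partial>P)"
    by (rule nn_integral_mono) (rule S_le)
  also have "\<dots> = ennreal (2 / \<Delta>\<^sup>2) * (\<integral>\<^sup>+\<omega>. ennreal ((cmod (LINT u|lborel. g1 \<omega> u))\<^sup>2) \<partial>P)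
      + ennreal 2 * (\<integral>\<^sup>+\<omega>. ennreal ((cmod (LINT u|lborel. g2 \<omega> u))\<^sup>2) \<partial>P)"
    by (subst nn_integral_add) (auto simp: nn_integral_cmult simp del: ennreal_numeral)
  also have "\<dots> \<le> ennreal (2 / \<Delta>\<^sup>2) * (ennreal (CA / real n) * Q) + ennreal 2 * (ennreal (CN / real n) * Q)"
    by (intro add_mono mult_left_mono E1 E2) auto
  also have "\<dots> = ennreal (2 / \<Delta>\<^sup>2 * (CA / real n) + 2 * (CN / real n)) * Q"
  proof -
    have "ennreal (2 / \<Delta>\<^sup>2 * (CA / real n)) = ennreal (2 / \<Delta>\<^sup>2) * ennreal (CA / real n)" by (rule ennreal_mult') simp
    moreover have "ennreal (2 * (CN / real n)) = ennreal 2 * ennreal (CN / real n)" by (rule ennreal_mult') simp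
    moreover have "ennreal (2 / \<Delta>\<^sup>2 * (CA / real n) + 2 * (CN / real n)) = ennreal (2 / \<Delta>\<^sup>2 * (CA / real n)) + ennreal (2 * (CN / real n))"
      using CA_pos CN_pos by (intro ennreal_plus) auto
    ultimately show ?thesis by (simp only: distrib_right mult.assoc)
  qed
  also have "2 / \<Delta>\<^sup>2 * (CA / real n) + 2 * (CN / real n) = (2 * CA / \<Delta>\<^sup>2 + 2 * CN) / real n"
    by (simp add: add_divide_distrib)
  finally show "(\<integral>\<^sup>+\<omega>. ennreal ((cmod (S \<omega>))\<^sup>2) \<partial>P) \<le> ennreal ((2 * CA / \<Delta>\<^sup>2 + 2 * CN) / real n) *
     (\<integral>\<^sup>+u. \<integral>\<^sup>+v. ennreal (b u * b v * (cmod (R (u - v)) + cmod (\<phi>' u) * cmod (\<phi>' v) + cmod (F u) * cmod (F v))) \<partial>lborel \<partial>lborel)"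
    unfolding Q_def K_def .
  show "\<And>\<omega>. \<omega> \<in> space P \<Longrightarrow> integrable lborel (\<lambda>u. w u * (ecf_deriv X \<Delta> n \<omega> u / of_real \<Delta> / \<i> * inv_ecf X \<Delta> n \<omega> u - F u))"
    by (rule S_int)
qed

end

section \<open>Deterministic integral bounds\<close>

text \<open>Young's inequality for convolutions: use \<open>2 b(u) b(v) \<le> b(u)\<^sup>2 + b(v)\<^sup>2\<close> and integrate the kernel first.\<close>
lemma double_integral_translation_kernel:
  fixes b r :: "real \<Rightarrow> real"
  assumes [measurable]: "b \<in> borel_measurable borel" "r \<in> borel_measurable borel"
    and b: "\<And>u. 0 \<le> b u" and r: "\<And>u. 0 \<le> r u"
  shows "(\<integral>\<^sup>+u. \<integral>\<^sup>+v. ennreal (b u * b v * r (u - v)) \<partial>lborel \<partial>lborel)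
     \<le> (\<integral>\<^sup>+u. ennreal ((b u)\<^sup>2) \<partial>lborel) * (\<integral>\<^sup>+u. ennreal (r u) \<partial>lborel)"
proof -
  define B where "B = (\<integral>\<^sup>+u. ennreal ((b u)\<^sup>2) \<partial>lborel)"
  define I where "I = (\<integral>\<^sup>+u. ennreal (r u) \<partial>lborel)"
  have tr1: "(\<integral>\<^sup>+v. ennreal (r (u - v)) \<partial>lborel) = I" for u
    using nn_integral_real_affine[of "\<lambda>u. ennreal (r u)" "-1" u] by (simp add: I_def)
  have tr2: "(\<integral>\<^sup>+u. ennreal (r (u - v)) \<partial>lborel) = I" for v
    using nn_integral_real_affine[of "\<lambda>u. ennreal (r u)" 1 "-v"] by (simp add: I_def)
  have le: "ennreal (b u * b v * r (u - v)) \<le> ennreal (1 / 2) * (ennreal ((b u)\<^sup>2) * ennreal (r (u - v)))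
      + ennreal (1 / 2) * (ennreal ((b v)\<^sup>2) * ennreal (r (u - v)))" for u v
  proof -
    have "b u * b v \<le> 1 / 2 * (b u)\<^sup>2 + 1 / 2 * (b v)\<^sup>2" using sum_squares_bound[of "b u" "b v"] by simp
    then have "b u * b v * r (u - v) \<le> (1 / 2 * (b u)\<^sup>2 + 1 / 2 * (b v)\<^sup>2) * r (u - v)"
      by (rule mult_right_mono) (rule r)
    also have "\<dots> = 1 / 2 * ((b u)\<^sup>2 * r (u - v)) + 1 / 2 * ((b v)\<^sup>2 * r (u - v))" by (simp add: distrib_right)
    finally have "ennreal (b u * b v * r (u - v)) \<le> ennreal (1 / 2 * ((b u)\<^sup>2 * r (u - v)) + 1 / 2 * ((b v)\<^sup>2 * r (u - v)))"
      by (rule ennreal_leI)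
    also have "\<dots> = ennreal (1 / 2 * ((b u)\<^sup>2 * r (u - v))) + ennreal (1 / 2 * ((b v)\<^sup>2 * r (u - v)))"
      using r by (intro ennreal_plus) auto
    finally show ?thesis by (simp only: ennreal_mult'[OF zero_le_power2] ennreal_mult'[of "1/2"] zero_le_divide_1_iff zero_le_numeral)
  qed
  have one: "(\<integral>\<^sup>+u. \<integral>\<^sup>+v. ennreal (1 / 2) * (ennreal ((b u)\<^sup>2) * ennreal (r (u - v))) \<partial>lborel \<partial>lborel) = ennreal (1 / 2) * (B * I)"
    by (simp add: nn_integral_cmult tr1 nn_integral_multc B_def del: ennreal_half)
  have two: "(\<integral>\<^sup>+u. \<integral>\<^sup>+v. ennreal (1 / 2) * (ennreal ((b v)\<^sup>2) * ennreal (r (u - v))) \<partial>lborel \<partial>lborel) = ennreal (1 / 2) * (B * I)"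
    by (subst lborel_pair.Fubini') (simp_all add: nn_integral_cmult tr2 nn_integral_multc B_def)
  have "(\<integral>\<^sup>+u. \<integral>\<^sup>+v. ennreal (b u * b v * r (u - v)) \<partial>lborel \<partial>lborel)
     \<le> (\<integral>\<^sup>+u. \<integral>\<^sup>+v. ennreal (1 / 2) * (ennreal ((b u)\<^sup>2) * ennreal (r (u - v)))
      + ennreal (1 / 2) * (ennreal ((b v)\<^sup>2) * ennreal (r (u - v))) \<partial>lborel \<partial>lborel)"
    by (intro nn_integral_mono le)
  also have "\<dots> = ennreal (1 / 2) * (B * I) + ennreal (1 / 2) * (B * I)"
  proof -
    have "(\<integral>\<^sup>+u. \<integral>\<^sup>+v. ennreal (1 / 2) * (ennreal ((b u)\<^sup>2) * ennreal (r (u - v)))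
        + ennreal (1 / 2) * (ennreal ((b v)\<^sup>2) * ennreal (r (u - v))) \<partial>lborel \<partial>lborel)
      = (\<integral>\<^sup>+u. (\<integral>\<^sup>+v. ennreal (1 / 2) * (ennreal ((b u)\<^sup>2) * ennreal (r (u - v))) \<partial>lborel)
        + (\<integral>\<^sup>+v. ennreal (1 / 2) * (ennreal ((b v)\<^sup>2) * ennreal (r (u - v))) \<partial>lborel) \<partial>lborel)"
      by (intro nn_integral_cong nn_integral_add) measurable
    also have "\<dots> = (\<integral>\<^sup>+u. \<integral>\<^sup>+v. ennreal (1 / 2) * (ennreal ((b u)\<^sup>2) * ennreal (r (u - v))) \<partial>lborel \<partial>lborel)
        + (\<integral>\<^sup>+u. \<integral>\<^sup>+v. ennreal (1 / 2) * (ennreal ((b v)\<^sup>2) * ennreal (r (u - v))) \<partial>lborel \<partial>lborel)"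
      by (rule nn_integral_add) measurable
    finally show ?thesis unfolding one two .
  qed
  also have "\<dots> = (ennreal (1 / 2) + ennreal (1 / 2)) * (B * I)" by (rule distrib_right[symmetric])
  also have "\<dots> = B * I" by (subst ennreal_plus[symmetric]) auto
  finally show ?thesis unfolding B_def I_def .
qed

lemma double_integral_product_kernel:
  fixes b f :: "real \<Rightarrow> real"
  assumes [measurable]: "b \<in> borel_measurable borel" "f \<in> borel_measurable borel"
    and b: "\<And>u. 0 \<le> b u" and f: "\<And>u. 0 \<le> f u"
  shows "(\<integral>\<^sup>+u. \<integral>\<^sup>+v. ennreal (b u * b v * (f u * f v)) \<partial>lborel \<partial>lborel)
     \<le> (\<integral>\<^sup>+u. ennreal ((b u)\<^sup>2) \<partial>lborel) * (\<integral>\<^sup>+u. ennreal ((f u)\<^sup>2) \<partial>lborel)"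
proof -
  have eq: "ennreal (b u * b v * (f u * f v)) = (ennreal (b u) * ennreal (f u)) * (ennreal (b v) * ennreal (f v))" for u v
    using b f by (simp add: ennreal_mult'[symmetric] mult_ac)
  have "(\<integral>\<^sup>+u. \<integral>\<^sup>+v. ennreal (b u * b v * (f u * f v)) \<partial>lborel \<partial>lborel) = (\<integral>\<^sup>+u. ennreal (b u) * ennreal (f u) \<partial>lborel)\<^sup>2"
    unfolding eq by (simp add: nn_integral_cmult nn_integral_multc power2_eq_square)
  also have "\<dots> \<le> (\<integral>\<^sup>+u. (ennreal (b u))\<^sup>2 \<partial>lborel) * (\<integral>\<^sup>+u. (ennreal (f u))\<^sup>2 \<partial>lborel)"
    by (rule Cauchy_Schwarz_nn_integral) auto
  finally show ?thesis using b f by (simp add: ennreal_power)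
qed

lemma double_integral_bounded_kernel:
  fixes b :: "real \<Rightarrow> real"
  assumes [measurable]: "b \<in> borel_measurable borel" and b: "\<And>u. 0 \<le> b u" and k: "\<And>u v. k u v \<le> \<kappa>"
  shows "(\<integral>\<^sup>+u. \<integral>\<^sup>+v. ennreal (b u * b v * k u v) \<partial>lborel \<partial>lborel) \<le> ennreal \<kappa> * (\<integral>\<^sup>+u. ennreal (b u) \<partial>lborel)\<^sup>2"
proof -
  have "(\<integral>\<^sup>+u. \<integral>\<^sup>+v. ennreal (b u * b v * k u v) \<partial>lborel \<partial>lborel)
     \<le> (\<integral>\<^sup>+u. \<integral>\<^sup>+v. ennreal \<kappa> * (ennreal (b u) * ennreal (b v)) \<partial>lborel \<partial>lborel)"
  proof (intro nn_integral_mono)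
    fix u v
    have "b u * b v * k u v \<le> b u * b v * \<kappa>" using b k by (intro mult_left_mono) auto
    then have "ennreal (b u * b v * k u v) \<le> ennreal (b u * b v * \<kappa>)" by (rule ennreal_leI)
    also have "\<dots> = ennreal \<kappa> * (ennreal (b u) * ennreal (b v))"
    proof -
      have "ennreal (b u * b v * \<kappa>) = ennreal (b u * b v) * ennreal \<kappa>"
        using b by (intro ennreal_mult' mult_nonneg_nonneg)
      moreover have "ennreal (b u * b v) = ennreal (b u) * ennreal (b v)" by (rule ennreal_mult'[OF b])
      ultimately show ?thesis by (simp only: mult.commute)
    qed
    finally show "ennreal (b u * b v * k u v) \<le> ennreal \<kappa> * (ennreal (b u) * ennreal (b v))" .
  qed
  also have "\<dots> = ennreal \<kappa> * (\<integral>\<^sup>+u. ennreal (b u) \<partial>lborel)\<^sup>2"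
    by (simp add: nn_integral_cmult nn_integral_multc power2_eq_square)
  finally show ?thesis .
qed

lemma powr_one_plus_square_le:
  fixes u :: real
  assumes "\<bar>u\<bar> \<le> H"
  shows "(1 + u\<^sup>2) powr e \<le> (1 + H\<^sup>2) powr \<bar>e\<bar>"
proof -
  have "(1 + u\<^sup>2) powr e \<le> (1 + u\<^sup>2) powr \<bar>e\<bar>" by (intro powr_mono) auto
  also have "\<dots> \<le> (1 + H\<^sup>2) powr \<bar>e\<bar>"
    using assms by (intro powr_mono2) (auto simp: abs_le_square_iff[symmetric])
  finally show ?thesis .
qed

lemma nn_integral_interval_le:
  fixes f :: "real \<Rightarrow> real"
  assumes "\<And>u. \<bar>u\<bar> \<le> H \<Longrightarrow> f u \<le> B" and "H \<ge> 0" "B \<ge> 0"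
  shows "(\<integral>\<^sup>+u\<in>{-H..H}. ennreal (f u) \<partial>lborel) \<le> ennreal (2 * H * B)"
proof -
  have "(\<integral>\<^sup>+u\<in>{-H..H}. ennreal (f u) \<partial>lborel) \<le> (\<integral>\<^sup>+u. ennreal B * indicator {-H..H} u \<partial>lborel)"
    using assms(1) by (intro nn_integral_mono) (auto simp: indicator_def abs_le_iff intro!: ennreal_leI)
  also have "\<dots> = ennreal B * ennreal (2 * H)"
    using assms(2) by (simp add: nn_integral_cmult_indicator)
  also have "\<dots> = ennreal (2 * H * B)" using assms by (simp add: ennreal_mult'[symmetric] mult.commute)
  finally show ?thesis .
qed

text \<open>The weight is bounded on \<open>[-1, 1]\<close> and comparable with \<open>\<bar>u\<bar> powr (2 e)\<close> outside.\<close>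
lemma weight_integral_le:
  fixes e H :: real
  assumes H: "H \<ge> 1" and prim: "\<And>x. 1 \<le> x \<Longrightarrow> x \<le> H \<Longrightarrow> (G has_real_derivative x powr (2 * e)) (at x)"
  shows "(\<integral>\<^sup>+u\<in>{-H..H}. ennreal ((1 + u\<^sup>2) powr e) \<partial>lborel) \<le> ennreal (2 * 2 powr \<bar>e\<bar> * (1 + (G H - G 1)))"
proof -
  let ?f = "\<lambda>u. ennreal ((1 + u\<^sup>2) powr e)"
  have mono: "G 1 \<le> G H"
    by (rule DERIV_nonneg_imp_nondecreasing[OF H]) (use prim in \<open>auto intro!: exI\<close>)
  have tail: "(\<integral>\<^sup>+u\<in>{1..H}. ?f u \<partial>lborel) \<le> ennreal (2 powr \<bar>e\<bar> * (G H - G 1))"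
  proof -
    have "(\<integral>\<^sup>+u\<in>{1..H}. ?f u \<partial>lborel) \<le> (\<integral>\<^sup>+u. ennreal (2 powr \<bar>e\<bar>) * (ennreal (u powr (2 * e)) * indicator {1..H} u) \<partial>lborel)"
    proof (rule nn_integral_mono)
      fix u :: real
      show "?f u * indicator {1..H} u \<le> ennreal (2 powr \<bar>e\<bar>) * (ennreal (u powr (2 * e)) * indicator {1..H} u)"
      proof (cases "u \<in> {1..H}")
        case True
        then have u: "1 \<le> u" by simp
        have "(1 + u\<^sup>2) powr e = (u\<^sup>2 * (1 + 1 / u\<^sup>2)) powr e" proof -
          have "u\<^sup>2 * (1 + 1 / u\<^sup>2) = 1 + u\<^sup>2" using u by (simp add: distrib_left)
          then show ?thesis by simp
        qed
        also have "\<dots> = (u powr 2) powr e * (1 + 1 / u\<^sup>2) powr e" using u by (simp add: powr_mult powr_numeral)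
        also have "\<dots> \<le> (u powr 2) powr e * 2 powr \<bar>e\<bar>"
        proof (intro mult_left_mono)
          have "(1 + 1 / u\<^sup>2) powr e \<le> (1 + 1 / u\<^sup>2) powr \<bar>e\<bar>" by (intro powr_mono) auto
          also have "\<dots> \<le> 2 powr \<bar>e\<bar>"
            using u by (intro powr_mono2) (auto simp: one_le_power)
          finally show "(1 + 1 / u\<^sup>2) powr e \<le> 2 powr \<bar>e\<bar>" .
        qed simp
        finally have "(1 + u\<^sup>2) powr e \<le> 2 powr \<bar>e\<bar> * u powr (2 * e)" by (simp add: powr_powr mult.commute)
        then show ?thesis using True by (simp add: ennreal_mult'[symmetric] ennreal_leI)
      qed simp
    qed
    also have "\<dots> = ennreal (2 powr \<bar>e\<bar>) * (\<integral>\<^sup>+u. ennreal (u powr (2 * e)) * indicator {1..H} u \<partial>lborel)"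
      by (rule nn_integral_cmult) measurable
    also have "(\<integral>\<^sup>+u. ennreal (u powr (2 * e)) * indicator {1..H} u \<partial>lborel) = ennreal (G H - G 1)"
      by (rule nn_integral_FTC_Icc) (use H prim in auto)
    finally show ?thesis using mono by (simp add: ennreal_mult'[symmetric])
  qed
  have refl: "(\<integral>\<^sup>+u\<in>{-H..-1}. ?f u \<partial>lborel) = (\<integral>\<^sup>+u\<in>{1..H}. ?f u \<partial>lborel)"
  proof -
    have "(\<integral>\<^sup>+u\<in>{1..H}. ?f u \<partial>lborel) = (\<integral>\<^sup>+u. ?f (- u) * indicator {1..H} (- u) \<partial>lborel)"
      by (rule nn_integral_lborel_uminus[symmetric]) measurable
    also have "\<dots> = (\<integral>\<^sup>+u\<in>{-H..-1}. ?f u \<partial>lborel)"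
      by (intro nn_integral_cong) (auto simp: indicator_def)
    finally show ?thesis by simp
  qed
  have mid: "(\<integral>\<^sup>+u\<in>{-1..1}. ?f u \<partial>lborel) \<le> ennreal (2 * 1 * 2 powr \<bar>e\<bar>)"
    by (rule nn_integral_interval_le) (use powr_one_plus_square_le[of _ 1 e] in auto)
  have "(\<integral>\<^sup>+u\<in>{-H..H}. ?f u \<partial>lborel) \<le> (\<integral>\<^sup>+u. ?f u * indicator {-1..1} u + (?f u * indicator {1..H} u + ?f u * indicator {-H..-1} u) \<partial>lborel)"
    by (intro nn_integral_mono) (auto simp: indicator_def)
  also have "\<dots> = (\<integral>\<^sup>+u\<in>{-1..1}. ?f u \<partial>lborel) + ((\<integral>\<^sup>+u\<in>{1..H}. ?f u \<partial>lborel) + (\<integral>\<^sup>+u\<in>{-H..-1}. ?f u \<partial>lborel))"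
  proof -
    have "(\<integral>\<^sup>+u. ?f u * indicator {1..H} u + ?f u * indicator {-H..-1} u \<partial>lborel)
        = (\<integral>\<^sup>+u\<in>{1..H}. ?f u \<partial>lborel) + (\<integral>\<^sup>+u\<in>{-H..-1}. ?f u \<partial>lborel)"
      by (rule nn_integral_add) measurable
    moreover have "(\<integral>\<^sup>+u. ?f u * indicator {-1..1} u + (?f u * indicator {1..H} u + ?f u * indicator {-H..-1} u) \<partial>lborel)
        = (\<integral>\<^sup>+u\<in>{-1..1}. ?f u \<partial>lborel) + (\<integral>\<^sup>+u. ?f u * indicator {1..H} u + ?f u * indicator {-H..-1} u \<partial>lborel)"
      by (rule nn_integral_add) measurable
    ultimately show ?thesis by (simp only:)
  qed
  also have "\<dots> \<le> ennreal (2 * 1 * 2 powr \<bar>e\<bar>) + (ennreal (2 powr \<bar>e\<bar> * (G H - G 1)) + ennreal (2 powr \<bar>e\<bar> * (G H - G 1)))"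
    unfolding refl by (intro add_mono mid tail)
  also have "\<dots> = ennreal (2 * 2 powr \<bar>e\<bar> * (1 + (G H - G 1)))"
    using mono by (subst ennreal_plus[symmetric], simp, simp, subst ennreal_plus[symmetric]) (auto simp: algebra_simps)
  finally show ?thesis .
qed

lemma weight_integral_cases:
  fixes e H :: real
  assumes H: "H \<ge> 1"
  defines "J \<equiv> (\<integral>\<^sup>+u\<in>{-H..H}. ennreal ((1 + u\<^sup>2) powr e) \<partial>lborel)"
  shows "2 * e < - 1 \<Longrightarrow> J \<le> ennreal (2 * 2 powr \<bar>e\<bar> * (1 - 1 / (2 * e + 1)))"
    and "2 * e = - 1 \<Longrightarrow> J \<le> ennreal (2 * 2 powr \<bar>e\<bar> * (1 + ln H))"
    and "2 * e > - 1 \<Longrightarrow> J \<le> ennreal (2 * 2 powr \<bar>e\<bar> * (1 + 1 / (2 * e + 1)) * H powr (2 * e + 1))"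
proof -
  have prim: "((\<lambda>x. x powr (2 * e + 1) / (2 * e + 1)) has_real_derivative x powr (2 * e)) (at x)"
    if "2 * e \<noteq> - 1" "1 \<le> x" for x
  proof -
    have ne: "2 * e + 1 \<noteq> 0" using that by simp
    have "((\<lambda>x. x powr (2 * e + 1)) has_real_derivative (2 * e + 1) * x powr (2 * e + 1 - 1)) (at x)"
      by (rule has_real_derivative_powr) (use that in simp)
    from DERIV_cdivide[OF this, of "2 * e + 1"] ne show ?thesis by simp
  qed
  show "J \<le> ennreal (2 * 2 powr \<bar>e\<bar> * (1 - 1 / (2 * e + 1)))" if e: "2 * e < - 1"
  proof -
    have "J \<le> ennreal (2 * 2 powr \<bar>e\<bar> * (1 + (H powr (2 * e + 1) / (2 * e + 1) - 1 powr (2 * e + 1) / (2 * e + 1))))"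
      unfolding J_def by (rule weight_integral_le[OF H prim]) (use e in auto)
    also have "\<dots> \<le> ennreal (2 * 2 powr \<bar>e\<bar> * (1 - 1 / (2 * e + 1)))"
      using e by (intro ennreal_leI mult_left_mono) (auto simp: divide_nonneg_neg)
    finally show ?thesis .
  qed
  show "J \<le> ennreal (2 * 2 powr \<bar>e\<bar> * (1 + ln H))" if e: "2 * e = - 1"
  proof -
    have "J \<le> ennreal (2 * 2 powr \<bar>e\<bar> * (1 + (ln H - ln 1)))"
      unfolding J_def
      by (rule weight_integral_le[OF H]) (auto intro!: derivative_eq_intros simp: e powr_minus_divide)
    then show ?thesis by simp
  qed
  show "J \<le> ennreal (2 * 2 powr \<bar>e\<bar> * (1 + 1 / (2 * e + 1)) * H powr (2 * e + 1))" if e: "2 * e > - 1"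
  proof -
    have "J \<le> ennreal (2 * 2 powr \<bar>e\<bar> * (1 + (H powr (2 * e + 1) / (2 * e + 1) - 1 powr (2 * e + 1) / (2 * e + 1))))"
      unfolding J_def by (rule weight_integral_le[OF H prim]) (use e in auto)
    also have "\<dots> \<le> ennreal (2 * 2 powr \<bar>e\<bar> * (1 * H powr (2 * e + 1) + 1 / (2 * e + 1) * H powr (2 * e + 1)))"
    proof (intro ennreal_leI mult_left_mono)
      have "1 \<le> H powr (2 * e + 1)" using H e by (intro ge_one_powr_ge_zero) auto
      moreover have "1 / (2 * e + 1) \<ge> 0" using e by simp
      ultimately show "1 + (H powr (2 * e + 1) / (2 * e + 1) - 1 powr (2 * e + 1) / (2 * e + 1))
        \<le> 1 * H powr (2 * e + 1) + 1 / (2 * e + 1) * H powr (2 * e + 1)"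
        unfolding powr_one_eq_one mult_1 times_divide_eq_left by linarith
    qed simp
    finally show ?thesis by (simp only: distrib_right[symmetric] mult.assoc)
  qed
qed

lemma powr_half_square: "(x powr (t / 2))\<^sup>2 = x powr (t::real)"
  by (simp add: power2_eq_square flip: powr_add)

text \<open>The exponents of the two Sobolev weights average to the exponent on the left.\<close>
lemma weighted_Cauchy_Schwarz:
  fixes f g :: "real \<Rightarrow> complex"
  assumes [measurable]: "f \<in> borel_measurable borel" "g \<in> borel_measurable borel"
    and f: "(\<integral>\<^sup>+u. ennreal ((cmod (f u))\<^sup>2 * (1 + u\<^sup>2) powr s) \<partial>lborel) \<le> ennreal M"
    and g: "(\<integral>\<^sup>+u. ennreal ((cmod (g u))\<^sup>2 * (1 + u\<^sup>2) powr a) \<partial>lborel) \<le> ennreal N"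
    and "M \<ge> 0"
  shows "(\<integral>\<^sup>+u. ennreal (cmod (f u) * cmod (g u) * (1 + u\<^sup>2) powr ((a + s) / 2)) \<partial>lborel)\<^sup>2 \<le> ennreal (M * N)"
proof -
  have pos: "1 + u\<^sup>2 > (0::real)" for u by (simp add: add_pos_nonneg)
  have sq: "(ennreal (cmod z * (1 + u\<^sup>2) powr (t / 2)))\<^sup>2 = ennreal ((cmod z)\<^sup>2 * (1 + u\<^sup>2) powr t)" for z u t
    by (simp add: ennreal_power power_mult_distrib powr_half_square)
  have "ennreal (cmod (f u) * cmod (g u) * (1 + u\<^sup>2) powr ((a + s) / 2))
     = ennreal (cmod (f u) * (1 + u\<^sup>2) powr (s / 2)) * ennreal (cmod (g u) * (1 + u\<^sup>2) powr (a / 2))" for u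
    by (subst ennreal_mult[symmetric]) (auto simp: add_divide_distrib powr_add mult_ac)
  then have "(\<integral>\<^sup>+u. ennreal (cmod (f u) * cmod (g u) * (1 + u\<^sup>2) powr ((a + s) / 2)) \<partial>lborel)\<^sup>2
     = (\<integral>\<^sup>+u. ennreal (cmod (f u) * (1 + u\<^sup>2) powr (s / 2)) * ennreal (cmod (g u) * (1 + u\<^sup>2) powr (a / 2)) \<partial>lborel)\<^sup>2"
    by simp
  also have "\<dots> \<le> (\<integral>\<^sup>+u. (ennreal (cmod (f u) * (1 + u\<^sup>2) powr (s / 2)))\<^sup>2 \<partial>lborel)
      * (\<integral>\<^sup>+u. (ennreal (cmod (g u) * (1 + u\<^sup>2) powr (a / 2)))\<^sup>2 \<partial>lborel)"
    by (rule Cauchy_Schwarz_nn_integral) measurable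
  also have "\<dots> \<le> ennreal M * ennreal N"
    unfolding sq by (intro mult_mono f g) auto
  also have "\<dots> = ennreal (M * N)" using \<open>M \<ge> 0\<close> by (simp add: ennreal_mult')
  finally show ?thesis .
qed

text \<open>The exponent \<open>a + s\<close> in the hypothesis on \<open>G\<close> is exactly what the two Sobolev weights can absorb.\<close>
lemma bias_bound:
  fixes f g G :: "real \<Rightarrow> complex"
  assumes meas: "f \<in> borel_measurable borel" "g \<in> borel_measurable borel"
    and f: "(\<integral>\<^sup>+u. ennreal ((cmod (f u))\<^sup>2 * (1 + u\<^sup>2) powr s) \<partial>lborel) \<le> ennreal M"
    and g: "(\<integral>\<^sup>+u. ennreal ((cmod (g u))\<^sup>2 * (1 + u\<^sup>2) powr a) \<partial>lborel) \<le> ennreal N"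
    and M: "M \<ge> 0" and k: "a + s > 0" and h: "h > 0" and B: "B \<ge> 0"
    and G: "\<And>u. cmod (1 - G u) \<le> B * \<bar>u\<bar> powr (a + s)"
  shows "ennreal ((cmod (LINT u|lborel. f u * (1 - G (h * u)) * g u))\<^sup>2) \<le> ennreal (B\<^sup>2 * M * N * h powr (2 * (a + s)))"
proof -
  define q where "q = B * h powr (a + s)"
  have q0: "q \<ge> 0" using B by (simp add: q_def)
  note [measurable] = meas
  have le: "cmod (f u * (1 - G (h * u)) * g u) \<le> q * (cmod (f u) * cmod (g u) * (1 + u\<^sup>2) powr ((a + s) / 2))" for u
  proof -
    have "\<bar>u\<bar> powr (a + s) = (u\<^sup>2) powr ((a + s) / 2)"
    proof (cases "u = 0")
      case False
      have "u\<^sup>2 = \<bar>u\<bar> powr 2" using False by (simp add: powr_numeral)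
      then have "(u\<^sup>2) powr ((a + s) / 2) = \<bar>u\<bar> powr (2 * ((a + s) / 2))" by (simp only: powr_powr)
      moreover have "2 * ((a + s) / 2) = a + s" by simp
      ultimately show ?thesis by (simp only:)
    qed simp
    also have "\<dots> \<le> (1 + u\<^sup>2) powr ((a + s) / 2)" using k by (intro powr_mono2) auto
    finally have "cmod (1 - G (h * u)) \<le> q * (1 + u\<^sup>2) powr ((a + s) / 2)"
      using G[of "h * u"] h B unfolding q_def abs_mult
      by (auto simp: powr_mult mult.assoc intro: order_trans[OF _ mult_left_mono[OF mult_left_mono]])
    then have "cmod (f u) * cmod (1 - G (h * u)) * cmod (g u) \<le> cmod (f u) * (q * (1 + u\<^sup>2) powr ((a + s) / 2)) * cmod (g u)"
      by (intro mult_right_mono mult_left_mono) auto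
    then show ?thesis by (simp add: norm_mult mult_ac)
  qed
  have "ennreal (cmod (LINT u|lborel. f u * (1 - G (h * u)) * g u))
     \<le> (\<integral>\<^sup>+u. ennreal (cmod (f u * (1 - G (h * u)) * g u)) \<partial>lborel)"
    by (rule ennreal_norm_integral_le)
  also have "\<dots> \<le> (\<integral>\<^sup>+u. ennreal q * ennreal (cmod (f u) * cmod (g u) * (1 + u\<^sup>2) powr ((a + s) / 2)) \<partial>lborel)"
    using le q0 by (intro nn_integral_mono) (simp add: ennreal_mult'[symmetric] ennreal_leI)
  also have "\<dots> = ennreal q * (\<integral>\<^sup>+u. ennreal (cmod (f u) * cmod (g u) * (1 + u\<^sup>2) powr ((a + s) / 2)) \<partial>lborel)"
    by (rule nn_integral_cmult) measurable
  finally have "(ennreal (cmod (LINT u|lborel. f u * (1 - G (h * u)) * g u)))\<^sup>2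
     \<le> (ennreal q * (\<integral>\<^sup>+u. ennreal (cmod (f u) * cmod (g u) * (1 + u\<^sup>2) powr ((a + s) / 2)) \<partial>lborel))\<^sup>2"
    by (rule power_mono) simp
  also have "\<dots> \<le> (ennreal q)\<^sup>2 * ennreal (M * N)"
    unfolding power_mult_distrib by (intro mult_left_mono weighted_Cauchy_Schwarz meas f g M) auto
  also have "\<dots> = ennreal (B\<^sup>2 * M * N * h powr (2 * (a + s)))"
  proof -
    have "(ennreal q)\<^sup>2 * ennreal (M * N) = ennreal (q\<^sup>2 * (M * N))"
      using q0 by (simp add: ennreal_power ennreal_mult')
    also have "q\<^sup>2 * (M * N) = B\<^sup>2 * M * N * h powr (2 * (a + s))"
      using h by (simp add: q_def power_mult_distrib powr_power mult_ac)
    finally show ?thesis .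
  qed
  finally show ?thesis by (simp add: ennreal_power)
qed

lemma noise_weight_square_integral:
  fixes f :: "real \<Rightarrow> complex" and b :: "real \<Rightarrow> real"
  assumes [measurable]: "f \<in> borel_measurable borel"
    and f: "(\<integral>\<^sup>+u. ennreal ((cmod (f u))\<^sup>2 * (1 + u\<^sup>2) powr s) \<partial>lborel) \<le> ennreal M" and M: "M \<ge> 0"
    and b: "\<And>u. 0 \<le> b u" "\<And>u. b u \<le> q * (cmod (f u) * (indicator {-H..H} u * (1 + u\<^sup>2) powr (\<gamma> / 2)))"
    and q: "q \<ge> 0" and L: "\<And>u. \<bar>u\<bar> \<le> H \<Longrightarrow> (1 + u\<^sup>2) powr (\<gamma> - s) \<le> L"
  shows "(\<integral>\<^sup>+u. ennreal ((b u)\<^sup>2) \<partial>lborel) \<le> ennreal (q\<^sup>2 * M * L)"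
proof -
  have pos: "1 + u\<^sup>2 > (0::real)" for u by (simp add: add_pos_nonneg)
  have L0: "L \<ge> 0 \<or> H < 0"
    using L[of 0] by force
  have le: "(b u)\<^sup>2 \<le> q\<^sup>2 * max 0 L * ((cmod (f u))\<^sup>2 * (1 + u\<^sup>2) powr s)" for u
  proof (cases "\<bar>u\<bar> \<le> H")
    case True
    have ind: "indicator {-H..H} u = (1::real)" using True by (simp add: indicator_def abs_le_iff)
    have "(b u)\<^sup>2 \<le> (q * (cmod (f u) * (1 + u\<^sup>2) powr (\<gamma> / 2)))\<^sup>2"
      using b(2)[of u] ind by (intro power_mono b) simp
    also have "\<dots> = q\<^sup>2 * ((cmod (f u))\<^sup>2 * (1 + u\<^sup>2) powr \<gamma>)"
      by (simp add: power_mult_distrib powr_half_square)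
    also have "(1 + u\<^sup>2) powr \<gamma> = (1 + u\<^sup>2) powr (\<gamma> - s) * (1 + u\<^sup>2) powr s"
      by (simp flip: powr_add)
    also have "q\<^sup>2 * ((cmod (f u))\<^sup>2 * ((1 + u\<^sup>2) powr (\<gamma> - s) * (1 + u\<^sup>2) powr s))
       \<le> q\<^sup>2 * ((cmod (f u))\<^sup>2 * (max 0 L * (1 + u\<^sup>2) powr s))"
      using L[OF True] by (intro mult_left_mono mult_right_mono) auto
    finally show ?thesis by (simp add: mult_ac)
  next
    case False
    then have "indicator {-H..H} u = (0::real)" by (auto simp: indicator_def)
    then have "b u = 0" using b(1)[of u] b(2)[of u] by simp
    then show ?thesis by simp
  qed
  have "(\<integral>\<^sup>+u. ennreal ((b u)\<^sup>2) \<partial>lborel) \<le> (\<integral>\<^sup>+u. ennreal (q\<^sup>2 * max 0 L) * ennreal ((cmod (f u))\<^sup>2 * (1 + u\<^sup>2) powr s) \<partial>lborel)"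
    by (intro nn_integral_mono order_trans[OF ennreal_leI[OF le]]) (simp add: ennreal_mult')
  also have "\<dots> = ennreal (q\<^sup>2 * max 0 L) * (\<integral>\<^sup>+u. ennreal ((cmod (f u))\<^sup>2 * (1 + u\<^sup>2) powr s) \<partial>lborel)"
    by (rule nn_integral_cmult) measurable
  also have "\<dots> \<le> ennreal (q\<^sup>2 * max 0 L) * ennreal M" by (intro mult_left_mono f) auto
  also have "\<dots> = ennreal (q\<^sup>2 * max 0 L * M)" by (simp add: ennreal_mult')
  also have "q\<^sup>2 * max 0 L * M = max 0 (q\<^sup>2 * M * L)"
    using M by (auto simp: max_def mult_ac zero_le_mult_iff mult_le_0_iff)
  finally show ?thesis by (simp add: max_def ennreal_neg split: if_splits)
qed

text \<open>Cauchy-Schwarz, with the Sobolev weight of \<open>f\<close> in one factor and the remaining weight in the other.\<close>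
lemma noise_weight_integral_square:
  fixes f :: "real \<Rightarrow> complex" and b :: "real \<Rightarrow> real"
  assumes [measurable]: "f \<in> borel_measurable borel"
    and f: "(\<integral>\<^sup>+u. ennreal ((cmod (f u))\<^sup>2 * (1 + u\<^sup>2) powr s) \<partial>lborel) \<le> ennreal M"
    and b: "\<And>u. b u \<le> q * (cmod (f u) * (indicator {-H..H} u * (1 + u\<^sup>2) powr (\<gamma> / 2)))"
    and q: "q \<ge> 0"
  shows "(\<integral>\<^sup>+u. ennreal (b u) \<partial>lborel)\<^sup>2 \<le> ennreal (q\<^sup>2 * M) * (\<integral>\<^sup>+u\<in>{-H..H}. ennreal ((1 + u\<^sup>2) powr (\<gamma> - s)) \<partial>lborel)"
proof -
  have sq1: "(ennreal (q * (cmod z * (1 + u\<^sup>2) powr (s / 2))))\<^sup>2 = ennreal (q\<^sup>2) * ennreal ((cmod z)\<^sup>2 * (1 + u\<^sup>2) powr s)" for z u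
    using q by (simp add: ennreal_power power_mult_distrib powr_half_square flip: ennreal_mult')
  have sq2: "(ennreal (indicator {-H..H} u * (1 + u\<^sup>2) powr ((\<gamma> - s) / 2)))\<^sup>2 = ennreal ((1 + u\<^sup>2) powr (\<gamma> - s)) * indicator {-H..H} u" for u :: real
    by (simp add: ennreal_power power_mult_distrib powr_half_square indicator_def)
  have le: "ennreal (b u) \<le> ennreal (q * (cmod (f u) * (1 + u\<^sup>2) powr (s / 2))) * ennreal (indicator {-H..H} u * (1 + u\<^sup>2) powr ((\<gamma> - s) / 2))" for u
  proof -
    have "(1 + u\<^sup>2) powr (\<gamma> / 2) = (1 + u\<^sup>2) powr (s / 2) * (1 + u\<^sup>2) powr ((\<gamma> - s) / 2)"
      by (simp add: diff_divide_distrib flip: powr_add)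
    then have "b u \<le> (q * (cmod (f u) * (1 + u\<^sup>2) powr (s / 2))) * (indicator {-H..H} u * (1 + u\<^sup>2) powr ((\<gamma> - s) / 2))"
      using b[of u] by (simp add: mult_ac)
    then show ?thesis using q by (subst ennreal_mult'[symmetric]) (auto intro: ennreal_leI)
  qed
  have "(\<integral>\<^sup>+u. ennreal (b u) \<partial>lborel)\<^sup>2
     \<le> (\<integral>\<^sup>+u. ennreal (q * (cmod (f u) * (1 + u\<^sup>2) powr (s / 2))) * ennreal (indicator {-H..H} u * (1 + u\<^sup>2) powr ((\<gamma> - s) / 2)) \<partial>lborel)\<^sup>2"
    by (intro power_mono nn_integral_mono le) simp
  also have "\<dots> \<le> (\<integral>\<^sup>+u. (ennreal (q * (cmod (f u) * (1 + u\<^sup>2) powr (s / 2))))\<^sup>2 \<partial>lborel)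
      * (\<integral>\<^sup>+u. (ennreal (indicator {-H..H} u * (1 + u\<^sup>2) powr ((\<gamma> - s) / 2)))\<^sup>2 \<partial>lborel)"
    by (rule Cauchy_Schwarz_nn_integral) measurable
  also have "\<dots> = (ennreal (q\<^sup>2) * (\<integral>\<^sup>+u. ennreal ((cmod (f u))\<^sup>2 * (1 + u\<^sup>2) powr s) \<partial>lborel))
      * (\<integral>\<^sup>+u\<in>{-H..H}. ennreal ((1 + u\<^sup>2) powr (\<gamma> - s)) \<partial>lborel)"
    unfolding sq1 sq2 by (subst nn_integral_cmult) auto
  also have "\<dots> \<le> (ennreal (q\<^sup>2) * ennreal M) * (\<integral>\<^sup>+u\<in>{-H..H}. ennreal ((1 + u\<^sup>2) powr (\<gamma> - s)) \<partial>lborel)"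
    by (intro mult_right_mono mult_left_mono f) auto
  finally show ?thesis by (simp add: ennreal_mult')
qed

text \<open>A translation kernel with integrable profile and a product kernel with square integrable factors act
  boundedly on \<open>L\<^sup>2\<close>; a bounded kernel only acts on \<open>L\<^sup>1\<close>.\<close>
lemma (in increment_sample) sample_kernel_bounds:
  fixes \<Psi>1 \<Psi>2 F :: "real \<Rightarrow> complex" and b :: "real \<Rightarrow> real"
  assumes [measurable]: "\<Psi>1 \<in> borel_measurable borel" "\<Psi>2 \<in> borel_measurable borel" "b \<in> borel_measurable borel"
    and R: "\<And>t. cmod (R t) \<le> \<Delta> * cmod (\<Psi>2 t) + \<Delta>\<^sup>2 * (cmod (\<Psi>1 t))\<^sup>2"
    and \<phi>': "\<And>t. cmod (\<phi>' t) \<le> \<Delta> * cmod (\<Psi>1 t)" and F: "\<And>t. cmod (F t) = cmod (\<Psi>1 t)"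
    and b: "\<And>u. 0 \<le> b u"
  defines "Q \<equiv> (\<integral>\<^sup>+u. \<integral>\<^sup>+v. ennreal (b u * b v * (cmod (R (u - v)) + cmod (\<phi>' u) * cmod (\<phi>' v) + cmod (F u) * cmod (F v))) \<partial>lborel \<partial>lborel)"
  shows "\<lbrakk>\<And>t. cmod (\<Psi>2 t) \<le> a; \<And>t. (cmod (\<Psi>1 t))\<^sup>2 \<le> a\<rbrakk> \<Longrightarrow>
       Q \<le> ennreal ((\<Delta> + 2 * \<Delta>\<^sup>2 + 1) * a) * (\<integral>\<^sup>+u. ennreal (b u) \<partial>lborel)\<^sup>2"
    and "\<lbrakk>(\<integral>\<^sup>+t. ennreal (cmod (\<Psi>2 t)) \<partial>lborel) \<le> ennreal a; (\<integral>\<^sup>+t. ennreal ((cmod (\<Psi>1 t))\<^sup>2) \<partial>lborel) \<le> ennreal a; a \<ge> 0\<rbrakk> \<Longrightarrow>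
       Q \<le> ennreal ((\<Delta> + 2 * \<Delta>\<^sup>2 + 1) * a) * (\<integral>\<^sup>+u. ennreal ((b u)\<^sup>2) \<partial>lborel)"
proof -
  define r where "r t = \<Delta> * cmod (\<Psi>2 t) + \<Delta>\<^sup>2 * (cmod (\<Psi>1 t))\<^sup>2" for t
  define g where "g t = sqrt (\<Delta>\<^sup>2 + 1) * cmod (\<Psi>1 t)" for t
  have [measurable]: "r \<in> borel_measurable borel" "g \<in> borel_measurable borel" unfolding r_def g_def by measurable
  have r0: "r t \<ge> 0" and g0: "g t \<ge> 0" for t using \<Delta> by (auto simp: r_def g_def)
  have gg: "g u * g v = (\<Delta>\<^sup>2 + 1) * (cmod (\<Psi>1 u) * cmod (\<Psi>1 v))" for u v
    by (simp add: g_def mult_ac flip: real_sqrt_mult power2_eq_square) 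
  have K: "cmod (R (u - v)) + cmod (\<phi>' u) * cmod (\<phi>' v) + cmod (F u) * cmod (F v) \<le> r (u - v) + g u * g v" for u v
  proof -
    have "cmod (\<phi>' u) * cmod (\<phi>' v) \<le> (\<Delta> * cmod (\<Psi>1 u)) * (\<Delta> * cmod (\<Psi>1 v))"
      using \<Delta> by (intro mult_mono \<phi>') auto
    then show ?thesis using R[of "u - v"] unfolding gg r_def F
      by (simp add: algebra_simps power2_eq_square)
  qed
  have Q_le: "Q \<le> (\<integral>\<^sup>+u. \<integral>\<^sup>+v. ennreal (b u * b v * (r (u - v) + g u * g v)) \<partial>lborel \<partial>lborel)"
    unfolding Q_def by (intro nn_integral_mono ennreal_leI mult_left_mono K mult_nonneg_nonneg b)
  show "Q \<le> ennreal ((\<Delta> + 2 * \<Delta>\<^sup>2 + 1) * a) * (\<integral>\<^sup>+u. ennreal (b u) \<partial>lborel)\<^sup>2"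
    if 2: "\<And>t. cmod (\<Psi>2 t) \<le> a" and 1: "\<And>t. (cmod (\<Psi>1 t))\<^sup>2 \<le> a"
  proof -
    have "r (u - v) + g u * g v \<le> (\<Delta> + 2 * \<Delta>\<^sup>2 + 1) * a" for u v
    proof -
      have "cmod (\<Psi>1 u) * cmod (\<Psi>1 v) \<le> a"
        using sum_squares_bound[of "cmod (\<Psi>1 u)" "cmod (\<Psi>1 v)"] 1[of u] 1[of v] by linarith
      then have "g u * g v \<le> (\<Delta>\<^sup>2 + 1) * a" unfolding gg by (intro mult_left_mono) auto
      moreover have "r (u - v) \<le> \<Delta> * a + \<Delta>\<^sup>2 * a"
        unfolding r_def using \<Delta> by (intro add_mono mult_left_mono 1 2) auto
      ultimately show ?thesis by (simp add: algebra_simps)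
    qed
    from double_integral_bounded_kernel[OF _ b this] Q_le show ?thesis by (auto intro: order_trans)
  qed
  show "Q \<le> ennreal ((\<Delta> + 2 * \<Delta>\<^sup>2 + 1) * a) * (\<integral>\<^sup>+u. ennreal ((b u)\<^sup>2) \<partial>lborel)"
    if 2: "(\<integral>\<^sup>+t. ennreal (cmod (\<Psi>2 t)) \<partial>lborel) \<le> ennreal a"
      and 1: "(\<integral>\<^sup>+t. ennreal ((cmod (\<Psi>1 t))\<^sup>2) \<partial>lborel) \<le> ennreal a" and a: "a \<ge> 0"
  proof -
    define B where "B = (\<integral>\<^sup>+u. ennreal ((b u)\<^sup>2) \<partial>lborel)"
    have ir: "(\<integral>\<^sup>+t. ennreal (r t) \<partial>lborel) \<le> ennreal (\<Delta> * a + \<Delta>\<^sup>2 * a)"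
    proof -
      have "(\<integral>\<^sup>+t. ennreal (r t) \<partial>lborel) = (\<integral>\<^sup>+t. ennreal \<Delta> * ennreal (cmod (\<Psi>2 t)) + ennreal (\<Delta>\<^sup>2) * ennreal ((cmod (\<Psi>1 t))\<^sup>2) \<partial>lborel)"
        using \<Delta> by (intro nn_integral_cong) (simp add: r_def ennreal_mult')
      also have "\<dots> = ennreal \<Delta> * (\<integral>\<^sup>+t. ennreal (cmod (\<Psi>2 t)) \<partial>lborel) + ennreal (\<Delta>\<^sup>2) * (\<integral>\<^sup>+t. ennreal ((cmod (\<Psi>1 t))\<^sup>2) \<partial>lborel)"
        by (subst nn_integral_add) (auto simp: nn_integral_cmult)
      also have "\<dots> \<le> ennreal \<Delta> * ennreal a + ennreal (\<Delta>\<^sup>2) * ennreal a"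
        by (intro add_mono mult_left_mono 1 2) auto
      also have "\<dots> = ennreal (\<Delta> * a + \<Delta>\<^sup>2 * a)"
        using \<Delta> a by (simp add: ennreal_mult')
      finally show ?thesis .
    qed
    have ig: "(\<integral>\<^sup>+t. ennreal ((g t)\<^sup>2) \<partial>lborel) \<le> ennreal ((\<Delta>\<^sup>2 + 1) * a)"
    proof -
      have "(\<integral>\<^sup>+t. ennreal ((g t)\<^sup>2) \<partial>lborel) = (\<integral>\<^sup>+t. ennreal (\<Delta>\<^sup>2 + 1) * ennreal ((cmod (\<Psi>1 t))\<^sup>2) \<partial>lborel)"
      proof (rule nn_integral_cong)
        fix t
        show "ennreal ((g t)\<^sup>2) = ennreal (\<Delta>\<^sup>2 + 1) * ennreal ((cmod (\<Psi>1 t))\<^sup>2)"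
          by (subst ennreal_mult'[symmetric]) (auto simp: g_def power_mult_distrib)
      qed
      also have "\<dots> = ennreal (\<Delta>\<^sup>2 + 1) * (\<integral>\<^sup>+t. ennreal ((cmod (\<Psi>1 t))\<^sup>2) \<partial>lborel)"
        by (rule nn_integral_cmult) measurable
      also have "\<dots> \<le> ennreal (\<Delta>\<^sup>2 + 1) * ennreal a" by (intro mult_left_mono 1) auto
      also have "\<dots> = ennreal ((\<Delta>\<^sup>2 + 1) * a)" by (rule ennreal_mult'[symmetric]) simp
      finally show ?thesis .
    qed
    have "Q \<le> (\<integral>\<^sup>+u. \<integral>\<^sup>+v. ennreal (b u * b v * r (u - v)) + ennreal (b u * b v * (g u * g v)) \<partial>lborel \<partial>lborel)"
    proof (rule order_trans[OF Q_le], intro nn_integral_mono)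
      fix u v
      show "ennreal (b u * b v * (r (u - v) + g u * g v)) \<le> ennreal (b u * b v * r (u - v)) + ennreal (b u * b v * (g u * g v))"
        using b r0 g0 by (subst ennreal_plus[symmetric]) (auto simp: distrib_left)
    qed
    also have "\<dots> = (\<integral>\<^sup>+u. (\<integral>\<^sup>+v. ennreal (b u * b v * r (u - v)) \<partial>lborel) + (\<integral>\<^sup>+v. ennreal (b u * b v * (g u * g v)) \<partial>lborel) \<partial>lborel)"
      by (intro nn_integral_cong nn_integral_add) measurable
    also have "\<dots> = (\<integral>\<^sup>+u. \<integral>\<^sup>+v. ennreal (b u * b v * r (u - v)) \<partial>lborel \<partial>lborel)
        + (\<integral>\<^sup>+u. \<integral>\<^sup>+v. ennreal (b u * b v * (g u * g v)) \<partial>lborel \<partial>lborel)"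
      by (rule nn_integral_add) measurable
    also have "\<dots> \<le> B * (\<integral>\<^sup>+t. ennreal (r t) \<partial>lborel) + B * (\<integral>\<^sup>+t. ennreal ((g t)\<^sup>2) \<partial>lborel)"
      unfolding B_def
      by (intro add_mono double_integral_translation_kernel double_integral_product_kernel b r0 g0) measurable
    also have "\<dots> \<le> B * ennreal (\<Delta> * a + \<Delta>\<^sup>2 * a) + B * ennreal ((\<Delta>\<^sup>2 + 1) * a)"
      by (intro add_mono mult_left_mono ir ig) auto
    also have "\<dots> = B * ennreal ((\<Delta> * a + \<Delta>\<^sup>2 * a) + (\<Delta>\<^sup>2 + 1) * a)"
      using \<Delta> a by (subst ennreal_plus) (auto simp: distrib_left)
    also have "(\<Delta> * a + \<Delta>\<^sup>2 * a) + (\<Delta>\<^sup>2 + 1) * a = (\<Delta> + 2 * \<Delta>\<^sup>2 + 1) * a" by (simp add: algebra_simps)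
    finally show ?thesis by (simp add: B_def mult.commute)
  qed
qed

section \<open>The risk on the class of measures\<close>

lemma (in prob_space) indep_vars_reindex:
  assumes inj: "inj_on h I" and ind: "indep_vars (\<lambda>_. N) (\<lambda>i. Y (h i)) I"
  shows "indep_vars (\<lambda>_. N) Y (h ` I)"
  unfolding indep_vars_def2 indep_sets_def
proof (intro conjI ballI allI impI)
  fix j assume "j \<in> h ` I"
  then show "random_variable N (Y j)" "{Y j -` A \<inter> space M |A. A \<in> sets N} \<subseteq> events"
    using ind by (auto simp: indep_vars_def2 measurable_def)
next
  fix J A assume J: "J \<subseteq> h ` I" "J \<noteq> {}" "finite J" and A: "A \<in> (\<Pi> j\<in>J. {Y j -` A \<inter> space M |A. A \<in> sets N})"
  obtain J' where J': "J' \<subseteq> I" "J = h ` J'" using J(1) by (auto simp: subset_image_iff)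
  have i': "inj_on h J'" using inj J'(1) by (rule inj_on_subset)
  have "finite J'" "J' \<noteq> {}" using J J' i' finite_imageD by auto
  moreover have "(\<lambda>i. A (h i)) \<in> (\<Pi> i\<in>J'. {Y (h i) -` A \<inter> space M |A. A \<in> sets N})"
    using A J' by blast
  moreover have "\<And>J. J \<subseteq> I \<Longrightarrow> J \<noteq> {} \<Longrightarrow> finite J \<Longrightarrow>
      \<forall>A\<in>(\<Pi> i\<in>J. {Y (h i) -` A \<inter> space M |A. A \<in> sets N}). prob (\<Inter>i\<in>J. A i) = (\<Prod>i\<in>J. prob (A i))"
    using ind by (simp add: indep_vars_def2 indep_sets_def)
  ultimately have "prob (\<Inter>i\<in>J'. A (h i)) = (\<Prod>i\<in>J'. prob (A (h i)))" using J'(1) by blast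
  then show "prob (\<Inter>j\<in>J. A j) = (\<Prod>j\<in>J. prob (A j))"
    unfolding J'(2) by (simp add: prod.reindex[OF i'])
qed

text \<open>Independence and stationarity are stated for general times and are used for the grid
  \<open>0, \<Delta>, 2 \<Delta>, \<dots>\<close>; the second moment exists because the characteristic function is twice differentiable.\<close>
lemma levy_increment_sample:
  assumes pj: "pure_jump_levy P X \<nu>" and jm: "is_jump_measure m \<nu>" and \<Delta>: "\<Delta> > 0" and n: "n > 0"
  shows "increment_sample P X \<Delta> n (distr P borel (X \<Delta>))"
proof -
  interpret jump_measure \<nu> m by (rule pure_jump_levy_char[OF pj jm])
  have lp: "levy_process P X" using pj by (simp add: pure_jump_levy_def)
  then interpret P: prob_space P by (simp add: levy_process_def)
  have Xm: "X t \<in> borel_measurable P" if "t \<ge> 0" for t using lp that by (simp add: levy_process_def)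
  have ch: "char (distr P borel (X \<Delta>)) u = exp (of_real \<Delta> * \<Psi> u)" for u
    using pure_jump_levy_char(2)[OF pj jm, of \<Delta> u] \<Delta> by simp
  have D: "real_distribution (distr P borel (X \<Delta>))"
    using P.prob_space_distr[OF Xm[of \<Delta>]] \<Delta> by (simp add: real_distribution_def real_distribution_axioms_def)
  show ?thesis
  proof
    show "\<Delta> > 0" "n > 0" by fact+
    define t where "t i = real i * \<Delta>" for i
    have "0 \<le> t 0" "mono t" using \<Delta> by (auto simp: t_def mono_def)
    then have "P.indep_vars (\<lambda>_. borel) (\<lambda>i w. X (t (Suc i)) w - X (t i) w) {..<2 * n}"
      using lp unfolding levy_process_def by blast
    also have "(\<lambda>i w. X (t (Suc i)) w - X (t i) w) = (\<lambda>i. increment X \<Delta> (Suc i))"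
      by (simp add: fun_eq_iff increment_def t_def)
    finally have "P.indep_vars (\<lambda>_. borel) (increment X \<Delta>) (Suc ` {..<2 * n})"
      by (intro P.indep_vars_reindex) auto
    also have "Suc ` {..<2 * n} = {1..2 * n}" by (simp add: image_Suc_lessThan)
    finally show "P.indep_vars (\<lambda>_. borel) (increment X \<Delta>) {1..2 * n}" .
    fix k assume k: "k \<in> {1..2 * n}"
    define r where "r = (real k - 1) * \<Delta>"
    have "r \<ge> 0" using k \<Delta> by (auto simp: r_def)
    then have "distr P borel (\<lambda>w. X (r + \<Delta>) w - X r w) = distr P borel (X \<Delta>)"
      using lp \<Delta> unfolding levy_process_def by auto
    moreover have "r + \<Delta> = real k * \<Delta>" by (simp add: r_def algebra_simps)
    ultimately show "distr P borel (increment X \<Delta> k) = distr P borel (X \<Delta>)"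
      by (simp add: increment_def[abs_def] r_def)
  next
    show "integrable (distr P borel (X \<Delta>)) (\<lambda>x. x\<^sup>2)" by (rule increment_moments(1)[OF D ch])
    show "char (distr P borel (X \<Delta>)) u \<noteq> 0" for u by (simp add: ch)
  qed
qed

lemma (in increment_sample) stochastic_error_measurable:
  assumes [measurable]: "w \<in> borel_measurable borel" "F \<in> borel_measurable borel"
  shows "(\<lambda>\<omega>. LINT u|lborel. w u * (ecf_deriv X \<Delta> n \<omega> u / of_real \<Delta> / \<i> * inv_ecf X \<Delta> n \<omega> u - F u)) \<in> borel_measurable P"
proof -
  have "(\<lambda>\<omega>. LINT u|lborel. w u * ((dev \<omega> u + \<phi>' u) / of_real \<Delta> / \<i> * A \<omega> u - F u)) \<in> borel_measurable P"
    by measurable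
  then show ?thesis by (simp add: dev_def A_def)
qed

lemma sobolev_fourier_function:
  assumes "f \<in> sobolev_class s M"
  shows "has_fourier_function f (fourier_function f)"
    and "(\<integral>\<^sup>+u. ennreal ((cmod (fourier_function f (- u)))\<^sup>2 * (1 + u\<^sup>2) powr s) \<partial>lborel) \<le> ennreal M"
proof -
  obtain g where g: "has_fourier_function f g"
    and M: "(\<integral>\<^sup>+u. ennreal ((cmod (g (- u)))\<^sup>2 * (1 + \<bar>u\<bar>\<^sup>2) powr s) \<partial>lborel) \<le> ennreal M"
    using assms by (auto simp: sobolev_class_def)
  show "has_fourier_function f (fourier_function f)" by (rule fourier_function_works[OF g])
  have "AE u in lborel. fourier_function f (- u) = g (- u)"
    by (rule AE_lborel_uminus[OF fourier_function_AE_eq[OF g]])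
  then have "(\<integral>\<^sup>+u. ennreal ((cmod (fourier_function f (- u)))\<^sup>2 * (1 + u\<^sup>2) powr s) \<partial>lborel)
      = (\<integral>\<^sup>+u. ennreal ((cmod (g (- u)))\<^sup>2 * (1 + \<bar>u\<bar>\<^sup>2) powr s) \<partial>lborel)"
    by (intro nn_integral_cong_AE) (auto elim!: eventually_mono)
  with M show "(\<integral>\<^sup>+u. ennreal ((cmod (fourier_function f (- u)))\<^sup>2 * (1 + u\<^sup>2) powr s) \<partial>lborel) \<le> ennreal M" by simp
qed

lemma (in jump_measure) measure_class_bounds:
  assumes m: "m \<in> measure_class C C1bar C2bar C\<phi> c\<phi> \<beta> \<rho> a M\<mu>" and C: "C > 0" and C2: "C2bar > 0"
  shows "cmod (exp (\<Psi> u)) \<ge> C\<phi> * (1 + u\<^sup>2) powr (- \<beta> / 2) * exp (- c\<phi> * (if \<rho> = 0 then 1 else \<bar>u\<bar> powr \<rho>))"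
    and "cmod (\<Psi>2 t) \<le> C2bar / C" and "(cmod (\<Psi>1 t))\<^sup>2 \<le> C2bar / C"
    and "C1bar < \<infinity> \<Longrightarrow> (\<integral>\<^sup>+t. ennreal (cmod (\<Psi>2 t)) \<partial>lborel) \<le> ennreal (enn2real C1bar / C)"
    and "C1bar < \<infinity> \<Longrightarrow> (\<integral>\<^sup>+t. ennreal ((cmod (\<Psi>1 t))\<^sup>2) \<partial>lborel) \<le> ennreal (enn2real C1bar / C)"
    and "(\<integral>\<^sup>+u. ennreal ((cmod (transform u))\<^sup>2 * (1 + u\<^sup>2) powr a) \<partial>lborel) \<le> ennreal M\<mu>"
proof -
  obtain P :: "(real \<Rightarrow> real) measure" and X \<nu>' where pj: "pure_jump_levy P X \<nu>'" and jm: "is_jump_measure m \<nu>'"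
    and lower: "\<And>u. cmod (char (distr P borel (X 1)) u) \<ge>
           C\<phi> * (1 + \<bar>u\<bar>\<^sup>2) powr (- \<beta> / 2) * exp (- c\<phi> * (if \<rho> = 0 then 1 else \<bar>u\<bar> powr \<rho>))"
    and c1: "const1 C \<nu>' \<le> C1bar" and c2: "const2 C \<nu>' \<le> ennreal C2bar"
    and sob: "signed_integral m \<in> sobolev_class a M\<mu>"
    using m unfolding measure_class_def by blast
  \<comment> \<open>The process that witnesses membership in the class may differ from the given one.\<close>
  have eq: "levy_exponent \<nu>' = \<Psi>"
    by (rule levy_exponent_unique[OF pure_jump_levy_char(1)[OF pj jm]]) unfold_locales
  show "cmod (exp (\<Psi> u)) \<ge> C\<phi> * (1 + u\<^sup>2) powr (- \<beta> / 2) * exp (- c\<phi> * (if \<rho> = 0 then 1 else \<bar>u\<bar> powr \<rho>))"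
    using lower[of u] pure_jump_levy_char(2)[OF pj jm, of 1 u] by (simp add: eq)
  have scale: "x \<le> ennreal (b / C)" if "ennreal C * x \<le> ennreal b" "b \<ge> 0" for x b
  proof (cases x)
    case (real r)
    then have "ennreal (C * r) \<le> ennreal b" using that C by (simp add: ennreal_mult')
    then have "C * r \<le> b" using that by simp
    then show ?thesis using real C by (auto simp: field_simps intro!: ennreal_leI)
  next
    case top
    then show ?thesis using that C by (simp add: ennreal_mult_top top_unique)
  qed
  define S2 where "S2 = (SUP u. ennreal (cmod (\<Psi>2 u)))"
  define S1 where "S1 = (SUP u. ennreal (cmod (\<Psi>1 u)))"
  have "ennreal C * (S2 + 2 * S1\<^sup>2) \<le> ennreal C2bar"
    using c2 unfolding const2_def eq vderiv_levy_exponent S1_def S2_def .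
  then have S: "S2 + 2 * S1\<^sup>2 \<le> ennreal (C2bar / C)" using C2 by (intro scale) auto
  have "ennreal (cmod (\<Psi>2 t)) \<le> S2" unfolding S2_def by (rule SUP_upper) simp
  also have "\<dots> \<le> S2 + 2 * S1\<^sup>2" by simp
  also note S
  finally show "cmod (\<Psi>2 t) \<le> C2bar / C" using C C2 by simp
  have le2: "x \<le> y + 2 * x" for x y :: ennreal
    unfolding mult_2 using add_increasing[of "y + x" x x] by (simp add: add.assoc)
  have "ennreal (cmod (\<Psi>1 t)) \<le> S1" unfolding S1_def by (rule SUP_upper) simp
  then have "ennreal ((cmod (\<Psi>1 t))\<^sup>2) \<le> S1\<^sup>2" by (simp add: power_mono flip: ennreal_power)
  also have "\<dots> \<le> S2 + 2 * S1\<^sup>2" by (rule le2)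
  also note S
  finally show "(cmod (\<Psi>1 t))\<^sup>2 \<le> C2bar / C" using C C2 by simp
  define I2 where "I2 = (\<integral>\<^sup>+t. ennreal (cmod (\<Psi>2 t)) \<partial>lborel)"
  define I1 where "I1 = (\<integral>\<^sup>+t. ennreal ((cmod (\<Psi>1 t))\<^sup>2) \<partial>lborel)"
  have I: "I2 + 2 * I1 \<le> ennreal (enn2real C1bar / C)" if "C1bar < \<infinity>"
  proof (rule scale)
    have "ennreal C * (I2 + 2 * I1) \<le> C1bar"
      using c1 unfolding const1_def eq vderiv_levy_exponent I1_def I2_def .
    then show "ennreal C * (I2 + 2 * I1) \<le> ennreal (enn2real C1bar)" using that by simp
  qed simp
  have "I2 \<le> I2 + 2 * I1" by simp
  then show "C1bar < \<infinity> \<Longrightarrow> (\<integral>\<^sup>+t. ennreal (cmod (\<Psi>2 t)) \<partial>lborel) \<le> ennreal (enn2real C1bar / C)"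
    using I unfolding I2_def[symmetric] by (blast intro: order_trans)
  show "C1bar < \<infinity> \<Longrightarrow> (\<integral>\<^sup>+t. ennreal ((cmod (\<Psi>1 t))\<^sup>2) \<partial>lborel) \<le> ennreal (enn2real C1bar / C)"
    using I le2[of I1 I2] unfolding I1_def[symmetric] by (blast intro: order_trans)
  note S = sobolev_fourier_function[OF sob]
  have "AE u in lborel. fourier_function (signed_integral m) (- u) = transform (- u)"
    by (rule AE_lborel_uminus[OF signed_integral_fourier_AE[OF S(1)]])
  then have e: "(\<integral>\<^sup>+u. ennreal ((cmod (fourier_function (signed_integral m) (- u)))\<^sup>2 * (1 + u\<^sup>2) powr a) \<partial>lborel)
      = (\<integral>\<^sup>+u. ennreal ((cmod (transform (- u)))\<^sup>2 * (1 + (- u)\<^sup>2) powr a) \<partial>lborel)"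
    by (intro nn_integral_cong_AE) (auto elim!: eventually_mono)
  have "(\<integral>\<^sup>+u. ennreal ((cmod (transform (- u)))\<^sup>2 * (1 + (- u)\<^sup>2) powr a) \<partial>lborel)
      = (\<integral>\<^sup>+u. ennreal ((cmod (transform u))\<^sup>2 * (1 + u\<^sup>2) powr a) \<partial>lborel)"
    by (rule nn_integral_lborel_uminus) measurable
  with e S(2) show "(\<integral>\<^sup>+u. ennreal ((cmod (transform u))\<^sup>2 * (1 + u\<^sup>2) powr a) \<partial>lborel) \<le> ennreal M\<mu>" by simp
qed

text \<open>The modulus of \<open>exp (\<Delta> z)\<close> is the power \<open>\<Delta>\<close> of the modulus of \<open>exp z\<close>, which turns the decay exponent
  \<open>\<beta>\<close> of the class into \<open>\<Delta> \<beta>\<close>.\<close>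
lemma increment_char_lower_bound:
  fixes z :: complex
  assumes z: "cmod (exp z) \<ge> C\<phi> * (1 + u\<^sup>2) powr (- \<beta> / 2) * exp (- c\<phi> * (if \<rho> = 0 then 1 else \<bar>u\<bar> powr \<rho>))"
    and C: "C\<phi> > 0" and c: "c\<phi> \<ge> 0" and \<rho>: "\<rho> \<ge> 0" and \<Delta>: "\<Delta> > 0" and u: "\<bar>u\<bar> \<le> H"
  shows "1 / cmod (exp (of_real \<Delta> * z))
     \<le> C\<phi> powr (- \<Delta>) * exp (\<Delta> * c\<phi> * (if \<rho> = 0 then 1 else H powr \<rho>)) * (1 + u\<^sup>2) powr (\<Delta> * \<beta> / 2)"
proof -
  define \<kappa> where "\<kappa> = (if \<rho> = 0 then 1 else \<bar>u\<bar> powr \<rho>)"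
  define \<kappa>' where "\<kappa>' = (if \<rho> = 0 then 1 else H powr \<rho>)"
  have le: "\<kappa> \<le> \<kappa>'" using u \<rho> by (auto simp: \<kappa>_def \<kappa>'_def intro!: powr_mono2)
  define l where "l = C\<phi> * (1 + u\<^sup>2) powr (- \<beta> / 2) * exp (- c\<phi> * \<kappa>)"
  have p: "1 + u\<^sup>2 > 0" by (simp add: add_pos_nonneg)
  have l0: "l > 0" using C p by (simp add: l_def)
  have "cmod (exp (of_real \<Delta> * z)) = cmod (exp z) powr \<Delta>" by (simp add: exp_powr_real mult.commute)
  also have "\<dots> \<ge> l powr \<Delta>" using z l0 \<Delta> by (intro powr_mono2) (auto simp: l_def \<kappa>_def)
  finally have "1 / cmod (exp (of_real \<Delta> * z)) \<le> 1 / l powr \<Delta>" using l0 by (intro divide_left_mono) auto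
  also have "\<dots> = l powr (- \<Delta>)" by (simp add: powr_minus_divide)
  also have "\<dots> = C\<phi> powr (- \<Delta>) * (1 + u\<^sup>2) powr (\<Delta> * \<beta> / 2) * exp (\<Delta> * c\<phi> * \<kappa>)"
    unfolding l_def using C p by (simp add: powr_mult powr_powr exp_powr_real mult_ac)
  also have "\<dots> \<le> C\<phi> powr (- \<Delta>) * (1 + u\<^sup>2) powr (\<Delta> * \<beta> / 2) * exp (\<Delta> * c\<phi> * \<kappa>')"
    using le \<Delta> c by (intro mult_left_mono) (auto intro!: mult_left_mono)
  finally show ?thesis unfolding \<kappa>'_def by (simp only: mult_ac)
qed

text \<open>Twice the product of the constants in \<open>stochastic_error\<close> and \<open>sample_kernel_bounds\<close>; the factor two comes
  from separating bias and noise.\<close>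
definition noise_constant :: "real \<Rightarrow> real" where
  "noise_constant \<Delta> = 2 * (2 * (4 + 194 * \<Delta> + 384 * \<Delta>\<^sup>2) / \<Delta>\<^sup>2 + 2 * (388 + 768 * \<Delta> + 40 / \<Delta>)) * (\<Delta> + 2 * \<Delta>\<^sup>2 + 1)"

text \<open>The right-hand sides involve \<open>m\<close> and the process only through the parameters of the class, which makes
  the bounds uniform.\<close>
lemma risk_bound:
  fixes f :: distribution and FK :: "real \<Rightarrow> complex"
  assumes cl: "m \<in> measure_class C C1bar C2bar C\<phi> c\<phi> \<beta> \<rho> a M\<mu>"
    and ex: "\<exists>\<theta>. has_pairing f m \<theta>" and ap: "associated_process m P X"
    and f: "f \<in> sobolev_class s Mf" and Mf: "Mf > 0"
    and C: "C > 0" "C2bar > 0" "C\<phi> > 0" "c\<phi> \<ge> 0" "\<rho> \<ge> 0" and as: "a + s > 0"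
    and FK: "has_fourier_function (kernel_distribution K) FK" "FK \<in> borel_measurable borel" "\<And>u. cmod (FK u) \<le> R"
      "\<And>u. cmod (1 - FK u) \<le> B * \<bar>u\<bar> powr (a + s)" "\<And>u. \<bar>u\<bar> > pi \<Longrightarrow> FK u = 0"
    and R: "R \<ge> 0" and B: "B \<ge> 0" and \<Delta>: "\<Delta> > 0" and n: "n > 0" and h: "h > 0"
  defines "q \<equiv> R * (C\<phi> powr (- \<Delta>) * exp (\<Delta> * c\<phi> * (if \<rho> = 0 then 1 else (pi / h) powr \<rho>)))"
    and "risk \<equiv> (\<integral>\<^sup>+w. ennreal ((cmod (pairing f m - estimator f K X \<Delta> h n w))\<^sup>2) \<partial>P)"
  shows "risk \<le> ennreal (2 * (B\<^sup>2 * Mf * M\<mu> * h powr (2 * (a + s))))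
      + ennreal (noise_constant \<Delta> * (C2bar / C) * (q\<^sup>2 * Mf) / real n)
        * (\<integral>\<^sup>+u\<in>{-(pi / h)..pi / h}. ennreal ((1 + u\<^sup>2) powr (\<Delta> * \<beta> - s)) \<partial>lborel)" (is ?general)
    and "\<lbrakk>C1bar < \<infinity>; \<And>u. \<bar>u\<bar> \<le> pi / h \<Longrightarrow> (1 + u\<^sup>2) powr (\<Delta> * \<beta> - s) \<le> L\<rbrakk> \<Longrightarrow>
      risk \<le> ennreal (2 * (B\<^sup>2 * Mf * M\<mu> * h powr (2 * (a + s))))
        + ennreal (noise_constant \<Delta> * (enn2real C1bar / C) * (q\<^sup>2 * Mf * L) / real n)"
proof -
  obtain \<nu> where pj: "pure_jump_levy P X \<nu>" and jm: "is_jump_measure m \<nu>"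
    using ap by (auto simp: associated_process_def)
  interpret jump_measure \<nu> m by (rule pure_jump_levy_char[OF pj jm])
  interpret S: increment_sample P X \<Delta> n "distr P borel (X \<Delta>)" by (rule levy_increment_sample[OF pj jm \<Delta> n])
  note mc = measure_class_bounds[OF cl C(1,2)]
  note sf = sobolev_fourier_function[OF f]
  define ff where "ff u = fourier_function f (- u)" for u
  have ft: "tempered_function ff"
    unfolding ff_def[abs_def] using sf(1) by (intro tempered_function_uminus) (simp add: has_fourier_function_def)
  note [measurable] = tempered_function_measurable[OF ft] FK(2)
  have ff2: "(\<integral>\<^sup>+u. ennreal ((cmod (ff u))\<^sup>2 * (1 + u\<^sup>2) powr s) \<partial>lborel) \<le> ennreal Mf"
    using sf(2) by (simp add: ff_def)
  have p: "1 + u\<^sup>2 > (0::real)" for u by (simp add: add_pos_nonneg)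
  have int_fF: "integrable lborel (\<lambda>u. ff u * transform u)"
  proof (rule integrableI_bounded)
    have CS: "(\<integral>\<^sup>+u. ennreal (cmod (ff u) * cmod (transform u) * (1 + u\<^sup>2) powr ((a + s) / 2)) \<partial>lborel)\<^sup>2 \<le> ennreal (Mf * M\<mu>)"
      using Mf by (intro weighted_Cauchy_Schwarz ff2 mc(6)) auto
    have "(\<integral>\<^sup>+u. ennreal (norm (ff u * transform u)) \<partial>lborel)
        \<le> (\<integral>\<^sup>+u. ennreal (cmod (ff u) * cmod (transform u) * (1 + u\<^sup>2) powr ((a + s) / 2)) \<partial>lborel)" (is "_ \<le> ?I")
    proof (intro nn_integral_mono ennreal_leI)
      fix u :: real
      have "1 \<le> (1 + u\<^sup>2) powr ((a + s) / 2)" using as by (intro ge_one_powr_ge_zero) auto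
      then have "cmod (ff u) * cmod (transform u) * 1 \<le> cmod (ff u) * cmod (transform u) * (1 + u\<^sup>2) powr ((a + s) / 2)"
        by (intro mult_left_mono) auto
      then show "norm (ff u * transform u) \<le> cmod (ff u) * cmod (transform u) * (1 + u\<^sup>2) powr ((a + s) / 2)"
        by (simp add: norm_mult)
    qed
    also have "?I < \<infinity>"
    proof (rule ccontr)
      assume "\<not> ?I < \<infinity>"
      then have "?I = \<top>" by (metis top.not_eq_extremum infinity_ennreal_def)
      moreover have "(\<top>::ennreal)\<^sup>2 = \<top>" by (simp add: power2_eq_square ennreal_top_mult)
      ultimately have "\<top> \<le> ennreal (Mf * M\<mu>)" using CS by metis
      then show False by (meson ennreal_less_top leD)
    qed
    finally show "(\<integral>\<^sup>+u. ennreal (norm (ff u * transform u)) \<partial>lborel) < \<infinity>" .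
  qed measurable
  have pair: "pairing f m = 1 / (2 * of_real pi) * (LINT u|lborel. ff u * transform u)"
    using pairing_eq[OF ex sf(1)] int_fF by (simp add: ff_def)
  define w where "w u = ff u * FK (h * u)" for u
  have w0: "w u = 0" if "\<bar>u\<bar> > pi / h" for u
    using FK(5)[of "h * u"] that h by (simp add: w_def abs_mult field_simps)
  have w: "integrable lborel w"
    unfolding w_def[abs_def]
  proof (rule tempered_function_times_compact_support[OF ft])
    show "(\<lambda>u. FK (h * u)) \<in> borel_measurable borel" by measurable
    show "cmod (FK (h * u)) \<le> R" for u by (rule FK(3))
    show "FK (h * u) = 0" if "\<bar>u\<bar> > pi / h" for u
      using FK(5)[of "h * u"] that h by (simp add: abs_mult field_simps)
  qed
  note [measurable] = borel_measurable_integrable[OF w]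
  define e where "e \<omega> u = ecf_deriv X \<Delta> n \<omega> u / of_real \<Delta> / \<i> * inv_ecf X \<Delta> n \<omega> u" for \<omega> u
  have est: "estimator f K X \<Delta> h n \<omega> = 1 / (2 * of_real pi) * (LINT u|lborel. w u * e \<omega> u)" if \<omega>: "\<omega> \<in> space P" for \<omega>
  proof -
    have k: "has_fourier_function (kernel_distribution (scaled_kernel K h)) (\<lambda>u. FK (h * u))"
      by (rule scaled_kernel_fourier_function[OF FK(1) h FK(2,3)])
    have em: "e \<omega> \<in> borel_measurable lborel" 
    proof -
      have [measurable]: "(\<lambda>u. ecf_deriv X \<Delta> n \<omega> u) \<in> borel_measurable lborel" 
        using measurable_Pair2[OF S.ecf_deriv_measurable \<omega>] by simp
      have [measurable]: "(\<lambda>u. inv_ecf X \<Delta> n \<omega> u) \<in> borel_measurable lborel" 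
        using measurable_Pair2[OF S.A_measurable \<omega>] by (simp add: S.A_def)
      show ?thesis unfolding e_def[abs_def] by measurable
    qed
    have km: "fourier_function (kernel_distribution (scaled_kernel K h)) \<in> borel_measurable borel"
      using fourier_function_works[OF k] by (auto simp: has_fourier_function_def intro: tempered_function_measurable)
    note [measurable] = em km
    have "(LINT u|lborel. ff u * fourier_function (kernel_distribution (scaled_kernel K h)) u * e \<omega> u) = (LINT u|lborel. w u * e \<omega> u)"
      using fourier_function_AE_eq[OF k] by (intro integral_cong_AE) (auto simp: w_def elim!: eventually_mono)
    then show ?thesis by (simp add: estimator_def ff_def e_def)
  qed
  have ch: "S.\<phi> u = exp (of_real \<Delta> * \<Psi> u)" for u
    using pure_jump_levy_char(2)[OF pj jm, of \<Delta> u] \<Delta> by simp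
  note mom = increment_moments[OF S.D ch]
  have phi': "S.\<phi>' u = of_real \<Delta> * \<i> * transform u * S.\<phi> u" for u
    unfolding S.\<phi>'_def mom(2) ch Psi1_eq by simp
  have Tb: "cmod (transform u) \<le> (LINT x|weighted. \<bar>sgn x\<bar>)" for u by (rule transform_bound)
  note SE = S.stochastic_error[OF w transform_measurable Tb phi']
  define Sx where "Sx \<omega> = (LINT u|lborel. w u * (e \<omega> u - transform u))" for \<omega>
  define b where "b u = cmod (w u) / cmod (S.\<phi> u)" for u
  define Q where "Q = (\<integral>\<^sup>+u. \<integral>\<^sup>+v. ennreal (b u * b v * (cmod (S.R (u - v)) + cmod (S.\<phi>' u) * cmod (S.\<phi>' v)
      + cmod (transform u) * cmod (transform v))) \<partial>lborel \<partial>lborel)"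
  define c where "c = (2 * (4 + 194 * \<Delta> + 384 * \<Delta>\<^sup>2) / \<Delta>\<^sup>2 + 2 * (388 + 768 * \<Delta> + 40 / \<Delta>)) / real n"
  have noise: "(\<integral>\<^sup>+\<omega>. ennreal ((cmod (Sx \<omega>))\<^sup>2) \<partial>P) \<le> ennreal c * Q"
    using SE(2) unfolding Sx_def e_def Q_def b_def c_def S.CA_def S.CN_def .
  define V where "V = B\<^sup>2 * Mf * M\<mu> * h powr (2 * (a + s))"
  define bias where "bias = (LINT u|lborel. ff u * (1 - FK (h * u)) * transform u)"
  have bias: "ennreal ((cmod bias)\<^sup>2) \<le> ennreal V"
    unfolding bias_def V_def using Mf by (intro bias_bound ff2 mc(6) as h B FK(4)) auto
  have wF: "integrable lborel (\<lambda>u. w u * transform u)"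
  proof (rule Bochner_Integration.integrable_bound)
    show "integrable lborel (\<lambda>u. (LINT x|weighted. \<bar>sgn x\<bar>) * cmod (w u))" using w by simp
    show "AE u in lborel. norm (w u * transform u) \<le> norm ((LINT x|weighted. \<bar>sgn x\<bar>) * cmod (w u))"
      using mult_right_mono[OF Tb norm_ge_zero] by (intro AE_I2) (simp add: norm_mult mult.commute order_trans[OF _ abs_ge_self])
  qed measurable
  have err: "(cmod (pairing f m - estimator f K X \<Delta> h n \<omega>))\<^sup>2 \<le> 2 * (cmod bias)\<^sup>2 + 2 * (cmod (Sx \<omega>))\<^sup>2"
    if \<omega>: "\<omega> \<in> space P" for \<omega>
  proof -
    have i: "integrable lborel (\<lambda>u. w u * (e \<omega> u - transform u))" using SE(1)[OF \<omega>] by (simp add: e_def)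
    have "(LINT u|lborel. w u * e \<omega> u) = (LINT u|lborel. w u * (e \<omega> u - transform u) + w u * transform u)"
      by (simp add: algebra_simps)
    also have "\<dots> = Sx \<omega> + (LINT u|lborel. w u * transform u)"
      unfolding Sx_def by (rule Bochner_Integration.integral_add[OF i wF])
    finally have 1: "(LINT u|lborel. w u * e \<omega> u) = Sx \<omega> + (LINT u|lborel. w u * transform u)" .
    have "bias = (LINT u|lborel. ff u * transform u - w u * transform u)"
      by (simp add: bias_def w_def algebra_simps)
    also have "\<dots> = (LINT u|lborel. ff u * transform u) - (LINT u|lborel. w u * transform u)"
      by (rule Bochner_Integration.integral_diff[OF int_fF wF])
    finally have 2: "(LINT u|lborel. ff u * transform u) = bias + (LINT u|lborel. w u * transform u)" by simp
    have "pairing f m - estimator f K X \<Delta> h n \<omega> = 1 / (2 * of_real pi) * (bias - Sx \<omega>)"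
      unfolding pair est[OF \<omega>] 1 2 by (simp only: right_diff_distrib[symmetric] add_diff_cancel_right)
    then have "cmod (pairing f m - estimator f K X \<Delta> h n \<omega>) = 1 / (2 * pi) * cmod (bias - Sx \<omega>)"
      by (simp add: norm_mult norm_divide)
    also have "\<dots> \<le> 1 * cmod (bias - Sx \<omega>)"
      using pi_gt3 by (intro mult_right_mono) auto
    also have "\<dots> \<le> cmod bias + cmod (Sx \<omega>)" using norm_triangle_ineq4[of bias "Sx \<omega>"] by simp
    finally have "(cmod (pairing f m - estimator f K X \<Delta> h n \<omega>))\<^sup>2 \<le> (cmod bias + cmod (Sx \<omega>))\<^sup>2" by (intro power_mono) auto
    also have "\<dots> \<le> 2 * (cmod bias)\<^sup>2 + 2 * (cmod (Sx \<omega>))\<^sup>2"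
      using sum_squares_bound[of "cmod bias" "cmod (Sx \<omega>)"] by (simp add: power2_sum)
    finally show ?thesis .
  qed
  have [measurable]: "Sx \<in> borel_measurable P"
    unfolding Sx_def[abs_def] e_def by (rule S.stochastic_error_measurable) measurable
  have two: "ennreal (2 * x) = ennreal 2 * ennreal x" for x by (rule ennreal_mult') simp
  have "risk \<le> (\<integral>\<^sup>+\<omega>. ennreal 2 * ennreal ((cmod bias)\<^sup>2) + ennreal 2 * ennreal ((cmod (Sx \<omega>))\<^sup>2) \<partial>P)"
    unfolding risk_def two[symmetric]
    by (intro nn_integral_mono) (use err in \<open>auto intro!: ennreal_leI simp flip: ennreal_plus\<close>)
  also have "\<dots> = ennreal 2 * ennreal ((cmod bias)\<^sup>2) + ennreal 2 * (\<integral>\<^sup>+\<omega>. ennreal ((cmod (Sx \<omega>))\<^sup>2) \<partial>P)"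
    by (subst nn_integral_add) (auto simp: nn_integral_cmult S.emeasure_space_1 simp del: ennreal_numeral)
  also have "\<dots> \<le> ennreal 2 * ennreal V + ennreal 2 * (ennreal c * Q)"
    by (intro add_mono mult_left_mono bias noise) auto
  also have "\<dots> = ennreal (2 * V) + ennreal (2 * c) * Q" by (simp only: two mult.assoc)
  finally have risk: "risk \<le> ennreal (2 * V) + ennreal (2 * c) * Q" .
  have c0: "c \<ge> 0" using \<Delta> by (auto simp: c_def)
  have q0: "q \<ge> 0" using R by (simp add: q_def)
  have b0: "b u \<ge> 0" for u by (simp add: b_def)
  have bm: "b \<in> borel_measurable borel" unfolding b_def by measurable
  have b_le: "b u \<le> q * (cmod (ff u) * (indicator {-(pi / h)..pi / h} u * (1 + u\<^sup>2) powr (\<Delta> * \<beta> / 2)))" for u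
  proof (cases "\<bar>u\<bar> \<le> pi / h")
    case True
    then have u: "u \<in> {-(pi / h)..pi / h}" by (auto simp: abs_le_iff)
    have l: "1 / cmod (S.\<phi> u) \<le> C\<phi> powr (- \<Delta>) * exp (\<Delta> * c\<phi> * (if \<rho> = 0 then 1 else (pi / h) powr \<rho>)) * (1 + u\<^sup>2) powr (\<Delta> * \<beta> / 2)"
      unfolding ch by (rule increment_char_lower_bound[OF mc(1) C(3,4,5) \<Delta> True])
    have "b u = cmod (ff u) * cmod (FK (h * u)) * (1 / cmod (S.\<phi> u))" by (simp add: b_def w_def norm_mult)
    also have "\<dots> \<le> cmod (ff u) * R * (C\<phi> powr (- \<Delta>) * exp (\<Delta> * c\<phi> * (if \<rho> = 0 then 1 else (pi / h) powr \<rho>)) * (1 + u\<^sup>2) powr (\<Delta> * \<beta> / 2))"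
      using FK(3) R by (intro mult_mono mult_left_mono l) auto
    finally show ?thesis using u by (simp add: q_def mult_ac)
  next
    case False
    then have "w u = 0" by (intro w0) simp
    then show ?thesis using q0 by (simp add: b_def)
  qed
  have R_le: "cmod (S.R t) \<le> \<Delta> * cmod (\<Psi>2 t) + \<Delta>\<^sup>2 * (cmod (\<Psi>1 t))\<^sup>2" for t
  proof -
    have "S.R t = - ((of_real \<Delta> * \<Psi>2 t + (of_real \<Delta> * \<Psi>1 t)\<^sup>2) * exp (of_real \<Delta> * \<Psi> t))"
      unfolding mom(3)[symmetric] S.R_def by simp
    then have "cmod (S.R t) = cmod (of_real \<Delta> * \<Psi>2 t + (of_real \<Delta> * \<Psi>1 t)\<^sup>2) * cmod (S.\<phi> t)"
      by (simp only: ch norm_minus_cancel norm_mult)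
    also have "\<dots> \<le> cmod (of_real \<Delta> * \<Psi>2 t + (of_real \<Delta> * \<Psi>1 t)\<^sup>2) * 1"
      by (intro mult_left_mono S.D.cmod_char_le_1) auto
    also have "\<dots> \<le> cmod (of_real \<Delta> * \<Psi>2 t) + cmod ((of_real \<Delta> * \<Psi>1 t)\<^sup>2)"
      using norm_triangle_ineq by simp
    also have "\<dots> = \<Delta> * cmod (\<Psi>2 t) + \<Delta>\<^sup>2 * (cmod (\<Psi>1 t))\<^sup>2"
      using \<Delta> by (simp add: norm_mult norm_power power_mult_distrib)
    finally show ?thesis .
  qed
  have nP: "cmod (transform u) = cmod (\<Psi>1 u)" for u by (simp add: Psi1_eq norm_mult)
  have phi'_le: "cmod (S.\<phi>' t) \<le> \<Delta> * cmod (\<Psi>1 t)" for t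
  proof -
    have "cmod (S.\<phi>' t) = \<Delta> * cmod (\<Psi>1 t) * cmod (S.\<phi> t)" using \<Delta> by (simp add: phi' norm_mult nP)
    also have "\<dots> \<le> \<Delta> * cmod (\<Psi>1 t) * 1" using \<Delta> by (intro mult_left_mono S.D.cmod_char_le_1) auto
    finally show ?thesis by simp
  qed
  have "\<Psi>1 \<in> borel_measurable borel" "\<Psi>2 \<in> borel_measurable borel"
    by (intro borel_measurable_continuous_onI Psi1_continuous Psi2_continuous)+
  note kernel = S.sample_kernel_bounds[OF this bm R_le phi'_le nP b0, folded Q_def]
  note as_real = ennreal_mult'[symmetric]
  have N: "noise_constant \<Delta> * A * y / real n = 2 * c * ((\<Delta> + 2 * \<Delta>\<^sup>2 + 1) * A * y)" for A y
    by (simp only: noise_constant_def c_def times_divide_eq_right times_divide_eq_left mult_ac)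
  have D0: "\<Delta> + 2 * \<Delta>\<^sup>2 + 1 \<ge> 0" using \<Delta> by auto
  show ?general
  proof -
    define J where "J = (\<integral>\<^sup>+u\<in>{-(pi / h)..pi / h}. ennreal ((1 + u\<^sup>2) powr (\<Delta> * \<beta> - s)) \<partial>lborel)"
    have "Q \<le> ennreal ((\<Delta> + 2 * \<Delta>\<^sup>2 + 1) * (C2bar / C)) * (\<integral>\<^sup>+u. ennreal (b u) \<partial>lborel)\<^sup>2"
      by (rule kernel(1)[OF mc(2,3)])
    also have "\<dots> \<le> ennreal ((\<Delta> + 2 * \<Delta>\<^sup>2 + 1) * (C2bar / C)) * (ennreal (q\<^sup>2 * Mf) * J)"
      unfolding J_def by (intro mult_left_mono noise_weight_integral_square[OF _ ff2 b_le q0]) auto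
    also have "\<dots> = ennreal ((\<Delta> + 2 * \<Delta>\<^sup>2 + 1) * (C2bar / C) * (q\<^sup>2 * Mf)) * J"
    proof -
      have "ennreal ((\<Delta> + 2 * \<Delta>\<^sup>2 + 1) * (C2bar / C) * (q\<^sup>2 * Mf))
          = ennreal ((\<Delta> + 2 * \<Delta>\<^sup>2 + 1) * (C2bar / C)) * ennreal (q\<^sup>2 * Mf)"
        by (rule ennreal_mult') (use D0 C in simp)
      then show ?thesis by (simp only: mult.assoc)
    qed
    finally have "ennreal (2 * c) * Q \<le> ennreal (2 * c) * (ennreal ((\<Delta> + 2 * \<Delta>\<^sup>2 + 1) * (C2bar / C) * (q\<^sup>2 * Mf)) * J)"
      by (rule mult_left_mono) simp
    also have "\<dots> = ennreal (2 * c * ((\<Delta> + 2 * \<Delta>\<^sup>2 + 1) * (C2bar / C) * (q\<^sup>2 * Mf))) * J"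
    proof -
      have "ennreal (2 * c * ((\<Delta> + 2 * \<Delta>\<^sup>2 + 1) * (C2bar / C) * (q\<^sup>2 * Mf)))
          = ennreal (2 * c) * ennreal ((\<Delta> + 2 * \<Delta>\<^sup>2 + 1) * (C2bar / C) * (q\<^sup>2 * Mf))"
        by (rule ennreal_mult') (use c0 in simp)
      then show ?thesis by (simp only: mult.assoc)
    qed
    finally have "risk \<le> ennreal (2 * V) + ennreal (2 * c * ((\<Delta> + 2 * \<Delta>\<^sup>2 + 1) * (C2bar / C) * (q\<^sup>2 * Mf))) * J"
      using risk by (meson add_left_mono order_trans)
    then show ?thesis unfolding N V_def J_def .
  qed
  show "risk \<le> ennreal (2 * (B\<^sup>2 * Mf * M\<mu> * h powr (2 * (a + s))))
        + ennreal (noise_constant \<Delta> * (enn2real C1bar / C) * (q\<^sup>2 * Mf * L) / real n)"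
    if C1: "C1bar < \<infinity>" and L: "\<And>u. \<bar>u\<bar> \<le> pi / h \<Longrightarrow> (1 + u\<^sup>2) powr (\<Delta> * \<beta> - s) \<le> L"
  proof -
    have "Q \<le> ennreal ((\<Delta> + 2 * \<Delta>\<^sup>2 + 1) * (enn2real C1bar / C)) * (\<integral>\<^sup>+u. ennreal ((b u)\<^sup>2) \<partial>lborel)"
      using C by (intro kernel(2) mc(4,5) C1) auto
    also have "\<dots> \<le> ennreal ((\<Delta> + 2 * \<Delta>\<^sup>2 + 1) * (enn2real C1bar / C)) * ennreal (q\<^sup>2 * Mf * L)"
      using Mf by (intro mult_left_mono noise_weight_square_integral[OF _ ff2 _ b0 b_le q0 L]) auto
    also have "\<dots> = ennreal ((\<Delta> + 2 * \<Delta>\<^sup>2 + 1) * (enn2real C1bar / C) * (q\<^sup>2 * Mf * L))"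
      by (rule as_real) (use D0 C in auto)
    finally have "ennreal (2 * c) * Q \<le> ennreal (2 * c) * ennreal ((\<Delta> + 2 * \<Delta>\<^sup>2 + 1) * (enn2real C1bar / C) * (q\<^sup>2 * Mf * L))"
      by (rule mult_left_mono) simp
    also have "\<dots> = ennreal (2 * c * ((\<Delta> + 2 * \<Delta>\<^sup>2 + 1) * (enn2real C1bar / C) * (q\<^sup>2 * Mf * L)))"
      by (rule as_real) (use c0 in simp)
    finally have "risk \<le> ennreal (2 * V) + ennreal (2 * c * ((\<Delta> + 2 * \<Delta>\<^sup>2 + 1) * (enn2real C1bar / C) * (q\<^sup>2 * Mf * L)))"
      using risk by (meson add_left_mono order_trans)
    then show ?thesis unfolding N V_def .
  qed
qed

section \<open>Rates of convergence\<close>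

lemma worst_case_risk_bounds:
  fixes f :: distribution and FK :: "real \<Rightarrow> complex" and C1bar :: ennreal and \<beta> :: real
  assumes f: "f \<in> sobolev_class s Mf" and Mf: "Mf > 0" and C: "C > 0" "C2bar > 0" "C\<phi> > 0" "M\<mu> > 0" "c\<phi> \<ge> 0" "\<rho> \<ge> 0"
    and as: "a + s > 0"
    and FK: "has_fourier_function (kernel_distribution K) FK" "FK \<in> borel_measurable borel" "\<And>u. cmod (FK u) \<le> R"
      "\<And>u. cmod (1 - FK u) \<le> B * \<bar>u\<bar> powr (a + s)" "\<And>u. \<bar>u\<bar> > pi \<Longrightarrow> FK u = 0"
    and R: "R \<ge> 0" and B: "B \<ge> 0" and \<Delta>: "\<Delta> > 0"
  defines "W \<equiv> worst_case_risk TYPE('w) (measure_class C C1bar C2bar C\<phi> c\<phi> \<beta> \<rho> a M\<mu>) f K \<Delta>"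
    and "E \<equiv> \<lambda>h. (exp (\<Delta> * c\<phi> * (if \<rho> = 0 then 1 else (pi / h) powr \<rho>)))\<^sup>2"
  obtains V N where "V \<ge> 0" "N \<ge> 0"
    "\<And>h n. \<lbrakk>h > 0; n > 0\<rbrakk> \<Longrightarrow> W h n \<le> ennreal (V * h powr (2 * (a + s)))
        + ennreal (N * E h / real n) * (\<integral>\<^sup>+u\<in>{-(pi / h)..pi / h}. ennreal ((1 + u\<^sup>2) powr (\<Delta> * \<beta> - s)) \<partial>lborel)"
    "\<And>h n L. \<lbrakk>C1bar < \<infinity>; h > 0; n > 0; \<And>u. \<bar>u\<bar> \<le> pi / h \<Longrightarrow> (1 + u\<^sup>2) powr (\<Delta> * \<beta> - s) \<le> L\<rbrakk> \<Longrightarrow>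
        W h n \<le> ennreal (V * h powr (2 * (a + s))) + ennreal (N * E h * L / real n)"
proof
  define c where "c = R * C\<phi> powr (- \<Delta>)"
  define A where "A = max (C2bar / C) (enn2real C1bar / C)"
  define V where "V = 2 * (B\<^sup>2 * Mf * M\<mu>)"
  define N where "N = noise_constant \<Delta> * A * (c\<^sup>2 * Mf)"
  have nc: "noise_constant \<Delta> \<ge> 0" using \<Delta> by (simp add: noise_constant_def)
  have A0: "A \<ge> 0" using C by (simp add: A_def max_def)
  show "V \<ge> 0" using Mf C by (simp add: V_def)
  show "N \<ge> 0" using nc A0 Mf by (simp add: N_def)
  have NE: "noise_constant \<Delta> * A' * ((R * (C\<phi> powr (- \<Delta>) * exp (\<Delta> * c\<phi> * (if \<rho> = 0 then 1 else (pi / h) powr \<rho>))))\<^sup>2 * Mf * L) / real n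
      \<le> N * E h * L / real n" if "A' \<le> A" "L \<ge> 0" for A' h L n
  proof -
    have "noise_constant \<Delta> * A' * (c\<^sup>2 * E h * Mf * L) / real n \<le> noise_constant \<Delta> * A * (c\<^sup>2 * E h * Mf * L) / real n"
      using that nc Mf by (intro divide_right_mono mult_right_mono mult_left_mono) (auto simp: E_def)
    then show ?thesis by (simp only: c_def E_def N_def power_mult_distrib mult_ac)
  qed
  show "W h n \<le> ennreal (V * h powr (2 * (a + s)))
        + ennreal (N * E h / real n) * (\<integral>\<^sup>+u\<in>{-(pi / h)..pi / h}. ennreal ((1 + u\<^sup>2) powr (\<Delta> * \<beta> - s)) \<partial>lborel)"
    if h: "h > 0" and n: "n > 0" for h n
    unfolding W_def worst_case_risk_def
  proof (rule SUP_least, clarify)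
    fix m and P :: "'w measure" and X and \<theta>
    assume "m \<in> measure_class C C1bar C2bar C\<phi> c\<phi> \<beta> \<rho> a M\<mu>" "has_pairing f m \<theta>" "associated_process m P X"
    note b = risk_bound(1)[OF this(1) exI[of "has_pairing f m" \<theta>, OF this(2)] this(3) f Mf C(1,2,3,5,6) as FK R B \<Delta> n h]
    show "(\<integral>\<^sup>+ x. ennreal ((cmod (pairing f m - estimator f K X \<Delta> h n x))\<^sup>2) \<partial>P)
       \<le> ennreal (V * h powr (2 * (a + s)))
        + ennreal (N * E h / real n) * (\<integral>\<^sup>+u\<in>{-(pi / h)..pi / h}. ennreal ((1 + u\<^sup>2) powr (\<Delta> * \<beta> - s)) \<partial>lborel)"
      using NE[of "C2bar / C" 1 h n]
      by (intro order_trans[OF b] add_mono mult_right_mono ennreal_leI) (auto simp: V_def A_def mult_ac)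
  qed
  show "W h n \<le> ennreal (V * h powr (2 * (a + s))) + ennreal (N * E h * L / real n)"
    if C1: "C1bar < \<infinity>" and h: "h > 0" and n: "n > 0" and L: "\<And>u. \<bar>u\<bar> \<le> pi / h \<Longrightarrow> (1 + u\<^sup>2) powr (\<Delta> * \<beta> - s) \<le> L" for h n L
    unfolding W_def worst_case_risk_def
  proof (rule SUP_least, clarify)
    fix m and P :: "'w measure" and X and \<theta>
    assume "m \<in> measure_class C C1bar C2bar C\<phi> c\<phi> \<beta> \<rho> a M\<mu>" "has_pairing f m \<theta>" "associated_process m P X"
    note b = risk_bound(2)[OF this(1) exI[of "has_pairing f m" \<theta>, OF this(2)] this(3) f Mf C(1,2,3,5,6) as FK R B \<Delta> n h C1 L]
    have "L \<ge> 0" using L[of 0] h by simp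
    then show "(\<integral>\<^sup>+ x. ennreal ((cmod (pairing f m - estimator f K X \<Delta> h n x))\<^sup>2) \<partial>P)
       \<le> ennreal (V * h powr (2 * (a + s))) + ennreal (N * E h * L / real n)"
      using NE[of "enn2real C1bar / C" L h n]
      by (intro order_trans[OF b] add_mono mult_right_mono ennreal_leI) (auto simp: V_def A_def mult_ac)
  qed
qed

text \<open>Separates the risk bound in terms of a simple rate \<open>g\<close> from the comparison of \<open>g\<close> with the rate \<open>r\<close> of the
  theorem, which involves \<open>\<Delta> n\<close> instead of \<open>n\<close>.\<close>
lemma rate_bound_transfer:
  fixes W :: "nat \<Rightarrow> ennreal"
  assumes c: "c > 0" and A: "A \<ge> 0"
    and W: "\<forall>\<^sub>F n in sequentially. W n \<le> ennreal (A * g n)"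
    and r: "\<forall>\<^sub>F n in sequentially. 0 \<le> g n \<and> c * g n \<le> r n"
  shows "\<exists>B>0. \<forall>\<^sub>F n in sequentially. W n \<le> ennreal (B * r n)"
proof (intro exI conjI)
  show "(A + 1) / c > 0" using c A by simp
  show "\<forall>\<^sub>F n in sequentially. W n \<le> ennreal ((A + 1) / c * r n)"
    using W r
  proof eventually_elim
    case (elim n)
    have "A * g n \<le> (A + 1) * g n" using elim by (simp add: distrib_right)
    also have "\<dots> = (A + 1) / c * (c * g n)" using c by simp
    also have "\<dots> \<le> (A + 1) / c * r n" using elim c A by (intro mult_left_mono) auto
    finally show ?case using elim(1) by (meson ennreal_leI order_trans)
  qed
qed

text \<open>The value at \<open>0\<close> only serves to keep the bandwidth positive.\<close>
definition bandwidth :: "real \<Rightarrow> nat \<Rightarrow> real" where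
  "bandwidth d n = (if n = 0 then 1 else real n powr (- 1 / d))"

lemma bandwidth_pos: "bandwidth d n > 0" by (simp add: bandwidth_def)

lemma bandwidth_powr: "n > 0 \<Longrightarrow> bandwidth d n powr k = real n powr (- (k / d))"
  by (simp add: bandwidth_def powr_powr)

lemma cutoff_eq: "n > 0 \<Longrightarrow> pi / bandwidth d n = pi * real n powr (1 / d)"
  by (simp add: bandwidth_def powr_minus_divide)

lemma cutoff_ge_1: "n > 0 \<Longrightarrow> d > 0 \<Longrightarrow> pi / bandwidth d n \<ge> 1"
proof -
  assume n: "n > 0" and d: "d > 0"
  have "1 \<le> real n powr (1 / d)" using n d by (intro ge_one_powr_ge_zero) auto
  then have "1 * 1 \<le> pi * real n powr (1 / d)" using pi_gt3 by (intro mult_mono) auto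
  then show ?thesis using n by (simp add: cutoff_eq)
qed

lemma cutoff_powr: "n > 0 \<Longrightarrow> (pi / bandwidth d n) powr x / real n = pi powr x * real n powr (x / d - 1)"
  by (simp add: cutoff_eq powr_mult powr_powr powr_diff)

text \<open>With this bandwidth, bias and noise are both multiples of \<open>n powr (- k / d)\<close>.  The parametric
  rate is the case \<open>d = k\<close>.\<close>
lemma power_rate:
  fixes W :: "nat \<Rightarrow> ennreal"
  assumes V: "V \<ge> 0" and M: "M \<ge> 0" and d: "d \<noteq> 0"
    and W: "\<And>n. n > 0 \<Longrightarrow> W n \<le> ennreal (V * bandwidth d n powr k) + ennreal (M * ((pi / bandwidth d n) powr (d - k) / real n))"
    and r: "\<And>n. n > 0 \<Longrightarrow> r n = c * real n powr (- (k / d))" and c: "c > 0"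
  shows "\<exists>B>0. \<forall>\<^sub>F n in sequentially. W n \<le> ennreal (B * r n)"
proof (rule rate_bound_transfer[OF c])
  show "V + M * pi powr (d - k) \<ge> 0" using V M by simp
  show "\<forall>\<^sub>F n in sequentially. W n \<le> ennreal ((V + M * pi powr (d - k)) * real n powr (- (k / d)))"
    using eventually_gt_at_top[of 0]
  proof eventually_elim
    case (elim n)
    have e: "(d - k) / d - 1 = - (k / d)" using d by (simp add: field_simps)
    from W[OF elim] show ?case
      using V M unfolding cutoff_powr[OF elim] bandwidth_powr[OF elim] e by (simp add: distrib_right mult.assoc)
  qed
  show "\<forall>\<^sub>F n in sequentially. 0 \<le> real n powr (- (k / d)) \<and> c * real n powr (- (k / d)) \<le> r n"
    using eventually_gt_at_top[of 0] by eventually_elim (use r in auto)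
qed

lemma log_rate:
  fixes W :: "nat \<Rightarrow> ennreal"
  assumes V: "V \<ge> 0" and M: "M \<ge> 0" and k: "k > 0" and \<Delta>: "\<Delta> > 0"
    and W: "\<And>n. n > 0 \<Longrightarrow> W n \<le> ennreal (V * bandwidth k n powr k) + ennreal (M * ((1 + ln (pi / bandwidth k n)) / real n))"
  shows "\<exists>B>0. \<forall>\<^sub>F n in sequentially. W n \<le> ennreal (B * (ln (\<Delta> * real n) * (\<Delta> * real n) powr (- 1)))"
proof (rule rate_bound_transfer[where c = "1 / (2 * \<Delta>)"])
  define c where "c = 1 + ln pi + 1 / k"
  define A where "A = V + M * c"
  have lp: "ln pi \<ge> 0" using pi_gt3 by simp
  show "1 / (2 * \<Delta>) > 0" using \<Delta> by simp
  show "A \<ge> 0" using V M k lp by (simp add: A_def c_def)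
  have l1: "\<forall>\<^sub>F n in sequentially. ln (real n) \<ge> 1" by real_asymp
  show "\<forall>\<^sub>F n in sequentially. W n \<le> ennreal (A * (ln (real n) / real n))"
    using eventually_gt_at_top[of 0] l1
  proof eventually_elim
    case (elim n)
    have b: "bandwidth k n powr k = 1 / real n" using elim k by (simp add: bandwidth_powr powr_minus_divide)
    have l: "ln (pi / bandwidth k n) = ln pi + ln (real n) / k"
      using elim by (simp add: cutoff_eq ln_mult ln_powr)
    have "1 + ln (pi / bandwidth k n) \<le> c * ln (real n)"
    proof -
      have "(1 + ln pi) * 1 \<le> (1 + ln pi) * ln (real n)" using lp elim by (intro mult_left_mono) auto
      then show ?thesis unfolding l c_def by (simp add: distrib_right)
    qed
    then have "V * (1 / real n) + M * ((1 + ln (pi / bandwidth k n)) / real n)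
        \<le> V * (ln (real n) / real n) + M * (c * ln (real n) / real n)"
      using elim V M by (intro add_mono mult_left_mono divide_right_mono) auto
    also have "\<dots> = A * (ln (real n) / real n)" by (simp add: A_def distrib_right add_divide_distrib)
    finally have le: "V * (1 / real n) + M * ((1 + ln (pi / bandwidth k n)) / real n) \<le> A * (ln (real n) / real n)" .
    have "1 + ln (pi / bandwidth k n) \<ge> 0" unfolding l using lp elim k by (intro add_nonneg_nonneg) auto
    then have "ennreal (V * (1 / real n)) + ennreal (M * ((1 + ln (pi / bandwidth k n)) / real n))
       = ennreal (V * (1 / real n) + M * ((1 + ln (pi / bandwidth k n)) / real n))"
      using V M by (intro ennreal_plus[symmetric]) auto
    with W[OF elim(1)] ennreal_leI[OF le] show ?case unfolding b by (metis order_trans)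
  qed
  have l2: "\<forall>\<^sub>F n in sequentially. ln (\<Delta> * real n) \<ge> ln (real n) / 2" using \<Delta> by real_asymp
  show "\<forall>\<^sub>F n in sequentially. 0 \<le> ln (real n) / real n \<and>
      1 / (2 * \<Delta>) * (ln (real n) / real n) \<le> ln (\<Delta> * real n) * (\<Delta> * real n) powr (- 1)"
    using eventually_gt_at_top[of 0] l1 l2
  proof eventually_elim
    case (elim n)
    have "1 / (2 * \<Delta>) * (ln (real n) / real n) = ln (real n) / 2 / (\<Delta> * real n)" by simp
    also have "\<dots> \<le> ln (\<Delta> * real n) / (\<Delta> * real n)" using elim \<Delta> by (intro divide_right_mono) auto
    also have "\<dots> = ln (\<Delta> * real n) * (\<Delta> * real n) powr (- 1)" using elim \<Delta> by (simp add: powr_minus_divide)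
    finally show ?case using elim by simp
  qed
qed

text \<open>Even after multiplication by powers of logarithms, a noise of order \<open>1 / sqrt n\<close> is negligible.\<close>
lemma noise_below_log_rate:
  fixes q p :: real
  shows "(\<lambda>n. sqrt (real n + 3) / real n * ln (real n + 3) powr q * ln (real n) powr p) \<longlonglongrightarrow> 0"
  by real_asymp

text \<open>The bandwidth is chosen such that the squared exponential factor does not exceed \<open>sqrt (n + 3)\<close>.  The
  noise is then of order \<open>1 / sqrt n\<close> up to logarithms, whereas the bias is a negative power of \<open>ln n\<close>.\<close>
lemma logarithmic_power_rate:
  fixes W :: "real \<Rightarrow> nat \<Rightarrow> ennreal"
  assumes V: "V \<ge> 0" and N: "N \<ge> 0" and D: "D \<ge> 0" and \<rho>: "\<rho> > 0" and \<Delta>: "\<Delta> > 0" and k: "k > 0"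
    and W: "\<And>h n. h > 0 \<Longrightarrow> n > 0 \<Longrightarrow> W h n \<le> ennreal (V * h powr k) +
      ennreal (N * (exp (D * (pi / h) powr \<rho>))\<^sup>2 / real n * (2 * (pi / h) * (1 + (pi / h)\<^sup>2) powr e))" and e: "e \<ge> 0"
  shows "\<exists>h. (\<forall>n. h n > 0) \<and> (\<exists>B>0. \<forall>\<^sub>F n in sequentially. W (h n) n \<le> ennreal (B * (ln (\<Delta> * real n) / \<Delta>) powr (- (k / \<rho>))))"
proof -
  \<comment> \<open>\<open>D + 1\<close> instead of \<open>D\<close> avoids a division by zero\<close>
  define c where "c = 1 / (4 * (D + 1) * pi powr \<rho>)"
  define r where "r = 1 / \<rho>"
  define p where "p = k / \<rho>"
  define h where "h n = (c * ln (real n + 3)) powr (- r)" for n :: nat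
  have c: "c > 0" using D by (simp add: c_def)
  have r: "r > 0" using \<rho> by (simp add: r_def)
  \<comment> \<open>the shift by \<open>3 > exp 1\<close> makes the logarithm at least \<open>1\<close> for all \<open>n\<close>\<close>
  have ln1: "ln (real n + 3) \<ge> 1" for n :: nat
    using e_less_272 by (subst ln_ge_iff) auto
  have hpos: "h n > 0" for n using c ln1[of n] by (simp add: h_def)
  have H: "pi / h n = pi * (c * ln (real n + 3)) powr r" for n
    by (simp add: h_def powr_minus_divide)
  have hk: "h n powr k = (c * ln (real n + 3)) powr (- p)" for n
    by (simp add: h_def powr_powr p_def r_def)
  have E: "(exp (D * (pi / h n) powr \<rho>))\<^sup>2 \<le> sqrt (real n + 3)" for n
  proof -
    have "(pi / h n) powr \<rho> = pi powr \<rho> * (c * ln (real n + 3))"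
      using c ln1[of n] \<rho> unfolding H by (simp add: powr_mult powr_powr r_def)
    then have "2 * (D * (pi / h n) powr \<rho>) = 2 * D * (pi powr \<rho> * c) * ln (real n + 3)" by simp
    also have "pi powr \<rho> * c = 1 / (4 * (D + 1))" by (simp add: c_def)
    also have "2 * D * (1 / (4 * (D + 1))) * ln (real n + 3) = D / (D + 1) * (ln (real n + 3) / 2)"
      using D by (simp add: field_simps)
    also have "\<dots> \<le> 1 * (ln (real n + 3) / 2)" using D ln1[of n] by (intro mult_right_mono) auto
    finally have "exp (2 * (D * (pi / h n) powr \<rho>)) \<le> exp (ln (real n + 3) / 2)" by simp
    also have "\<dots> = sqrt (real n + 3)" by (simp add: powr_half_sqrt[symmetric] powr_def)
    finally show ?thesis by (simp add: exp_double)
  qed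
  define G where "G = 1 + (pi * c powr r)\<^sup>2"
  have P: "2 * (pi / h n) * (1 + (pi / h n)\<^sup>2) powr e \<le> 2 * G powr (e + 1) * ln (real n + 3) powr (2 * r * (e + 1))" for n
  proof -
    define y where "y = ln (real n + 3)"
    have y: "y \<ge> 1" using ln1[of n] by (simp add: y_def)
    have H0: "pi / h n \<ge> 0" using hpos[of n] by simp
    have "1 + (pi / h n)\<^sup>2 = 1 + (pi * c powr r)\<^sup>2 * y powr (2 * r)"
      using c y unfolding H y_def[symmetric]
      by (simp add: powr_mult power_mult_distrib mult.assoc power2_eq_square flip: powr_add)
    also have "\<dots> \<le> 1 * y powr (2 * r) + (pi * c powr r)\<^sup>2 * y powr (2 * r)"
      using ge_one_powr_ge_zero[of y "2 * r"] y r by simp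
    also have "\<dots> = G * y powr (2 * r)" by (simp add: G_def distrib_right)
    finally have le: "1 + (pi / h n)\<^sup>2 \<le> G * y powr (2 * r)" .
    have "pi / h n \<le> 1 + (pi / h n)\<^sup>2"
      using sum_squares_bound[of "pi / h n" 1] H0 by simp
    then have "pi / h n * (1 + (pi / h n)\<^sup>2) powr e \<le> (1 + (pi / h n)\<^sup>2) * (1 + (pi / h n)\<^sup>2) powr e"
      by (intro mult_right_mono) auto
    also have "\<dots> = (1 + (pi / h n)\<^sup>2) powr (e + 1)"
      by (simp add: powr_add add_pos_nonneg mult.commute)
    also have "\<dots> \<le> (G * y powr (2 * r)) powr (e + 1)" using e le by (intro powr_mono2) auto
    also have "\<dots> = G powr (e + 1) * y powr (2 * r * (e + 1))"
      by (simp add: G_def powr_mult powr_powr)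
    finally show ?thesis by (simp add: y_def)
  qed
  have "\<exists>B>0. \<forall>\<^sub>F n in sequentially. W (h n) n \<le> ennreal (B * (ln (\<Delta> * real n) / \<Delta>) powr (- (k / \<rho>)))"
  proof (rule rate_bound_transfer[where c = "(2 / \<Delta>) powr (- p)" and A = "V * c powr (- p) + N * (2 * G powr (e + 1))"])
    show "(2 / \<Delta>) powr (- p) > 0" using \<Delta> by simp
    show "V * c powr (- p) + N * (2 * G powr (e + 1)) \<ge> 0" using V N by simp
    have l1: "\<forall>\<^sub>F n in sequentially. ln (real n) \<ge> 1" by real_asymp
    have "\<forall>\<^sub>F n in sequentially. sqrt (real n + 3) / real n * ln (real n + 3) powr (2 * r * (e + 1)) * ln (real n) powr p < 1"
      by (rule order_tendstoD(2)[OF noise_below_log_rate]) simp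
    with eventually_gt_at_top[of 0] l1
    show "\<forall>\<^sub>F n in sequentially. W (h n) n \<le> ennreal ((V * c powr (- p) + N * (2 * G powr (e + 1))) * ln (real n) powr (- p))"
    proof eventually_elim
      case (elim n)
      define y where "y = ln (real n + 3)"
      have "h n powr k \<le> (c * ln (real n)) powr (- p)"
      proof -
        have "0 < c * ln (real n)" using mult_pos_pos[OF c, of "ln (real n)"] elim by linarith
        moreover have "c * ln (real n) \<le> c * ln (real n + 3)" using c elim by (intro mult_left_mono) auto
        ultimately show ?thesis unfolding hk using k \<rho> by (intro powr_mono2') (auto simp: p_def)
      qed
      then have b: "V * h n powr k \<le> V * c powr (- p) * ln (real n) powr (- p)"
        using V c elim by (simp add: powr_mult mult.assoc mult_left_mono)
      have "sqrt (real n + 3) / real n * y powr (2 * r * (e + 1)) \<le> ln (real n) powr (- p)"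
      proof -
        have "0 < ln (real n) powr p" using elim by (subst powr_gt_zero) linarith
        then show ?thesis using elim(3) unfolding powr_minus_divide y_def by (simp only: pos_le_divide_eq less_imp_le)
      qed
      then have s: "2 * G powr (e + 1) * (sqrt (real n + 3) / real n * y powr (2 * r * (e + 1))) \<le> 2 * G powr (e + 1) * ln (real n) powr (- p)"
        by (intro mult_left_mono) auto
      have "(exp (D * (pi / h n) powr \<rho>))\<^sup>2 / real n * (2 * (pi / h n) * (1 + (pi / h n)\<^sup>2) powr e)
          \<le> sqrt (real n + 3) / real n * (2 * G powr (e + 1) * y powr (2 * r * (e + 1)))"
        unfolding y_def using hpos[of n] by (intro mult_mono divide_right_mono E P) auto
      also have "\<dots> \<le> 2 * G powr (e + 1) * ln (real n) powr (- p)" using s by (simp add: mult_ac)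
      finally have "N * ((exp (D * (pi / h n) powr \<rho>))\<^sup>2 / real n * (2 * (pi / h n) * (1 + (pi / h n)\<^sup>2) powr e))
          \<le> N * (2 * G powr (e + 1) * ln (real n) powr (- p))" using N by (rule mult_left_mono)
      then have v: "N * (exp (D * (pi / h n) powr \<rho>))\<^sup>2 / real n * (2 * (pi / h n) * (1 + (pi / h n)\<^sup>2) powr e)
          \<le> N * (2 * G powr (e + 1)) * ln (real n) powr (- p)" by (simp add: mult.assoc)
      have "W (h n) n \<le> ennreal (V * c powr (- p) * ln (real n) powr (- p)) + ennreal (N * (2 * G powr (e + 1)) * ln (real n) powr (- p))"
        by (rule order_trans[OF W[OF hpos elim(1)] add_mono[OF ennreal_leI[OF b] ennreal_leI[OF v]]])
      also have "\<dots> = ennreal ((V * c powr (- p) + N * (2 * G powr (e + 1))) * ln (real n) powr (- p))"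
        using V N by (simp add: distrib_right)
      finally show ?case .
    qed
    have l2: "\<forall>\<^sub>F n in sequentially. ln (\<Delta> * real n) \<le> 2 * ln (real n)" using \<Delta> by real_asymp
    have l3: "\<forall>\<^sub>F n in sequentially. ln (\<Delta> * real n) > 0" using \<Delta> by real_asymp
    show "\<forall>\<^sub>F n in sequentially. 0 \<le> ln (real n) powr (- p) \<and>
        (2 / \<Delta>) powr (- p) * ln (real n) powr (- p) \<le> (ln (\<Delta> * real n) / \<Delta>) powr (- (k / \<rho>))"
      using l1 l2 l3
    proof eventually_elim
      case (elim n)
      have "(2 / \<Delta>) powr (- p) * ln (real n) powr (- p) = (2 * ln (real n) / \<Delta>) powr (- p)"
        using \<Delta> elim by (simp flip: powr_mult)
      also have "\<dots> \<le> (ln (\<Delta> * real n) / \<Delta>) powr (- p)"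
        using elim \<Delta> k \<rho> by (intro powr_mono2' divide_right_mono) (auto simp: p_def)
      finally show ?case by (simp add: p_def)
    qed
  qed
  with hpos show ?thesis by blast
qed

theorem theorem3p3:
  fixes f :: distribution
    and K :: "real \<Rightarrow> real" and FK :: "real \<Rightarrow> complex"
    and C1bar :: ennreal
    and C C2bar C\<phi> c\<phi> \<beta> \<rho> a M\<mu> s Mf LK RK \<Delta> :: real
  assumes "C > 0" "C1bar > 0" "C2bar > 0" "C\<phi> > 0" "M\<mu> > 0" "c\<phi> \<ge> 0" "\<beta> \<ge> 0" "\<rho> \<ge> 0"
    and "Mf > 0" and "f \<in> sobolev_class s Mf"
    and "a > - s"
    and "tempered_function (\<lambda>x. complex_of_real (K x))"
    and "has_fourier_function (kernel_distribution K) FK"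
    and "FK 0 = 1"
    and "support FK \<subseteq> {- pi..pi}"
    and "FK = indicator {- pi..pi} \<or>
         (LK > 0 \<and> RK > 0 \<and> kernel_order (a + s) K \<and> FK \<in> hoelder_class UNIV (a + s) LK RK)"
    and "\<Delta> > 0"
  shows "\<exists>h :: nat \<Rightarrow> real. (\<forall>n. h n > 0) \<and>
    (\<exists>B>0. \<forall>\<^sub>F n in sequentially.
       worst_case_risk TYPE('w) (measure_class C C1bar C2bar C\<phi> c\<phi> \<beta> \<rho> a M\<mu>) f K \<Delta> (h n) n
         \<le> ennreal (B * rate C1bar \<beta> \<rho> a s \<Delta> n))"
proof -
  define k where "k = 2 * (a + s)"
  define e where "e = \<Delta> * \<beta> - s"
  have as: "a + s > 0" and k: "k > 0" using assms(11) by (auto simp: k_def)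
  have "FK = indicator {- pi..pi} \<or> (kernel_order (a + s) K \<and> FK \<in> hoelder_class UNIV (a + s) LK RK)"
    using assms(16) by blast
  from kernel_transform_bounds[OF as assms(12-15) this]
  obtain R B where R: "R > 0" "B > 0" "FK \<in> borel_measurable borel" "\<And>u. cmod (FK u) \<le> R"
    "\<And>u. cmod (1 - FK u) \<le> B * \<bar>u\<bar> powr (a + s)" "\<And>u. \<bar>u\<bar> > pi \<Longrightarrow> FK u = 0" by blast
  define W where "W = worst_case_risk TYPE('w) (measure_class C C1bar C2bar C\<phi> c\<phi> \<beta> \<rho> a M\<mu>) f K \<Delta>"
  define E where "E h = (exp (\<Delta> * c\<phi> * (if \<rho> = 0 then 1 else (pi / h) powr \<rho>)))\<^sup>2" for h
  define J where "J h = (\<integral>\<^sup>+u\<in>{-(pi / h)..pi / h}. ennreal ((1 + u\<^sup>2) powr e) \<partial>lborel)" for h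
  obtain V N where V: "V \<ge> 0" and N: "N \<ge> 0"
    and W1: "\<And>h n. \<lbrakk>h > 0; n > 0\<rbrakk> \<Longrightarrow> W h n \<le> ennreal (V * h powr k) + ennreal (N * E h / real n) * J h"
    and W2: "\<And>h n L. \<lbrakk>C1bar < \<infinity>; h > 0; n > 0; \<And>u. \<bar>u\<bar> \<le> pi / h \<Longrightarrow> (1 + u\<^sup>2) powr e \<le> L\<rbrakk> \<Longrightarrow>
        W h n \<le> ennreal (V * h powr k) + ennreal (N * E h * L / real n)"
    by (rule worst_case_risk_bounds[OF assms(10,9,1,3,4,5,6,8) as assms(13) R(3-6) less_imp_le[OF R(1)] less_imp_le[OF R(2)] assms(17),
          where C1bar = C1bar and \<beta> = \<beta>]) (auto simp: W_def E_def J_def k_def e_def)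
  show ?thesis
    unfolding W_def[symmetric]
  proof (cases "\<rho> = 0")
    case \<rho>: True
    define M where "M = N * (exp (\<Delta> * c\<phi>))\<^sup>2"
    have NE: "N * E h = M" for h by (simp add: E_def M_def \<rho>)
    have M: "M \<ge> 0" using N by (simp add: M_def)
    have T: "(\<Delta> * real n) powr x = \<Delta> powr x * real n powr x" for x n
      using assms(17) by (simp add: powr_mult)
    \<comment> \<open>If \<open>\<rho> = 0\<close>, the lower bound for \<open>\<phi>\<close> has no exponential decay, and \<open>E\<close> is constant.\<close>
    have W1': "W (bandwidth d n) n \<le> ennreal (V * bandwidth d n powr k) + ennreal (M * c * (x / real n))"
      if "n > 0" "c \<ge> 0" "J (bandwidth d n) \<le> ennreal (c * x)" for d n c x
    proof -
      have "ennreal (M / real n) * J (bandwidth d n) \<le> ennreal (M / real n) * ennreal (c * x)"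
        by (rule mult_left_mono[OF that(3)]) simp
      also have "\<dots> = ennreal (M / real n * (c * x))" by (rule ennreal_mult'[symmetric]) (use M in simp)
      finally have "ennreal (M / real n) * J (bandwidth d n) \<le> ennreal (M * c * (x / real n))" by (simp add: mult.assoc)
      then show ?thesis
        using W1[OF bandwidth_pos that(1), of d] unfolding NE by (meson add_left_mono order_trans)
    qed
    show "\<exists>h. (\<forall>n. h n > 0) \<and> (\<exists>B>0. \<forall>\<^sub>F n in sequentially. W (h n) n \<le> ennreal (B * rate C1bar \<beta> \<rho> a s \<Delta> n))"
    proof (cases "C1bar < \<infinity>")
      case C1: True
      show ?thesis
      proof (cases "s \<ge> \<Delta> * \<beta>")
        case s: True
        have "\<exists>B>0. \<forall>\<^sub>F n in sequentially. W (bandwidth k n) n \<le> ennreal (B * rate C1bar \<beta> \<rho> a s \<Delta> n)"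
        proof (rule power_rate[OF V M, where d = k and c = "\<Delta> powr - 1"])
          fix n :: nat assume n: "n > 0"
          have le1: "(1 + u\<^sup>2) powr e \<le> 1" for u :: real
            using powr_mono[of e 0 "1 + u\<^sup>2"] s by (simp add: e_def add_nonneg_eq_0_iff)
          have "W (bandwidth k n) n \<le> ennreal (V * bandwidth k n powr k) + ennreal (N * E (bandwidth k n) * 1 / real n)"
            by (rule W2[OF C1 bandwidth_pos n le1])
          then show "W (bandwidth k n) n \<le> ennreal (V * bandwidth k n powr k) + ennreal (M * ((pi / bandwidth k n) powr (k - k) / real n))"
            using bandwidth_pos[of k n] by (simp add: NE)
          show "rate C1bar \<beta> \<rho> a s \<Delta> n = \<Delta> powr - 1 * real n powr - (k / k)"
            using \<rho> C1 s k by (simp add: rate_def T abs_mult)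
        qed (use k assms(17) in auto)
        then show ?thesis using bandwidth_pos by blast
      next
        case s: False
        define d where "d = 2 * a + 2 * \<Delta> * \<beta>"
        have e: "e > 0" using s by (simp add: e_def)
        have d: "d > 0" "d - k = 2 * e" using k e by (auto simp: d_def k_def e_def)
        have "\<exists>B>0. \<forall>\<^sub>F n in sequentially. W (bandwidth d n) n \<le> ennreal (B * rate C1bar \<beta> \<rho> a s \<Delta> n)"
        proof (rule power_rate[OF V, where d = d and M = "M * 2 powr e" and k = k and c = "\<Delta> powr - (k / d)"])
          fix n :: nat assume n: "n > 0"
          define H where "H = pi / bandwidth d n"
          have H: "H \<ge> 1" unfolding H_def by (rule cutoff_ge_1[OF n d(1)])
          have L: "(1 + u\<^sup>2) powr e \<le> 2 powr e * H powr (2 * e)" if "\<bar>u\<bar> \<le> pi / bandwidth d n" for u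
          proof -
            have "u\<^sup>2 \<le> H\<^sup>2" using power_mono[OF that[folded H_def] abs_ge_zero, of 2] by simp
            then have "1 + u\<^sup>2 \<le> 2 * H\<^sup>2" using one_le_power[OF H, of 2] by linarith
            then have "1 + u\<^sup>2 \<le> 2 * H powr 2" using H by (simp add: powr_numeral)
            then have "(1 + u\<^sup>2) powr e \<le> (2 * H powr 2) powr e" using e by (intro powr_mono2) auto
            also have "\<dots> = 2 powr e * H powr (2 * e)" by (simp add: powr_mult powr_powr)
            finally show ?thesis .
          qed
          show "W (bandwidth d n) n \<le> ennreal (V * bandwidth d n powr k) + ennreal (M * 2 powr e * ((pi / bandwidth d n) powr (d - k) / real n))"
            using W2[OF C1 bandwidth_pos n L] unfolding NE d(2) by (simp add: H_def mult.assoc)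
          show "rate C1bar \<beta> \<rho> a s \<Delta> n = \<Delta> powr - (k / d) * real n powr - (k / d)"
            using \<rho> C1 s by (simp add: rate_def T k_def d_def)
        qed (use M d assms(17) in auto)
        then show ?thesis using bandwidth_pos by blast
      qed
    next
      case C1: False
      define c where "c = 2 * 2 powr \<bar>e\<bar>"
      have c: "c \<ge> 0" by (simp add: c_def)
      consider "2 * e < - 1" | "2 * e = - 1" | "2 * e > - 1" by linarith
      then show ?thesis
      proof cases
        case 1
        have c': "c * (1 - 1 / (2 * e + 1)) \<ge> 0" using 1 by (auto simp: c_def intro!: mult_nonneg_nonneg)
        have "\<exists>B>0. \<forall>\<^sub>F n in sequentially. W (bandwidth k n) n \<le> ennreal (B * rate C1bar \<beta> \<rho> a s \<Delta> n)"
        proof (rule power_rate[OF V, where d = k and M = "M * (c * (1 - 1 / (2 * e + 1)))" and c = "\<Delta> powr - 1"])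
          fix n :: nat assume n: "n > 0"
          have "J (bandwidth k n) \<le> ennreal (c * (1 - 1 / (2 * e + 1)) * 1)"
            using weight_integral_cases(1)[OF cutoff_ge_1[OF n k] 1] by (simp add: J_def c_def)
          from W1'[OF n c' this]
          show "W (bandwidth k n) n \<le> ennreal (V * bandwidth k n powr k)
              + ennreal (M * (c * (1 - 1 / (2 * e + 1))) * ((pi / bandwidth k n) powr (k - k) / real n))"
            using bandwidth_pos[of k n] by simp
          show "rate C1bar \<beta> \<rho> a s \<Delta> n = \<Delta> powr - 1 * real n powr - (k / k)"
            using \<rho> C1 1 k by (simp add: rate_def T e_def abs_mult)
        qed (use k M c' assms(17) in auto)
        then show ?thesis using bandwidth_pos by blast
      next
        case 2
        have "\<exists>B>0. \<forall>\<^sub>F n in sequentially. W (bandwidth k n) n \<le> ennreal (B * (ln (\<Delta> * real n) * (\<Delta> * real n) powr (- 1)))"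
        proof (rule log_rate[OF V _ k assms(17)])
          fix n :: nat assume n: "n > 0"
          have "J (bandwidth k n) \<le> ennreal (c * (1 + ln (pi / bandwidth k n)))"
            using weight_integral_cases(2)[OF cutoff_ge_1[OF n k] 2] by (simp add: J_def c_def)
          from W1'[OF n c this]
          show "W (bandwidth k n) n \<le> ennreal (V * bandwidth k n powr k) + ennreal (M * c * ((1 + ln (pi / bandwidth k n)) / real n))" .
        qed (use M c in simp)
        moreover have "rate C1bar \<beta> \<rho> a s \<Delta> n = ln (\<Delta> * real n) * (\<Delta> * real n) powr (- 1)" for n
          using \<rho> C1 2 by (simp add: rate_def e_def Let_def)
        ultimately show ?thesis using bandwidth_pos by auto
      next
        case 3
        define d where "d = 2 * a + 2 * \<Delta> * \<beta> + 1"
        have d: "d > 0" "d - k = 2 * e + 1" using k 3 by (auto simp: d_def k_def e_def)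
        have c': "c * (1 + 1 / (2 * e + 1)) \<ge> 0" using 3 by (auto simp: c_def intro!: mult_nonneg_nonneg)
        have "\<exists>B>0. \<forall>\<^sub>F n in sequentially. W (bandwidth d n) n \<le> ennreal (B * rate C1bar \<beta> \<rho> a s \<Delta> n)"
        proof (rule power_rate[OF V, where d = d and M = "M * (c * (1 + 1 / (2 * e + 1)))" and k = k and c = 1])
          fix n :: nat assume n: "n > 0"
          have "J (bandwidth d n) \<le> ennreal (c * (1 + 1 / (2 * e + 1)) * (pi / bandwidth d n) powr (2 * e + 1))"
            using weight_integral_cases(3)[OF cutoff_ge_1[OF n d(1)] 3] by (simp add: J_def c_def)
          from W1'[OF n c' this]
          show "W (bandwidth d n) n \<le> ennreal (V * bandwidth d n powr k)
              + ennreal (M * (c * (1 + 1 / (2 * e + 1))) * ((pi / bandwidth d n) powr (d - k) / real n))"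
            unfolding d(2) .
          show "rate C1bar \<beta> \<rho> a s \<Delta> n = 1 * real n powr - (k / d)"
            using \<rho> C1 3 by (simp add: rate_def e_def k_def d_def)
        qed (use M c' d in auto)
        then show ?thesis using bandwidth_pos by blast
      qed
    qed
  next
    case \<rho>: False
    have \<rho>0: "\<rho> > 0" using \<rho> assms(8) by simp
    have "\<exists>h. (\<forall>n. h n > 0) \<and> (\<exists>B>0. \<forall>\<^sub>F n in sequentially. W (h n) n \<le> ennreal (B * (ln (\<Delta> * real n) / \<Delta>) powr (- (k / \<rho>))))"
    proof (rule logarithmic_power_rate[OF V N _ \<rho>0 assms(17) k])
      fix h :: real and n :: nat assume h: "h > 0" and n: "n > 0"
      have "J h \<le> ennreal (2 * (pi / h) * (1 + (pi / h)\<^sup>2) powr \<bar>e\<bar>)"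
        unfolding J_def using h by (intro nn_integral_interval_le powr_one_plus_square_le) auto
      then have "ennreal (N * E h / real n) * J h \<le> ennreal (N * E h / real n) * ennreal (2 * (pi / h) * (1 + (pi / h)\<^sup>2) powr \<bar>e\<bar>)"
        by (rule mult_left_mono) simp
      also have "\<dots> = ennreal (N * E h / real n * (2 * (pi / h) * (1 + (pi / h)\<^sup>2) powr \<bar>e\<bar>))"
        by (rule ennreal_mult'[symmetric]) (use N in \<open>simp add: E_def\<close>)
      finally have "W h n \<le> ennreal (V * h powr k) + ennreal (N * E h / real n * (2 * (pi / h) * (1 + (pi / h)\<^sup>2) powr \<bar>e\<bar>))"
        using W1[OF h n] by (meson add_left_mono order_trans)
      then show "W h n \<le> ennreal (V * h powr k) + ennreal (N * (exp (\<Delta> * c\<phi> * (pi / h) powr \<rho>))\<^sup>2 / real n *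
          (2 * (pi / h) * (1 + (pi / h)\<^sup>2) powr \<bar>e\<bar>))"
        using \<rho> by (simp add: E_def)
    qed (use assms(6,17) in auto)
    moreover have "rate C1bar \<beta> \<rho> a s \<Delta> n = (ln (\<Delta> * real n) / \<Delta>) powr (- (k / \<rho>))" for n
      using \<rho> by (simp add: rate_def k_def)
    ultimately show "\<exists>h. (\<forall>n. h n > 0) \<and> (\<exists>B>0. \<forall>\<^sub>F n in sequentially. W (h n) n \<le> ennreal (B * rate C1bar \<beta> \<rho> a s \<Delta> n))"
      by simp
  qed
qed

end
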